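(* Let $1<p<\infty$, $n\in\mathbb N$, and $T(a)+H(b)\in\mathcal F_{TH}^p(-2n,2n)$ with subordinated pair $(c,d)$. Let $d=\boldsymbol\sigma(d)d_+t^{-2n}\tilde d_+^{-1}$ be the Wiener–Hopf factorization of $d$ in $L^p$, and define for $k=0,\dots,n-1$ $$\omega_k^{a,b}:=T^{-1}(ct^{-2n})\,T(\tilde a^{-1}t^{-n})\big(d_+^{-1}(t^{n-k-1}+\boldsymbol\sigma(d)t^{n+k})\big)$$ (here $T(ct^{-2n})$ is invertible on $H^p$), and the $n\times n$ matrix $W_n(a,b)=(\omega_{jk}^{a,b})_{j,k=0}^{n-1}$, $\omega_{jk}^{a,b}=\frac1{2\pi}\int_0^{2\pi}\omega_k^{a,b}(e^{i\theta})e^{-ij\theta}\,d\theta$. Define $W_n(\bar a,\widetilde{\bar b})$ analogously for the matching pair $(\bar a,\widetilde{\bar b})$ (for which $T(\bar a)+H(\widetilde{\bar b})\in\mathcal F^q_{TH}(-2n,2n)$), with $p$ replaced by $q=p/(p-1)$. Then: (a) $T(a)+H(b)$ is left-invertible iff $W_n(a,b)$ is nondegenerate; (b) $T(a)+H(b)$ is right-invertible iff $W_n(\bar a,\widetilde{\bar b})$ is nondegenerate; (c) $T(a)+H(b)$ is invertible iff both $W_n(a,b)$ and $W_n(\bar a,\widetilde{\bar b})$ are nondegenerate; (d) if $W_n(a,b)$ and $W_n(a,-b)$ are nondegenerate, then $T(a)+H(b)$ and $T(a)-H(b)$ are both invertible.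
   Context: $\mathbb T$ is the unit circle, $1<p<\infty$, $1/p+1/q=1$; $H^p=\{f\in L^p(\mathbb T):\hat f_n=0\ \forall n<0\}$, $\overline{H^p}=\{f\in L^p:\hat f_n=0\ \forall n>0\}$; $P$ is the Riesz projection onto $H^p$, $Q=I-P$, $(Jf)(t)=t^{-1}f(t^{-1})$, $\tilde a(t)=a(1/t)$, $\bar a$ is the complex conjugate; $t$ denotes $t\mapsto t$. On $H^p$: $T(a)f=P(af)$, $H(a)f=P(aQJf)$. A pair $(a,b)$ with $a\in GL^\infty(\mathbb T)$ (invertible in $L^\infty$) and $b\in L^\infty(\mathbb T)$ is a matching pair if $a\tilde a=b\tilde b$; the subordinated pair is $(c,d)$, $c:=a/b$, $d:=a/\tilde b$, with $c\tilde c=d\tilde d=1$. We write $T(a)+H(b)\in\mathcal F_{TH}^p(\kappa_1,\kappa_2)$ if $(a,b)$ is a matching pair whose subordinated operators $T(c),T(d)$ are Fredholm on $H^p$ with $\operatorname{ind}T(c)=\kappa_1$, $\operatorname{ind}T(d)=\kappa_2$. A Wiener–Hopf factorization of $a\in L^\infty$ in $L^p$ is $a=a_-t^ma_+$ with $m\in\mathbb Z$, $a_+\in H^q$, $a_+^{-1}\in H^p$, $a_-\in\overline{H^p}$, $a_-^{-1}\in\overline{H^q}$, and $\|a_+^{-1}P(a_+\varphi)\|_p\le c_p\|\varphi\|_p$ for all trigonometric polynomials $\varphi$. If $g$ satisfies $g\tilde g=1$ and $T(g)$ is Fredholm on $H^p$ with index $n$, its Wiener–Hopf factorization normalized by $g_-(\infty)=1$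 has the form $g=\boldsymbol\sigma(g)g_+t^{-n}\tilde g_+^{-1}$ with $\boldsymbol\sigma(g)=g_+(0)\in\{-1,1\}$ (the factorization signature) and plus factor $g_+$. *)

theory Defs
  imports "HOL-Analysis.Analysis" "Jordan_Normal_Form.Determinant"
begin

text \<open>Functions on the unit circle are represented as functions complex => complex,
  of which only the values on the unit circle matter.  The circle is parametrised by
  theta in [0, 2 pi] via cis; all statements are modulo equality almost everywhere.\<close>

definition circ :: "(complex \<Rightarrow> complex) \<Rightarrow> real \<Rightarrow> complex" where
  "circ f \<theta> = f (cis \<theta>)"

abbreviation TM :: "real measure" where
  "TM \<equiv> lebesgue_on {0..2*pi}"

definition ae_eq :: "(complex \<Rightarrow> complex) \<Rightarrow> (complex \<Rightarrow> complex) \<Rightarrow> bool" where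
  "ae_eq f g \<longleftrightarrow> (AE \<theta> in TM. f (cis \<theta>) = g (cis \<theta>))"

definition Lp :: "real \<Rightarrow> (complex \<Rightarrow> complex) set" where
  "Lp p = {f. circ f \<in> borel_measurable TM \<and>
              integrable TM (\<lambda>\<theta>. norm (circ f \<theta>) powr p)}"

definition pnorm :: "real \<Rightarrow> (complex \<Rightarrow> complex) \<Rightarrow> real" where
  "pnorm p f = (LINT \<theta>|TM. norm (circ f \<theta>) powr p) powr (1 / p)"

definition Linf :: "(complex \<Rightarrow> complex) set" where
  "Linf = {f. circ f \<in> borel_measurable TM \<and> (\<exists>C. AE \<theta> in TM. norm (circ f \<theta>) \<le> C)}"

definition GLinf :: "(complex \<Rightarrow> complex) set" where
  "GLinf = {f. f \<in> Linf \<and> (\<exists>g\<in>Linf. ae_eq (\<lambda>z. f z * g z) (\<lambda>z. 1))}"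

definition fc :: "(complex \<Rightarrow> complex) \<Rightarrow> int \<Rightarrow> complex" where
  "fc f j = (1 / (2 * pi)) * (LINT \<theta>|TM. f (cis \<theta>) * cis (- (of_int j * \<theta>)))"

definition Hp :: "real \<Rightarrow> (complex \<Rightarrow> complex) set" where
  "Hp p = {f \<in> Lp p. \<forall>j<0. fc f j = 0}"

definition Hbar :: "real \<Rightarrow> (complex \<Rightarrow> complex) set" where
  "Hbar p = {f \<in> Lp p. \<forall>j>0. fc f j = 0}"

text \<open>Riesz projection (well defined up to a.e. equality; M. Riesz theorem).\<close>
definition Pr :: "(complex \<Rightarrow> complex) \<Rightarrow> (complex \<Rightarrow> complex)" where
  "Pr f = (SOME g. g \<in> Lp 1 \<and> (\<forall>j. fc g j = (if j \<ge> 0 then fc f j else 0)))"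

definition Qr :: "(complex \<Rightarrow> complex) \<Rightarrow> (complex \<Rightarrow> complex)" where
  "Qr f = (\<lambda>z. f z - Pr f z)"

definition Jflip :: "(complex \<Rightarrow> complex) \<Rightarrow> (complex \<Rightarrow> complex)" where
  "Jflip f = (\<lambda>t. inverse t * f (inverse t))"

definition tld :: "(complex \<Rightarrow> complex) \<Rightarrow> (complex \<Rightarrow> complex)" where
  "tld a = (\<lambda>t. a (inverse t))"

definition Toep :: "(complex \<Rightarrow> complex) \<Rightarrow> (complex \<Rightarrow> complex) \<Rightarrow> (complex \<Rightarrow> complex)" where
  "Toep a f = Pr (\<lambda>z. a z * f z)"

definition Hank :: "(complex \<Rightarrow> complex) \<Rightarrow> (complex \<Rightarrow> complex) \<Rightarrow> (complex \<Rightarrow> complex)" where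
  "Hank b f = Pr (\<lambda>z. b z * Qr (Jflip f) z)"

definition TH :: "(complex \<Rightarrow> complex) \<Rightarrow> (complex \<Rightarrow> complex) \<Rightarrow> (complex \<Rightarrow> complex) \<Rightarrow> (complex \<Rightarrow> complex)" where
  "TH a b f = (\<lambda>z. Toep a f z + Hank b f z)"

definition lincomb :: "(int \<Rightarrow> complex) set \<Rightarrow> ((int \<Rightarrow> complex) \<Rightarrow> complex) \<Rightarrow> int \<Rightarrow> complex" where
  "lincomb K u = (\<lambda>j. \<Sum>v\<in>K. u v * v j)"

definition cspan :: "(int \<Rightarrow> complex) set \<Rightarrow> (int \<Rightarrow> complex) set" where
  "cspan K = {lincomb K u | u. True}"

definition cindep :: "(int \<Rightarrow> complex) set \<Rightarrow> bool" where
  "cindep K \<longleftrightarrow> (\<forall>u. lincomb K u = (\<lambda>_. 0) \<longrightarrow> (\<forall>v\<in>K. u v = 0))"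

text \<open>Elements of H^p are identified with their Fourier coefficient sequences
  (an L^p function is determined a.e. by its Fourier coefficients).\<close>

definition ker_seq :: "real \<Rightarrow> ((complex \<Rightarrow> complex) \<Rightarrow> (complex \<Rightarrow> complex)) \<Rightarrow> (int \<Rightarrow> complex) set" where
  "ker_seq p A = {fc f | f. f \<in> Hp p \<and> ae_eq (A f) (\<lambda>_. 0)}"

definition ran_seq :: "real \<Rightarrow> ((complex \<Rightarrow> complex) \<Rightarrow> (complex \<Rightarrow> complex)) \<Rightarrow> (int \<Rightarrow> complex) set" where
  "ran_seq p A = {fc (A f) | f. f \<in> Hp p}"

definition closed_range :: "real \<Rightarrow> ((complex \<Rightarrow> complex) \<Rightarrow> (complex \<Rightarrow> complex)) \<Rightarrow> bool" where
  "closed_range p A \<longleftrightarrow>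
     (\<forall>F g. (\<forall>k. F k \<in> Hp p) \<and> g \<in> Lp p \<and>
            (\<lambda>k. pnorm p (\<lambda>z. A (F k) z - g z)) \<longlonglongrightarrow> 0
        \<longrightarrow> (\<exists>h\<in>Hp p. ae_eq (A h) g))"

definition fredholm_index :: "real \<Rightarrow> ((complex \<Rightarrow> complex) \<Rightarrow> (complex \<Rightarrow> complex)) \<Rightarrow> int \<Rightarrow> bool" where
  "fredholm_index p A \<kappa> \<longleftrightarrow> closed_range p A \<and>
     (\<exists>K C. finite K \<and> finite C \<and> cindep K \<and> cspan K = ker_seq p A \<and>
            cindep C \<and> C \<subseteq> fc ` Hp p \<and>
            {(\<lambda>j. r j + s j) | r s. r \<in> ran_seq p A \<and> s \<in> cspan C} = fc ` Hp p \<and>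
            cspan C \<inter> ran_seq p A = {\<lambda>_. 0} \<and>
            \<kappa> = int (card K) - int (card C))"

definition bounded_op :: "real \<Rightarrow> ((complex \<Rightarrow> complex) \<Rightarrow> (complex \<Rightarrow> complex)) \<Rightarrow> bool" where
  "bounded_op p B \<longleftrightarrow>
     (\<forall>f\<in>Hp p. B f \<in> Hp p) \<and>
     (\<forall>f\<in>Hp p. \<forall>g\<in>Hp p. ae_eq f g \<longrightarrow> ae_eq (B f) (B g)) \<and>
     (\<forall>f\<in>Hp p. \<forall>g\<in>Hp p. ae_eq (B (\<lambda>z. f z + g z)) (\<lambda>z. B f z + B g z)) \<and>
     (\<forall>f\<in>Hp p. \<forall>c. ae_eq (B (\<lambda>z. c * f z)) (\<lambda>z. c * B f z)) \<and>
     (\<exists>M. \<forall>f\<in>Hp p. pnorm p (B f) \<le> M * pnorm p f)"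

definition left_invertible :: "real \<Rightarrow> ((complex \<Rightarrow> complex) \<Rightarrow> (complex \<Rightarrow> complex)) \<Rightarrow> bool" where
  "left_invertible p A \<longleftrightarrow> (\<exists>B. bounded_op p B \<and> (\<forall>f\<in>Hp p. ae_eq (B (A f)) f))"

definition right_invertible :: "real \<Rightarrow> ((complex \<Rightarrow> complex) \<Rightarrow> (complex \<Rightarrow> complex)) \<Rightarrow> bool" where
  "right_invertible p A \<longleftrightarrow> (\<exists>B. bounded_op p B \<and> (\<forall>f\<in>Hp p. ae_eq (A (B f)) f))"

definition invertible_op :: "real \<Rightarrow> ((complex \<Rightarrow> complex) \<Rightarrow> (complex \<Rightarrow> complex)) \<Rightarrow> bool" where
  "invertible_op p A \<longleftrightarrow> (\<exists>B. bounded_op p B \<and> (\<forall>f\<in>Hp p. ae_eq (B (A f)) f)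
                                            \<and> (\<forall>f\<in>Hp p. ae_eq (A (B f)) f))"

definition matching_pair :: "(complex \<Rightarrow> complex) \<Rightarrow> (complex \<Rightarrow> complex) \<Rightarrow> bool" where
  "matching_pair a b \<longleftrightarrow> a \<in> GLinf \<and> b \<in> Linf \<and>
     ae_eq (\<lambda>t. a t * tld a t) (\<lambda>t. b t * tld b t)"

definition sub_c :: "(complex \<Rightarrow> complex) \<Rightarrow> (complex \<Rightarrow> complex) \<Rightarrow> (complex \<Rightarrow> complex)" where
  "sub_c a b = (\<lambda>t. a t / b t)"

definition sub_d :: "(complex \<Rightarrow> complex) \<Rightarrow> (complex \<Rightarrow> complex) \<Rightarrow> (complex \<Rightarrow> complex)" where
  "sub_d a b = (\<lambda>t. a t / tld b t)"

definition F_TH :: "real \<Rightarrow> int \<Rightarrow> int \<Rightarrow> (complex \<Rightarrow> complex) \<Rightarrow> (complex \<Rightarrow> complex) \<Rightarrow> bool" where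
  "F_TH p \<kappa>1 \<kappa>2 a b \<longleftrightarrow> matching_pair a b \<and>
     fredholm_index p (Toep (sub_c a b)) \<kappa>1 \<and> fredholm_index p (Toep (sub_d a b)) \<kappa>2"

definition trig_poly :: "(complex \<Rightarrow> complex) \<Rightarrow> bool" where
  "trig_poly \<phi> \<longleftrightarrow> (\<exists>S c. finite S \<and> \<phi> = (\<lambda>z. \<Sum>j\<in>S. c j * z powi j))"

definition conj_exp :: "real \<Rightarrow> real" where
  "conj_exp p = p / (p - 1)"

definition wh_fact :: "real \<Rightarrow> (complex \<Rightarrow> complex) \<Rightarrow> (complex \<Rightarrow> complex) \<Rightarrow> int \<Rightarrow> (complex \<Rightarrow> complex) \<Rightarrow> bool" where
  "wh_fact p a am m ap \<longleftrightarrow>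
     ae_eq a (\<lambda>t. am t * t powi m * ap t) \<and>
     ap \<in> Hp (conj_exp p) \<and> (\<lambda>t. inverse (ap t)) \<in> Hp p \<and>
     am \<in> Hbar p \<and> (\<lambda>t. inverse (am t)) \<in> Hbar (conj_exp p) \<and>
     (\<exists>c. \<forall>\<phi>. trig_poly \<phi> \<longrightarrow>
        pnorm p (\<lambda>t. inverse (ap t) * Pr (\<lambda>z. ap z * \<phi> z) t) \<le> c * pnorm p \<phi>)"

text \<open>Plus factor of the factorization normalised by am(infinity) = 1, i.e. the
  zeroth Fourier coefficient of the minus factor equals 1.\<close>
definition wh_plus :: "real \<Rightarrow> (complex \<Rightarrow> complex) \<Rightarrow> (complex \<Rightarrow> complex)" where
  "wh_plus p g = (case (SOME (am, m, ap). wh_fact p g am m ap \<and> fc am 0 = 1) of (am, m, ap) \<Rightarrow> ap)"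

text \<open>Factorization signature sigma(g) = g_+(0).\<close>
definition wh_sigma :: "real \<Rightarrow> (complex \<Rightarrow> complex) \<Rightarrow> complex" where
  "wh_sigma p g = fc (wh_plus p g) 0"

definition Tinv :: "real \<Rightarrow> (complex \<Rightarrow> complex) \<Rightarrow> (complex \<Rightarrow> complex) \<Rightarrow> (complex \<Rightarrow> complex)" where
  "Tinv p g h = (SOME f. f \<in> Hp p \<and> ae_eq (Toep g f) h)"

definition omega :: "real \<Rightarrow> nat \<Rightarrow> (complex \<Rightarrow> complex) \<Rightarrow> (complex \<Rightarrow> complex) \<Rightarrow> nat \<Rightarrow> (complex \<Rightarrow> complex)" where
  "omega p n a b k =
     (let c = sub_c a b; d = sub_d a b; dp = wh_plus p d; s = wh_sigma p d in
      Tinv p (\<lambda>t. c t * t powi (- (2 * int n)))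
        (Toep (\<lambda>t. inverse (tld a t) * t powi (- int n))
           (\<lambda>t. inverse (dp t) * (t ^ (n - k - 1) + s * t ^ (n + k)))))"

definition Wmat :: "real \<Rightarrow> nat \<Rightarrow> (complex \<Rightarrow> complex) \<Rightarrow> (complex \<Rightarrow> complex) \<Rightarrow> complex mat" where
  "Wmat p n a b = Matrix.mat n n (\<lambda>(j, k). fc (omega p n a b k) (int j))"

end

theory Submission
  imports Defs "HOL-Complex_Analysis.Complex_Analysis" "HOL-Library.Function_Algebras"
begin

text \<open>
  Put \<open>c = a / b\<close> and \<open>d = a / tilde b\<close>. Writing \<open>(T(a) + H(b)) f = g\<close> as \<open>a f + b J f = g + J u\<close> with an
  unknown \<open>u\<close> in \<open>H\<^sup>p\<close>, one finds that \<open>u\<close> solves \<open>d u - J u = g - d J g\<close> and that \<open>f\<close> solves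
  \<open>c f + J f = (g + J u) / b\<close>. The first equation is always solvable, and its homogeneous solutions are
  spanned by the functions \<open>d\<^sub>+\<^sup>-\<^sup>1 (t\<^bsup>n-k-1\<^esup> + \<sigma>(d) t\<^bsup>n+k\<^esup>)\<close>. The second one has at most one solution, and
  it has one exactly when the first \<open>n\<close> coefficients of an explicit function vanish. Adjusting \<open>u\<close> by a
  homogeneous solution changes these coefficients by the matrix \<open>W\<^sub>n(a, b)\<close>. Hence \<open>T(a) + H(b)\<close> is
  invertible if \<open>W\<^sub>n(a, b)\<close> is nondegenerate, and has a nontrivial kernel otherwise. Right invertibility is
  treated by passing to the adjoint \<open>T(bar a) + H(bar (tilde b))\<close> on \<open>H\<^sup>q\<close>.
\<close>

section \<open>Powers of absolute values\<close>

lemma Bernoulli_powr_less: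
  fixes p u :: real
  assumes "1 < p" "0 \<le> u" "u \<noteq> 1"
  shows "1 + p * (u - 1) < u powr p"
proof -
  have deriv: "((\<lambda>x. x powr p) has_real_derivative p * x powr (p - 1)) (at x)" if "0 < x" for x
    using that by (auto intro!: derivative_eq_intros)
  consider (zero) "u = 0" | (small) "0 < u" "u < 1" | (large) "1 < u" using assms by linarith
  then show ?thesis
  proof cases
    case zero
    then show ?thesis using assms by simp
  next
    case small
    obtain z where z: "u < z" "z < 1" "1 powr p - u powr p = (1 - u) * (p * z powr (p - 1))"
      using MVT2[OF small(2), of "\<lambda>x. x powr p" "\<lambda>x. p * x powr (p - 1)"] deriv small(1) by auto
    have "z powr (p - 1) < 1 powr (p - 1)" using z small assms by (intro powr_less_mono2) auto
    then have "(1 - u) * (p * z powr (p - 1)) < (1 - u) * (p * 1)"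
      using small assms by (intro mult_strict_left_mono) auto
    then show ?thesis using z by (simp add: algebra_simps)
  next
    case large
    obtain z where z: "1 < z" "z < u" "u powr p - 1 powr p = (u - 1) * (p * z powr (p - 1))"
      using MVT2[OF large, of "\<lambda>x. x powr p" "\<lambda>x. p * x powr (p - 1)"] deriv by auto
    have "1 < z powr (p - 1)" using z assms by (simp add: gr_one_powr)
    then have "(u - 1) * (p * 1) < (u - 1) * (p * z powr (p - 1))"
      using large assms by (intro mult_strict_left_mono) auto
    then show ?thesis using z by (simp add: algebra_simps)
  qed
qed

lemma powr_gt_tangent:
  fixes p m x :: real
  assumes "1 < p" "0 \<le> x" "0 < m" "x \<noteq> m"
  shows "m powr p + p * m powr (p - 1) * (x - m) < x powr p"
proof -
  have "(1 + p * (x / m - 1)) * m powr p < (x / m) powr p * m powr p"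
    using assms by (intro mult_strict_right_mono Bernoulli_powr_less) auto
  moreover have "(x / m) powr p * m powr p = x powr p"
    using assms by (simp flip: powr_mult)
  moreover have "m powr p = m * m powr (p - 1)" using assms by (simp add: powr_mult_base)
  then have "(1 + p * (x / m - 1)) * m powr p = m powr p + p * m powr (p - 1) * (x - m)"
    using assms by (simp add: field_simps)
  ultimately show ?thesis by simp
qed

lemma powr_ge_tangent:
  fixes p m x :: real
  assumes "1 < p" "0 \<le> x" "0 \<le> m"
  shows "m powr p + p * m powr (p - 1) * (x - m) \<le> x powr p"
proof (cases "m = 0 \<or> x = m")
  case False
  then show ?thesis using powr_gt_tangent[of p x m] assms by simp
qed auto

lemma norm_midpoint_powr_less:
  fixes a b :: complex
  assumes "1 < p" "a \<noteq> b"
  shows "norm ((a + b) / 2) powr p < (norm a powr p + norm b powr p) / 2"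
proof (cases "norm a = norm b")
  case True
  have "(norm (a + b))\<^sup>2 + (norm (a - b))\<^sup>2 = 2 * (norm a)\<^sup>2 + 2 * (norm b)\<^sup>2"
    by (simp add: cmod_power2) (simp add: power2_eq_square algebra_simps)
  moreover have "0 < (norm (a - b))\<^sup>2" using assms by simp
  ultimately have "(norm (a + b))\<^sup>2 < (2 * norm a)\<^sup>2" using True by (simp add: power2_eq_square)
  then have "norm (a + b) < 2 * norm a" by (rule power_less_imp_less_base) simp
  then have "norm ((a + b) / 2) powr p < norm a powr p"
    using assms by (intro powr_less_mono2) (auto simp: norm_divide)
  then show ?thesis using True by simp
next
  case False
  define m where "m = (norm a + norm b) / 2"
  have "0 < m"
  proof (cases "a = 0")
    case True
    then show ?thesis using False by (simp add: m_def)
  qed (simp add: m_def add_pos_nonneg)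
  moreover have "norm a \<noteq> m" "norm b \<noteq> m" using False by (auto simp: m_def field_simps)
  ultimately have tangents: "m powr p + p * m powr (p - 1) * (norm a - m) < norm a powr p"
    "m powr p + p * m powr (p - 1) * (norm b - m) < norm b powr p"
    using assms by (auto intro!: powr_gt_tangent)
  have "p * m powr (p - 1) * (norm a - m) + p * m powr (p - 1) * (norm b - m)
      = p * m powr (p - 1) * (norm a + norm b - 2 * m)"
    by (simp add: algebra_simps)
  then have "p * m powr (p - 1) * (norm a - m) + p * m powr (p - 1) * (norm b - m) = 0"
    by (simp add: m_def)
  then have "m powr p < (norm a powr p + norm b powr p) / 2" using tangents by argo
  moreover have "norm ((a + b) / 2) powr p \<le> m powr p"
    using norm_triangle_ineq[of a b] assms by (intro powr_mono2) (auto simp: m_def norm_divide)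
  ultimately show ?thesis by linarith
qed

definition midpoint_gap :: "real \<Rightarrow> complex \<Rightarrow> complex \<Rightarrow> real" where
  "midpoint_gap p a b = (norm a powr p + norm b powr p) / 2 - norm ((a + b) / 2) powr p"

lemma midpoint_gap_pos: "1 < p \<Longrightarrow> a \<noteq> b \<Longrightarrow> 0 < midpoint_gap p a b"
  using norm_midpoint_powr_less[of p a b] by (simp add: midpoint_gap_def)

lemma midpoint_gap_nonneg: "1 < p \<Longrightarrow> 0 \<le> midpoint_gap p a b"
  using midpoint_gap_pos[of p a b] by (cases "a = b") (auto simp: midpoint_gap_def)

lemma norm_divide_root_powr:
  fixes z :: complex
  assumes "0 < s" "p \<noteq> 0"
  shows "norm (z / of_real (s powr (1 / p))) powr p = norm z powr p / s"
  using assms by (simp add: norm_divide powr_divide powr_powr)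

lemma midpoint_gap_divide:
  assumes "0 < s" "p \<noteq> 0"
  shows "midpoint_gap p (a / of_real (s powr (1 / p))) (b / of_real (s powr (1 / p)))
    = midpoint_gap p a b / s"
proof -
  define r where "r = complex_of_real (s powr (1 / p))"
  note scale = norm_divide_root_powr[OF assms, folded r_def]
  have "(a / r + b / r) / 2 = ((a + b) / 2) / r" by (simp add: add_divide_distrib mult.commute)
  then have "midpoint_gap p (a / r) (b / r)
      = (norm a powr p / s + norm b powr p / s) / 2 - norm ((a + b) / 2) powr p / s"
    unfolding midpoint_gap_def by (simp only: scale)
  then show ?thesis unfolding midpoint_gap_def r_def by (simp add: add_divide_distrib diff_divide_distrib)
qed

lemma norm_le_1_if_sum_powr_eq_1:
  fixes a b :: complex
  assumes "norm a powr p + norm b powr p = 1" "0 < p"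
  shows "norm a \<le> 1"
proof (rule ccontr)
  assume "\<not> norm a \<le> 1"
  then have "1 < norm a powr p" using assms(2) by (simp add: gr_one_powr)
  then show False using assms(1) powr_ge_zero[of "norm b" p] by linarith
qed

lemma compact_separated_unit_pairs:
  assumes p: "0 < p"
  shows "compact {z :: complex \<times> complex.
    norm (fst z) powr p + norm (snd z) powr p = 1 \<and> \<epsilon> \<le> norm (fst z - snd z) powr p}" (is "compact ?S")
proof -
  have cont: "continuous_on UNIV (\<lambda>z. norm (g z) powr p)"
    if "continuous_on UNIV g" for g :: "complex \<times> complex \<Rightarrow> complex"
    using that p by (intro continuous_on_powr' continuous_intros) auto
  have "closed ?S"
    by (intro closed_Collect_conj closed_Collect_eq closed_Collect_le continuous_intros cont)
  moreover have "bounded ?S"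
  proof (rule boundedI)
    fix z :: "complex \<times> complex" assume "z \<in> ?S"
    then have "norm (fst z) \<le> 1" "norm (snd z) \<le> 1"
      using p norm_le_1_if_sum_powr_eq_1[of "fst z" p "snd z"]
        norm_le_1_if_sum_powr_eq_1[of "snd z" p "fst z"]
      by (simp_all add: add.commute)
    then show "norm z \<le> 2" using norm_Pair_le[of "fst z" "snd z"] by simp
  qed
  ultimately show ?thesis by (simp add: compact_eq_bounded_closed)
qed

lemma midpoint_gap_lower_bound:
  assumes p: "1 < p" and \<epsilon>: "0 < \<epsilon>"
  obtains \<delta> where "0 < \<delta>" "\<And>a b. norm a powr p + norm b powr p = 1 \<Longrightarrow>
    \<epsilon> \<le> norm (a - b) powr p \<Longrightarrow> \<delta> \<le> midpoint_gap p a b"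
proof -
  define S :: "(complex \<times> complex) set" where
    "S = {z. norm (fst z) powr p + norm (snd z) powr p = 1 \<and> \<epsilon> \<le> norm (fst z - snd z) powr p}"
  show thesis
  proof (cases "S = {}")
    case True
    then show thesis using that[of 1] by (auto simp: S_def)
  next
    case False
    have "continuous_on S (\<lambda>z. midpoint_gap p (fst z) (snd z))"
      unfolding midpoint_gap_def using p by (intro continuous_on_powr' continuous_intros) auto
    moreover have "compact S" unfolding S_def using p by (intro compact_separated_unit_pairs) simp
    ultimately obtain w where w: "w \<in> S" "\<And>z. z \<in> S \<Longrightarrow>
        midpoint_gap p (fst w) (snd w) \<le> midpoint_gap p (fst z) (snd z)"
      using continuous_attains_inf[OF _ False] by blast
    have "fst w \<noteq> snd w" using w(1) \<epsilon> by (auto simp: S_def)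
    then show thesis
      using that[OF midpoint_gap_pos[OF p]] w(2)[of "(_, _)"] by (auto simp: S_def)
  qed
qed

lemma norm_diff_powr_le_midpoint_gap_normalized:
  assumes p: "1 < p" and \<epsilon>: "0 < \<epsilon>"
  obtains C where "0 \<le> C"
    "\<And>a b. norm a powr p + norm b powr p = 1 \<Longrightarrow> norm (a - b) powr p \<le> \<epsilon> + C * midpoint_gap p a b"
proof -
  obtain \<delta> where \<delta>: "0 < \<delta>" "\<And>a b. norm a powr p + norm b powr p = 1 \<Longrightarrow>
    \<epsilon> \<le> norm (a - b) powr p \<Longrightarrow> \<delta> \<le> midpoint_gap p a b"
    using midpoint_gap_lower_bound[OF assms] by blast
  define C where "C = 2 powr p / \<delta>"
  have C: "0 \<le> C" using \<delta> by (simp add: C_def)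
  have "norm (a - b) powr p \<le> \<epsilon> + C * midpoint_gap p a b" if ab: "norm a powr p + norm b powr p = 1"
    for a b
  proof (cases "\<epsilon> \<le> norm (a - b) powr p")
    case True
    have "norm a \<le> 1" "norm b \<le> 1"
      using p ab norm_le_1_if_sum_powr_eq_1[of a p b] norm_le_1_if_sum_powr_eq_1[of b p a]
      by (simp_all add: add.commute)
    then have "norm (a - b) powr p \<le> 2 powr p"
      using norm_triangle_ineq4[of a b] p by (intro powr_mono2) auto
    also have "\<dots> = C * \<delta>" using \<delta> by (simp add: C_def)
    also have "\<dots> \<le> C * midpoint_gap p a b" using \<delta>(2)[OF ab True] C by (intro mult_left_mono) auto
    finally show ?thesis using \<epsilon> by linarith
  next
    case False
    then show ?thesis using C midpoint_gap_nonneg[OF p, of a b] by (smt (verit) mult_nonneg_nonneg)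
  qed
  then show thesis using that C by blast
qed

text \<open>The quantitative form of strict convexity from which uniform convexity of \<open>L\<^sup>p\<close> follows by integration.\<close>

lemma norm_diff_powr_le_midpoint_gap:
  assumes p: "1 < p" and \<epsilon>: "0 < \<epsilon>"
  obtains C where "0 \<le> C"
    "\<And>a b. norm (a - b) powr p \<le> \<epsilon> * (norm a powr p + norm b powr p) + C * midpoint_gap p a b"
proof -
  obtain C where C: "0 \<le> C" and normalized: "\<And>a b. norm a powr p + norm b powr p = 1 \<Longrightarrow>
    norm (a - b) powr p \<le> \<epsilon> + C * midpoint_gap p a b"
    using norm_diff_powr_le_midpoint_gap_normalized[OF assms] by blast
  show thesis
  proof (rule that[OF C])
    fix a b :: complex
    define s where "s = norm a powr p + norm b powr p"
    show "norm (a - b) powr p \<le> \<epsilon> * (norm a powr p + norm b powr p) + C * midpoint_gap p a b"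
    proof (cases "s = 0")
      case True
      then have "norm a powr p = 0" "norm b powr p = 0" unfolding s_def by (smt (verit) powr_ge_zero)+
      then show ?thesis by (simp add: midpoint_gap_def)
    next
      case False
      then have s: "0 < s" unfolding s_def by (smt (verit) powr_ge_zero)
      have p0: "p \<noteq> 0" using p by simp
      define r where "r = complex_of_real (s powr (1 / p))"
      note scale = norm_divide_root_powr[OF s p0, folded r_def]
      have "norm (a / r) powr p + norm (b / r) powr p = 1"
        using s by (simp add: scale s_def flip: add_divide_distrib)
      then have "norm ((a - b) / r) powr p \<le> \<epsilon> + C * (midpoint_gap p a b / s)"
        using normalized[of "a / r" "b / r"] midpoint_gap_divide[OF s p0, of a b]
        by (simp add: diff_divide_distrib r_def)
      then show ?thesis using s by (simp add: scale field_simps flip: s_def)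
    qed
  qed
qed

lemma powr_le_scaled:
  fixes u v C p :: real
  assumes "u \<le> C * v" "0 \<le> u" "0 \<le> v" "0 \<le> p" "0 \<le> C"
  shows "u powr p \<le> C powr p * v powr p"
proof -
  have "u powr p \<le> (C * v) powr p" using assms by (intro powr_mono2) auto
  then show ?thesis using assms by (simp add: powr_mult)
qed

lemma norm_add_powr_le:
  fixes a b :: complex
  assumes "0 \<le> p"
  shows "norm (a + b) powr p \<le> 2 powr p * (norm a powr p + norm b powr p)"
proof -
  have "norm (a + b) \<le> 2 * max (norm a) (norm b)" using norm_triangle_ineq[of a b] by linarith
  then have "norm (a + b) powr p \<le> 2 powr p * max (norm a) (norm b) powr p"
    using assms by (intro powr_le_scaled) (auto simp: le_max_iff_disj)
  also have "\<dots> \<le> 2 powr p * (norm a powr p + norm b powr p)"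
    by (intro mult_left_mono) (auto simp: max_def)
  finally show ?thesis .
qed

lemma tendsto_norm_powr:
  assumes "X \<longlonglongrightarrow> x" "0 < p"
  shows "(\<lambda>n. norm (X n :: complex) powr p) \<longlonglongrightarrow> norm x powr p"
  using tendsto_powr'[OF tendsto_norm[OF assms(1)] tendsto_const[of p]] assms(2) by simp

section \<open>\<open>L\<^sup>p\<close> spaces of complex functions\<close>

definition Lspace :: "'a measure \<Rightarrow> real \<Rightarrow> ('a \<Rightarrow> complex) set" where
  "Lspace M p = {f \<in> borel_measurable M. integrable M (\<lambda>x. norm (f x) powr p)}"

definition Lnorm :: "'a measure \<Rightarrow> real \<Rightarrow> ('a \<Rightarrow> complex) \<Rightarrow> real" where
  "Lnorm M p f = (LINT x|M. norm (f x) powr p) powr (1 / p)"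

lemma borel_measurable_cnj [measurable (raw)]:
  "f \<in> borel_measurable M \<Longrightarrow> (\<lambda>x. cnj (f x)) \<in> borel_measurable M"
  by (rule measurable_compose[OF _ borel_measurable_continuous_onI]) (auto intro: continuous_intros)

lemma Lspace_measurable [measurable_dest]: "f \<in> Lspace M p \<Longrightarrow> f \<in> borel_measurable M"
  and Lspace_integrable: "f \<in> Lspace M p \<Longrightarrow> integrable M (\<lambda>x. norm (f x) powr p)"
  by (auto simp: Lspace_def)

lemma Lspace_dominated:
  assumes "g \<in> Lspace M p" "f \<in> borel_measurable M" "AE x in M. norm (f x) \<le> C * norm (g x)" "0 \<le> p"
    "0 \<le> C"
  shows "f \<in> Lspace M p"
proof -
  note [measurable] = assms(2)
  have "integrable M (\<lambda>x. norm (f x) powr p)"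
  proof (rule Bochner_Integration.integrable_bound)
    show "integrable M (\<lambda>x. C powr p * norm (g x) powr p)" using Lspace_integrable[OF assms(1)] by simp
    show "AE x in M. norm (norm (f x) powr p) \<le> norm (C powr p * norm (g x) powr p)"
      using assms(3) by eventually_elim (simp add: powr_le_scaled assms(4,5))
  qed measurable
  then show ?thesis using assms(2) by (simp add: Lspace_def)
qed

lemma Lspace_add:
  assumes "f \<in> Lspace M p" "g \<in> Lspace M p" "0 \<le> p"
  shows "(\<lambda>x. f x + g x) \<in> Lspace M p"
proof -
  note [measurable] = assms(1,2)[THEN Lspace_measurable]
  have "integrable M (\<lambda>x. 2 powr p * (norm (f x) powr p + norm (g x) powr p))"
    using assms(1,2)[THEN Lspace_integrable] by simp
  then have "integrable M (\<lambda>x. norm (f x + g x) powr p)"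
    by (rule Bochner_Integration.integrable_bound) (use norm_add_powr_le[OF assms(3)] in auto)
  then show ?thesis by (simp add: Lspace_def)
qed

lemma Lspace_mult_left:
  assumes "f \<in> Lspace M p" "0 \<le> p"
  shows "(\<lambda>x. c * f x) \<in> Lspace M p"
  by (rule Lspace_dominated[OF assms(1), where C = "norm c"]) (use assms in \<open>auto simp: norm_mult\<close>)

lemma Lspace_diff:
  assumes "f \<in> Lspace M p" "g \<in> Lspace M p" "0 \<le> p"
  shows "(\<lambda>x. f x - g x) \<in> Lspace M p"
  using Lspace_add[OF assms(1) Lspace_mult_left[OF assms(2,3), of "-1"] assms(3)] by simp

lemma Lspace_bounded:
  assumes "finite_measure M" "f \<in> borel_measurable M" "AE x in M. norm (f x) \<le> C" "0 \<le> p"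
  shows "f \<in> Lspace M p"
proof -
  interpret finite_measure M by fact
  note [measurable] = assms(2)
  have "AE x in M. norm (norm (f x) powr p) \<le> C powr p"
    using assms(3) by eventually_elim (use assms in \<open>auto intro: powr_mono2\<close>)
  then have "integrable M (\<lambda>x. norm (f x) powr p)" by (intro integrable_const_bound) auto
  then show ?thesis by (simp add: Lspace_def)
qed

lemma Lnorm_nonneg [simp]: "0 \<le> Lnorm M p f"
  by (simp add: Lnorm_def)

lemma Lnorm_powr: "0 < p \<Longrightarrow> Lnorm M p f powr p = (LINT x|M. norm (f x) powr p)"
  by (simp add: Lnorm_def powr_powr integral_nonneg_AE)

lemma Lnorm_le_iff:
  assumes "0 < p" "0 \<le> c"
  shows "Lnorm M p f \<le> c \<longleftrightarrow> (LINT x|M. norm (f x) powr p) \<le> c powr p"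
  using assms powr_mono2[of p "Lnorm M p f" c] powr_less_mono2[of p c "Lnorm M p f"]
  by (auto simp: Lnorm_powr[symmetric] not_le[symmetric])

lemma Lnorm_mult_left: "0 < p \<Longrightarrow> Lnorm M p (\<lambda>x. c * f x) = norm c * Lnorm M p f"
  by (simp add: Lnorm_def norm_mult powr_mult powr_powr)

lemma Lnorm_eq_0:
  assumes "f \<in> Lspace M p" "0 < p" "Lnorm M p f = 0"
  shows "AE x in M. f x = 0"
proof -
  have "(LINT x|M. norm (f x) powr p) = 0" using Lnorm_powr[of p M f] assms by simp
  then have "AE x in M. norm (f x) powr p = 0"
    using Lspace_integrable[OF assms(1)] by (subst (asm) integral_nonneg_eq_0_iff_AE) auto
  then show ?thesis by simp
qed

lemma Lnorm_dominated:
  assumes "g \<in> Lspace M p" "f \<in> borel_measurable M" "AE x in M. norm (f x) \<le> C * norm (g x)" "0 < p"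
    "0 \<le> C"
  shows "Lnorm M p f \<le> C * Lnorm M p g"
proof -
  have f: "f \<in> Lspace M p" using assms by (intro Lspace_dominated[OF assms(1-3)]) auto
  have "(LINT x|M. norm (f x) powr p) \<le> (LINT x|M. C powr p * norm (g x) powr p)"
  proof (rule integral_mono_AE)
    show "AE x in M. norm (f x) powr p \<le> C powr p * norm (g x) powr p"
      using assms(3) by eventually_elim (use assms in \<open>simp add: powr_le_scaled\<close>)
  qed (use f assms(1) Lspace_integrable in auto)
  then show ?thesis using assms by (simp add: Lnorm_le_iff powr_mult Lnorm_powr)
qed

lemma Lnorm_cong_AE:
  assumes "AE x in M. f x = g x" "f \<in> borel_measurable M" "g \<in> borel_measurable M"
  shows "Lnorm M p f = Lnorm M p g"
proof -
  note [measurable] = assms(2,3)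
  have "(LINT x|M. norm (f x) powr p) = (LINT x|M. norm (g x) powr p)"
    using assms by (intro integral_cong_AE) auto
  then show ?thesis by (simp add: Lnorm_def)
qed

lemma conj_exp:
  assumes "1 < p"
  shows conj_exp_gt_1: "1 < conj_exp p" and conj_exp_sum: "1 / p + 1 / conj_exp p = 1"
    and conj_exp_conj_exp [simp]: "conj_exp (conj_exp p) = p"
  using assms by (auto simp: conj_exp_def divide_simps)

lemma norm_mult_le_Young:
  fixes u v :: complex
  assumes p: "1 < p" and AB: "0 < A" "0 < B"
  shows "norm (u * v) \<le> A * B * ((norm u powr p / A powr p) / p
    + (norm v powr conj_exp p / B powr conj_exp p) / conj_exp p)"
proof -
  have "norm u / A * (norm v / B) \<le> (norm u / A) powr p / p + (norm v / B) powr conj_exp p / conj_exp p"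
    using AB by (intro Youngs_inequality[OF p conj_exp_gt_1[OF p] conj_exp_sum[OF p]]) auto
  then have "A * B * (norm u / A * (norm v / B))
      \<le> A * B * ((norm u / A) powr p / p + (norm v / B) powr conj_exp p / conj_exp p)"
    using AB by (intro mult_left_mono) auto
  then show ?thesis using AB by (simp add: norm_mult powr_divide)
qed

lemma Hoelder_integrable:
  assumes f: "f \<in> Lspace M p" and g: "g \<in> Lspace M (conj_exp p)" and p: "1 < p"
  shows "integrable M (\<lambda>x. f x * g x)"
proof (rule Bochner_Integration.integrable_bound)
  note [measurable] = Lspace_measurable[OF f] Lspace_measurable[OF g]
  show "integrable M (\<lambda>x. norm (f x) powr p / p + norm (g x) powr conj_exp p / conj_exp p)"
    using Lspace_integrable[OF f] Lspace_integrable[OF g] by auto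
  show "AE x in M. norm (f x * g x)
      \<le> norm (norm (f x) powr p / p + norm (g x) powr conj_exp p / conj_exp p)"
    using norm_mult_le_Young[OF p, of 1 1] by (intro AE_I2) (simp add: order.trans[OF _ abs_ge_self])
qed (use f g in measurable)

lemma Hoelder_inequality:
  assumes f: "f \<in> Lspace M p" and g: "g \<in> Lspace M (conj_exp p)" and p: "1 < p"
  shows "(LINT x|M. norm (f x * g x)) \<le> Lnorm M p f * Lnorm M (conj_exp p) g"
proof -
  define q A B where "q = conj_exp p" and "A = Lnorm M p f" and "B = Lnorm M q g"
  note q = conj_exp_gt_1[OF p, folded q_def]
  note [measurable] = Lspace_measurable[OF f] Lspace_measurable[OF g]
  show ?thesis
  proof (cases "A = 0 \<or> B = 0")
    case True
    then have "AE x in M. norm (f x * g x) = 0"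
      using Lnorm_eq_0[OF f] Lnorm_eq_0[OF g] p q by (auto simp: A_def B_def q_def)
    then have "(LINT x|M. norm (f x * g x)) = (LINT x|M. 0)" by (intro integral_cong_AE) auto
    then show ?thesis by simp
  next
    case False
    then have AB: "0 < A" "0 < B" by (auto simp: A_def B_def less_le)
    note integrable = Lspace_integrable[OF f] Lspace_integrable[OF g, folded q_def]
    have "(LINT x|M. norm (f x * g x)) \<le>
      (LINT x|M. A * B * ((norm (f x) powr p / A powr p) / p + (norm (g x) powr q / B powr q) / q))"
    proof (rule integral_mono)
      show "integrable M (\<lambda>x. norm (f x * g x))" using Hoelder_integrable[OF assms] by simp
    qed (use integrable norm_mult_le_Young[OF p AB] in \<open>auto simp: q_def\<close>)
    also have "\<dots> = A * B * ((A powr p / A powr p) / p + (B powr q / B powr q) / q)"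
      using integrable p q by (simp add: A_def B_def Lnorm_powr)
    also have "\<dots> = A * B" using AB p conj_exp_sum[OF p] by (simp add: q_def)
    finally show ?thesis by (simp add: A_def B_def q_def)
  qed
qed

lemma Lnorm_dual_attained:
  assumes f: "f \<in> Lspace M p" and p: "1 < p"
  obtains \<psi> where "\<psi> \<in> Lspace M (conj_exp p)" "Lnorm M (conj_exp p) \<psi> \<le> 1"
    "(LINT x|M. f x * \<psi> x) = complex_of_real (Lnorm M p f)"
proof -
  define q where "q = conj_exp p"
  have q: "1 < q" "(p - 1) * q = p" using conj_exp_gt_1[OF p] p by (auto simp: q_def conj_exp_def)
  note [measurable] = Lspace_measurable[OF f]
  define A where "A = Lnorm M p f"
  have A: "0 \<le> A" by (simp add: A_def)
  define \<psi> where "\<psi> x = cnj (f x) * of_real (norm (f x) powr (p - 2) / A powr (p - 1))" for x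
  have pm1: "norm z * norm z powr (p - 2) = norm z powr (p - 1)" for z :: complex
    using powr_mult_base[of "norm z" "p - 2"] by (cases "z = 0") auto
  have "norm (\<psi> x) = norm (f x) powr (p - 1) / A powr (p - 1)" for x
    by (simp add: \<psi>_def norm_mult pm1 A norm_divide)
  then have norm_\<psi>: "norm (\<psi> x) powr q = norm (f x) powr p / A powr p" for x
    using A by (simp add: powr_divide powr_powr q)
  have "\<psi> \<in> borel_measurable M" unfolding \<psi>_def by measurable
  then have \<psi>: "\<psi> \<in> Lspace M q" using Lspace_integrable[OF f] by (simp add: Lspace_def norm_\<psi>)
  have "(LINT x|M. norm (\<psi> x) powr q) = A powr p / A powr p"
    unfolding norm_\<psi> using p by (simp add: A_def Lnorm_powr)
  then have "(LINT x|M. norm (\<psi> x) powr q) \<le> 1 powr q" by (cases "A = 0") auto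
  then have norm_le: "Lnorm M q \<psi> \<le> 1" using q by (subst Lnorm_le_iff) auto
  have "f x * \<psi> x = complex_of_real (norm (f x) powr p / A powr (p - 1))" for x
  proof -
    have "norm (f x) * (norm (f x) * norm (f x) powr (p - 2)) = norm (f x) powr p"
      unfolding pm1 using powr_mult_base[of "norm (f x)" "p - 1"] p by (cases "f x = 0") auto
    moreover have "f x * cnj (f x) = complex_of_real (norm (f x) * norm (f x))"
      using complex_norm_square[of "f x"] by (simp add: power2_eq_square)
    ultimately show ?thesis unfolding \<psi>_def by (simp add: mult.assoc[symmetric] flip: of_real_mult)
  qed
  then have "(LINT x|M. f x * \<psi> x) = complex_of_real (LINT x|M. norm (f x) powr p / A powr (p - 1))"
    by simp
  also have "(LINT x|M. norm (f x) powr p / A powr (p - 1)) = A powr p / A powr (p - 1)"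
    using p by (simp add: A_def Lnorm_powr)
  also have "\<dots> = A" using A p by (cases "A = 0") (auto simp flip: powr_diff)
  finally show thesis using that \<psi> norm_le unfolding q_def A_def by blast
qed

lemma Lnorm_triangle:
  assumes f: "f \<in> Lspace M p" and g: "g \<in> Lspace M p" and p: "1 < p"
  shows "Lnorm M p (\<lambda>x. f x + g x) \<le> Lnorm M p f + Lnorm M p g"
proof -
  have sum: "(\<lambda>x. f x + g x) \<in> Lspace M p" using Lspace_add[OF f g] p by simp
  obtain \<psi> where \<psi>: "\<psi> \<in> Lspace M (conj_exp p)" "Lnorm M (conj_exp p) \<psi> \<le> 1"
    "(LINT x|M. (f x + g x) * \<psi> x) = complex_of_real (Lnorm M p (\<lambda>x. f x + g x))"
    using Lnorm_dual_attained[OF sum p] .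
  have bound: "norm (LINT x|M. h x * \<psi> x) \<le> Lnorm M p h" if "h \<in> Lspace M p" for h
  proof -
    have "norm (LINT x|M. h x * \<psi> x) \<le> (LINT x|M. norm (h x * \<psi> x))" by (rule integral_norm_bound)
    also have "\<dots> \<le> Lnorm M p h * Lnorm M (conj_exp p) \<psi>" by (rule Hoelder_inequality[OF that \<psi>(1) p])
    also have "\<dots> \<le> Lnorm M p h" using \<psi>(2) by (simp add: mult_left_le)
    finally show ?thesis .
  qed
  have "complex_of_real (Lnorm M p (\<lambda>x. f x + g x)) = (LINT x|M. f x * \<psi> x) + (LINT x|M. g x * \<psi> x)"
    unfolding \<psi>(3)[symmetric] distrib_right
    by (intro Bochner_Integration.integral_add Hoelder_integrable[OF _ \<psi>(1) p] f g)
  then have "Lnorm M p (\<lambda>x. f x + g x) = norm ((LINT x|M. f x * \<psi> x) + (LINT x|M. g x * \<psi> x))"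
    by (metis Lnorm_nonneg abs_of_nonneg norm_of_real)
  also have "\<dots> \<le> Lnorm M p f + Lnorm M p g" by (intro norm_triangle_mono bound f g)
  finally show ?thesis .
qed

lemma Lnorm_uniformly_convex:
  assumes p: "1 < p" and \<epsilon>: "0 < \<epsilon>"
  obtains C where "0 \<le> C" "\<And>f g. f \<in> Lspace M p \<Longrightarrow> g \<in> Lspace M p \<Longrightarrow>
    Lnorm M p (\<lambda>x. f x - g x) powr p \<le> \<epsilon> * (Lnorm M p f powr p + Lnorm M p g powr p)
      + C * ((Lnorm M p f powr p + Lnorm M p g powr p) / 2 - Lnorm M p (\<lambda>x. (f x + g x) / 2) powr p)"
proof -
  obtain C where C: "0 \<le> C"
    "\<And>a b. norm (a - b) powr p \<le> \<epsilon> * (norm a powr p + norm b powr p) + C * midpoint_gap p a b"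
    using norm_diff_powr_le_midpoint_gap[OF p \<epsilon>] by blast
  show thesis
  proof (rule that[OF C(1)])
    fix f g assume f: "f \<in> Lspace M p" and g: "g \<in> Lspace M p"
    have "(\<lambda>x. (f x + g x) / 2) \<in> Lspace M p" "(\<lambda>x. f x - g x) \<in> Lspace M p"
      using Lspace_mult_left[OF Lspace_add[OF f g], of "1/2"] Lspace_diff[OF f g] p by simp_all
    note integrable = f[THEN Lspace_integrable] g[THEN Lspace_integrable] this[THEN Lspace_integrable]
    have "(LINT x|M. norm (f x - g x) powr p) \<le>
      (LINT x|M. \<epsilon> * (norm (f x) powr p + norm (g x) powr p) + C * midpoint_gap p (f x) (g x))"
      using integrable C(2) unfolding midpoint_gap_def by (intro integral_mono) auto
    also have "\<dots> = \<epsilon> * ((LINT x|M. norm (f x) powr p) + (LINT x|M. norm (g x) powr p))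
      + C * (((LINT x|M. norm (f x) powr p) + (LINT x|M. norm (g x) powr p)) / 2
          - (LINT x|M. norm ((f x + g x) / 2) powr p))"
      using integrable unfolding midpoint_gap_def by simp
    finally show "Lnorm M p (\<lambda>x. f x - g x) powr p \<le> \<epsilon> * (Lnorm M p f powr p + Lnorm M p g powr p)
      + C * ((Lnorm M p f powr p + Lnorm M p g powr p) / 2 - Lnorm M p (\<lambda>x. (f x + g x) / 2) powr p)"
      using p by (simp add: Lnorm_powr)
  qed
qed

lemma Lspace_imp_integrable:
  assumes "finite_measure M" "f \<in> Lspace M p" "1 < p"
  shows "integrable M f"
  using Hoelder_integrable[OF assms(2) Lspace_bounded[OF assms(1), of "\<lambda>_. 1" 1] assms(3)]
    conj_exp_gt_1[OF assms(3)] by simp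

lemma integral_norm_le_Lnorm:
  assumes "finite_measure M" "f \<in> Lspace M p" "1 < p"
  shows "(LINT x|M. norm (f x)) \<le> Lnorm M p f * Lnorm M (conj_exp p) (\<lambda>_. 1)"
  using Hoelder_inequality[OF assms(2) Lspace_bounded[OF assms(1), of "\<lambda>_. 1" 1] assms(3)]
    conj_exp_gt_1[OF assms(3)] by simp

lemma Lnorm_Fatou:
  assumes F: "\<And>k. F k \<in> Lspace M p" and bound: "\<And>k. Lnorm M p (F k) \<le> e" and p: "0 < p"
    and lim: "AE x in M. (\<lambda>k. F k x) \<longlonglongrightarrow> f x" and f[measurable]: "f \<in> borel_measurable M"
  shows "f \<in> Lspace M p" and "Lnorm M p f \<le> e"
proof -
  note [measurable] = F[THEN Lspace_measurable]
  have e: "0 \<le> e" using bound[of 0] Lnorm_nonneg[of M p "F 0"] by linarith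
  have "AE x in M. ennreal (norm (f x) powr p) = liminf (\<lambda>k. ennreal (norm (F k x) powr p))"
    using lim
  proof eventually_elim
    case (elim x)
    then have "(\<lambda>k. ennreal (norm (F k x) powr p)) \<longlonglongrightarrow> ennreal (norm (f x) powr p)"
      using p by (intro tendsto_ennrealI tendsto_norm_powr)
    then show ?case by (rule lim_imp_Liminf[OF sequentially_bot, symmetric])
  qed
  then have "(\<integral>\<^sup>+x. ennreal (norm (f x) powr p) \<partial>M)
      = (\<integral>\<^sup>+x. liminf (\<lambda>k. ennreal (norm (F k x) powr p)) \<partial>M)"
    by (rule nn_integral_cong_AE)
  also have "\<dots> \<le> liminf (\<lambda>k. \<integral>\<^sup>+x. ennreal (norm (F k x) powr p) \<partial>M)"
    by (rule nn_integral_liminf) measurable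
  also have "\<dots> \<le> liminf (\<lambda>k::nat. ennreal (e powr p))"
  proof (intro Liminf_mono always_eventually allI)
    fix k
    have "(\<integral>\<^sup>+x. ennreal (norm (F k x) powr p) \<partial>M) = ennreal (Lnorm M p (F k) powr p)"
      using Lspace_integrable[OF F] p by (simp add: nn_integral_eq_integral Lnorm_powr)
    also have "\<dots> \<le> ennreal (e powr p)" using bound[of k] p by (intro ennreal_leI powr_mono2) auto
    finally show "(\<integral>\<^sup>+x. ennreal (norm (F k x) powr p) \<partial>M) \<le> ennreal (e powr p)" .
  qed
  finally have nn_bound: "(\<integral>\<^sup>+x. ennreal (norm (f x) powr p) \<partial>M) \<le> ennreal (e powr p)"
    by (simp add: Liminf_const)
  then have int: "integrable M (\<lambda>x. norm (f x) powr p)"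
    by (intro integrableI_bounded) (auto intro: le_less_trans)
  then show "f \<in> Lspace M p" using f by (simp add: Lspace_def)
  have "(LINT x|M. norm (f x) powr p) \<le> e powr p"
    using nn_bound int by (simp add: nn_integral_eq_integral ennreal_le_iff)
  then show "Lnorm M p f \<le> e" using p e by (simp add: Lnorm_le_iff)
qed

lemma Lnorm_Cauchy_AE_subsequence:
  fixes F :: "nat \<Rightarrow> 'a \<Rightarrow> complex"
  assumes fin: "finite_measure M" and p: "1 < p" and F: "\<And>n. F n \<in> Lspace M p"
    and Cauchy: "\<And>e. 0 < e \<Longrightarrow> \<exists>N. \<forall>m\<ge>N. \<forall>n\<ge>N. Lnorm M p (\<lambda>x. F m x - F n x) < e"
  obtains r where "strict_mono r" "AE x in M. Cauchy (\<lambda>i. F (r i) x)"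
proof (rule cauchy_L1_AE_cauchy_subseq[of M F])
  define K where "K = Lnorm M (conj_exp p) (\<lambda>_. 1) + 1"
  have K: "0 < K" by (simp add: K_def add_nonneg_pos)
  have L1_bound: "(LINT x|M. norm (F m x - F n x)) \<le> Lnorm M p (\<lambda>x. F m x - F n x) * K" for m n
  proof -
    have "(\<lambda>x. F m x - F n x) \<in> Lspace M p" using Lspace_diff[OF F F] p by simp
    then have "(LINT x|M. norm (F m x - F n x)) \<le> Lnorm M p (\<lambda>x. F m x - F n x) * (K - 1)"
      using integral_norm_le_Lnorm[OF fin _ p] by (simp add: K_def)
    also have "\<dots> \<le> Lnorm M p (\<lambda>x. F m x - F n x) * K" by (intro mult_left_mono) auto
    finally show ?thesis .
  qed
  show "integrable M (F n)" for n by (rule Lspace_imp_integrable[OF fin F p])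
  fix e :: real assume "0 < e"
  then obtain N where N: "\<forall>m\<ge>N. \<forall>n\<ge>N. Lnorm M p (\<lambda>x. F m x - F n x) < e / K"
    using Cauchy[of "e / K"] K by auto
  show "\<exists>N. \<forall>i\<ge>N. \<forall>j\<ge>N. (LINT x|M. norm (F i x - F j x)) < e"
  proof (intro exI[of _ N] allI impI)
    fix i j assume "N \<le> i" "N \<le> j"
    then have "Lnorm M p (\<lambda>x. F i x - F j x) * K < e" using N K by (simp add: field_simps)
    then show "(LINT x|M. norm (F i x - F j x)) < e" using L1_bound[of i j] by linarith
  qed
qed (rule that)

theorem Lspace_complete:
  fixes F :: "nat \<Rightarrow> 'a \<Rightarrow> complex"
  assumes fin: "finite_measure M" and p: "1 < p" and F: "\<And>n. F n \<in> Lspace M p"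
    and Cauchy: "\<And>e. 0 < e \<Longrightarrow> \<exists>N. \<forall>m\<ge>N. \<forall>n\<ge>N. Lnorm M p (\<lambda>x. F m x - F n x) < e"
  obtains f where "f \<in> Lspace M p" "(\<lambda>n. Lnorm M p (\<lambda>x. F n x - f x)) \<longlonglongrightarrow> 0"
proof -
  note [measurable] = F[THEN Lspace_measurable]
  obtain r where r: "strict_mono r" "AE x in M. Cauchy (\<lambda>i. F (r i) x)"
    using Lnorm_Cauchy_AE_subsequence[OF assms] by blast
  define f where "f x = lim (\<lambda>k. F (r k) x)" for x
  have [measurable]: "f \<in> borel_measurable M" unfolding f_def by measurable
  have lim: "AE x in M. (\<lambda>k. F (r k) x) \<longlonglongrightarrow> f x"
    using r(2) by eventually_elim (simp add: f_def Cauchy_convergent_iff convergent_LIMSEQ_iff)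
  have tail: "(\<lambda>x. F n x - f x) \<in> Lspace M p \<and> Lnorm M p (\<lambda>x. F n x - f x) \<le> e"
    if N: "\<forall>m\<ge>N. \<forall>n\<ge>N. Lnorm M p (\<lambda>x. F m x - F n x) < e" and n: "N \<le> n" for N n e
  proof -
    define D where "D k x = F n x - F (r (k + N)) x" for k x
    have "D k \<in> Lspace M p" for k unfolding D_def using Lspace_diff[OF F F] p by simp
    moreover have "Lnorm M p (D k) \<le> e" for k
      using N n seq_suble[OF r(1), of "k + N"] unfolding D_def by (auto intro: less_imp_le)
    moreover have "AE x in M. (\<lambda>k. D k x) \<longlonglongrightarrow> F n x - f x"
      unfolding D_def using lim by eventually_elim (intro tendsto_intros LIMSEQ_ignore_initial_segment)
    ultimately show ?thesis using Lnorm_Fatou[of D M p e "\<lambda>x. F n x - f x"] p by simp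
  qed
  obtain N where "(\<lambda>x. F N x - f x) \<in> Lspace M p" using tail[of _ 1] Cauchy[of 1] by auto
  then have "f \<in> Lspace M p" using Lspace_diff[OF F[of N], of "\<lambda>x. F N x - f x"] p by simp
  moreover have "(\<lambda>n. Lnorm M p (\<lambda>x. F n x - f x)) \<longlonglongrightarrow> 0"
  proof (rule LIMSEQ_I)
    fix e :: real assume "0 < e"
    then obtain N where N: "\<forall>m\<ge>N. \<forall>n\<ge>N. Lnorm M p (\<lambda>x. F m x - F n x) < e / 2"
      using Cauchy[of "e/2"] by auto
    show "\<exists>N. \<forall>n\<ge>N. norm (Lnorm M p (\<lambda>x. F n x - f x) - 0) < e"
      using tail[OF N] \<open>0 < e\<close> by (intro exI[of _ N]) fastforce
  qed
  ultimately show thesis by (rule that)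
qed

lemma Lnorm_dominated_convergence:
  assumes F[measurable]: "\<And>n. F n \<in> borel_measurable M" and lim: "AE x in M. (\<lambda>n. F n x) \<longlonglongrightarrow> 0"
    and bound: "\<And>n. AE x in M. norm (F n x) \<le> w x" and w: "integrable M (\<lambda>x. w x powr p)" and p: "0 < p"
  shows "(\<lambda>n. Lnorm M p (F n)) \<longlonglongrightarrow> 0"
proof -
  have "(\<lambda>n. LINT x|M. norm (F n x) powr p) \<longlonglongrightarrow> (LINT x|M. 0)"
  proof (rule integral_dominated_convergence[where w = "\<lambda>x. w x powr p"])
    show "AE x in M. (\<lambda>n. norm (F n x) powr p) \<longlonglongrightarrow> 0"
      using lim
    proof eventually_elim
      case (elim x)
      then show ?case using tendsto_norm_powr[OF elim p] by simp
    qed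
    show "AE x in M. norm (norm (F n x) powr p) \<le> w x powr p" for n
      using bound[of n]
    proof eventually_elim
      case (elim x)
      then show ?case using p by (simp add: powr_mono2)
    qed
  qed (use w in simp_all)
  then have "(\<lambda>n. (LINT x|M. norm (F n x) powr p) powr (1 / p)) \<longlonglongrightarrow> 0 powr (1 / p)"
    by (intro tendsto_powr'[OF _ tendsto_const]) (use p in \<open>simp_all add: integral_nonneg_AE\<close>)
  then show ?thesis unfolding Lnorm_def using p by simp
qed

section \<open>Lebesgue measure on the circle\<close>

lemma finite_measure_TM: "finite_measure TM"
  by (rule finite_measure_lebesgue_on) auto

lemma borel_measurable_TM: "f \<in> borel_measurable borel \<Longrightarrow> f \<in> borel_measurable TM"
  by (intro measurable_restrict_space1 measurable_completion) simp

lemma cis_2pi_minus: "cis (2 * pi - \<theta>) = cis (- \<theta>)"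
  by (simp add: complex_eq_iff)

lemma measurable_TM_reflect: "(\<lambda>x. 2 * pi - x) \<in> TM \<rightarrow>\<^sub>M TM"
proof -
  have "(\<lambda>x::real. 2 * pi + (-1) * x) \<in> lebesgue \<rightarrow>\<^sub>M lebesgue"
    using lebesgue_affine_measurable[where c = "\<lambda>x::real. -1" and t = "2 * pi"] by simp
  then show ?thesis by (intro measurable_restrict_space3) auto
qed

lemma distr_TM_reflect: "distr TM TM (\<lambda>x. 2 * pi - x) = TM"
proof (rule measure_eqI)
  fix A assume "A \<in> sets (distr TM TM (\<lambda>x. 2 * pi - x))"
  then have TM: "A \<in> sets TM" by simp
  then have A: "A \<in> sets lebesgue" "A \<subseteq> {0..2*pi}" by (auto simp: sets_restrict_space)
  have image: "(\<lambda>x. 2 * pi - x) -` A \<inter> space TM = (\<lambda>x. (-1) *\<^sub>R x + 2 * pi) ` A"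
    using A(2) by (auto simp: image_iff intro!: bexI[where x = "2 * pi - _"])
  have "emeasure (distr TM TM (\<lambda>x. 2 * pi - x)) A = emeasure TM ((\<lambda>x. 2 * pi - x) -` A \<inter> space TM)"
    by (rule emeasure_distr[OF measurable_TM_reflect TM])
  also have "\<dots> = emeasure lebesgue ((\<lambda>x. 2 * pi - x) -` A \<inter> space TM)"
    using measurable_sets[OF measurable_TM_reflect TM]
    by (intro emeasure_restrict_space) (auto simp: sets_restrict_space)
  also have "\<dots> = emeasure lebesgue A"
    unfolding image by (subst emeasure_lebesgue_affine) simp
  also have "\<dots> = emeasure TM A" using A by (intro emeasure_restrict_space[symmetric]) auto
  finally show "emeasure (distr TM TM (\<lambda>x. 2 * pi - x)) A = emeasure TM A" .
qed simp

lemma AE_cis_uminus: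
  assumes "AE \<theta> in TM. P (cis \<theta>)" shows "AE \<theta> in TM. P (cis (- \<theta>))"
proof -
  have "AE \<theta> in TM. P (cis (2 * pi - \<theta>))"
    by (rule AE_distrD[OF measurable_TM_reflect, unfolded distr_TM_reflect, OF assms])
  then show ?thesis by (simp add: cis_2pi_minus)
qed

lemma borel_measurable_cis_uminus:
  assumes "(\<lambda>\<theta>. f (cis \<theta>)) \<in> borel_measurable TM"
  shows "(\<lambda>\<theta>. f (cis (- \<theta>))) \<in> borel_measurable TM"
  using measurable_compose[OF measurable_TM_reflect assms] by (simp add: cis_2pi_minus)

lemma integral_cis_uminus:
  fixes h :: "complex \<Rightarrow> 'b::{banach, second_countable_topology}"
  assumes "(\<lambda>\<theta>. h (cis \<theta>)) \<in> borel_measurable TM"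
  shows "(LINT \<theta>|TM. h (cis (- \<theta>))) = (LINT \<theta>|TM. h (cis \<theta>))"
  using integral_distr[OF measurable_TM_reflect assms] by (simp add: distr_TM_reflect cis_2pi_minus)

lemma integrable_cis_uminus:
  fixes h :: "complex \<Rightarrow> 'b::{banach, second_countable_topology}"
  assumes "integrable TM (\<lambda>\<theta>. h (cis \<theta>))"
  shows "integrable TM (\<lambda>\<theta>. h (cis (- \<theta>)))"
proof -
  have "integrable TM (\<lambda>\<theta>. h (cis (2 * pi - \<theta>)))"
    using assms by (intro integrable_distr[OF measurable_TM_reflect]) (simp add: distr_TM_reflect)
  then show ?thesis by (simp add: cis_2pi_minus)
qed

lemma integrable_cis: "integrable TM (\<lambda>\<theta>. cis (r * \<theta>))"
  by (intro finite_measure.integrable_const_bound[OF finite_measure_TM, of _ 1] borel_measurable_TM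
      borel_measurable_continuous_onI continuous_intros) auto

lemma integral_cis_powi: "(LINT \<theta>|TM. cis \<theta> powi k) = (if k = 0 then 2 * pi else 0)"
proof (cases "k = 0")
  case True
  then show ?thesis by (simp add: measure_restrict_space scaleR_conv_of_real)
next
  case False
  define F where "F \<theta> = cis (of_int k * \<theta>) / (\<i> * of_int k)" for \<theta>
  have "((\<lambda>\<theta>. cis (of_int k * \<theta>)) has_integral F (2 * pi) - F 0) {0..2*pi}"
  proof (rule fundamental_theorem_of_calculus)
    fix \<theta> :: real
    have "((\<lambda>\<theta>. exp (\<i> * of_real (of_int k * \<theta>)) / (\<i> * of_int k))
      has_vector_derivative exp (\<i> * of_real (of_int k * \<theta>))) (at \<theta> within {0..2*pi})"
      using False by (auto intro!: derivative_eq_intros has_vector_derivative_real_field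
        simp: field_simps)
    then show "(F has_vector_derivative cis (of_int k * \<theta>)) (at \<theta> within {0..2*pi})"
      by (simp add: F_def[abs_def] cis_conv_exp)
  qed simp
  moreover have "F (2 * pi) = F 0"
    using cis_multiple_2pi[of "of_int k"] by (simp add: F_def mult.commute)
  ultimately have "integral {0..2*pi} (\<lambda>\<theta>. cis (of_int k * \<theta>)) = 0" by (simp add: integral_unique)
  then show ?thesis
    using False lebesgue_integral_eq_integral[OF integrable_cis, of "of_int k"]
    by (simp add: cis_power_int)
qed

definition circ_measurable :: "(complex \<Rightarrow> complex) \<Rightarrow> bool" where
  "circ_measurable f \<longleftrightarrow> (\<lambda>\<theta>. f (cis \<theta>)) \<in> borel_measurable TM"

lemma circ_measurableD: "circ_measurable f \<Longrightarrow> (\<lambda>\<theta>. f (cis \<theta>)) \<in> borel_measurable TM"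
  by (simp add: circ_measurable_def)

lemma circ_measurable_continuous:
  assumes "continuous_on (sphere 0 1) f" shows "circ_measurable f"
  unfolding circ_measurable_def
  by (intro borel_measurable_TM borel_measurable_continuous_onI continuous_on_compose2[OF assms])
    (auto intro!: continuous_intros)

lemma circ_measurable_const [simp]: "circ_measurable (\<lambda>_. c)"
  and circ_measurable_ident [simp]: "circ_measurable (\<lambda>z. z)"
  and circ_measurable_power [simp]: "circ_measurable (\<lambda>z. z ^ m)"
  by (auto intro!: circ_measurable_continuous continuous_intros)

lemma circ_measurable_add [simp]: "circ_measurable f \<Longrightarrow> circ_measurable g \<Longrightarrow>
    circ_measurable (\<lambda>z. f z + g z)"
  and circ_measurable_diff [simp]: "circ_measurable f \<Longrightarrow> circ_measurable g \<Longrightarrow>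
    circ_measurable (\<lambda>z. f z - g z)"
  and circ_measurable_mult [simp]: "circ_measurable f \<Longrightarrow> circ_measurable g \<Longrightarrow>
    circ_measurable (\<lambda>z. f z * g z)"
  and circ_measurable_uminus [simp]: "circ_measurable f \<Longrightarrow> circ_measurable (\<lambda>z. - f z)"
  and circ_measurable_inverse [simp]: "circ_measurable f \<Longrightarrow> circ_measurable (\<lambda>z. inverse (f z))"
  and circ_measurable_divide [simp]: "circ_measurable f \<Longrightarrow> circ_measurable g \<Longrightarrow>
    circ_measurable (\<lambda>z. f z / g z)"
  and circ_measurable_cnj [simp]: "circ_measurable f \<Longrightarrow> circ_measurable (\<lambda>z. cnj (f z))"
  and circ_measurable_powi [simp]: "circ_measurable f \<Longrightarrow> circ_measurable (\<lambda>z. f z powi k)"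
  by (simp_all add: circ_measurable_def power_int_def)

lemma circ_measurable_compose_inverse [simp]: "circ_measurable f \<Longrightarrow> circ_measurable (\<lambda>z. f (inverse z))"
  by (simp add: circ_measurable_def borel_measurable_cis_uminus)

lemma circ_measurable_sum [simp]:
  "(\<And>i. i \<in> I \<Longrightarrow> circ_measurable (f i)) \<Longrightarrow> circ_measurable (\<lambda>z. \<Sum>i\<in>I. f i z)"
  by (induction I rule: infinite_finite_induct) auto

lemma Arg2pi_cis: "0 \<le> \<theta> \<Longrightarrow> \<theta> < 2 * pi \<Longrightarrow> Arg2pi (cis \<theta>) = \<theta>"
  by (rule Arg2pi_unique[of 1]) (auto simp: cis_conv_exp)

lemma circle_extension:
  assumes h[measurable]: "h \<in> borel_measurable TM"
  obtains F where "circ_measurable F" "AE \<theta> in TM. F (cis \<theta>) = h \<theta>"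
proof
  define F where "F z = h (Arg2pi z)" for z
  have F: "F (cis \<theta>) = (if \<theta> = 2 * pi then h 0 else h \<theta>)" if "\<theta> \<in> {0..2*pi}" for \<theta>
    using that Arg2pi_cis[of \<theta>] Arg2pi_cis[of 0] cis_2pi by (auto simp: F_def)
  have "{\<theta> \<in> space TM. \<theta> = 2 * pi} = {2 * pi}" by auto
  then have "{\<theta> \<in> space TM. \<theta> = 2 * pi} \<in> sets TM" by (simp add: sets_restrict_space_iff)
  then have "(\<lambda>\<theta>. if \<theta> = 2 * pi then h 0 else h \<theta>) \<in> borel_measurable TM"
    by (intro measurable_If measurable_const h) simp_all
  then show "circ_measurable F"
    unfolding circ_measurable_def by (rule measurable_cong[THEN iffD1, rotated]) (simp add: F)
  have "{2 * pi} \<in> null_sets lebesgue" by (simp add: negligible_iff_null_sets[symmetric])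
  then have "AE \<theta> in lebesgue. \<theta> \<notin> {2 * pi}" by (rule AE_not_in)
  then have "AE \<theta> in lebesgue. \<theta> \<in> {0..2*pi} \<longrightarrow> F (cis \<theta>) = h \<theta>" by eventually_elim (simp add: F)
  then show "AE \<theta> in TM. F (cis \<theta>) = h \<theta>" by (simp add: AE_restrict_space_iff)
qed

section \<open>Measurable functions on the circle modulo null sets\<close>

lemma ae_eq_refl [simp]: "ae_eq f f"
  by (simp add: ae_eq_def)

lemma ae_eq_sym: "ae_eq f g \<Longrightarrow> ae_eq g f"
  unfolding ae_eq_def by (erule eventually_mono) simp

lemma ae_eq_trans: "ae_eq f g \<Longrightarrow> ae_eq g h \<Longrightarrow> ae_eq f h"
  unfolding ae_eq_def by (erule (1) eventually_elim2) simp

lemma ae_eq_map: "ae_eq f f' \<Longrightarrow> ae_eq (\<lambda>z. h (f z)) (\<lambda>z. h (f' z))"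
  unfolding ae_eq_def by (erule eventually_mono) simp

lemma ae_eq_map2: "ae_eq f f' \<Longrightarrow> ae_eq g g' \<Longrightarrow> ae_eq (\<lambda>z. h (f z) (g z)) (\<lambda>z. h (f' z) (g' z))"
  unfolding ae_eq_def by (erule (1) eventually_elim2) simp

lemma ae_eq_compose_inverse: "ae_eq f g \<Longrightarrow> ae_eq (\<lambda>z. f (inverse z)) (\<lambda>z. g (inverse z))"
  using AE_cis_uminus[of "\<lambda>z. f z = g z"] by (simp add: ae_eq_def)

quotient_type circle_fun = "complex \<Rightarrow> complex" /
  partial: "\<lambda>f g. circ_measurable f \<and> circ_measurable g \<and> ae_eq f g"
proof (rule part_equivpI)
  show "\<exists>f. circ_measurable f \<and> circ_measurable f \<and> ae_eq f f" by (rule exI[of _ "\<lambda>_. 0"]) simp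
qed (auto simp: symp_def transp_def intro: ae_eq_sym ae_eq_trans)

definition circ_class :: "(complex \<Rightarrow> complex) \<Rightarrow> circle_fun" where
  "circ_class = abs_circle_fun"

lemma circ_class_eq_iff: "circ_measurable f \<Longrightarrow> circ_measurable g \<Longrightarrow> circ_class f = circ_class g \<longleftrightarrow> ae_eq f g"
  using Quotient3_rel[OF Quotient3_circle_fun, of f g] by (simp add: circ_class_def)

lemma circ_class_eqI:
  "circ_measurable f \<Longrightarrow> circ_measurable g \<Longrightarrow> (\<And>\<theta>. f (cis \<theta>) = g (cis \<theta>)) \<Longrightarrow> circ_class f = circ_class g"
  by (simp add: circ_class_eq_iff ae_eq_def)

lemma circle_fun_cases [cases type: circle_fun]:
  obtains (circ_class) F where "f = circ_class F" "circ_measurable F"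
  using Quotient3_rep_reflp[OF Quotient3_circle_fun, of f]
    Quotient3_abs_rep[OF Quotient3_circle_fun, of f]
    that[of "rep_circle_fun f"] by (simp add: circ_class_def)

instantiation circle_fun :: "{zero, one, plus, minus, times, uminus, inverse}"
begin

lift_definition zero_circle_fun :: circle_fun is "\<lambda>_. 0" by simp
lift_definition one_circle_fun :: circle_fun is "\<lambda>_. 1" by simp
lift_definition plus_circle_fun :: "circle_fun \<Rightarrow> circle_fun \<Rightarrow> circle_fun" is "\<lambda>f g z. f z + g z"
  by (simp add: ae_eq_map2)
lift_definition minus_circle_fun :: "circle_fun \<Rightarrow> circle_fun \<Rightarrow> circle_fun" is "\<lambda>f g z. f z - g z"
  by (simp add: ae_eq_map2)
lift_definition times_circle_fun :: "circle_fun \<Rightarrow> circle_fun \<Rightarrow> circle_fun" is "\<lambda>f g z. f z * g z"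
  by (simp add: ae_eq_map2)
lift_definition uminus_circle_fun :: "circle_fun \<Rightarrow> circle_fun" is "\<lambda>f z. - f z"
  by (simp add: ae_eq_map)
lift_definition inverse_circle_fun :: "circle_fun \<Rightarrow> circle_fun" is "\<lambda>f z. inverse (f z)"
  by (simp add: ae_eq_map)
definition divide_circle_fun :: "circle_fun \<Rightarrow> circle_fun \<Rightarrow> circle_fun" where
  "divide_circle_fun f g = f * inverse g"

instance ..

end

lemma circ_class_0: "0 = circ_class (\<lambda>_. 0)"
  and circ_class_1: "1 = circ_class (\<lambda>_. 1)"
  and circ_class_add: "circ_measurable F \<Longrightarrow> circ_measurable G \<Longrightarrow>
    circ_class F + circ_class G = circ_class (\<lambda>z. F z + G z)"
  and circ_class_diff: "circ_measurable F \<Longrightarrow> circ_measurable G \<Longrightarrow>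
    circ_class F - circ_class G = circ_class (\<lambda>z. F z - G z)"
  and circ_class_mult: "circ_measurable F \<Longrightarrow> circ_measurable G \<Longrightarrow>
    circ_class F * circ_class G = circ_class (\<lambda>z. F z * G z)"
  and circ_class_uminus: "circ_measurable F \<Longrightarrow> - circ_class F = circ_class (\<lambda>z. - F z)"
  and circ_class_inverse: "circ_measurable F \<Longrightarrow> inverse (circ_class F) = circ_class (\<lambda>z. inverse (F z))"
  by (simp_all add: circ_class_def zero_circle_fun_def one_circle_fun_def plus_circle_fun.abs_eq
      minus_circle_fun.abs_eq times_circle_fun.abs_eq uminus_circle_fun.abs_eq inverse_circle_fun.abs_eq)

lemmas circ_class_ring = circ_class_0 circ_class_1 circ_class_add circ_class_diff circ_class_mult
  circ_class_uminus

instance circle_fun :: comm_ring_1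
proof
  fix f g h :: circle_fun
  show "f + g + h = f + (g + h)" "f * g * h = f * (g * h)" "(f + g) * h = f * h + g * h"
    by (cases f, cases g, cases h, simp add: circ_class_ring algebra_simps)+
  show "f + g = g + f" "f * g = g * f" "f - g = f + - g"
    by (cases f, cases g, simp add: circ_class_ring algebra_simps)+
  show "0 + f = f" "- f + f = 0" "1 * f = f" by (cases f, simp add: circ_class_ring)+
  show "(0::circle_fun) \<noteq> 1"
  proof
    assume "(0::circle_fun) = 1"
    then have "AE \<theta> in TM. False" by (simp add: circ_class_ring circ_class_eq_iff ae_eq_def)
    then have "emeasure TM (space TM) = 0" by (simp add: ae_filter_eq_bot_iff eventually_False)
    then show False by (simp add: emeasure_restrict_space)
  qed
qed

lemma circ_class_divide:
  "circ_measurable F \<Longrightarrow> circ_measurable G \<Longrightarrow> circ_class F / circ_class G = circ_class (\<lambda>z. F z / G z)"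
  by (simp add: divide_circle_fun_def circ_class_inverse circ_class_mult divide_inverse)

lift_definition const :: "complex \<Rightarrow> circle_fun" is "\<lambda>c _. c" by simp
lift_definition tpow :: "int \<Rightarrow> circle_fun" is "\<lambda>k t. t powi k" by simp
lift_definition bar :: "circle_fun \<Rightarrow> circle_fun" is "\<lambda>f z. cnj (f z)"
  by (simp add: ae_eq_map)
lift_definition tilde :: "circle_fun \<Rightarrow> circle_fun" is "\<lambda>f z. f (inverse z)"
  by (simp add: ae_eq_compose_inverse)
lift_definition mean :: "circle_fun \<Rightarrow> complex" is "\<lambda>f. (LINT \<theta>|TM. f (cis \<theta>)) / of_real (2 * pi)"
  by (intro arg_cong2[where f = "(/)"] integral_cong_AE) (auto simp: ae_eq_def circ_measurable_def)
lift_definition cnorm :: "real \<Rightarrow> circle_fun \<Rightarrow> real" is "\<lambda>p f. Lnorm TM p (\<lambda>\<theta>. f (cis \<theta>))"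
  by (intro Lnorm_cong_AE) (auto simp: ae_eq_def circ_measurable_def)
lift_definition ess_bounded :: "real \<Rightarrow> circle_fun \<Rightarrow> bool" is "\<lambda>C f. AE \<theta> in TM. norm (f (cis \<theta>)) \<le> C"
  unfolding ae_eq_def by (intro eventually_subst) (elim conjE eventually_mono, simp)

definition Lp_class :: "real \<Rightarrow> circle_fun set" where
  "Lp_class p = circ_class ` {F. circ_measurable F \<and> (\<lambda>\<theta>. F (cis \<theta>)) \<in> Lspace TM p}"

definition Linf_class :: "circle_fun set" where
  "Linf_class = {f. \<exists>C. ess_bounded C f}"

definition GLinf_class :: "circle_fun set" where
  "GLinf_class = {f \<in> Linf_class. inverse f \<in> Linf_class \<and> f * inverse f = 1}"

definition fourier :: "circle_fun \<Rightarrow> int \<Rightarrow> complex" where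
  "fourier f j = mean (f * tpow (- j))"

lemma circ_class_const: "const c = circ_class (\<lambda>_. c)"
  and circ_class_tpow: "tpow k = circ_class (\<lambda>z. z powi k)"
  and circ_class_bar: "circ_measurable F \<Longrightarrow> bar (circ_class F) = circ_class (\<lambda>z. cnj (F z))"
  and circ_class_tilde: "circ_measurable F \<Longrightarrow> tilde (circ_class F) = circ_class (\<lambda>z. F (inverse z))"
  and mean_circ_class: "circ_measurable F \<Longrightarrow>
    mean (circ_class F) = (LINT \<theta>|TM. F (cis \<theta>)) / of_real (2 * pi)"
  and cnorm_circ_class: "circ_measurable F \<Longrightarrow> cnorm p (circ_class F) = Lnorm TM p (\<lambda>\<theta>. F (cis \<theta>))"
  and ess_bounded_circ_class:
    "circ_measurable F \<Longrightarrow> ess_bounded C (circ_class F) \<longleftrightarrow> (AE \<theta> in TM. norm (F (cis \<theta>)) \<le> C)"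
  by (simp_all add: circ_class_def const_def tpow_def bar.abs_eq tilde.abs_eq mean.abs_eq cnorm.abs_eq
      ess_bounded.abs_eq)

lemma circ_class_in_Lp_class_iff:
  assumes F: "circ_measurable F"
  shows "circ_class F \<in> Lp_class p \<longleftrightarrow> (\<lambda>\<theta>. F (cis \<theta>)) \<in> Lspace TM p"
proof
  assume "circ_class F \<in> Lp_class p"
  then obtain G where G: "circ_measurable G" "(\<lambda>\<theta>. G (cis \<theta>)) \<in> Lspace TM p" "ae_eq F G"
    using F by (auto simp: Lp_class_def circ_class_eq_iff)
  have "AE \<theta> in TM. norm (F (cis \<theta>)) powr p = norm (G (cis \<theta>)) powr p"
    using G(3) unfolding ae_eq_def by eventually_elim simp
  then have "integrable TM (\<lambda>\<theta>. norm (F (cis \<theta>)) powr p) \<longleftrightarrow> integrable TM (\<lambda>\<theta>. norm (G (cis \<theta>)) powr p)"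
    using F G(1)[THEN circ_measurableD] circ_measurableD[OF F] by (intro integrable_cong_AE) auto
  then show "(\<lambda>\<theta>. F (cis \<theta>)) \<in> Lspace TM p" using F G(2) by (simp add: Lspace_def circ_measurable_def)
qed (use F in \<open>auto simp: Lp_class_def\<close>)

lemmas circ_class_simps = circ_class_ring circ_class_inverse circ_class_divide circ_class_const
  circ_class_tpow circ_class_bar
  circ_class_tilde mean_circ_class cnorm_circ_class ess_bounded_circ_class circ_class_in_Lp_class_iff

lemma circ_class_sum:
  "(\<And>i. i \<in> I \<Longrightarrow> circ_measurable (f i)) \<Longrightarrow> (\<Sum>i\<in>I. circ_class (f i)) = circ_class (\<lambda>z. \<Sum>i\<in>I. f i z)"
  by (induction I rule: infinite_finite_induct) (simp_all add: circ_class_0 circ_class_add)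

lemma Lspace_class:
  assumes "h \<in> Lspace TM p"
  obtains F where "circ_measurable F" "circ_class F \<in> Lp_class p" "AE \<theta> in TM. F (cis \<theta>) = h \<theta>"
proof -
  obtain F where F: "circ_measurable F" "AE \<theta> in TM. F (cis \<theta>) = h \<theta>"
    using circle_extension[OF Lspace_measurable[OF assms]] .
  then have "integrable TM (\<lambda>\<theta>. norm (F (cis \<theta>)) powr p)"
    using Lspace_integrable[OF assms] Lspace_measurable[OF assms] circ_measurableD[OF F(1)]
    by (subst integrable_cong_AE[where g = "\<lambda>\<theta>. norm (h \<theta>) powr p"]) (auto elim: eventually_mono)
  then show thesis using that F by (simp add: circ_class_in_Lp_class_iff Lspace_def circ_measurable_def)
qed

lemma inverse_unique_class:
  fixes f g :: circle_fun
  assumes "f * g = 1" shows "inverse f = g"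
proof (cases f, cases g)
  fix F G assume F: "f = circ_class F" "circ_measurable F" and G: "g = circ_class G" "circ_measurable G"
  then have "ae_eq (\<lambda>z. F z * G z) (\<lambda>_. 1)" using assms by (simp add: circ_class_simps circ_class_eq_iff)
  then have "ae_eq (\<lambda>z. inverse (F z)) G"
    unfolding ae_eq_def by (rule eventually_mono) (rule inverse_unique)
  then show ?thesis using F G by (simp add: circ_class_simps circ_class_eq_iff)
qed

lemma inverse_mult_class: "inverse (f * g) = inverse f * inverse (g :: circle_fun)"
  by (cases f, cases g) (simp add: circ_class_simps)

lemma inverse_inverse_class [simp]: "inverse (inverse f) = (f :: circle_fun)"
  by (cases f) (simp add: circ_class_simps)

lemma inverse_uminus_class: "inverse (- f) = - inverse (f :: circle_fun)"
  by (cases f) (simp add: circ_class_simps)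

lemma const_0 [simp]: "const 0 = 0" and const_1 [simp]: "const 1 = 1"
  and const_add: "const (a + b) = const a + const b" and const_diff: "const (a - b) = const a - const b"
  and const_mult: "const (a * b) = const a * const b" and const_uminus: "const (- a) = - const a"
  by (simp_all add: circ_class_simps)

lemma const_mult_assoc: "const a * (const b * f) = const (a * b) * f"
  by (simp add: const_mult mult.assoc)

lemma tpow_0 [simp]: "tpow 0 = 1"
  by (simp add: circ_class_simps)

lemma tpow_mult: "tpow a * tpow b = tpow (a + b)"
  unfolding circ_class_tpow
  by (simp add: circ_class_mult) (rule circ_class_eqI, simp_all add: power_int_add)

lemma tpow_mult_assoc: "tpow a * (tpow b * f) = tpow (a + b) * f"
  by (simp add: mult.assoc[symmetric] tpow_mult)

lemma tpow_cancel [simp]: "tpow k * (tpow (- k) * f) = f" "tpow (- k) * (tpow k * f) = f"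
  by (simp_all add: tpow_mult_assoc)

lemma circ_class_power: "circ_class (\<lambda>z. z ^ m) = tpow (int m)"
  by (simp add: circ_class_tpow)

lemma bar_0 [simp]: "bar 0 = 0" and bar_1 [simp]: "bar 1 = 1"
  and bar_const [simp]: "bar (const c) = const (cnj c)"
  by (simp_all add: circ_class_simps)

lemma bar_add [simp]: "bar (f + g) = bar f + bar g" and bar_diff [simp]: "bar (f - g) = bar f - bar g"
  and bar_mult [simp]: "bar (f * g) = bar f * bar g"
  by (cases f, cases g, simp add: circ_class_simps)+

lemma bar_uminus [simp]: "bar (- f) = - bar f" and bar_inverse [simp]: "bar (inverse f) = inverse (bar f)"
  and bar_bar [simp]: "bar (bar f) = f"
  by (cases f, simp add: circ_class_simps)+

lemma bar_divide [simp]: "bar (f / g) = bar f / bar g"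
  by (simp add: divide_circle_fun_def)

lemma bar_tpow [simp]: "bar (tpow k) = tpow (- k)"
  unfolding circ_class_tpow
  by (simp add: circ_class_bar) (rule circ_class_eqI, simp_all add: cis_power_int cis_cnj)

lemma tilde_0 [simp]: "tilde 0 = 0" and tilde_1 [simp]: "tilde 1 = 1"
  and tilde_const [simp]: "tilde (const c) = const c"
  by (simp_all add: circ_class_simps)

lemma tilde_add [simp]: "tilde (f + g) = tilde f + tilde g"
  and tilde_diff [simp]: "tilde (f - g) = tilde f - tilde g"
  and tilde_mult [simp]: "tilde (f * g) = tilde f * tilde g"
  by (cases f, cases g, simp add: circ_class_simps)+

lemma tilde_uminus [simp]: "tilde (- f) = - tilde f"
  and tilde_inverse [simp]: "tilde (inverse f) = inverse (tilde f)"
  and tilde_tilde [simp]: "tilde (tilde f) = f" and tilde_bar [simp]: "tilde (bar f) = bar (tilde f)"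
  by (cases f, simp add: circ_class_simps)+

lemma tilde_divide [simp]: "tilde (f / g) = tilde f / tilde g"
  by (simp add: divide_circle_fun_def)

lemma tilde_tpow [simp]: "tilde (tpow k) = tpow (- k)"
  unfolding circ_class_tpow
  by (simp add: circ_class_tilde) (rule circ_class_eqI, simp_all add: cis_power_int cis_inverse)

section \<open>Norms and bounded multipliers\<close>

lemma Lp_class_add: "f \<in> Lp_class p \<Longrightarrow> g \<in> Lp_class p \<Longrightarrow> 0 \<le> p \<Longrightarrow> f + g \<in> Lp_class p"
  by (cases f, cases g) (simp add: circ_class_simps Lspace_add)

lemma Lp_class_diff: "f \<in> Lp_class p \<Longrightarrow> g \<in> Lp_class p \<Longrightarrow> 0 \<le> p \<Longrightarrow> f - g \<in> Lp_class p"
  by (cases f, cases g) (simp add: circ_class_simps Lspace_diff)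

lemma Lp_class_const_mult: "f \<in> Lp_class p \<Longrightarrow> 0 \<le> p \<Longrightarrow> const c * f \<in> Lp_class p"
  by (cases f) (simp add: circ_class_simps Lspace_mult_left)

lemma cnorm_nonneg [simp]: "0 \<le> cnorm p f"
  by (cases f) (simp add: circ_class_simps)

lemma cnorm_const_mult: "0 < p \<Longrightarrow> cnorm p (const c * f) = norm c * cnorm p f"
  by (cases f) (simp add: circ_class_simps Lnorm_mult_left)

lemma cnorm_const: "0 < p \<Longrightarrow> cnorm p (const c) = norm c * cnorm p 1"
  using cnorm_const_mult[of p c 1] by simp

lemma cnorm_uminus: "0 < p \<Longrightarrow> cnorm p (- f) = cnorm p f"
  using cnorm_const_mult[of p "-1" f] by (simp add: const_uminus)

lemma cnorm_0 [simp]: "0 < p \<Longrightarrow> cnorm p 0 = 0"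
  using cnorm_const[of p 0] by simp

lemma cnorm_eq_0: "f \<in> Lp_class p \<Longrightarrow> 0 < p \<Longrightarrow> cnorm p f = 0 \<Longrightarrow> f = 0"
  by (cases f) (simp add: circ_class_simps circ_class_eq_iff ae_eq_def Lnorm_eq_0)

lemma cnorm_minus_commute: "0 < p \<Longrightarrow> cnorm p (f - g) = cnorm p (g - f)"
  using cnorm_uminus[of p "f - g"] by simp

lemma cnorm_triangle: "f \<in> Lp_class p \<Longrightarrow> g \<in> Lp_class p \<Longrightarrow> 1 < p \<Longrightarrow> cnorm p (f + g) \<le> cnorm p f + cnorm p g"
  by (cases f, cases g) (simp add: circ_class_simps Lnorm_triangle)

lemma cnorm_triangle_diff:
  "f \<in> Lp_class p \<Longrightarrow> g \<in> Lp_class p \<Longrightarrow> 1 < p \<Longrightarrow> cnorm p (f - g) \<le> cnorm p f + cnorm p g"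
  using cnorm_triangle[of f p "const (-1) * g"] Lp_class_const_mult[of g p "-1"]
  by (simp add: const_uminus cnorm_uminus)

lemma cnorm_le_add_diff:
  assumes "f \<in> Lp_class p" "g \<in> Lp_class p" "1 < p"
  shows "cnorm p f \<le> cnorm p g + cnorm p (f - g)"
  using cnorm_triangle[OF assms(2) Lp_class_diff[OF assms(1,2)] assms(3)] assms(3) by simp

lemma cnorm_triangle_via:
  assumes "f \<in> Lp_class p" "g \<in> Lp_class p" "h \<in> Lp_class p" "1 < p"
  shows "cnorm p (f - g) \<le> cnorm p (f - h) + cnorm p (h - g)"
  using cnorm_triangle[of "f - h" p "h - g"] assms by (simp add: Lp_class_diff)

lemma ess_bounded_mult_Lp:
  assumes "ess_bounded C g" "f \<in> Lp_class p" "0 < p" "0 \<le> C"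
  shows "g * f \<in> Lp_class p" "cnorm p (g * f) \<le> C * cnorm p f"
proof -
  obtain F G where FG: "f = circ_class F" "circ_measurable F" "g = circ_class G" "circ_measurable G"
    by (cases f, cases g)
  have F: "(\<lambda>\<theta>. F (cis \<theta>)) \<in> Lspace TM p" using assms FG by (simp add: circ_class_simps)
  have GF: "(\<lambda>\<theta>. G (cis \<theta>) * F (cis \<theta>)) \<in> borel_measurable TM"
    using FG by (intro borel_measurable_times circ_measurableD)
  have "AE \<theta> in TM. norm (G (cis \<theta>)) \<le> C" using assms FG by (simp add: circ_class_simps)
  then have bound: "AE \<theta> in TM. norm (G (cis \<theta>) * F (cis \<theta>)) \<le> C * norm (F (cis \<theta>))"
    by eventually_elim (simp add: norm_mult mult_right_mono)
  show "g * f \<in> Lp_class p" using Lspace_dominated[OF F GF bound] assms FG by (simp add: circ_class_simps)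
  show "cnorm p (g * f) \<le> C * cnorm p f" using Lnorm_dominated[OF F GF bound] assms FG
    by (simp add: circ_class_simps)
qed

lemma ess_bounded_mono: "ess_bounded C f \<Longrightarrow> C \<le> D \<Longrightarrow> ess_bounded D f"
  by (cases f) (auto simp: circ_class_simps elim: eventually_mono)

lemma Linf_classE:
  assumes "g \<in> Linf_class" obtains C where "0 \<le> C" "ess_bounded C g"
proof -
  obtain C where "ess_bounded C g" using assms by (auto simp: Linf_class_def)
  then show ?thesis using that[of "max 0 C"] ess_bounded_mono[of C g "max 0 C"] by simp
qed

lemma Linf_mult_Lp: "g \<in> Linf_class \<Longrightarrow> f \<in> Lp_class p \<Longrightarrow> 0 < p \<Longrightarrow> g * f \<in> Lp_class p"
  by (meson Linf_classE ess_bounded_mult_Lp(1))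

lemma Lp_mult_Linf: "g \<in> Linf_class \<Longrightarrow> f \<in> Lp_class p \<Longrightarrow> 0 < p \<Longrightarrow> f * g \<in> Lp_class p"
  using Linf_mult_Lp[of g f p] by (simp add: mult.commute)

lemma ess_bounded_tpow: "ess_bounded 1 (tpow k)"
  by (simp add: circ_class_simps norm_power_int)

lemma ess_bounded_const: "ess_bounded (norm c) (const c)"
  by (simp add: circ_class_simps)

lemma ess_bounded_mult: "ess_bounded C f \<Longrightarrow> ess_bounded D g \<Longrightarrow> 0 \<le> C \<Longrightarrow> ess_bounded (C * D) (f * g)"
  by (cases f, cases g) (auto simp: circ_class_simps norm_mult elim!: eventually_elim2 intro!: mult_mono)

lemma ess_bounded_add: "ess_bounded C f \<Longrightarrow> ess_bounded D g \<Longrightarrow> ess_bounded (C + D) (f + g)"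
  by (cases f, cases g) (auto simp: circ_class_simps elim!: eventually_elim2 intro!: norm_triangle_mono)

lemma ess_bounded_bar: "ess_bounded C f \<Longrightarrow> ess_bounded C (bar f)"
  by (cases f) (simp add: circ_class_simps)

lemma ess_bounded_tilde: "ess_bounded C f \<Longrightarrow> ess_bounded C (tilde f)"
proof (cases f)
  case (circ_class F)
  then show "ess_bounded C f \<Longrightarrow> ess_bounded C (tilde f)"
    using AE_cis_uminus[of "\<lambda>z. norm (F z) \<le> C"] by (simp add: circ_class_simps)
qed

lemma Linf_class_const [simp]: "const c \<in> Linf_class" and Linf_class_tpow [simp]: "tpow k \<in> Linf_class"
  and Linf_class_0 [simp]: "0 \<in> Linf_class" and Linf_class_1 [simp]: "1 \<in> Linf_class"
  using ess_bounded_const[of c] ess_bounded_tpow[of k] ess_bounded_const[of 0] ess_bounded_const[of 1]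
  unfolding Linf_class_def const_0 const_1 by blast+

lemma Linf_class_add [simp]: "f \<in> Linf_class \<Longrightarrow> g \<in> Linf_class \<Longrightarrow> f + g \<in> Linf_class"
  using ess_bounded_add unfolding Linf_class_def by blast

lemma Linf_class_mult [simp]: "f \<in> Linf_class \<Longrightarrow> g \<in> Linf_class \<Longrightarrow> f * g \<in> Linf_class"
  using ess_bounded_mult by (metis (mono_tags, lifting) Linf_classE Linf_class_def mem_Collect_eq)

lemma Linf_class_bar [simp]: "f \<in> Linf_class \<Longrightarrow> bar f \<in> Linf_class"
  and Linf_class_tilde [simp]: "f \<in> Linf_class \<Longrightarrow> tilde f \<in> Linf_class"
  using ess_bounded_bar ess_bounded_tilde unfolding Linf_class_def by blast+

lemma Linf_class_uminus [simp]: "f \<in> Linf_class \<Longrightarrow> - f \<in> Linf_class"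
  using Linf_class_mult[OF Linf_class_const[of "-1"], of f] by (simp add: const_uminus)

lemma Linf_class_subset_Lp: "f \<in> Linf_class \<Longrightarrow> 0 \<le> p \<Longrightarrow> f \<in> Lp_class p"
  by (cases f) (auto simp: Linf_class_def circ_class_simps
    intro: Lspace_bounded[OF finite_measure_TM circ_measurableD])

lemma Lp_class_simps [simp]:
  "0 \<le> p \<Longrightarrow> const c \<in> Lp_class p" "0 \<le> p \<Longrightarrow> tpow k \<in> Lp_class p" "0 \<le> p \<Longrightarrow> 0 \<in> Lp_class p"
    "0 \<le> p \<Longrightarrow> 1 \<in> Lp_class p"
  by (simp_all add: Linf_class_subset_Lp)

lemma Lp_class_tpow_mult: "f \<in> Lp_class p \<Longrightarrow> 0 < p \<Longrightarrow> tpow k * f \<in> Lp_class p"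
  by (simp add: Linf_mult_Lp)

lemma cnorm_tpow_mult:
  assumes "f \<in> Lp_class p" "0 < p" shows "cnorm p (tpow k * f) = cnorm p f"
proof (rule antisym)
  show "cnorm p (tpow k * f) \<le> cnorm p f" using ess_bounded_mult_Lp(2)[OF ess_bounded_tpow assms] by simp
  show "cnorm p f \<le> cnorm p (tpow k * f)"
    using ess_bounded_mult_Lp(2)[OF ess_bounded_tpow Lp_class_tpow_mult[OF assms] assms(2), of "- k" k]
    by simp
qed

lemma Lp_class_bar: "f \<in> Lp_class p \<Longrightarrow> bar f \<in> Lp_class p"
  and cnorm_bar [simp]: "cnorm p (bar f) = cnorm p f"
  by (cases f, simp add: circ_class_simps Lspace_def Lnorm_def borel_measurable_cnj)+

lemma Lp_class_tilde:
  assumes "f \<in> Lp_class p" shows "tilde f \<in> Lp_class p"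
proof (cases f)
  case (circ_class F)
  then show ?thesis
    using assms integrable_cis_uminus[of "\<lambda>z. norm (F z) powr p"] circ_measurable_compose_inverse[of F]
    by (simp add: circ_class_simps Lspace_def circ_measurable_def)
qed

lemma cnorm_tilde [simp]: "cnorm p (tilde f) = cnorm p f"
proof (cases f)
  case (circ_class F)
  then have "(\<lambda>\<theta>. norm (F (cis \<theta>)) powr p) \<in> borel_measurable TM" using circ_measurableD[of F] by simp
  then show ?thesis
    using circ_class integral_cis_uminus[of "\<lambda>z. norm (F z) powr p"]
    by (simp add: circ_class_simps Lnorm_def)
qed

section \<open>Means and Fourier coefficients\<close>

lemma circ_class_in_L1_iff: "circ_measurable F \<Longrightarrow>
    circ_class F \<in> Lp_class 1 \<longleftrightarrow> integrable TM (\<lambda>\<theta>. F (cis \<theta>))"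
  by (simp add: circ_class_simps Lspace_def circ_measurable_def integrable_norm_iff)

lemma mean_add: "f \<in> Lp_class 1 \<Longrightarrow> g \<in> Lp_class 1 \<Longrightarrow> mean (f + g) = mean f + mean g"
  by (cases f, cases g) (simp add: circ_class_in_L1_iff, simp add: circ_class_simps add_divide_distrib)

lemma mean_diff: "f \<in> Lp_class 1 \<Longrightarrow> g \<in> Lp_class 1 \<Longrightarrow> mean (f - g) = mean f - mean g"
  by (cases f, cases g) (simp add: circ_class_in_L1_iff, simp add: circ_class_simps diff_divide_distrib)

lemma mean_const_mult: "mean (const c * f) = c * mean f"
  by (cases f) (simp add: circ_class_simps)

lemma mean_0 [simp]: "mean 0 = 0"
  by (simp add: circ_class_simps)

lemma mean_bar: "mean (bar f) = cnj (mean f)"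
  by (cases f) (simp add: circ_class_simps)

lemma mean_tilde: "mean (tilde f) = mean f"
  by (cases f) (simp add: circ_class_simps integral_cis_uminus circ_measurableD)

lemma mean_tpow: "mean (tpow k) = (if k = 0 then 1 else 0)"
  by (simp add: circ_class_simps integral_cis_powi)

lemma mean_sum:
  assumes "\<And>i. i \<in> I \<Longrightarrow> f i \<in> Lp_class 1"
  shows "mean (\<Sum>i\<in>I. f i) = (\<Sum>i\<in>I. mean (f i))" and "(\<Sum>i\<in>I. f i) \<in> Lp_class 1"
  using assms by (induction I rule: infinite_finite_induct) (auto simp: mean_add Lp_class_add)

lemma class_Hoelder:
  assumes "f \<in> Lp_class p" "g \<in> Lp_class (conj_exp p)" "1 < p"
  shows "f * g \<in> Lp_class 1" "norm (mean (f * g)) \<le> cnorm p f * cnorm (conj_exp p) g"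
proof -
  obtain F G where FG: "f = circ_class F" "circ_measurable F" "g = circ_class G" "circ_measurable G"
    by (cases f, cases g)
  have L: "(\<lambda>\<theta>. F (cis \<theta>)) \<in> Lspace TM p" "(\<lambda>\<theta>. G (cis \<theta>)) \<in> Lspace TM (conj_exp p)"
    using assms FG by (auto simp: circ_class_simps)
  show "f * g \<in> Lp_class 1"
    using Hoelder_integrable[OF L assms(3)] FG by (simp add: circ_class_mult circ_class_in_L1_iff)
  have "norm (LINT \<theta>|TM. F (cis \<theta>) * G (cis \<theta>)) \<le> (LINT \<theta>|TM. norm (F (cis \<theta>) * G (cis \<theta>)))"
    by (rule integral_norm_bound)
  also note Hoelder_inequality[OF L assms(3)]
  finally have "norm (LINT \<theta>|TM. F (cis \<theta>) * G (cis \<theta>)) \<le> cnorm p f * cnorm (conj_exp p) g"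
    using FG by (simp add: circ_class_simps)
  moreover have "norm (mean (f * g)) = norm (LINT \<theta>|TM. F (cis \<theta>) * G (cis \<theta>)) / (2 * pi)"
    using FG by (simp add: circ_class_simps norm_divide norm_mult)
  moreover have "norm (LINT \<theta>|TM. F (cis \<theta>) * G (cis \<theta>)) / (2 * pi)
      \<le> norm (LINT \<theta>|TM. F (cis \<theta>) * G (cis \<theta>)) / 1"
    using pi_gt3 by (intro divide_left_mono) auto
  ultimately show "norm (mean (f * g)) \<le> cnorm p f * cnorm (conj_exp p) g" by simp
qed

lemma Lp_class_imp_L1: "f \<in> Lp_class p \<Longrightarrow> 1 < p \<Longrightarrow> f \<in> Lp_class 1"
  using class_Hoelder(1)[of f p 1] conj_exp_gt_1[of p] by simp

lemma cnorm_dual_attained: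
  assumes "f \<in> Lp_class p" "1 < p"
  obtains \<psi> where "\<psi> \<in> Lp_class (conj_exp p)" "cnorm (conj_exp p) \<psi> \<le> 1"
    "mean (f * \<psi>) = complex_of_real (cnorm p f / (2 * pi))"
proof (cases f)
  case (circ_class F)
  then have "(\<lambda>\<theta>. F (cis \<theta>)) \<in> Lspace TM p" using assms by (auto simp: circ_class_simps)
  then obtain h where h: "h \<in> Lspace TM (conj_exp p)" "Lnorm TM (conj_exp p) h \<le> 1"
    "(LINT \<theta>|TM. F (cis \<theta>) * h \<theta>) = complex_of_real (Lnorm TM p (\<lambda>\<theta>. F (cis \<theta>)))"
    using Lnorm_dual_attained[OF _ assms(2)] by blast
  obtain G where G: "circ_measurable G" "circ_class G \<in> Lp_class (conj_exp p)"
    "AE \<theta> in TM. G (cis \<theta>) = h \<theta>"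
    using Lspace_class[OF h(1)] .
  note [measurable] = Lspace_measurable[OF h(1)] circ_measurableD[OF G(1)]
    circ_measurableD[OF circ_class(2)]
  show thesis
  proof (rule that[OF G(2)])
    show "cnorm (conj_exp p) (circ_class G) \<le> 1"
      using h(2) Lnorm_cong_AE[OF G(3)] G(1) by (simp add: circ_class_simps)
    have "(LINT \<theta>|TM. F (cis \<theta>) * G (cis \<theta>)) = (LINT \<theta>|TM. F (cis \<theta>) * h \<theta>)"
      using G(3) by (intro integral_cong_AE) (auto elim: eventually_mono)
    then show "mean (f * circ_class G) = complex_of_real (cnorm p f / (2 * pi))"
      using circ_class G(1) h(3) by (simp add: circ_class_simps)
  qed
qed

lemma cnorm_uniformly_convex:
  assumes "1 < p" "0 < \<epsilon>"
  obtains C where "0 \<le> C" "\<And>f g. f \<in> Lp_class p \<Longrightarrow> g \<in> Lp_class p \<Longrightarrow>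
    cnorm p (f - g) powr p \<le> \<epsilon> * (cnorm p f powr p + cnorm p g powr p)
      + C * ((cnorm p f powr p + cnorm p g powr p) / 2 - cnorm p (const (1/2) * (f + g)) powr p)"
proof -
  obtain C where C: "0 \<le> C" "\<And>f g. f \<in> Lspace TM p \<Longrightarrow> g \<in> Lspace TM p \<Longrightarrow>
    Lnorm TM p (\<lambda>x. f x - g x) powr p \<le> \<epsilon> * (Lnorm TM p f powr p + Lnorm TM p g powr p)
      + C * ((Lnorm TM p f powr p + Lnorm TM p g powr p) / 2 - Lnorm TM p (\<lambda>x. (f x + g x) / 2) powr p)"
    using Lnorm_uniformly_convex[OF assms] by blast
  show thesis
  proof (rule that[OF C(1)])
    fix f g assume fg: "f \<in> Lp_class p" "g \<in> Lp_class p"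
    obtain F G where "f = circ_class F" "circ_measurable F" "g = circ_class G" "circ_measurable G"
      by (cases f, cases g)
    then show "cnorm p (f - g) powr p \<le> \<epsilon> * (cnorm p f powr p + cnorm p g powr p)
      + C * ((cnorm p f powr p + cnorm p g powr p) / 2 - cnorm p (const (1/2) * (f + g)) powr p)"
      using fg C(2)[of "\<lambda>\<theta>. F (cis \<theta>)" "\<lambda>\<theta>. G (cis \<theta>)"] by (simp add: circ_class_simps)
  qed
qed

lemma fourier_add: "f \<in> Lp_class 1 \<Longrightarrow> g \<in> Lp_class 1 \<Longrightarrow> fourier (f + g) j = fourier f j + fourier g j"
  by (simp add: fourier_def distrib_right mean_add Lp_mult_Linf)

lemma fourier_diff: "f \<in> Lp_class 1 \<Longrightarrow> g \<in> Lp_class 1 \<Longrightarrow> fourier (f - g) j = fourier f j - fourier g j"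
  by (simp add: fourier_def left_diff_distrib mean_diff Lp_mult_Linf)

lemma fourier_add_Lp:
    "f \<in> Lp_class p \<Longrightarrow> g \<in> Lp_class p \<Longrightarrow> 1 < p \<Longrightarrow> fourier (f + g) j = fourier f j + fourier g j"
  and fourier_diff_Lp:
    "f \<in> Lp_class p \<Longrightarrow> g \<in> Lp_class p \<Longrightarrow> 1 < p \<Longrightarrow> fourier (f - g) j = fourier f j - fourier g j"
  by (intro fourier_add fourier_diff Lp_class_imp_L1; assumption)+

lemma fourier_const_mult [simp]: "fourier (const c * f) j = c * fourier f j"
  by (simp add: fourier_def mult.assoc mean_const_mult)

lemma fourier_0 [simp]: "fourier 0 j = 0"
  by (simp add: fourier_def)

lemma fourier_sum:
  assumes "\<And>i. i \<in> I \<Longrightarrow> f i \<in> Lp_class 1"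
  shows "fourier (\<Sum>i\<in>I. f i) j = (\<Sum>i\<in>I. fourier (f i) j)"
  unfolding fourier_def sum_distrib_right using assms by (intro mean_sum) (simp add: Lp_mult_Linf)

lemma fourier_tpow_mult [simp]: "fourier (tpow k * f) j = fourier f (j - k)"
proof -
  have "tpow k * f * tpow (- j) = f * (tpow k * tpow (- j))" by (simp only: ac_simps)
  then show ?thesis by (simp add: fourier_def tpow_mult)
qed

lemma fourier_tpow: "fourier (tpow k) j = (if k = j then 1 else 0)"
  by (simp add: fourier_def tpow_mult mean_tpow)

lemma fourier_1: "fourier 1 j = (if j = 0 then 1 else 0)"
  using fourier_tpow[of 0 j] by auto

lemma fourier_const: "fourier (const c) j = (if j = 0 then c else 0)"
  using fourier_const_mult[of c 1 j] by (simp add: fourier_1)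

lemma fourier_tilde [simp]: "fourier (tilde f) j = fourier f (- j)"
  using mean_tilde[of "f * tpow j"] by (simp add: fourier_def)

lemma fourier_bar [simp]: "fourier (bar f) j = cnj (fourier f (- j))"
  using mean_bar[of "f * tpow j"] by (simp add: fourier_def)

lemma norm_fourier_le:
  assumes f: "f \<in> Lp_class p" and p: "1 < p"
  shows "norm (fourier f j) \<le> cnorm p f * cnorm (conj_exp p) 1"
  using class_Hoelder(2)[OF f _ p, of "tpow (- j)"] cnorm_tpow_mult[of 1 "conj_exp p" "- j"]
    conj_exp_gt_1[OF p]
  by (simp add: fourier_def)

definition Lp_conv :: "real \<Rightarrow> (nat \<Rightarrow> circle_fun) \<Rightarrow> circle_fun \<Rightarrow> bool" where
  "Lp_conv p F f \<longleftrightarrow> (\<lambda>n. cnorm p (F n - f)) \<longlonglongrightarrow> 0"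

definition Lp_Cauchy :: "real \<Rightarrow> (nat \<Rightarrow> circle_fun) \<Rightarrow> bool" where
  "Lp_Cauchy p F \<longleftrightarrow> (\<forall>e>0. \<exists>N. \<forall>m\<ge>N. \<forall>n\<ge>N. cnorm p (F m - F n) < e)"

lemma Lp_convI:
  assumes "\<And>n. cnorm p (F n - f) \<le> r n" "r \<longlonglongrightarrow> 0"
  shows "Lp_conv p F f"
  unfolding Lp_conv_def by (rule Lim_null_comparison[OF always_eventually assms(2)])
    (use assms(1) in simp)

theorem Lp_class_complete:
  assumes p: "1 < p" and F: "\<And>n. F n \<in> Lp_class p" and Cauchy: "Lp_Cauchy p F"
  obtains f where "f \<in> Lp_class p" "Lp_conv p F f"
proof -
  have "\<exists>G. circ_measurable G \<and> F n = circ_class G" for n by (cases "F n") auto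
  then obtain G where G: "\<And>n. circ_measurable (G n)" "\<And>n. F n = circ_class (G n)" by metis
  have "\<exists>N. \<forall>m\<ge>N. \<forall>n\<ge>N. Lnorm TM p (\<lambda>\<theta>. G m (cis \<theta>) - G n (cis \<theta>)) < e" if "0 < e" for e
    using Cauchy that by (simp add: Lp_Cauchy_def G circ_class_simps)
  moreover have "(\<lambda>\<theta>. G n (cis \<theta>)) \<in> Lspace TM p" for n using F[of n] by (simp add: G circ_class_simps)
  ultimately obtain h where h: "h \<in> Lspace TM p" "(\<lambda>n. Lnorm TM p (\<lambda>\<theta>. G n (cis \<theta>) - h \<theta>)) \<longlonglongrightarrow> 0"
    using Lspace_complete[OF finite_measure_TM p, of "\<lambda>n \<theta>. G n (cis \<theta>)"] by blast
  obtain H where H: "circ_measurable H" "circ_class H \<in> Lp_class p" "AE \<theta> in TM. H (cis \<theta>) = h \<theta>"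
    using Lspace_class[OF h(1)] .
  have "Lnorm TM p (\<lambda>\<theta>. G n (cis \<theta>) - h \<theta>) = cnorm p (F n - circ_class H)" for n
    unfolding G(2) circ_class_diff[OF G(1) H(1)] cnorm_circ_class[OF circ_measurable_diff[OF G(1) H(1)]]
    using H(3) G(1)[of n, THEN circ_measurableD] H(1)[THEN circ_measurableD] Lspace_measurable[OF h(1)]
    by (intro Lnorm_cong_AE) (auto elim: eventually_mono)
  then show thesis using that[OF H(2)] h(2) by (simp add: Lp_conv_def)
qed

lemma fourier_tendsto:
  assumes p: "1 < p" and F: "\<And>n. F n \<in> Lp_class p" and f: "f \<in> Lp_class p" and lim: "Lp_conv p F f"
  shows "(\<lambda>n. fourier (F n) j) \<longlonglongrightarrow> fourier f j"
proof (rule LIM_zero_cancel, rule Lim_null_comparison[OF always_eventually])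
  show "\<forall>n. norm (fourier (F n) j - fourier f j) \<le> cnorm p (F n - f) * cnorm (conj_exp p) 1"
    using norm_fourier_le[OF Lp_class_diff[OF F f] p] p by (simp add: fourier_diff_Lp[OF F f p])
  show "(\<lambda>n. cnorm p (F n - f) * cnorm (conj_exp p) 1) \<longlonglongrightarrow> 0"
    using lim unfolding Lp_conv_def by (rule tendsto_mult_left_zero)
qed

lemma cnorm_tendsto:
  assumes p: "1 < p" and F: "\<And>n. F n \<in> Lp_class p" and f: "f \<in> Lp_class p" and lim: "Lp_conv p F f"
  shows "(\<lambda>n. cnorm p (F n)) \<longlonglongrightarrow> cnorm p f"
proof (rule LIM_zero_cancel, rule Lim_null_comparison[OF always_eventually lim[unfolded Lp_conv_def]])
  show "\<forall>n. norm (cnorm p (F n) - cnorm p f) \<le> cnorm p (F n - f)"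
    using cnorm_le_add_diff[OF F f p] cnorm_le_add_diff[OF f F p] cnorm_minus_commute[of p f "F _"] p
    by (simp add: abs_le_iff algebra_simps)
qed

lemma fc_fourier: "circ_measurable F \<Longrightarrow> fc F j = fourier (circ_class F) j"
  by (simp add: fc_def fourier_def circ_class_simps cis_power_int)

lemma Lp_iff: "F \<in> Lp p \<longleftrightarrow> circ_measurable F \<and> circ_class F \<in> Lp_class p"
  by (auto simp: Lp_def circ_def[abs_def] circ_measurable_def circ_class_in_Lp_class_iff Lspace_def)

lemma pnorm_cnorm: "circ_measurable F \<Longrightarrow> pnorm p F = cnorm p (circ_class F)"
  by (simp add: pnorm_def circ_class_simps Lnorm_def circ_def)

lemma LIMSEQ_0_less:
  fixes X :: "nat \<Rightarrow> real"
  assumes "X \<longlonglongrightarrow> 0" "0 < e"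
  obtains n where "X n < e"
  using eventually_happens'[OF sequentially_bot order_tendstoD(2)[OF assms]] by blast

section \<open>Density of trigonometric polynomials\<close>

inductive_set monom_span :: "int set \<Rightarrow> circle_fun set" for K where
  monom_span_0 [simp]: "0 \<in> monom_span K"
| monom_span_step: "f \<in> monom_span K \<Longrightarrow> k \<in> K \<Longrightarrow> const c * tpow k + f \<in> monom_span K"

abbreviation trig_polys :: "circle_fun set" where
  "trig_polys \<equiv> monom_span UNIV"

abbreviation analytic_polys :: "circle_fun set" where
  "analytic_polys \<equiv> monom_span {0..}"

lemma monom_span_monom: "k \<in> K \<Longrightarrow> const c * tpow k \<in> monom_span K"
  using monom_span_step[OF monom_span_0, of k K c] by simp

lemma monom_span_const: "0 \<in> K \<Longrightarrow> const c \<in> monom_span K"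
  using monom_span_monom[of 0 K c] by simp

lemma monom_span_add: "f \<in> monom_span K \<Longrightarrow> g \<in> monom_span K \<Longrightarrow> f + g \<in> monom_span K"
  by (induction rule: monom_span.induct) (auto simp: add.assoc intro: monom_span.intros)

lemma monom_span_sum: "(\<And>i. i \<in> I \<Longrightarrow> f i \<in> monom_span K) \<Longrightarrow> sum f I \<in> monom_span K"
  by (induction I rule: infinite_finite_induct) (auto intro: monom_span_add)

lemma monom_span_const_mult: "f \<in> monom_span K \<Longrightarrow> const c * f \<in> monom_span K"
proof (induction rule: monom_span.induct)
  case (monom_span_step f k d)
  have "const c * (const d * tpow k + f) = const (c * d) * tpow k + const c * f"
    by (simp add: distrib_left const_mult_assoc)
  then show ?case using monom_span_step monom_span.monom_span_step by simp
qed simp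

lemma trig_polys_mult:
  assumes f: "f \<in> trig_polys" and g: "g \<in> trig_polys"
  shows "f * g \<in> trig_polys"
proof -
  have shift: "tpow k * g \<in> trig_polys" for k
    using g
  proof (induction rule: monom_span.induct)
    case (monom_span_step g l c)
    have "tpow k * (const c * tpow l + g) = const c * tpow (k + l) + tpow k * g"
      by (simp add: distrib_left mult.left_commute tpow_mult)
    then show ?case using monom_span_step monom_span.monom_span_step by simp
  qed simp
  show ?thesis
    using f
    by (induction rule: monom_span.induct)
      (auto simp: distrib_right mult.assoc intro: monom_span_add monom_span_const_mult shift)
qed

lemma monom_span_subset_Linf: "f \<in> monom_span K \<Longrightarrow> f \<in> Linf_class"
  by (induction rule: monom_span.induct) auto

lemma monom_span_subset_Lp: "f \<in> monom_span K \<Longrightarrow> 0 \<le> p \<Longrightarrow> f \<in> Lp_class p"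
  by (simp add: monom_span_subset_Linf Linf_class_subset_Lp)

lemma linear_in_trig_polys:
  fixes g :: "complex \<Rightarrow> real"
  assumes "bounded_linear g"
  shows "circ_class (\<lambda>z. of_real (g z)) \<in> trig_polys"
proof -
  define c where "c = Complex (g 1 / 2) (- g \<i> / 2)"
  have linear: "g z = Re z * g 1 + Im z * g \<i>" for z
  proof -
    have "z = Re z *\<^sub>R 1 + Im z *\<^sub>R \<i>" by (simp add: complex_eq_iff)
    then have "g z = g (Re z *\<^sub>R 1 + Im z *\<^sub>R \<i>)" by (rule arg_cong)
    then show ?thesis using assms by (simp add: linear_simps)
  qed
  have g_Re: "g z = 2 * Re (c * z)" for z using linear[of z] by (simp add: c_def algebra_simps)
  have "of_real (g (cis \<theta>)) = c * cis \<theta> powi 1 + cnj c * cis \<theta> powi -1" for \<theta>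
  proof -
    have "cis \<theta> powi -1 = cnj (cis \<theta>)" by (simp add: cis_cnj)
    then show ?thesis using g_Re[of "cis \<theta>"] complex_add_cnj[of "c * cis \<theta>"] by simp
  qed
  moreover have "circ_measurable (\<lambda>z. of_real (g z))"
    using assms by (intro circ_measurable_continuous continuous_intros linear_continuous_on)
  ultimately have "circ_class (\<lambda>z. of_real (g z)) = circ_class (\<lambda>z. c * z powi 1 + cnj c * z powi -1)"
    by (intro circ_class_eqI) simp_all
  also have "\<dots> = const c * tpow 1 + const (cnj c) * tpow (-1)"
    by (simp add: circ_class_simps)
  also have "\<dots> \<in> trig_polys" by (intro monom_span_add monom_span_monom) auto
  finally show ?thesis .
qed

lemma real_polynomial_in_trig_polys:
  fixes g :: "complex \<Rightarrow> real"
  assumes "real_polynomial_function g"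
  shows "circ_measurable (\<lambda>z. of_real (g z))" "circ_class (\<lambda>z. of_real (g z)) \<in> trig_polys"
proof -
  have "circ_measurable (\<lambda>z. of_real (g z)) \<and> circ_class (\<lambda>z. of_real (g z)) \<in> trig_polys"
    using assms
  proof (induction rule: real_polynomial_function.induct)
    case (linear f)
    then show ?case
      by (intro conjI linear_in_trig_polys circ_measurable_continuous continuous_intros
        linear_continuous_on)
  next
    case (const c)
    then show ?case by (simp add: circ_class_const[symmetric] monom_span_const)
  next
    case (add f g)
    then show ?case by (simp add: monom_span_add flip: circ_class_add)
  next
    case (mult f g)
    then show ?case by (simp add: trig_polys_mult flip: circ_class_mult)
  qed
  then show "circ_measurable (\<lambda>z. of_real (g z))" "circ_class (\<lambda>z. of_real (g z)) \<in> trig_polys" by auto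
qed

lemma continuous_trig_poly_approx:
  assumes u: "continuous_on (sphere 0 1) u" and e: "0 < e"
  obtains v where "circ_measurable v" "circ_class v \<in> trig_polys" "\<And>\<theta>. norm (u (cis \<theta>) - v (cis \<theta>)) < e"
proof -
  obtain v where v: "polynomial_function v" "\<And>z. z \<in> sphere 0 1 \<Longrightarrow> norm (u z - v z) < e"
    using Stone_Weierstrass_polynomial_function[OF compact_sphere u e] by blast
  have parts: "real_polynomial_function (\<lambda>z. Re (v z))" "real_polynomial_function (\<lambda>z. Im (v z))"
    using v(1) bounded_linear_Re bounded_linear_Im unfolding polynomial_function_def o_def by blast+
  note Re = real_polynomial_in_trig_polys[OF parts(1)] and Im = real_polynomial_in_trig_polys[OF parts(2)]
  have split: "v = (\<lambda>z. of_real (Re (v z)) + \<i> * of_real (Im (v z)))" by (simp flip: complex_eq)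
  show thesis
  proof (rule that)
    show "circ_measurable v" by (subst split) (simp add: Re Im)
    have "circ_class v = circ_class (\<lambda>z. of_real (Re (v z)))
        + const \<i> * circ_class (\<lambda>z. of_real (Im (v z)))"
      by (subst split) (simp add: circ_class_simps Re Im)
    then show "circ_class v \<in> trig_polys" by (simp add: Re Im monom_span_add monom_span_const_mult)
    show "norm (u (cis \<theta>) - v (cis \<theta>)) < e" for \<theta> by (rule v(2)) simp
  qed
qed

lemma continuous_on_sphere_Arg2pi:
  fixes h :: "real \<Rightarrow> complex"
  assumes h: "continuous_on {0..2*pi} h" "h 0 = h (2 * pi)"
  shows "continuous_on (sphere 0 1) (\<lambda>z. h (Arg2pi z))"
proof (subst continuous_on_closed_vimage, simp, intro allI impI)
  fix B :: "complex set" assume B: "closed B"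
  have h_Arg2pi: "h (Arg2pi (cis \<theta>)) = h \<theta>" if "\<theta> \<in> {0..2*pi}" for \<theta>
    using that Arg2pi_cis[of \<theta>] Arg2pi_cis[of 0] h(2) cis_2pi by (cases "\<theta> = 2 * pi") auto
  have "(\<lambda>z. h (Arg2pi z)) -` B \<inter> sphere 0 1 = cis ` (h -` B \<inter> {0..2*pi})"
  proof (intro Set.set_eqI iffI)
    fix z assume z: "z \<in> (\<lambda>z. h (Arg2pi z)) -` B \<inter> sphere 0 1"
    then have "z = cis (Arg2pi z)" using Arg2pi_eq[of z] by (simp add: cis_conv_exp)
    then show "z \<in> cis ` (h -` B \<inter> {0..2*pi})"
      using z Arg2pi[of z] by (intro image_eqI[of _ _ "Arg2pi z"]) auto
  qed (use h_Arg2pi in auto)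
  moreover have "compact (h -` B \<inter> {0..2*pi})"
    using continuous_on_closed_vimage[of "{0..2*pi}" h] h(1) B
    by (auto intro!: compact_Int_closed[of "{0..2*pi}", simplified Int_commute]
      simp: compact_eq_bounded_closed bounded_Int)
  then have "closed (cis ` (h -` B \<inter> {0..2*pi}))"
    by (intro compact_imp_closed compact_continuous_image continuous_intros)
  ultimately show "closed ((\<lambda>z. h (Arg2pi z)) -` B \<inter> sphere 0 1)" by simp
qed

lemma bounded_measurable_interval_approx:
  assumes F: "circ_measurable F" and bound: "\<And>\<theta>. norm (F (cis \<theta>)) \<le> 1"
  obtains h and N where "\<And>n::nat. continuous_on {0..2*pi} (h n)" "\<And>n. h n 0 = 0" "\<And>n. h n (2 * pi) = 0"
    "\<And>n \<theta>. \<theta> \<in> {0..2*pi} \<Longrightarrow> norm (h n \<theta>) \<le> 1" "negligible N"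
    "\<And>\<theta>. 0 < \<theta> \<Longrightarrow> \<theta> < 2 * pi \<Longrightarrow> \<theta> \<notin> N \<Longrightarrow> (\<lambda>n. h n \<theta>) \<longlonglongrightarrow> F (cis \<theta>)"
proof -
  have "(\<lambda>\<theta>. F (cis \<theta>)) measurable_on {0..2*pi}"
    using circ_measurableD[OF F] by (simp add: measurable_on_iff_borel_measurable)
  then obtain N g where N: "negligible N" and g: "\<And>n. continuous_on UNIV (g n)"
    and g_lim: "\<And>x. x \<notin> N \<Longrightarrow> (\<lambda>n. g n x) \<longlonglongrightarrow> (if x \<in> {0..2*pi} then F (cis x) else 0)"
    unfolding measurable_on_def by blast
  define clamp where "clamp = closest_point (cball (0::complex) 1)"
  have clamp: "norm (clamp w) \<le> 1" "continuous_on A clamp" "norm w \<le> 1 \<Longrightarrow> clamp w = w" for w A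
    using closest_point_in_set[of "cball (0::complex) 1" w]
    by (auto simp: clamp_def closest_point_self intro!: continuous_on_closest_point)
  define cutoff where "cutoff n \<theta> = min 1 (real n * min \<theta> (2 * pi - \<theta>))" for n :: nat and \<theta>
  have cutoff: "0 \<le> cutoff n \<theta>" "cutoff n \<theta> \<le> 1" if "\<theta> \<in> {0..2*pi}" for n \<theta>
    using that by (auto simp: cutoff_def)
  define h where "h n \<theta> = of_real (cutoff n \<theta>) * clamp (g n \<theta>)" for n \<theta>
  have h_cont: "continuous_on {0..2*pi} (h n)" for n
    unfolding h_def cutoff_def
    by (intro continuous_intros continuous_on_compose2[OF clamp(2)] continuous_on_subset[OF g]) auto
  have h_lim: "(\<lambda>n. h n \<theta>) \<longlonglongrightarrow> F (cis \<theta>)" if \<theta>: "0 < \<theta>" "\<theta> < 2 * pi" "\<theta> \<notin> N" for \<theta>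
  proof -
    have "filterlim (\<lambda>n. real n * min \<theta> (2 * pi - \<theta>)) at_top sequentially"
      using \<theta>
      by (intro filterlim_at_top_mult_tendsto_pos[OF tendsto_const] filterlim_real_sequentially) auto
    then have "eventually (\<lambda>n. 1 \<le> real n * min \<theta> (2 * pi - \<theta>)) sequentially"
      by (simp add: filterlim_at_top)
    then have "eventually (\<lambda>n. cutoff n \<theta> = 1) sequentially"
      by eventually_elim (simp add: cutoff_def)
    moreover have "(\<lambda>n. clamp (g n \<theta>)) \<longlonglongrightarrow> clamp (F (cis \<theta>))"
      using g_lim[OF \<theta>(3)] \<theta> clamp(2)[of UNIV]
      by (intro isCont_tendsto_compose[of _ clamp]) (auto simp: continuous_on_eq_continuous_at)
    ultimately show ?thesis
      using tendsto_mult[OF tendsto_of_real[OF tendsto_eventually]] clamp(3)[OF bound]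
      unfolding h_def by fastforce
  qed
  show thesis
  proof (rule that[OF h_cont _ _ _ N h_lim])
    show "norm (h n \<theta>) \<le> 1" if "\<theta> \<in> {0..2*pi}" for n \<theta>
      using cutoff[OF that, of n] clamp(1)[of "g n \<theta>"] by (simp add: h_def norm_mult mult_le_one)
  qed (simp_all add: h_def cutoff_def)
qed

lemma bounded_measurable_continuous_approx:
  assumes F: "circ_measurable F" and bound: "\<And>\<theta>. norm (F (cis \<theta>)) \<le> 1"
  obtains u where "\<And>n::nat. continuous_on (sphere 0 1) (u n)" "\<And>n \<theta>. norm (u n (cis \<theta>)) \<le> 1"
    "AE \<theta> in TM. (\<lambda>n. u n (cis \<theta>)) \<longlonglongrightarrow> F (cis \<theta>)"
proof -
  obtain h N where h: "\<And>n. continuous_on {0..2*pi} (h n)" "\<And>n. h n 0 = 0" "\<And>n. h n (2 * pi) = 0"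
    and h_bound: "\<And>n \<theta>. \<theta> \<in> {0..2*pi} \<Longrightarrow> norm (h n \<theta>) \<le> 1" and N: "negligible N"
    and h_lim: "\<And>\<theta>. 0 < \<theta> \<Longrightarrow> \<theta> < 2 * pi \<Longrightarrow> \<theta> \<notin> N \<Longrightarrow> (\<lambda>n. h n \<theta>) \<longlonglongrightarrow> F (cis \<theta>)"
    using bounded_measurable_interval_approx[OF assms] by blast
  show thesis
  proof (rule that)
    show "continuous_on (sphere 0 1) (\<lambda>z. h n (Arg2pi z))" for n
      by (intro continuous_on_sphere_Arg2pi h(1)) (simp add: h(2,3))
    show "norm (h n (Arg2pi (cis \<theta>))) \<le> 1" for n \<theta>
      using Arg2pi[of "cis \<theta>"] by (intro h_bound) simp
    have "N \<union> {0, 2*pi} \<in> null_sets lebesgue" using N by (simp add: negligible_iff_null_sets[symmetric])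
    then have "AE \<theta> in lebesgue. \<theta> \<notin> N \<union> {0, 2*pi}" by (rule AE_not_in)
    then have "AE \<theta> in lebesgue. \<theta> \<in> {0..2*pi} \<longrightarrow> (\<lambda>n. h n (Arg2pi (cis \<theta>))) \<longlonglongrightarrow> F (cis \<theta>)"
      by eventually_elim (use h_lim Arg2pi_cis in auto)
    then show "AE \<theta> in TM. (\<lambda>n. h n (Arg2pi (cis \<theta>))) \<longlonglongrightarrow> F (cis \<theta>)" by (simp add: AE_restrict_space_iff)
  qed
qed

lemma LIMSEQ_1_over_Suc: "(\<lambda>n. 1 / (real n + 1)) \<longlonglongrightarrow> 0"
  using LIMSEQ_inverse_real_of_nat by (simp add: inverse_eq_divide add.commute)

lemma bounded_measurable_trig_poly_approx:
  assumes F: "circ_measurable F" and bound: "\<And>\<theta>. norm (F (cis \<theta>)) \<le> 1"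
  obtains u where "\<And>n::nat. circ_measurable (u n)" "\<And>n. circ_class (u n) \<in> trig_polys"
    "\<And>n \<theta>. norm (u n (cis \<theta>)) \<le> 2" "AE \<theta> in TM. (\<lambda>n. u n (cis \<theta>)) \<longlonglongrightarrow> F (cis \<theta>)"
proof -
  obtain v where v: "\<And>n. continuous_on (sphere 0 1) (v n)" "\<And>n \<theta>. norm (v n (cis \<theta>)) \<le> 1"
    and v_lim: "AE \<theta> in TM. (\<lambda>n. v n (cis \<theta>)) \<longlonglongrightarrow> F (cis \<theta>)"
    using bounded_measurable_continuous_approx[OF assms] by blast
  have "\<exists>u. circ_measurable u \<and> circ_class u \<in> trig_polys
      \<and> (\<forall>\<theta>. norm (v n (cis \<theta>) - u (cis \<theta>)) < 1 / (real n + 1))" for n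
    using continuous_trig_poly_approx[OF v(1), of "1 / (real n + 1)" n] by auto
  then obtain u where u: "\<And>n. circ_measurable (u n)" "\<And>n. circ_class (u n) \<in> trig_polys"
    "\<And>n \<theta>. norm (v n (cis \<theta>) - u n (cis \<theta>)) < 1 / (real n + 1)"
    by metis
  show thesis
  proof (rule that[OF u(1,2)])
    show "norm (u n (cis \<theta>)) \<le> 2" for n \<theta>
    proof -
      have "1 / (real n + 1) \<le> 1" by simp
      then show ?thesis
        using u(3)[of n \<theta>] v(2)[of n \<theta>] norm_triangle_ineq3[of "v n (cis \<theta>)" "u n (cis \<theta>)"] by linarith
    qed
    show "AE \<theta> in TM. (\<lambda>n. u n (cis \<theta>)) \<longlonglongrightarrow> F (cis \<theta>)"
      using v_lim
    proof eventually_elim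
      case (elim \<theta>)
      have "(\<lambda>n. v n (cis \<theta>) - u n (cis \<theta>)) \<longlonglongrightarrow> 0"
        using u(3) by (intro Lim_null_comparison[OF always_eventually LIMSEQ_1_over_Suc])
          (simp add: less_imp_le)
      then show ?case using tendsto_diff[OF elim, of "\<lambda>n. v n (cis \<theta>) - u n (cis \<theta>)" 0] by simp
    qed
  qed
qed

lemma integral_mult_bounded_eq_0:
  assumes F: "circ_measurable F" "integrable TM (\<lambda>\<theta>. F (cis \<theta>))"
    and orth: "\<And>u. circ_measurable u \<Longrightarrow> circ_class u \<in> trig_polys \<Longrightarrow> (LINT \<theta>|TM. F (cis \<theta>) * u (cis \<theta>)) = 0"
    and S: "circ_measurable S" "\<And>\<theta>. norm (S (cis \<theta>)) \<le> 1"
  shows "(LINT \<theta>|TM. F (cis \<theta>) * S (cis \<theta>)) = 0"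
proof -
  obtain u where u: "\<And>n. circ_measurable (u n)" "\<And>n. circ_class (u n) \<in> trig_polys"
    "\<And>n \<theta>. norm (u n (cis \<theta>)) \<le> 2"
    and u_lim: "AE \<theta> in TM. (\<lambda>n. u n (cis \<theta>)) \<longlonglongrightarrow> S (cis \<theta>)"
    using bounded_measurable_trig_poly_approx[OF S] by blast
  have "(\<lambda>n. LINT \<theta>|TM. F (cis \<theta>) * u n (cis \<theta>)) \<longlonglongrightarrow> (LINT \<theta>|TM. F (cis \<theta>) * S (cis \<theta>))"
  proof (rule integral_dominated_convergence[where w = "\<lambda>\<theta>. 2 * norm (F (cis \<theta>))"])
    show "(\<lambda>\<theta>. F (cis \<theta>) * S (cis \<theta>)) \<in> borel_measurable TM"
      "(\<lambda>\<theta>. F (cis \<theta>) * u n (cis \<theta>)) \<in> borel_measurable TM" for n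
      by (rule circ_measurableD, simp add: F(1) S(1) u(1))+
    show "AE \<theta> in TM. (\<lambda>n. F (cis \<theta>) * u n (cis \<theta>)) \<longlonglongrightarrow> F (cis \<theta>) * S (cis \<theta>)"
      using u_lim by eventually_elim (intro tendsto_intros)
    show "AE \<theta> in TM. norm (F (cis \<theta>) * u n (cis \<theta>)) \<le> 2 * norm (F (cis \<theta>))" for n
      by (intro AE_I2) (simp add: norm_mult mult.commute[of 2] mult_left_mono u(3))
  qed (use F(2) in simp)
  then show ?thesis by (simp add: orth[OF u(1,2)] LIMSEQ_const_iff)
qed

lemma mean_mult_trig_poly_eq_0:
  assumes "u \<in> trig_polys" "f \<in> Lp_class 1" "\<And>j. fourier f j = 0"
  shows "mean (f * u) = 0"
  using assms(1)
proof (induction rule: monom_span.induct)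
  case (monom_span_step g k c)
  have "f * (const c * tpow k + g) = const c * (f * tpow k) + f * g" by (simp add: algebra_simps)
  moreover have "mean (f * tpow k) = 0" using assms(3)[of "- k"] by (simp add: fourier_def)
  ultimately show ?case
    using monom_span_step assms(2)
    by (simp add: mean_add mean_const_mult Lp_mult_Linf Lp_class_const_mult monom_span_subset_Linf)
qed simp

theorem fourier_unique:
  assumes f: "f \<in> Lp_class 1" and zero: "\<And>j. fourier f j = 0"
  shows "f = 0"
proof (cases f)
  case (circ_class F)
  have F: "integrable TM (\<lambda>\<theta>. F (cis \<theta>))" using f circ_class by (simp add: circ_class_in_L1_iff)
  define S where "S z = cnj (F z) / of_real (norm (F z))" for z
  have "circ_measurable (\<lambda>z. of_real (norm (F z)))"
    using circ_class(2) by (simp add: circ_measurable_def)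
  then have S: "circ_measurable S" unfolding S_def using circ_class(2) by simp
  have "(LINT \<theta>|TM. F (cis \<theta>) * S (cis \<theta>)) = 0"
  proof (rule integral_mult_bounded_eq_0[OF circ_class(2) F _ S])
    show "(LINT \<theta>|TM. F (cis \<theta>) * u (cis \<theta>)) = 0" if "circ_measurable u" "circ_class u \<in> trig_polys" for u
      using mean_mult_trig_poly_eq_0[OF that(2) f zero] circ_class that(1) by (simp add: circ_class_simps)
  qed (simp add: S_def norm_divide)
  moreover have "F w * S w = of_real (norm (F w))" for w
    by (cases "F w = 0") (simp_all add: S_def complex_norm_square[symmetric] power2_eq_square)
  ultimately have "AE \<theta> in TM. norm (F (cis \<theta>)) = 0"
    using integral_nonneg_eq_0_iff_AE[OF integrable_norm[OF F]] by simp
  then show ?thesis using circ_class by (simp add: circ_class_simps circ_class_eq_iff ae_eq_def)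
qed

lemma fourier_eqI:
  assumes "f \<in> Lp_class 1" "g \<in> Lp_class 1" "\<And>j. fourier f j = fourier g j"
  shows "f = g"
  using fourier_unique[of "f - g"] Lp_class_diff[of f 1 g] assms by (simp add: fourier_diff)

lemma Linf_class_bounded_representative:
  assumes "f \<in> Linf_class"
  obtains C F where "0 < C" "f = circ_class F" "circ_measurable F" "\<And>z. norm (F z) \<le> C"
proof (cases f)
  case (circ_class G)
  obtain C where C: "AE \<theta> in TM. norm (G (cis \<theta>)) \<le> C" "0 \<le> C"
    using Linf_classE[OF assms] circ_class by (metis ess_bounded_circ_class)
  define F where "F z = (if norm (G z) \<le> C then G z else 0)" for z
  have "circ_measurable F"
    using circ_class(2) unfolding F_def circ_measurable_def by measurable
  moreover have "ae_eq G F" using C(1) unfolding ae_eq_def by eventually_elim (simp add: F_def)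
  ultimately show thesis
    using that[of "C + 1" F] circ_class C(2) by (auto simp: circ_class_eq_iff F_def add_increasing2)
qed

lemma Linf_class_dense_in_Lp:
  assumes f: "f \<in> Lp_class p" and p: "0 < p" and e: "0 < e"
  obtains g where "g \<in> Linf_class" "cnorm p (f - g) < e"
proof (cases f)
  case (circ_class F)
  then have F: "(\<lambda>\<theta>. F (cis \<theta>)) \<in> Lspace TM p" using f by (simp add: circ_class_simps)
  define T where "T m z = (if norm (F z) \<le> real m then F z else 0)" for m z
  have T: "circ_measurable (T m)" for m
    using circ_class(2) unfolding T_def circ_measurable_def by measurable
  have "(\<lambda>m. Lnorm TM p (\<lambda>\<theta>. F (cis \<theta>) - T m (cis \<theta>))) \<longlonglongrightarrow> 0"
  proof (rule Lnorm_dominated_convergence[OF _ _ _ Lspace_integrable[OF F] p])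
    show "(\<lambda>\<theta>. F (cis \<theta>) - T m (cis \<theta>)) \<in> borel_measurable TM" for m
      by (intro borel_measurable_diff circ_measurableD T circ_class(2))
    show "AE \<theta> in TM. (\<lambda>m. F (cis \<theta>) - T m (cis \<theta>)) \<longlonglongrightarrow> 0"
    proof (intro AE_I2 tendsto_eventually)
      fix \<theta>
      have "eventually (\<lambda>m. norm (F (cis \<theta>)) \<le> real m) sequentially"
        using filterlim_real_sequentially by (simp add: filterlim_at_top)
      then show "eventually (\<lambda>m. F (cis \<theta>) - T m (cis \<theta>) = 0) sequentially"
        by eventually_elim (simp add: T_def)
    qed
    show "AE \<theta> in TM. norm (F (cis \<theta>) - T m (cis \<theta>)) \<le> norm (F (cis \<theta>))" for m
      by (intro AE_I2) (simp add: T_def)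
  qed
  then obtain m where "Lnorm TM p (\<lambda>\<theta>. F (cis \<theta>) - T m (cis \<theta>)) < e"
    using e by (rule LIMSEQ_0_less)
  moreover have "ess_bounded (real m) (circ_class (T m))"
    using T by (simp add: circ_class_simps T_def)
  ultimately show thesis
    using that[of "circ_class (T m)"] circ_class T by (auto simp: Linf_class_def circ_class_simps)
qed

lemma trig_polys_approx_Linf:
  assumes f: "f \<in> Linf_class" and p: "0 < p" and e: "0 < e"
  obtains u where "u \<in> trig_polys" "cnorm p (f - u) < e"
proof -
  obtain C F where C: "0 < C" and F: "f = circ_class F" "circ_measurable F" "\<And>z. norm (F z) \<le> C"
    using Linf_class_bounded_representative[OF f] by metis
  define G where "G z = F z / of_real C" for z
  have G: "circ_measurable G" "norm (G (cis \<theta>)) \<le> 1" for \<theta>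
    using C F(2,3) by (simp_all add: G_def[abs_def] norm_divide)
  obtain u where u: "\<And>n. circ_measurable (u n)" "\<And>n. circ_class (u n) \<in> trig_polys"
    "\<And>n \<theta>. norm (u n (cis \<theta>)) \<le> 2" and u_lim: "AE \<theta> in TM. (\<lambda>n. u n (cis \<theta>)) \<longlonglongrightarrow> G (cis \<theta>)"
    using bounded_measurable_trig_poly_approx[OF G] by blast
  have "(\<lambda>n. Lnorm TM p (\<lambda>\<theta>. G (cis \<theta>) - u n (cis \<theta>))) \<longlonglongrightarrow> 0"
  proof (rule Lnorm_dominated_convergence[where w = "\<lambda>_. 3", OF _ _ _ _ p])
    show "(\<lambda>\<theta>. G (cis \<theta>) - u n (cis \<theta>)) \<in> borel_measurable TM" for n
      by (intro borel_measurable_diff circ_measurableD G u)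
    show "AE \<theta> in TM. (\<lambda>n. G (cis \<theta>) - u n (cis \<theta>)) \<longlonglongrightarrow> 0"
      using u_lim
    proof eventually_elim
      case (elim \<theta>)
      show ?case using tendsto_diff[OF tendsto_const[of "G (cis \<theta>)"] elim] by simp
    qed
    show "AE \<theta> in TM. norm (G (cis \<theta>) - u n (cis \<theta>)) \<le> 3" for n
    proof (intro AE_I2)
      fix \<theta>
      show "norm (G (cis \<theta>) - u n (cis \<theta>)) \<le> 3"
        using norm_triangle_ineq4[of "G (cis \<theta>)" "u n (cis \<theta>)"] G(2)[of \<theta>] u(3)[of n \<theta>] by linarith
    qed
    show "integrable TM (\<lambda>_. 3 powr p)" using finite_measure.integrable_const[OF finite_measure_TM] .
  qed
  then obtain n where n: "Lnorm TM p (\<lambda>\<theta>. G (cis \<theta>) - u n (cis \<theta>)) < e / C"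
    using e C by (elim LIMSEQ_0_less[of _ "e / C"]) auto
  have "f = const (of_real C) * circ_class G"
    using F C G(1) by (simp add: circ_class_simps G_def[abs_def])
  then have "f - const (of_real C) * circ_class (u n)
      = const (of_real C) * (circ_class G - circ_class (u n))"
    by (simp add: right_diff_distrib)
  then have "cnorm p (f - const (of_real C) * circ_class (u n))
      = C * cnorm p (circ_class G - circ_class (u n))"
    using C by (simp add: cnorm_const_mult[OF p])
  also have "\<dots> < e" using n C G(1) u(1)[of n] by (simp add: circ_class_simps field_simps)
  finally show thesis using that monom_span_const_mult u(2) by blast
qed

theorem trig_polys_dense:
  assumes f: "f \<in> Lp_class p" and p: "1 < p" and e: "0 < e"
  obtains u where "u \<in> trig_polys" "cnorm p (f - u) < e"
proof -
  obtain g where g: "g \<in> Linf_class" "cnorm p (f - g) < e / 2"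
    using Linf_class_dense_in_Lp[OF f, of "e / 2"] p e by auto
  obtain u where u: "u \<in> trig_polys" "cnorm p (g - u) < e / 2"
    using trig_polys_approx_Linf[OF g(1), of p "e / 2"] p e by auto
  have "cnorm p (f - u) \<le> cnorm p (f - g) + cnorm p (g - u)"
    using f g(1) u(1) p by (intro cnorm_triangle_via)
      (auto intro: Linf_class_subset_Lp monom_span_subset_Lp)
  then show thesis using that u g(2) by force
qed

section \<open>Fejer means\<close>

definition fejer_kernel :: "nat \<Rightarrow> complex \<Rightarrow> real" where
  "fejer_kernel N \<zeta> = (norm (\<Sum>j<N. \<zeta> ^ j))\<^sup>2 / real N"

definition fejer_weight :: "nat \<Rightarrow> int \<Rightarrow> real" where
  "fejer_weight N m = max 0 (1 - \<bar>real_of_int m\<bar> / real N)"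

definition fejer_sum :: "nat \<Rightarrow> (int \<Rightarrow> complex) \<Rightarrow> complex \<Rightarrow> complex" where
  "fejer_sum N y z = (\<Sum>m=- int N..int N. of_real (fejer_weight N m) * y m * z powi m)"

definition fejer_poly :: "nat \<Rightarrow> (int \<Rightarrow> complex) \<Rightarrow> circle_fun" where
  "fejer_poly N y = circ_class (fejer_sum N y)"

abbreviation fejer_mean :: "nat \<Rightarrow> circle_fun \<Rightarrow> circle_fun" where
  "fejer_mean N f \<equiv> fejer_poly N (fourier f)"

lemma fejer_kernel_nonneg [simp]: "0 \<le> fejer_kernel N \<zeta>"
  by (simp add: fejer_kernel_def)

lemma fejer_weight_0 [simp]: "fejer_weight N 0 = 1"
  and fejer_weight_minus [simp]: "fejer_weight N (- m) = fejer_weight N m"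
  by (simp_all add: fejer_weight_def)

lemma fejer_weight_eq_0: "1 \<le> N \<Longrightarrow> int N \<le> \<bar>m\<bar> \<Longrightarrow> fejer_weight N m = 0"
  by (simp add: fejer_weight_def field_simps)

lemma fejer_weight_tendsto: "(\<lambda>N. fejer_weight N m) \<longlonglongrightarrow> 1"
proof -
  have "(\<lambda>N. max 0 (1 - \<bar>real_of_int m\<bar> / real N)) \<longlonglongrightarrow> max 0 (1 - 0)"
    by (intro tendsto_intros lim_const_over_n)
  then show ?thesis by (simp add: fejer_weight_def)
qed

lemma circ_measurable_fejer_sum [simp]: "circ_measurable (fejer_sum N y)"
  unfolding fejer_sum_def[abs_def] by simp

lemma fejer_poly_eq_sum: "fejer_poly N y
    = (\<Sum>m=- int N..int N. const (of_real (fejer_weight N m) * y m) * tpow m)"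
  unfolding fejer_poly_def fejer_sum_def[abs_def]
  by (subst circ_class_sum[symmetric]) (simp_all add: circ_class_simps)

lemma fejer_poly_in_trig_polys: "fejer_poly N y \<in> trig_polys"
  unfolding fejer_poly_eq_sum by (intro monom_span_sum monom_span_monom) simp

lemma fejer_poly_in_Lp [simp]: "0 \<le> p \<Longrightarrow> fejer_poly N y \<in> Lp_class p"
  by (intro monom_span_subset_Lp[OF fejer_poly_in_trig_polys])

lemma fejer_poly_add: "fejer_poly N (\<lambda>j. y j + y' j) = fejer_poly N y + fejer_poly N y'"
  by (simp add: fejer_poly_eq_sum distrib_left distrib_right const_add sum.distrib)

lemma fejer_poly_const_mult: "fejer_poly N (\<lambda>j. c * y j) = const c * fejer_poly N y"
  by (simp add: fejer_poly_eq_sum sum_distrib_left const_mult ac_simps)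

lemma fourier_fejer_poly:
  assumes "1 \<le> N" shows "fourier (fejer_poly N y) j = of_real (fejer_weight N j) * y j"
proof -
  have "fourier (fejer_poly N y) j
      = (\<Sum>m=- int N..int N. of_real (fejer_weight N m) * y m * (if m = j then 1 else 0))"
    unfolding fejer_poly_eq_sum by (subst fourier_sum) (simp_all add: fourier_tpow Lp_class_const_mult)
  also have "\<dots> = (\<Sum>m=- int N..int N. if m = j then of_real (fejer_weight N m) * y m else 0)"
    by (intro sum.cong) auto
  finally show ?thesis using fejer_weight_eq_0[OF assms, of j] by (auto simp: sum.delta)
qed

lemma mean_fejer_poly_mult:
  assumes "\<psi> \<in> Lp_class 1"
  shows "mean (fejer_poly N y * \<psi>)
    = (\<Sum>m=- int N..int N. of_real (fejer_weight N m) * y m * fourier \<psi> (- m))"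
proof -
  have mult: "const c * tpow m * \<psi> = const c * (\<psi> * tpow m)" for c m by (simp only: ac_simps)
  have "mean (fejer_poly N y * \<psi>)
      = (\<Sum>m=- int N..int N. mean (const (of_real (fejer_weight N m) * y m) * tpow m * \<psi>))"
    unfolding fejer_poly_eq_sum sum_distrib_right using assms by (intro mean_sum) (simp add: Linf_mult_Lp)
  then show ?thesis unfolding mult mean_const_mult by (simp add: fourier_def)
qed

lemma card_diff_eq:
  "card {x \<in> {..<N} \<times> {..<N}. int (fst x) - int (snd x) = m} = nat (int N - \<bar>m\<bar>)"
proof -
  define \<phi> where "\<phi> i = (i + nat m, i + nat (- m))" for i
  have "{x \<in> {..<N} \<times> {..<N}. int (fst x) - int (snd x) = m} = \<phi> ` {..<nat (int N - \<bar>m\<bar>)}"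
  proof (intro Set.set_eqI iffI)
    fix x assume "x \<in> {x \<in> {..<N} \<times> {..<N}. int (fst x) - int (snd x) = m}"
    then show "x \<in> \<phi> ` {..<nat (int N - \<bar>m\<bar>)}"
      by (intro image_eqI[of _ _ "min (fst x) (snd x)"]) (auto simp: \<phi>_def prod_eq_iff)
  qed (auto simp: \<phi>_def)
  moreover have "inj_on \<phi> A" for A by (simp add: inj_on_def \<phi>_def)
  ultimately show ?thesis by (simp add: card_image)
qed

lemma fejer_kernel_expansion:
  assumes \<zeta>: "norm \<zeta> = 1" and N: "1 \<le> N"
  shows "complex_of_real (fejer_kernel N \<zeta>) = (\<Sum>m=- int N..int N. of_real (fejer_weight N m) * \<zeta> powi m)"
proof -
  have \<zeta>0: "\<zeta> \<noteq> 0" using \<zeta> by auto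
  have "\<zeta> * cnj \<zeta> = 1" using \<zeta> complex_norm_square[of \<zeta>] by simp
  then have powers: "\<zeta> ^ j * cnj \<zeta> ^ l = \<zeta> powi (int j - int l)" for j l
    using \<zeta>0 power_mult_distrib[of \<zeta> "cnj \<zeta>" l] by (simp add: power_int_diff power_int_of_nat field_simps)
  define A where "A m = {x \<in> {..<N} \<times> {..<N}. int (fst x) - int (snd x) = m}" for m
  have "complex_of_real (fejer_kernel N \<zeta>) = (\<Sum>j<N. \<zeta> ^ j) * cnj (\<Sum>j<N. \<zeta> ^ j) / of_nat N"
    unfolding fejer_kernel_def using complex_norm_square[of "\<Sum>j<N. \<zeta> ^ j"] by simp
  also have "(\<Sum>j<N. \<zeta> ^ j) * cnj (\<Sum>j<N. \<zeta> ^ j) = (\<Sum>x\<in>{..<N} \<times> {..<N}. \<zeta> powi (int (fst x) - int (snd x)))"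
    by (simp add: sum_product powers sum.cartesian_product case_prod_beta)
  also have "\<dots> = (\<Sum>m=- int N..int N. \<Sum>x\<in>A m. \<zeta> powi (int (fst x) - int (snd x)))"
    unfolding A_def by (intro sum.group[symmetric]) auto
  also have "\<dots> = (\<Sum>m=- int N..int N. of_nat (card (A m)) * \<zeta> powi m)"
    by (intro sum.cong refl) (simp add: A_def)
  also have "\<dots> / of_nat N = (\<Sum>m=- int N..int N. of_real (fejer_weight N m) * \<zeta> powi m)"
    unfolding sum_divide_distrib
  proof (intro sum.cong refl)
    fix m assume m: "m \<in> {- int N..int N}"
    have "card (A m) = nat (int N - \<bar>m\<bar>)" unfolding A_def by (rule card_diff_eq)
    moreover have "real (nat (int N - \<bar>m\<bar>)) = real N - \<bar>real_of_int m\<bar>" using m by (subst of_nat_nat) auto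
    ultimately have "fejer_weight N m = real (card (A m)) / real N"
      using m N by (simp add: fejer_weight_def field_simps)
    then show "of_nat (card (A m)) * \<zeta> powi m / of_nat N = of_real (fejer_weight N m) * \<zeta> powi m" by simp
  qed
  finally show ?thesis .
qed

lemma integrable_mult_cis:
  assumes "integrable TM F" shows "integrable TM (\<lambda>\<theta>. F \<theta> * cis (r * \<theta>))"
  using assms borel_measurable_integrable[OF integrable_cis]
  by (intro Bochner_Integration.integrable_bound[OF assms] borel_measurable_times) (auto simp: norm_mult)

lemma fejer_sum_convolution:
  assumes F: "integrable TM (\<lambda>\<theta>. F (cis \<theta>))" and z: "norm z = 1" and N: "1 \<le> N"
  shows "integrable TM (\<lambda>\<theta>. F (cis \<theta>) * of_real (fejer_kernel N (z * cis (- \<theta>))))"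
    and "fejer_sum N (fc F) z
      = (LINT \<theta>|TM. F (cis \<theta>) * of_real (fejer_kernel N (z * cis (- \<theta>)))) / of_real (2 * pi)"
proof -
  have integrable: "integrable TM (\<lambda>\<theta>. F (cis \<theta>) * cis (- (r * \<theta>)))" for r
    using integrable_mult_cis[OF F, of "- r"] by simp
  have expansion: "F (cis \<theta>) * of_real (fejer_kernel N (z * cis (- \<theta>))) =
    (\<Sum>m=- int N..int N. of_real (fejer_weight N m) * z powi m *
      (F (cis \<theta>) * cis (- (of_int m * \<theta>))))" for \<theta>
    using z N by (subst fejer_kernel_expansion)
      (simp_all add: norm_mult sum_distrib_left power_int_mult_distrib cis_power_int mult_ac)
  show "integrable TM (\<lambda>\<theta>. F (cis \<theta>) * of_real (fejer_kernel N (z * cis (- \<theta>))))"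
    unfolding expansion by (intro Bochner_Integration.integrable_sum integrable_mult_right integrable)
  have "(LINT \<theta>|TM. F (cis \<theta>) * of_real (fejer_kernel N (z * cis (- \<theta>)))) =
    (\<Sum>m=- int N..int N. of_real (fejer_weight N m) * z powi m *
      (LINT \<theta>|TM. F (cis \<theta>) * cis (- (of_int m * \<theta>))))"
    unfolding expansion by (simp add: Bochner_Integration.integral_sum integrable)
  then show "fejer_sum N (fc F) z =
    (LINT \<theta>|TM. F (cis \<theta>) * of_real (fejer_kernel N (z * cis (- \<theta>)))) / of_real (2 * pi)"
    unfolding fejer_sum_def fc_def by (simp add: sum_divide_distrib mult_ac)
qed

lemma fejer_kernel_mass:
  assumes z: "norm z = 1" and N: "1 \<le> N"
  shows "integrable TM (\<lambda>\<theta>. fejer_kernel N (z * cis (- \<theta>)))"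
    and "(LINT \<theta>|TM. fejer_kernel N (z * cis (- \<theta>))) = 2 * pi"
proof -
  have "integrable TM (\<lambda>\<theta>. (\<lambda>_. 1::complex) (cis \<theta>))"
    using finite_measure.integrable_const[OF finite_measure_TM] by simp
  note convolution = fejer_sum_convolution[OF this z N]
  have "integrable TM (\<lambda>\<theta>. complex_of_real (fejer_kernel N (z * cis (- \<theta>))))" using convolution(1) by simp
  then show "integrable TM (\<lambda>\<theta>. fejer_kernel N (z * cis (- \<theta>)))"
    by (simp only: complex_of_real_integrable_eq)
  have "fc (\<lambda>_. 1) m = (if m = 0 then 1 else 0)" for m
    using fourier_1[of m] by (simp add: fc_fourier circ_class_1)
  then have "fejer_sum N (fc (\<lambda>_. 1)) z = (\<Sum>m=- int N..int N. if m = 0 then 1 else 0)"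
    unfolding fejer_sum_def by (intro sum.cong) auto
  then have "complex_of_real (LINT \<theta>|TM. fejer_kernel N (z * cis (- \<theta>))) = complex_of_real (2 * pi)"
    using convolution(2) by (simp add: field_simps)
  then show "(LINT \<theta>|TM. fejer_kernel N (z * cis (- \<theta>))) = 2 * pi" by (simp only: of_real_eq_iff)
qed

lemma fejer_sum_real:
  assumes h: "integrable TM (\<lambda>\<theta>. h (cis \<theta>))" and z: "norm z = 1" and N: "1 \<le> N"
  shows "integrable TM (\<lambda>\<theta>. h (cis \<theta>) * fejer_kernel N (z * cis (- \<theta>)))"
    and "fejer_sum N (fc (\<lambda>z. complex_of_real (h z))) z =
      of_real ((LINT \<theta>|TM. h (cis \<theta>) * fejer_kernel N (z * cis (- \<theta>))) / (2 * pi))"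
proof -
  have "integrable TM (\<lambda>\<theta>. (\<lambda>z. complex_of_real (h z)) (cis \<theta>))" using h by simp
  note convolution = fejer_sum_convolution[OF this z N]
  show "integrable TM (\<lambda>\<theta>. h (cis \<theta>) * fejer_kernel N (z * cis (- \<theta>)))"
    using convolution(1) by (simp only: of_real_mult[symmetric] complex_of_real_integrable_eq)
  show "fejer_sum N (fc (\<lambda>z. complex_of_real (h z))) z =
      of_real ((LINT \<theta>|TM. h (cis \<theta>) * fejer_kernel N (z * cis (- \<theta>))) / (2 * pi))"
    unfolding convolution(2) by (simp flip: of_real_mult)
qed

lemma norm_fejer_sum_le:
  assumes F: "integrable TM (\<lambda>\<theta>. F (cis \<theta>))" and z: "norm z = 1" and N: "1 \<le> N"
  shows "norm (fejer_sum N (fc F) z)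
    \<le> (LINT \<theta>|TM. norm (F (cis \<theta>)) * fejer_kernel N (z * cis (- \<theta>))) / (2 * pi)"
  unfolding fejer_sum_convolution(2)[OF assms]
  using integral_norm_bound[of TM "\<lambda>\<theta>. F (cis \<theta>) * of_real (fejer_kernel N (z * cis (- \<theta>)))"]
  by (simp add: norm_divide norm_mult divide_right_mono)

text \<open>Jensen's inequality for the probability density \<open>fejer_kernel N (z * cis (- \<theta>)) / (2 * pi)\<close>.\<close>

lemma fejer_sum_Jensen:
  assumes F: "(\<lambda>\<theta>. F (cis \<theta>)) \<in> Lspace TM p" and p: "1 < p" and z: "norm z = 1" and N: "1 \<le> N"
  shows "norm (fejer_sum N (fc F) z) powr p
    \<le> Re (fejer_sum N (fc (\<lambda>z. complex_of_real (norm (F z) powr p))) z)"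
proof -
  have F_int: "integrable TM (\<lambda>\<theta>. F (cis \<theta>))" by (rule Lspace_imp_integrable[OF finite_measure_TM F p])
  define k where "k \<theta> = fejer_kernel N (z * cis (- \<theta>))" for \<theta>
  have k: "0 \<le> k \<theta>" for \<theta> by (simp add: k_def)
  note k_mass = fejer_kernel_mass[OF z N, folded k_def]
  note average = fejer_sum_real[OF _ z N, folded k_def]
  have integrable: "integrable TM (\<lambda>\<theta>. norm (F (cis \<theta>)) * k \<theta>)"
    "integrable TM (\<lambda>\<theta>. norm (F (cis \<theta>)) powr p * k \<theta>)"
    using average(1)[of "\<lambda>z. norm (F z)"] average(1)[of "\<lambda>z. norm (F z) powr p"] F_int
      Lspace_integrable[OF F]
    by simp_all
  define a where "a = (LINT \<theta>|TM. norm (F (cis \<theta>)) * k \<theta>) / (2 * pi)"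
  have a: "0 \<le> a" unfolding a_def using k by (intro divide_nonneg_pos integral_nonneg_AE) auto
  define slope where "slope = p * a powr (p - 1)"
  have "(LINT \<theta>|TM. a powr p * k \<theta> + slope * (norm (F (cis \<theta>)) * k \<theta> - a * k \<theta>))
      \<le> (LINT \<theta>|TM. norm (F (cis \<theta>)) powr p * k \<theta>)"
  proof (rule integral_mono)
    fix \<theta>
    have "(a powr p + slope * (norm (F (cis \<theta>)) - a)) * k \<theta> \<le> norm (F (cis \<theta>)) powr p * k \<theta>"
      using powr_ge_tangent[OF p norm_ge_zero a, of "F (cis \<theta>)"] k
      unfolding slope_def by (intro mult_right_mono) auto
    then show "a powr p * k \<theta> + slope * (norm (F (cis \<theta>)) * k \<theta> - a * k \<theta>)
        \<le> norm (F (cis \<theta>)) powr p * k \<theta>"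
      by (simp add: algebra_simps)
  qed (use k_mass integrable in auto)
  moreover have "(LINT \<theta>|TM. a powr p * k \<theta> + slope * (norm (F (cis \<theta>)) * k \<theta> - a * k \<theta>))
      = a powr p * (2 * pi)"
    using k_mass integrable by (simp add: a_def)
  ultimately have "a powr p \<le> (LINT \<theta>|TM. norm (F (cis \<theta>)) powr p * k \<theta>) / (2 * pi)"
    by (simp add: field_simps)
  moreover have "norm (fejer_sum N (fc F) z) powr p \<le> a powr p"
    using norm_fejer_sum_le[OF F_int z N] p by (intro powr_mono2) (auto simp: a_def k_def)
  moreover have "fejer_sum N (fc (\<lambda>z. complex_of_real (norm (F z) powr p))) z =
      of_real ((LINT \<theta>|TM. norm (F (cis \<theta>)) powr p * k \<theta>) / (2 * pi))"
    using Lspace_integrable[OF F] by (rule average(2))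
  ultimately show ?thesis by simp
qed

lemma integral_fejer_sum:
  assumes "circ_measurable F" "1 \<le> N"
  shows "(LINT \<theta>|TM. fejer_sum N (fc F) (cis \<theta>)) = (LINT \<theta>|TM. F (cis \<theta>))"
proof -
  have "fourier (fejer_poly N (fc F)) 0 = fc F 0" using assms by (simp add: fourier_fejer_poly)
  then show ?thesis using assms(1) by (simp add: fourier_def fc_def fejer_poly_def circ_class_simps)
qed

theorem cnorm_fejer_mean_le:
  assumes f: "f \<in> Lp_class p" and p: "1 < p" and N: "1 \<le> N"
  shows "cnorm p (fejer_mean N f) \<le> cnorm p f"
proof (cases f)
  case (circ_class F)
  then have F: "(\<lambda>\<theta>. F (cis \<theta>)) \<in> Lspace TM p" using f by (simp add: circ_class_simps)
  have fc_F: "fc F = fourier f" using circ_class by (simp add: fc_fourier fun_eq_iff)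
  have mean_Lp: "(\<lambda>\<theta>. fejer_sum N (fc F) (cis \<theta>)) \<in> Lspace TM p"
    using fejer_poly_in_Lp[of p N "fc F"] p by (simp add: fejer_poly_def circ_class_in_Lp_class_iff)
  define G where "G z = complex_of_real (norm (F z) powr p)" for z
  have G: "circ_measurable G"
    using Lspace_integrable[OF F] unfolding G_def circ_measurable_def by simp
  have G_int: "integrable TM (\<lambda>\<theta>. fejer_sum N (fc G) (cis \<theta>))"
    using fejer_poly_in_Lp[of 1 N "fc G"] by (simp add: fejer_poly_def circ_class_in_L1_iff)
  have "(LINT \<theta>|TM. norm (fejer_sum N (fc F) (cis \<theta>)) powr p)
      \<le> (LINT \<theta>|TM. Re (fejer_sum N (fc G) (cis \<theta>)))"
    using Lspace_integrable[OF mean_Lp] G_int fejer_sum_Jensen[OF F p _ N]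
    by (intro integral_mono) (simp_all add: G_def[abs_def])
  also have "\<dots> = Re (LINT \<theta>|TM. fejer_sum N (fc G) (cis \<theta>))" using G_int by simp
  also have "\<dots> = (LINT \<theta>|TM. norm (F (cis \<theta>)) powr p)"
    unfolding integral_fejer_sum[OF G N] by (simp add: G_def)
  finally have "Lnorm TM p (\<lambda>\<theta>. fejer_sum N (fc F) (cis \<theta>)) \<le> Lnorm TM p (\<lambda>\<theta>. F (cis \<theta>))"
    using p by (simp add: Lnorm_le_iff Lnorm_powr)
  then show ?thesis using circ_class fc_F by (simp add: fejer_poly_def circ_class_simps)
qed

section \<open>Weak compactness of balls\<close>

lemma near_minimizers_Cauchy:
  assumes p: "1 < p" and F: "\<And>n. F n \<in> Lp_class p" and M: "\<And>n. cnorm p (F n) \<le> M"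
    and d: "d \<longlonglongrightarrow> D" and upper: "\<And>n. cnorm p (F n) powr p \<le> D + 1 / (real n + 1)"
    and lower: "\<And>N m n. N \<le> m \<Longrightarrow> N \<le> n \<Longrightarrow> d N \<le> cnorm p (const (1/2) * (F m + F n)) powr p"
  shows "Lp_Cauchy p F"
  unfolding Lp_Cauchy_def
proof (intro allI impI)
  fix e :: real assume e: "0 < e"
  define \<epsilon> where "\<epsilon> = e powr p / (4 * M powr p + 1)"
  have "0 \<le> M powr p" by simp
  then have denom: "0 < 4 * M powr p + 1" by linarith
  then have \<epsilon>: "0 < \<epsilon>" using e by (simp add: \<epsilon>_def)
  obtain C where C: "0 \<le> C" and convex: "\<And>f g. f \<in> Lp_class p \<Longrightarrow> g \<in> Lp_class p \<Longrightarrow>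
    cnorm p (f - g) powr p \<le> \<epsilon> * (cnorm p f powr p + cnorm p g powr p)
      + C * ((cnorm p f powr p + cnorm p g powr p) / 2 - cnorm p (const (1/2) * (f + g)) powr p)"
    using cnorm_uniformly_convex[OF p \<epsilon>] by blast
  have "(\<lambda>N. C * (D + 1 / (real N + 1) - d N)) \<longlonglongrightarrow> C * (D + 0 - D)"
    by (intro tendsto_intros d LIMSEQ_1_over_Suc)
  then obtain N where N: "C * (D + 1 / (real N + 1) - d N) < e powr p / 2"
    using e LIMSEQ_0_less[of "\<lambda>N. C * (D + 1 / (real N + 1) - d N)" "e powr p / 2"] by auto
  have "cnorm p (F m - F n) < e" if mn: "N \<le> m" "N \<le> n" for m n
  proof -
    have upper_N: "cnorm p (F k) powr p \<le> D + 1 / (real N + 1)" if "N \<le> k" for k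
      using upper[of k] that divide_left_mono[of "real N + 1" "real k + 1" 1] by simp
    have "cnorm p (F m - F n) powr p \<le> \<epsilon> * (cnorm p (F m) powr p + cnorm p (F n) powr p)
      + C * ((cnorm p (F m) powr p + cnorm p (F n) powr p) / 2
        - cnorm p (const (1/2) * (F m + F n)) powr p)"
      by (rule convex[OF F F])
    also have "\<dots> \<le> \<epsilon> * (M powr p + M powr p) + C * (D + 1 / (real N + 1) - d N)"
    proof (intro add_mono mult_left_mono)
      show "(cnorm p (F m) powr p + cnorm p (F n) powr p) / 2 - cnorm p (const (1/2) * (F m + F n)) powr p
          \<le> D + 1 / (real N + 1) - d N"
        using upper_N[OF mn(1)] upper_N[OF mn(2)] lower[OF mn] by argo
    qed (use \<epsilon> C p M in \<open>auto intro: powr_mono2\<close>)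
    also have "\<dots> < e powr p"
    proof -
      have "\<epsilon> * (4 * M powr p + 1) = e powr p" using denom by (simp add: \<epsilon>_def)
      then show ?thesis using N \<epsilon> unfolding distrib_left by linarith
    qed
    finally show ?thesis using e p powr_mono2[of p e "cnorm p (F m - F n)"] by fastforce
  qed
  then show "\<exists>N. \<forall>m\<ge>N. \<forall>n\<ge>N. cnorm p (F m - F n) < e" by blast
qed

text \<open>Elements of nearly minimal norm form a Cauchy sequence, by uniform convexity.\<close>

theorem nested_convex_sets_limit:
  assumes p: "1 < p" and nonempty: "\<And>n::nat. K n \<noteq> {}" and Lp: "\<And>n. K n \<subseteq> Lp_class p"
    and nested: "\<And>m n. m \<le> n \<Longrightarrow> K n \<subseteq> K m" and bounded: "\<And>n f. f \<in> K n \<Longrightarrow> cnorm p f \<le> M"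
    and convex: "\<And>n f g. f \<in> K n \<Longrightarrow> g \<in> K n \<Longrightarrow> const (1/2) * (f + g) \<in> K n"
  obtains F f where "\<And>n. F n \<in> K n" "f \<in> Lp_class p" "Lp_conv p F f"
proof -
  define d where "d n = Inf ((\<lambda>f. cnorm p f powr p) ` K n)" for n
  have bdd: "bdd_below ((\<lambda>f. cnorm p f powr p) ` K n)" for n by (rule bdd_belowI[of _ 0]) auto
  have d_le: "d n \<le> cnorm p f powr p" if "f \<in> K n" for n f
    unfolding d_def using that bdd by (intro cInf_lower) auto
  have "incseq d"
    unfolding incseq_def d_def using nested nonempty bdd by (auto intro!: cInf_superset_mono)
  moreover have d_bound: "d n \<le> M powr p" for n
  proof -
    obtain f where f: "f \<in> K n" using nonempty by blast
    then have "cnorm p f powr p \<le> M powr p" using bounded p by (intro powr_mono2) auto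
    then show ?thesis using d_le[OF f] by linarith
  qed
  ultimately obtain D where D: "d \<longlonglongrightarrow> D" "\<And>n. d n \<le> D" using incseq_convergent by blast
  have "\<exists>f\<in>K n. cnorm p f powr p < d n + 1 / (real n + 1)" for n
    using cInf_lessD[of "(\<lambda>f. cnorm p f powr p) ` K n" "d n + 1 / (real n + 1)"] nonempty[of n]
    by (auto simp: d_def)
  then obtain F where F: "\<And>n. F n \<in> K n" "\<And>n. cnorm p (F n) powr p < d n + 1 / (real n + 1)" by metis
  have F_Lp: "F n \<in> Lp_class p" for n using F(1) Lp by blast
  have "Lp_Cauchy p F"
  proof (rule near_minimizers_Cauchy[OF p F_Lp bounded[OF F(1)] D(1)])
    show "cnorm p (F n) powr p \<le> D + 1 / (real n + 1)" for n using F(2)[of n] D(2)[of n] by linarith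
    show "d N \<le> cnorm p (const (1/2) * (F m + F n)) powr p" if "N \<le> m" "N \<le> n" for N m n
      using F(1) nested that by (intro d_le convex) blast+
  qed
  then obtain f where "f \<in> Lp_class p" "Lp_conv p F f"
    using Lp_class_complete[where F = F, OF p F_Lp] by blast
  then show thesis using that F(1) by blast
qed

definition coefficient_neighbourhood :: "real \<Rightarrow> real \<Rightarrow> (int \<Rightarrow> complex) \<Rightarrow> nat \<Rightarrow> circle_fun set" where
  "coefficient_neighbourhood p M y n = {f \<in> Lp_class p. cnorm p f \<le> M
    \<and> (\<forall>j. \<bar>j\<bar> \<le> int n \<longrightarrow> norm (fourier f j - y j) \<le> 1 / (real n + 1))}"

lemma coefficient_neighbourhood_antimono:
  assumes "m \<le> n" shows "coefficient_neighbourhood p M y n \<subseteq> coefficient_neighbourhood p M y m"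
proof -
  have "1 / (real n + 1) \<le> 1 / (real m + 1)" using assms by (intro divide_left_mono) auto
  then have "norm (fourier f j - y j) \<le> 1 / (real m + 1)"
    if "f \<in> coefficient_neighbourhood p M y n" "\<bar>j\<bar> \<le> int m" for f j
    using that assms by (fastforce simp: coefficient_neighbourhood_def intro: order.trans)
  then show ?thesis by (auto simp: coefficient_neighbourhood_def)
qed

lemma coefficient_neighbourhood_midpoint:
  assumes f: "f \<in> coefficient_neighbourhood p M y n" and g: "g \<in> coefficient_neighbourhood p M y n"
    and p: "1 < p"
  shows "const (1/2) * (f + g) \<in> coefficient_neighbourhood p M y n"
proof -
  have Lp: "f \<in> Lp_class p" "g \<in> Lp_class p" using f g by (auto simp: coefficient_neighbourhood_def)
  have "cnorm p (const (1/2) * (f + g)) \<le> M"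
    using cnorm_triangle[OF Lp p] f g p by (simp add: cnorm_const_mult coefficient_neighbourhood_def)
  moreover have "norm (fourier (const (1/2) * (f + g)) j - y j) \<le> 1 / (real n + 1)" if "\<bar>j\<bar> \<le> int n" for j
  proof -
    have "fourier (const (1/2) * (f + g)) j - y j = 1/2 * ((fourier f j - y j) + (fourier g j - y j))"
      unfolding fourier_const_mult fourier_add_Lp[OF Lp p] by (simp add: field_simps)
    then have "norm (fourier (const (1/2) * (f + g)) j - y j)
        \<le> 1/2 * (norm (fourier f j - y j) + norm (fourier g j - y j))"
      using norm_triangle_ineq[of "fourier f j - y j" "fourier g j - y j"] by (simp only: norm_mult) simp
    moreover have "norm (fourier f j - y j) \<le> 1 / (real n + 1)"
      "norm (fourier g j - y j) \<le> 1 / (real n + 1)"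
      using f g that by (auto simp: coefficient_neighbourhood_def)
    ultimately show ?thesis by argo
  qed
  ultimately show ?thesis using Lp p
    by (simp add: coefficient_neighbourhood_def Lp_class_const_mult Lp_class_add)
qed

theorem bounded_imp_weak_limit:
  assumes p: "1 < p" and Y: "\<And>n::nat. Y n \<in> Lp_class p" "\<And>n. cnorm p (Y n) \<le> M"
    and lim: "\<And>j. (\<lambda>n. fourier (Y n) j) \<longlonglongrightarrow> y j"
  obtains Z where "Z \<in> Lp_class p" "cnorm p Z \<le> M" "fourier Z = y"
proof -
  define K where "K = coefficient_neighbourhood p M y"
  note K_eq = coefficient_neighbourhood_def[of p M y, folded K_def]
  have nonempty: "K n \<noteq> {}" for n
  proof -
    have "eventually (\<lambda>k. \<forall>j\<in>{- int n..int n}. dist (fourier (Y k) j) (y j)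
        < 1 / (real n + 1)) sequentially"
      using lim by (intro eventually_ball_finite ballI tendstoD) auto
    then obtain k where "\<forall>j\<in>{- int n..int n}. dist (fourier (Y k) j) (y j) < 1 / (real n + 1)"
      using eventually_happens'[OF sequentially_bot] by blast
    then have "Y k \<in> K n" using Y by (auto simp: K_eq dist_norm abs_le_iff intro: less_imp_le)
    then show ?thesis by blast
  qed
  have nested: "\<And>m n. m \<le> n \<Longrightarrow> K n \<subseteq> K m" unfolding K_def by (rule coefficient_neighbourhood_antimono)
  have midpoint: "\<And>f g n. f \<in> K n \<Longrightarrow> g \<in> K n \<Longrightarrow> const (1/2) * (f + g) \<in> K n"
    unfolding K_def using p by (rule coefficient_neighbourhood_midpoint[rotated 2])
  have K: "K n \<subseteq> Lp_class p" "f \<in> K n \<Longrightarrow> cnorm p f \<le> M" for n f by (auto simp: K_eq)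
  obtain F Z where F: "\<And>n. F n \<in> K n" and Z: "Z \<in> Lp_class p" "Lp_conv p F Z"
    by (rule nested_convex_sets_limit[of p K M, OF p nonempty K(1) nested K(2) midpoint]) blast+
  have F_Lp: "F n \<in> Lp_class p" and F_bound: "cnorm p (F n) \<le> M" for n using F by (auto simp: K_eq)
  have "fourier Z j = y j" for j
  proof (rule LIMSEQ_unique[OF fourier_tendsto[OF p F_Lp Z] LIM_zero_cancel])
    have "eventually (\<lambda>n. norm (fourier (F n) j - y j) \<le> 1 / (real n + 1)) sequentially"
      using F by (auto simp: eventually_sequentially K_eq intro!: exI[of _ "nat \<bar>j\<bar>"])
    then show "(\<lambda>n. fourier (F n) j - y j) \<longlonglongrightarrow> 0" using LIMSEQ_1_over_Suc by (rule Lim_null_comparison)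
  qed
  moreover have "cnorm p Z \<le> M"
    by (rule LIMSEQ_le_const2[OF cnorm_tendsto[OF p F_Lp Z]]) (use F_bound in blast)
  ultimately show thesis using that Z(1) by blast
qed

corollary bounded_fejer_polys_imp_limit:
  assumes "1 < p" "\<And>N. 1 \<le> N \<Longrightarrow> cnorm p (fejer_poly N y) \<le> M"
  obtains Z where "Z \<in> Lp_class p" "cnorm p Z \<le> M" "fourier Z = y"
proof (rule bounded_imp_weak_limit[of p "\<lambda>n. fejer_poly (Suc n) y" M y])
  show "(\<lambda>n. fourier (fejer_poly (Suc n) y) j) \<longlonglongrightarrow> y j" for j
    using tendsto_mult[OF tendsto_of_real[OF LIMSEQ_Suc[OF fejer_weight_tendsto[of j]]]
      tendsto_const[of "y j"]]
    by (simp add: fourier_fejer_poly)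
qed (use assms that in auto)

section \<open>The theorem of M. Riesz\<close>

lemma cos_powr_inequality:
  fixes \<theta> :: real
  assumes p: "1 < p" "p \<le> 2" and t: "pi / 2 < p * t" "t < pi / 2" and \<theta>: "\<bar>\<theta>\<bar> \<le> pi / 2"
    and B: "B * cos (p * t) = - 1" "0 \<le> B" and A: "A * cos t powr p = 1 + B" "0 \<le> A"
  shows "1 \<le> A * cos \<theta> powr p - B * cos (p * \<theta>)"
proof -
  have "0 < p * t" using t(1) pi_gt_zero by linarith
  then have t_pos: "0 < t" using p by (simp add: zero_less_mult_iff)
  define \<phi> where "\<phi> = \<bar>\<theta>\<bar>"
  have \<phi>: "0 \<le> \<phi>" "\<phi> \<le> pi / 2" "cos \<phi> = cos \<theta>" "cos (p * \<phi>) = cos (p * \<theta>)"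
    using \<theta> by (auto simp: \<phi>_def abs_if)
  have "1 \<le> A * cos \<phi> powr p - B * cos (p * \<phi>)"
  proof (cases "\<phi> \<le> t")
    case True
    have "cos t \<le> cos \<phi>" using True \<phi> t by (intro cos_monotone_0_pi_le) auto
    moreover have "0 < cos t" using t_pos t(2) by (intro cos_gt_zero) auto
    ultimately have "A * cos t powr p \<le> A * cos \<phi> powr p"
      using A p by (intro mult_left_mono powr_mono2) auto
    moreover have "B * cos (p * \<phi>) \<le> B * 1" using B by (intro mult_left_mono) auto
    ultimately show ?thesis using A by linarith
  next
    case False
    have "p * \<phi> \<le> 2 * (pi / 2)" using p \<phi> by (intro mult_mono) auto
    then have "cos (p * \<phi>) \<le> cos (p * t)"
      using False p t_pos by (intro cos_monotone_0_pi_le) (auto intro: mult_left_mono)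
    then have "B * cos (p * \<phi>) \<le> B * cos (p * t)" using B by (intro mult_left_mono) auto
    moreover have "0 \<le> A * cos \<phi> powr p" using A by simp
    ultimately show ?thesis using B by linarith
  qed
  then show ?thesis by (simp add: \<phi>)
qed

lemma cos_powr_inequality_constants:
  assumes p: "1 < p" "p \<le> 2"
  obtains A B where "0 \<le> A" "0 \<le> B" "\<And>\<theta>. \<bar>\<theta>\<bar> \<le> pi / 2 \<Longrightarrow> 1 \<le> A * cos \<theta> powr p - B * cos (p * \<theta>)"
proof -
  define t where "t = (pi / (2 * p) + pi / 2) / 2"
  have "pi / (2 * p) < pi / 2" using p pi_gt_zero by (simp add: field_simps)
  then have "pi / (2 * p) < t" and t_less: "t < pi / 2" by (auto simp: t_def)
  then have pt: "pi / 2 < p * t" using p by (simp add: field_simps)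
  then have "0 < p * t" using pi_gt_zero by linarith
  then have t_pos: "0 < t" using p by (simp add: zero_less_mult_iff)
  have "p * t \<le> 2 * (pi / 2)" using p t_less t_pos by (intro mult_mono) auto
  then have cos_pt: "cos (p * t) < 0" using pt cos_monotone_0_pi[of "pi/2" "p * t"] by simp
  have cos_t: "0 < cos t" using t_pos t_less by (intro cos_gt_zero) auto
  define B where "B = - 1 / cos (p * t)"
  define A where "A = (1 + B) / cos t powr p"
  have B: "B * cos (p * t) = - 1" "0 \<le> B" using cos_pt by (auto simp: B_def divide_nonneg_neg)
  then have A: "A * cos t powr p = 1 + B" "0 \<le> A" using cos_t by (auto simp: A_def)
  show thesis using that[OF A(2) B(2)] cos_powr_inequality[OF p pt t_less _ B A] by blast
qed

lemma half_plane_powr_inequality: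
  assumes cos_powr: "\<And>\<theta>. \<bar>\<theta>\<bar> \<le> pi / 2 \<Longrightarrow> 1 \<le> A * cos \<theta> powr p - B * cos (p * \<theta>)" and w: "0 < Re w"
  shows "norm w powr p \<le> A * Re w powr p - B * Re (exp (of_real p * Ln w))"
proof -
  define \<theta> where "\<theta> = Im (Ln w)"
  have w0: "w \<noteq> 0" using w by auto
  have \<theta>: "\<bar>\<theta>\<bar> < pi / 2" using Re_Ln_pos_lt_imp[OF w] by (simp add: \<theta>_def)
  then have "0 < cos \<theta>" by (intro cos_gt_zero_pi) auto
  moreover have "Re w = norm w * cos \<theta>" using Re_exp[of "Ln w"] w0 by (simp add: \<theta>_def)
  moreover have "Re (exp (of_real p * Ln w)) = norm w powr p * cos (p * \<theta>)"
    using w0 by (simp add: Re_exp \<theta>_def powr_def)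
  moreover have "norm w powr p * 1 \<le> norm w powr p * (A * cos \<theta> powr p - B * cos (p * \<theta>))"
    using cos_powr[of \<theta>] \<theta> by (intro mult_left_mono) auto
  ultimately show ?thesis by (simp add: powr_mult algebra_simps)
qed

lemma continuous_on_circle_Lp:
  assumes "continuous_on (sphere 0 1) G" "0 \<le> p"
  shows "circ_measurable G" "circ_class G \<in> Lp_class p"
proof -
  show G: "circ_measurable G" using assms(1) by (rule circ_measurable_continuous)
  have "bounded (G ` sphere 0 1)" using assms(1)
    by (intro compact_imp_bounded compact_continuous_image) auto
  then obtain C where "\<And>z. z \<in> sphere 0 1 \<Longrightarrow> norm (G z) \<le> C" unfolding bounded_iff by blast
  then have "AE \<theta> in TM. norm (G (cis \<theta>)) \<le> C" by simp
  then show "circ_class G \<in> Lp_class p"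
    using Lspace_bounded[OF finite_measure_TM circ_measurableD[OF G]] G assms(2)
    by (simp add: circ_class_simps)
qed

lemma mean_value_circle:
  assumes G: "G holomorphic_on cball 0 1" shows "mean (circ_class G) = G 0"
proof -
  have cont: "continuous_on (sphere 0 1) G"
    using holomorphic_on_imp_continuous_on[OF G] by (rule continuous_on_subset) auto
  note L1 = continuous_on_circle_Lp[OF cont, of 1]
  then have integrable: "integrable TM (\<lambda>\<theta>. G (cis \<theta>))" by (simp add: circ_class_in_L1_iff)
  have "((\<lambda>u. G u / (u - 0)) has_contour_integral (2 * of_real pi * \<i> * G 0))
      (part_circlepath 0 1 0 (2 * pi))"
    using Cauchy_integral_circlepath_simple[OF G, of 0] by (simp add: circlepath_def)
  then have "((\<lambda>t. G (cis t) * \<i>) has_integral (2 * of_real pi * \<i> * G 0)) {0..2*pi}"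
    by (subst (asm) has_contour_integral_part_circlepath_iff) auto
  then have "((\<lambda>t. G (cis t) * \<i> * - \<i>) has_integral (2 * of_real pi * \<i> * G 0 * - \<i>)) {0..2*pi}"
    by (rule has_integral_mult_left)
  moreover have "2 * of_real pi * \<i> * G 0 * - \<i> = 2 * of_real pi * G 0" by (simp add: complex_eq_iff)
  ultimately have "integral {0..2*pi} (\<lambda>t. G (cis t)) = 2 * of_real pi * G 0"
    by (intro integral_unique) (simp only:, simp add: mult.assoc)
  then show ?thesis
    using L1 lebesgue_integral_eq_integral[OF integrable] by (simp add: circ_class_simps)
qed

lemma Re_ge_on_disc:
  assumes F: "F holomorphic_on UNIV" and circle: "\<And>z. norm z = 1 \<Longrightarrow> \<epsilon> \<le> Re (F z)" and z: "norm z \<le> 1"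
  shows "\<epsilon> \<le> Re (F z)"
proof -
  have "Re (- F z) \<le> - \<epsilon>"
  proof (rule maximum_real_frontier[of "\<lambda>z. - F z" "cball 0 1" "- \<epsilon>" z])
    show "(\<lambda>z. - F z) holomorphic_on interior (cball 0 1)"
      using F by (auto intro!: holomorphic_intros intro: holomorphic_on_subset)
    show "continuous_on (closure (cball 0 1)) (\<lambda>z. - F z)"
      using holomorphic_on_imp_continuous_on[OF F]
      by (auto intro!: continuous_intros intro: continuous_on_subset)
  qed (use circle z in \<open>auto simp: frontier_cball\<close>)
  then show ?thesis by simp
qed

text \<open>Calderon's argument: \<open>Re (F ^ p)\<close> has nonnegative mean, and in the right half plane the power
  \<open>\<bar>F\<bar> ^ p\<close> is dominated by \<open>(Re F) ^ p\<close> and \<open>- Re (F ^ p)\<close>.\<close>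

lemma cnorm_le_cnorm_Re_strict:
  assumes AB: "0 \<le> A" "0 \<le> B" and cos_powr: "\<And>\<theta>. \<bar>\<theta>\<bar> \<le> pi / 2 \<Longrightarrow> 1 \<le> A * cos \<theta> powr p - B * cos (p * \<theta>)"
    and p: "1 < p" and F: "F holomorphic_on UNIV" and \<epsilon>: "0 < \<epsilon>"
    and Re: "\<And>z. norm z = 1 \<Longrightarrow> \<epsilon> \<le> Re (F z)" and F0: "Im (F 0) = 0"
  shows "cnorm p (circ_class F) \<le> A powr (1 / p) * cnorm p (circ_class (\<lambda>z. complex_of_real (Re (F z))))"
proof -
  have pos: "0 < Re (F z)" if "norm z \<le> 1" for z using Re_ge_on_disc[OF F Re that] \<epsilon> by linarith
  define G where "G z = exp (of_real p * Ln (F z))" for z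
  have "F z \<notin> \<real>\<^sub>\<le>\<^sub>0" if "norm z \<le> 1" for z using pos[OF that] by (auto simp: complex_nonpos_Reals_iff)
  then have G: "G holomorphic_on cball 0 1"
    unfolding G_def[abs_def] by (auto intro!: holomorphic_intros holomorphic_on_subset[OF F])
  have cont: "continuous_on (sphere 0 1) F" "continuous_on (sphere 0 1) G"
    using holomorphic_on_imp_continuous_on[OF F] holomorphic_on_imp_continuous_on[OF G]
    by (auto elim: continuous_on_subset)
  then have cont_Re: "continuous_on (sphere 0 1) (\<lambda>z. complex_of_real (Re (F z)))"
    by (intro continuous_intros)
  have "0 \<le> p" using p by simp
  note F_Lp = continuous_on_circle_Lp[OF cont(1) this]
    and Re_Lp = continuous_on_circle_Lp[OF cont_Re this]
  have G_L1: "circ_measurable G" "integrable TM (\<lambda>\<theta>. G (cis \<theta>))"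
    using continuous_on_circle_Lp[OF cont(2), of 1] by (simp_all add: circ_class_in_L1_iff)
  have F_int: "integrable TM (\<lambda>\<theta>. norm (F (cis \<theta>)) powr p)" "integrable TM (\<lambda>\<theta>. Re (F (cis \<theta>)) powr p)"
    using F_Lp Re_Lp Lspace_integrable[of "\<lambda>\<theta>. F (cis \<theta>)"]
      Lspace_integrable[of "\<lambda>\<theta>. complex_of_real (Re (F (cis \<theta>)))" TM p] less_imp_le[OF pos]
    by (simp_all add: circ_class_simps)
  have "F 0 = of_real (Re (F 0))" "0 < Re (F 0)" using F0 pos[of 0] by (simp_all add: complex_eq_iff)
  then have "G 0 = of_real (exp (p * ln (Re (F 0))))"
    unfolding G_def by (metis Ln_of_real exp_of_real of_real_mult)
  then have "0 \<le> Re (mean (circ_class G))" by (simp add: mean_value_circle[OF G])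
  then have G_mean: "0 \<le> (LINT \<theta>|TM. Re (G (cis \<theta>)))"
    using G_L1 pi_gt_zero by (simp add: circ_class_simps zero_le_divide_iff)
  have "(LINT \<theta>|TM. norm (F (cis \<theta>)) powr p)
      \<le> (LINT \<theta>|TM. A * Re (F (cis \<theta>)) powr p - B * Re (G (cis \<theta>)))"
    using half_plane_powr_inequality[OF cos_powr pos] F_int G_L1(2)
    by (intro integral_mono) (auto simp: G_def)
  also have "\<dots> \<le> A * (LINT \<theta>|TM. Re (F (cis \<theta>)) powr p)"
    using F_int(2) G_L1(2) AB(2) G_mean by simp
  also have "\<dots> = (A powr (1 / p) * cnorm p (circ_class (\<lambda>z. complex_of_real (Re (F z))))) powr p"
    using Re_Lp p AB(1) less_imp_le[OF pos] by (simp add: circ_class_simps Lnorm_powr powr_mult powr_powr)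
  finally show ?thesis using F_Lp p by (simp add: circ_class_simps Lnorm_le_iff)
qed

lemma cnorm_le_cnorm_Re_perturbed:
  assumes AB: "0 \<le> A" "0 \<le> B" and cos_powr: "\<And>\<theta>. \<bar>\<theta>\<bar> \<le> pi / 2 \<Longrightarrow> 1 \<le> A * cos \<theta> powr p - B * cos (p * \<theta>)"
    and p: "1 < p" and F: "F holomorphic_on UNIV" "\<And>z. norm z = 1 \<Longrightarrow> 0 \<le> Re (F z)" "Im (F 0) = 0"
    and \<epsilon>: "0 < \<epsilon>"
  shows "cnorm p (circ_class F) \<le> A powr (1 / p) * cnorm p (circ_class (\<lambda>z. complex_of_real (Re (F z))))
    + \<epsilon> * ((A powr (1 / p) + 1) * cnorm p 1)"
proof -
  define C where "C = A powr (1 / p)"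
  define R where "R z = complex_of_real (Re (F z))" for z
  have cont: "continuous_on (sphere 0 1) F" "continuous_on (sphere 0 1) R"
    using holomorphic_on_imp_continuous_on[OF F(1)] unfolding R_def[abs_def]
    by (auto intro!: continuous_intros elim: continuous_on_subset)
  have "0 \<le> p" using p by simp
  note F_Lp = continuous_on_circle_Lp[OF cont(1) this]
    and R_Lp = continuous_on_circle_Lp[OF cont(2) this]
  have "cnorm p (circ_class F)
      \<le> cnorm p (circ_class F + const (of_real \<epsilon>)) + cnorm p (const (of_real \<epsilon>))"
    using cnorm_triangle_diff[of "circ_class F + const (of_real \<epsilon>)" p "const (of_real \<epsilon>)"] F_Lp p
    by (simp add: Lp_class_add)
  also have "circ_class F + const (of_real \<epsilon>) = circ_class (\<lambda>z. F z + of_real \<epsilon>)"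
    using F_Lp(1) by (simp add: circ_class_simps)
  also have "cnorm p (circ_class (\<lambda>z. F z + of_real \<epsilon>))
      \<le> C * cnorm p (circ_class (\<lambda>z. complex_of_real (Re (F z + of_real \<epsilon>))))"
    unfolding C_def
    by (rule cnorm_le_cnorm_Re_strict[OF AB cos_powr p _ \<epsilon>]) (use F in \<open>auto intro!: holomorphic_intros\<close>)
  also have "circ_class (\<lambda>z. complex_of_real (Re (F z + of_real \<epsilon>))) = circ_class R + const (of_real \<epsilon>)"
    using R_Lp(1) by (simp add: circ_class_simps R_def)
  also have "C * cnorm p (circ_class R + const (of_real \<epsilon>))
      \<le> C * (cnorm p (circ_class R) + cnorm p (const (of_real \<epsilon>)))"
    using R_Lp(2) p by (intro mult_left_mono cnorm_triangle) (auto simp: C_def)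
  also have "C * (cnorm p (circ_class R) + cnorm p (const (of_real \<epsilon>))) + cnorm p (const (of_real \<epsilon>))
      = C * cnorm p (circ_class R) + \<epsilon> * ((C + 1) * cnorm p 1)"
    using \<epsilon> p by (simp add: cnorm_const algebra_simps)
  finally show ?thesis by (simp add: R_def[abs_def] C_def)
qed

lemma cnorm_le_cnorm_Re:
  assumes p: "1 < p" "p \<le> 2"
  obtains C where "0 \<le> C" "\<And>F. F holomorphic_on UNIV \<Longrightarrow> (\<And>z. norm z = 1 \<Longrightarrow> 0 \<le> Re (F z)) \<Longrightarrow>
    Im (F 0) = 0 \<Longrightarrow> cnorm p (circ_class F) \<le> C * cnorm p (circ_class (\<lambda>z. complex_of_real (Re (F z))))"
proof -
  obtain A B where AB: "0 \<le> A" "0 \<le> B" "\<And>\<theta>. \<bar>\<theta>\<bar> \<le> pi / 2 \<Longrightarrow> 1 \<le> A * cos \<theta> powr p - B * cos (p * \<theta>)"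
    using cos_powr_inequality_constants[OF p] by blast
  define C where "C = A powr (1 / p)"
  have "cnorm p (circ_class F) \<le> C * cnorm p (circ_class (\<lambda>z. complex_of_real (Re (F z))))"
    if F: "F holomorphic_on UNIV" "\<And>z. norm z = 1 \<Longrightarrow> 0 \<le> Re (F z)" "Im (F 0) = 0" for F
  proof (rule field_le_epsilon)
    fix e :: real assume e: "0 < e"
    define \<epsilon> where "\<epsilon> = e / ((C + 1) * (cnorm p 1 + 1))"
    have C: "0 \<le> C" by (simp add: C_def)
    then have denom: "0 < (C + 1) * (cnorm p 1 + 1)" by (intro mult_pos_pos add_nonneg_pos) auto
    then have \<epsilon>: "0 < \<epsilon>" using e by (simp add: \<epsilon>_def)
    have "cnorm p (circ_class F) \<le> C * cnorm p (circ_class (\<lambda>z. complex_of_real (Re (F z))))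
        + \<epsilon> * ((C + 1) * cnorm p 1)"
      unfolding C_def using AB p(1) F \<epsilon> by (rule cnorm_le_cnorm_Re_perturbed)
    also have "\<epsilon> * ((C + 1) * cnorm p 1) \<le> \<epsilon> * ((C + 1) * (cnorm p 1 + 1))"
      using \<epsilon> C by (intro mult_left_mono) auto
    also have "\<dots> = e" unfolding \<epsilon>_def using denom by (intro nonzero_eq_divide_eq[THEN iffD1]) auto
    finally show "cnorm p (circ_class F) \<le> C * cnorm p (circ_class (\<lambda>z. complex_of_real (Re (F z)))) + e"
      by simp
  qed
  then show thesis using that[of C] by (simp add: C_def)
qed

definition nonneg_part :: "(int \<Rightarrow> complex) \<Rightarrow> int \<Rightarrow> complex" where
  "nonneg_part y j = (if 0 \<le> j then y j else 0)"

abbreviation riesz_mean :: "nat \<Rightarrow> circle_fun \<Rightarrow> circle_fun" where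
  "riesz_mean N f \<equiv> fejer_poly N (nonneg_part (fourier f))"

lemma fejer_sum_nonneg_part_holomorphic: "fejer_sum N (nonneg_part y) holomorphic_on S"
proof -
  have "(\<lambda>z. of_real (fejer_weight N m) * nonneg_part y m * z powi m) holomorphic_on S" for m
    by (cases "0 \<le> m") (auto simp: nonneg_part_def power_int_def intro!: holomorphic_intros)
  then show ?thesis unfolding fejer_sum_def[abs_def] by (intro holomorphic_on_sum)
qed

lemma fejer_sum_at_0: "fejer_sum N y 0 = y 0"
proof -
  have "fejer_sum N y 0 = (\<Sum>m=- int N..int N. if m = 0 then y 0 else 0)"
    unfolding fejer_sum_def by (intro sum.cong) (auto simp: power_int_0_left_if)
  then show ?thesis by simp
qed

lemma cnj_fejer_sum:
  assumes "norm z = 1" shows "cnj (fejer_sum N y z) = fejer_sum N (\<lambda>m. cnj (y (- m))) z"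
proof -
  have "cnj z = inverse z"
    using assms complex_norm_square[of z] by (intro inverse_unique[symmetric]) simp
  then have "cnj (fejer_sum N y z)
      = (\<Sum>m=- int N..int N. of_real (fejer_weight N (- m)) * cnj (y m) * z powi (- m))"
    unfolding fejer_sum_def by (simp add: power_int_inverse power_int_minus)
  also have "\<dots> = fejer_sum N (\<lambda>m. cnj (y (- m))) z"
    unfolding fejer_sum_def by (rule sum.reindex_bij_witness[of _ uminus uminus]) auto
  finally show ?thesis .
qed

lemma Re_fejer_sum_nonneg_part:
  assumes sym: "\<And>m. y (- m) = cnj (y m)" and z: "norm z = 1"
  shows "of_real (2 * Re (fejer_sum N (nonneg_part y) z)) = fejer_sum N y z + y 0"
proof -
  have "of_real (2 * Re (fejer_sum N (nonneg_part y) z))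
      = fejer_sum N (nonneg_part y) z + fejer_sum N (\<lambda>m. cnj (nonneg_part y (- m))) z"
    by (simp add: cnj_fejer_sum[OF z, symmetric] complex_add_cnj)
  also have "\<dots> = (\<Sum>m=- int N..int N. of_real (fejer_weight N m) * y m * z powi m
      + (if m = 0 then y 0 else 0))"
    unfolding fejer_sum_def sum.distrib[symmetric]
    using sym[of 0] by (intro sum.cong) (auto simp: nonneg_part_def sym[of "_ :: int"])
  also have "\<dots> = fejer_sum N y z + y 0" by (simp add: fejer_sum_def sum.distrib)
  finally show ?thesis .
qed

lemma riesz_mean_holomorphic:
  assumes h: "circ_measurable (\<lambda>z. complex_of_real (h z))" "\<And>z. 0 \<le> h z"
    and f_def: "f = circ_class (\<lambda>z. complex_of_real (h z))" and f: "f \<in> Lp_class p" and p: "1 < p"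
      and N: "1 \<le> N"
  obtains F where "F holomorphic_on UNIV" "\<And>z. norm z = 1 \<Longrightarrow> 0 \<le> Re (F z)" "Im (F 0) = 0"
    "circ_class (\<lambda>z. complex_of_real (Re (F z))) = fejer_mean N f"
    "circ_class F = const 2 * riesz_mean N f - const (fourier f 0)"
proof -
  define y where "y = fourier f"
  have "bar f = f" using h(1) by (simp add: f_def circ_class_simps)
  then have sym: "y (- m) = cnj (y m)" for m using fourier_bar[of f "- m"] by (simp add: y_def)
  have "integrable TM (\<lambda>\<theta>. h (cis \<theta>))"
    using Lp_class_imp_L1[OF f p] h(1)
    by (simp add: f_def circ_class_in_L1_iff complex_of_real_integrable_eq)
  note real_sum = fejer_sum_real(2)[OF this _ N]
  have y_fc: "fc (\<lambda>z. complex_of_real (h z)) = y"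
    using h(1) by (simp add: fc_fourier f_def y_def fun_eq_iff)
  have y_nonneg: "0 \<le> Re (fejer_sum N y z)" if "norm z = 1" for z
    using real_sum[OF that] h(2) unfolding y_fc by (auto intro!: divide_nonneg_pos integral_nonneg_AE)
  define F where "F z = 2 * fejer_sum N (nonneg_part y) z - y 0" for z
  have y0: "complex_of_real (Re (y 0)) = y 0" using sym[of 0] by (simp add: complex_eq_iff)
  have Re_F: "complex_of_real (Re (F z)) = fejer_sum N y z" if "norm z = 1" for z
    using Re_fejer_sum_nonneg_part[of y z N, OF sym that] y0 by (simp add: F_def)
  show thesis
  proof (rule that)
    show F_hol: "F holomorphic_on UNIV"
      unfolding F_def[abs_def] by (intro holomorphic_intros fejer_sum_nonneg_part_holomorphic)
    show "0 \<le> Re (F z)" if "norm z = 1" for z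
      using y_nonneg[OF that] Re_F[OF that] by (metis Re_complex_of_real)
    show "Im (F 0) = 0" using arg_cong[OF y0, of Im] by (simp add: F_def fejer_sum_at_0 nonneg_part_def)
    show "circ_class (\<lambda>z. complex_of_real (Re (F z))) = fejer_mean N f"
      unfolding fejer_poly_def y_def[symmetric]
      using holomorphic_on_imp_continuous_on[OF F_hol] Re_F
      by (intro circ_class_eqI circ_measurable_continuous circ_measurable_fejer_sum)
        (auto intro!: continuous_intros elim: continuous_on_subset)
    show "circ_class F = const 2 * riesz_mean N f - const (fourier f 0)"
      by (simp add: F_def[abs_def] fejer_poly_def y_def circ_class_simps)
  qed
qed

lemma riesz_mean_bound_nonneg:
  assumes p: "1 < p" "p \<le> 2"
  obtains C where "0 \<le> C" "\<And>h N. circ_measurable (\<lambda>z. complex_of_real (h z)) \<Longrightarrow> (\<And>z. 0 \<le> h z) \<Longrightarrow>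
    circ_class (\<lambda>z. complex_of_real (h z)) \<in> Lp_class p \<Longrightarrow> 1 \<le> N \<Longrightarrow>
    cnorm p (riesz_mean N (circ_class (\<lambda>z. complex_of_real (h z)))) \<le> C * cnorm p
      (circ_class (\<lambda>z. complex_of_real (h z)))"
proof -
  obtain A where A: "0 \<le> A" and half_plane: "\<And>F. F holomorphic_on UNIV \<Longrightarrow>
    (\<And>z. norm z = 1 \<Longrightarrow> 0 \<le> Re (F z)) \<Longrightarrow> Im (F 0) = 0 \<Longrightarrow>
    cnorm p (circ_class F) \<le> A * cnorm p (circ_class (\<lambda>z. complex_of_real (Re (F z))))"
    using cnorm_le_cnorm_Re[OF p] by blast
  define K where "K = cnorm (conj_exp p) 1 * cnorm p 1"
  have "cnorm p (riesz_mean N f) \<le> (A + K) * cnorm p f"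
    if h: "circ_measurable (\<lambda>z. complex_of_real (h z))" "\<And>z. 0 \<le> h z"
      and f_def: "f = circ_class (\<lambda>z. complex_of_real (h z))"
      and f: "f \<in> Lp_class p" and N: "1 \<le> N" for h f N
  proof -
    obtain F where F: "F holomorphic_on UNIV" "\<And>z. norm z = 1 \<Longrightarrow> 0 \<le> Re (F z)" "Im (F 0) = 0"
      and Re_F: "circ_class (\<lambda>z. complex_of_real (Re (F z))) = fejer_mean N f"
      and F_class: "circ_class F = const 2 * riesz_mean N f - const (fourier f 0)"
      using riesz_mean_holomorphic[OF h f_def f p(1) N] by blast
    have F_bound: "cnorm p (circ_class F) \<le> A * cnorm p f"
      using half_plane[OF F] mult_left_mono[OF cnorm_fejer_mean_le[OF f p(1) N] A] by (simp add: Re_F)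
    have "norm (fourier f 0) * cnorm p 1 \<le> K * cnorm p f"
      using mult_right_mono[OF norm_fourier_le[OF f p(1)], of "cnorm p 1" 0] by (simp add: K_def mult_ac)
    then have const_bound: "cnorm p (const (fourier f 0)) \<le> K * cnorm p f"
      using p by (simp add: cnorm_const)
    have "2 * cnorm p (riesz_mean N f) = cnorm p (circ_class F + const (fourier f 0))"
      using p by (simp add: F_class cnorm_const_mult)
    also have "\<dots> \<le> cnorm p (circ_class F) + cnorm p (const (fourier f 0))"
      unfolding F_class using p
      by (intro cnorm_triangle) (simp_all add: Lp_class_diff Lp_class_const_mult)
    finally show ?thesis using F_bound const_bound cnorm_nonneg[of p "riesz_mean N f"]
      unfolding distrib_right by linarith
  qed
  then show thesis using that[of "A + K"] A by (simp add: K_def)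
qed

lemma Lp_class_nonneg_decomposition:
  assumes f: "f \<in> Lp_class p" and p: "0 < p"
  obtains h :: "nat \<Rightarrow> complex \<Rightarrow> real" where "f
    = (\<Sum>k<4. const (\<i> ^ k) * circ_class (\<lambda>z. complex_of_real (h k z)))"
    "\<And>k z. 0 \<le> h k z" "\<And>k. circ_measurable (\<lambda>z. complex_of_real (h k z))"
    "\<And>k. circ_class (\<lambda>z. complex_of_real (h k z)) \<in> Lp_class p"
    "\<And>k. cnorm p (circ_class (\<lambda>z. complex_of_real (h k z))) \<le> cnorm p f"
proof (cases f)
  case (circ_class F)
  note [measurable] = circ_measurableD[OF circ_class(2)]
  define h where "h k z = max 0 (Re (F z / \<i> ^ k))" for k z
  have measurable: "circ_measurable (\<lambda>z. complex_of_real (h k z))" for k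
    unfolding circ_measurable_def h_def by measurable
  have bound: "AE \<theta> in TM. norm (complex_of_real (h k (cis \<theta>))) \<le> 1 * norm (F (cis \<theta>))" for k
  proof (rule AE_I2)
    show "norm (complex_of_real (h k (cis \<theta>))) \<le> 1 * norm (F (cis \<theta>))" for \<theta>
      using abs_Re_le_cmod[of "F (cis \<theta>) / \<i> ^ k"] by (auto simp: h_def norm_divide norm_power max_def)
  qed
  have F: "(\<lambda>\<theta>. F (cis \<theta>)) \<in> Lspace TM p" using f circ_class by (simp add: circ_class_simps)
  note domination = F circ_measurableD[OF measurable] bound
  show thesis
  proof (rule that)
    have "F z = (\<Sum>k<4. \<i> ^ k * complex_of_real (h k z))" for z
      by (simp add: eval_nat_numeral h_def complex_eq_iff max_def)
    then show "f = (\<Sum>k<4. const (\<i> ^ k) * circ_class (\<lambda>z. complex_of_real (h k z)))"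
      using circ_class measurable unfolding circ_class_const
      by (subst circ_class_mult circ_class_sum; simp)+ (intro circ_class_eqI; simp)
  next
    show "0 \<le> h k z" for k z by (simp add: h_def)
    show "circ_measurable (\<lambda>z. complex_of_real (h k z))" for k by (rule measurable)
    show "circ_class (\<lambda>z. complex_of_real (h k z)) \<in> Lp_class p" for k
      using Lspace_dominated[OF domination] p measurable by (simp add: circ_class_simps)
    show "cnorm p (circ_class (\<lambda>z. complex_of_real (h k z))) \<le> cnorm p f" for k
      using Lnorm_dominated[OF domination] p measurable circ_class by (simp add: circ_class_simps)
  qed
qed

lemma nonneg_part_add: "nonneg_part (\<lambda>j. y j + y' j) = (\<lambda>j. nonneg_part y j + nonneg_part y' j)"
  and nonneg_part_mult: "nonneg_part (\<lambda>j. c * y j) = (\<lambda>j. c * nonneg_part y j)"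
  and nonneg_part_0 [simp]: "nonneg_part (\<lambda>j. 0) = (\<lambda>j. 0)"
  by (simp_all add: nonneg_part_def fun_eq_iff)

lemma fejer_poly_0 [simp]: "fejer_poly N (\<lambda>j. 0) = 0"
  using fejer_poly_const_mult[of N 0 "\<lambda>j. 0"] by simp

lemma riesz_mean_sum:
  assumes "finite I" "\<And>k. k \<in> I \<Longrightarrow> f k \<in> Lp_class 1"
  shows "riesz_mean N (\<Sum>k\<in>I. const (c k) * f k) = (\<Sum>k\<in>I. const (c k) * riesz_mean N (f k))"
  using assms
proof (induction I rule: finite_induct)
  case empty
  have "fourier 0 = (\<lambda>j. 0)" by (simp add: fun_eq_iff)
  then show ?case by simp
next
  case (insert k I)
  have "(\<Sum>k\<in>I. const (c k) * f k) \<in> Lp_class 1"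
    using insert by (intro mean_sum(2)) (simp add: Lp_class_const_mult)
  then have "fourier (\<Sum>k\<in>insert k I. const (c k) * f k)
      = (\<lambda>j. c k * fourier (f k) j + fourier (\<Sum>k\<in>I. const (c k) * f k) j)"
    using insert by (simp add: fourier_add Lp_class_const_mult fun_eq_iff)
  then show ?case
    using insert by (simp add: nonneg_part_add nonneg_part_mult fejer_poly_add fejer_poly_const_mult)
qed

lemma cnorm_sum_le:
  assumes "1 < p" "\<And>k. k \<in> I \<Longrightarrow> f k \<in> Lp_class p"
  shows "cnorm p (\<Sum>k\<in>I. f k) \<le> (\<Sum>k\<in>I. cnorm p (f k))" "(\<Sum>k\<in>I. f k) \<in> Lp_class p"
proof -
  have "cnorm p (\<Sum>k\<in>I. f k) \<le> (\<Sum>k\<in>I. cnorm p (f k)) \<and> (\<Sum>k\<in>I. f k) \<in> Lp_class p"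
    using assms(2)
  proof (induction I rule: infinite_finite_induct)
    case (insert k I)
    then show ?case using cnorm_triangle[of "f k" p "sum f I"] assms(1) by (simp add: Lp_class_add)
  qed (use assms(1) in auto)
  then show "cnorm p (\<Sum>k\<in>I. f k) \<le> (\<Sum>k\<in>I. cnorm p (f k))" "(\<Sum>k\<in>I. f k) \<in> Lp_class p" by auto
qed

lemma riesz_mean_bound_le_2:
  assumes p: "1 < p" "p \<le> 2"
  obtains C where "0 \<le> C" "\<And>f N. f \<in> Lp_class p \<Longrightarrow> 1 \<le> N \<Longrightarrow> cnorm p (riesz_mean N f) \<le> C * cnorm p f"
proof -
  obtain C where C: "0 \<le> C" and bound: "\<And>h N. circ_measurable (\<lambda>z. complex_of_real (h z)) \<Longrightarrow>
      (\<And>z. 0 \<le> h z) \<Longrightarrow>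
    circ_class (\<lambda>z. complex_of_real (h z)) \<in> Lp_class p \<Longrightarrow> 1 \<le> N \<Longrightarrow>
    cnorm p (riesz_mean N (circ_class (\<lambda>z. complex_of_real (h z)))) \<le> C * cnorm p
      (circ_class (\<lambda>z. complex_of_real (h z)))"
    using riesz_mean_bound_nonneg[OF p] by metis
  have "cnorm p (riesz_mean N f) \<le> (4 * C) * cnorm p f" if f: "f \<in> Lp_class p" and N: "1 \<le> N" for f N
  proof -
    from Lp_class_nonneg_decomposition[OF f] p obtain h :: "nat \<Rightarrow> complex \<Rightarrow> real" where
      f_sum: "f = (\<Sum>k<4. const (\<i> ^ k) * circ_class (\<lambda>z. complex_of_real (h k z)))"
      and h: "\<And>k z. 0 \<le> h k z" "\<And>k. circ_measurable (\<lambda>z. complex_of_real (h k z))"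
        "\<And>k. circ_class (\<lambda>z. complex_of_real (h k z)) \<in> Lp_class p"
      and h_bound: "\<And>k. cnorm p (circ_class (\<lambda>z. complex_of_real (h k z))) \<le> cnorm p f"
      by auto
    define g where "g k = riesz_mean N (circ_class (\<lambda>z. complex_of_real (h k z)))" for k
    have g_bound: "cnorm p (g k) \<le> C * cnorm p f" for k
      unfolding g_def using bound[OF h(2,1,3) N, of k] mult_left_mono[OF h_bound C, of k] by linarith
    have "riesz_mean N f = (\<Sum>k<4. const (\<i> ^ k) * g k)"
      unfolding f_sum g_def using h(3) p by (intro riesz_mean_sum) (auto intro: Lp_class_imp_L1)
    also have "cnorm p \<dots> \<le> (\<Sum>k<4. cnorm p (const (\<i> ^ k) * g k))"
      using p by (intro cnorm_sum_le) (simp_all add: g_def Lp_class_const_mult)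
    also have "\<dots> = (\<Sum>k<4. cnorm p (g k))"
      using p by (intro sum.cong) (simp_all add: cnorm_const_mult norm_power)
    also have "\<dots> \<le> (\<Sum>k<(4::nat). C * cnorm p f)" by (intro sum_mono g_bound)
    finally show ?thesis by simp
  qed
  then show thesis using that[of "4 * C"] C by simp
qed

lemma riesz_mean_imp_limit:
  assumes "1 < p" "\<And>N. 1 \<le> N \<Longrightarrow> cnorm p (riesz_mean N f) \<le> C * cnorm p f"
  obtains g where "g \<in> Lp_class p" "cnorm p g \<le> C * cnorm p f" "fourier g = nonneg_part (fourier f)"
  using bounded_fejer_polys_imp_limit[OF assms] by blast

lemma riesz_mean_bound_dual:
  assumes p: "1 < p" and f: "f \<in> Lp_class p" and N: "1 \<le> N" and C: "0 \<le> C"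
    and dual_bound: "\<And>f N. f \<in> Lp_class (conj_exp p) \<Longrightarrow> 1 \<le> N \<Longrightarrow>
      cnorm (conj_exp p) (riesz_mean N f) \<le> C * cnorm (conj_exp p) f"
  shows "cnorm p (riesz_mean N f) \<le> (2 * pi * C) * cnorm p f"
proof -
  have q: "1 < conj_exp p" using p by (rule conj_exp_gt_1)
  have mean_Lp: "riesz_mean N f \<in> Lp_class p" using p by simp
  obtain \<psi> where \<psi>: "\<psi> \<in> Lp_class (conj_exp p)" "cnorm (conj_exp p) \<psi> \<le> 1"
    and attained: "mean (riesz_mean N f * \<psi>) = complex_of_real (cnorm p (riesz_mean N f) / (2 * pi))"
    using cnorm_dual_attained[OF mean_Lp p] by blast
  have tilde_\<psi>: "tilde \<psi> \<in> Lp_class (conj_exp p)" using \<psi>(1) by (rule Lp_class_tilde)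
  obtain g where g: "g \<in> Lp_class (conj_exp p)" "cnorm (conj_exp p) g \<le> C * cnorm (conj_exp p) (tilde \<psi>)"
    "fourier g = nonneg_part (fourier (tilde \<psi>))"
    using riesz_mean_imp_limit[OF q dual_bound[OF tilde_\<psi>]] by blast
  have "cnorm (conj_exp p) (tilde g) \<le> C" using g(2) mult_left_mono[OF \<psi>(2) C] by simp
  have "mean (riesz_mean N f * \<psi>) = mean (fejer_mean N f * tilde g)"
    using Lp_class_imp_L1[OF \<psi>(1) q] Lp_class_imp_L1[OF Lp_class_tilde[OF g(1)] q]
    by (simp add: mean_fejer_poly_mult g(3) nonneg_part_def if_distrib if_distribR cong: if_cong)
  then have "cnorm p (riesz_mean N f) / (2 * pi) = norm (mean (fejer_mean N f * tilde g))"
    using arg_cong[OF attained, of norm] by (simp add: norm_divide)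
  also have "\<dots> \<le> cnorm p (fejer_mean N f) * cnorm (conj_exp p) (tilde g)"
    using p g(1) by (intro class_Hoelder) (simp_all add: Lp_class_tilde)
  also have "\<dots> \<le> cnorm p f * C"
    using cnorm_fejer_mean_le[OF f p N] \<open>cnorm (conj_exp p) (tilde g) \<le> C\<close> by (intro mult_mono) auto
  finally show ?thesis by (simp add: field_simps)
qed

lemma riesz_mean_bound:
  assumes p: "1 < p"
  obtains C where "0 \<le> C" "\<And>f N. f \<in> Lp_class p \<Longrightarrow> 1 \<le> N \<Longrightarrow> cnorm p (riesz_mean N f) \<le> C * cnorm p f"
proof (cases "p \<le> 2")
  case True
  then show thesis using riesz_mean_bound_le_2[OF p] that by blast
next
  case False
  have q: "1 < conj_exp p" "conj_exp p \<le> 2" using p False by (auto simp: conj_exp_def field_simps)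
  obtain C where "0 \<le> C" "\<And>f N. f \<in> Lp_class (conj_exp p) \<Longrightarrow> 1 \<le> N \<Longrightarrow>
      cnorm (conj_exp p) (riesz_mean N f) \<le> C * cnorm (conj_exp p) f"
    using riesz_mean_bound_le_2[OF q] by blast
  then show thesis using that[of "2 * pi * C"] riesz_mean_bound_dual[OF p] by simp
qed

definition riesz :: "circle_fun \<Rightarrow> circle_fun" where
  "riesz f = (SOME g. g \<in> Lp_class 1 \<and> fourier g = nonneg_part (fourier f))"

lemma riesz_eqI: "g \<in> Lp_class 1 \<Longrightarrow> (\<And>j. fourier g j = (if 0 \<le> j then fourier f j else 0)) \<Longrightarrow> riesz f = g"
  unfolding riesz_def by (rule some_equality) (auto simp: nonneg_part_def fun_eq_iff intro: fourier_eqI)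

theorem Riesz_projection_bounded:
  assumes p: "1 < p"
  obtains C where "0 \<le> C" "\<And>f. f \<in> Lp_class p \<Longrightarrow> riesz f \<in> Lp_class p"
    "\<And>f. f \<in> Lp_class p \<Longrightarrow> cnorm p (riesz f) \<le> C * cnorm p f"
    "\<And>f. f \<in> Lp_class p \<Longrightarrow> fourier (riesz f) = nonneg_part (fourier f)"
proof -
  obtain C where C: "0 \<le> C" "\<And>f N. f \<in> Lp_class p \<Longrightarrow> 1 \<le> N \<Longrightarrow> cnorm p (riesz_mean N f) \<le> C * cnorm p f"
    using riesz_mean_bound[OF p] by blast
  have "riesz f \<in> Lp_class p \<and> cnorm p (riesz f) \<le> C * cnorm p f
      \<and> fourier (riesz f) = nonneg_part (fourier f)"
    if f: "f \<in> Lp_class p" for f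
  proof -
    obtain g where g: "g \<in> Lp_class p" "cnorm p g \<le> C * cnorm p f" "fourier g = nonneg_part (fourier f)"
      using riesz_mean_imp_limit[OF p C(2)[OF f]] by blast
    moreover have "riesz f = g"
      using Lp_class_imp_L1[OF g(1) p] g(3) by (intro riesz_eqI) (simp_all add: nonneg_part_def)
    ultimately show ?thesis by simp
  qed
  then show thesis using that C(1) by blast
qed

lemma riesz_Lp: "f \<in> Lp_class p \<Longrightarrow> 1 < p \<Longrightarrow> riesz f \<in> Lp_class p"
  by (rule Riesz_projection_bounded[of p]) auto

lemma fourier_riesz: "f \<in> Lp_class p \<Longrightarrow> 1 < p \<Longrightarrow> fourier (riesz f) j = (if 0 \<le> j then fourier f j else 0)"
  by (rule Riesz_projection_bounded[of p]) (auto simp: nonneg_part_def)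

lemma riesz_0 [simp]: "riesz 0 = 0"
  by (rule riesz_eqI) auto

lemma
  assumes f: "f \<in> Lp_class p" and g: "g \<in> Lp_class p" and p: "1 < p"
  shows riesz_add: "riesz (f + g) = riesz f + riesz g" and riesz_diff: "riesz (f - g) = riesz f - riesz g"
  by (rule riesz_eqI; simp add: fourier_add_Lp[OF _ _ p] fourier_diff_Lp[OF _ _ p] fourier_riesz[OF _ p]
    riesz_Lp[OF _ p]
      Lp_class_add Lp_class_diff Lp_class_imp_L1[OF _ p] f g)+

lemma riesz_const_mult:
  assumes f: "f \<in> Lp_class p" and p: "1 < p"
  shows "riesz (const c * f) = const c * riesz f"
  by (rule riesz_eqI) (simp_all add: fourier_riesz[OF f p] Lp_class_const_mult
    Lp_class_imp_L1[OF riesz_Lp[OF f p] p])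

section \<open>Hardy spaces\<close>

definition hardy :: "real \<Rightarrow> circle_fun set" where
  "hardy p = {f \<in> Lp_class p. \<forall>j<0. fourier f j = 0}"

definition cohardy :: "real \<Rightarrow> circle_fun set" where
  "cohardy p = {f \<in> Lp_class p. \<forall>j\<ge>0. fourier f j = 0}"

definition reflect :: "circle_fun \<Rightarrow> circle_fun" where
  "reflect f = tpow (- 1) * tilde f"

lemma hardy_Lp: "f \<in> hardy p \<Longrightarrow> f \<in> Lp_class p"
  and hardy_fourier_neg: "f \<in> hardy p \<Longrightarrow> j < 0 \<Longrightarrow> fourier f j = 0"
  by (simp_all add: hardy_def)

lemma cohardy_Lp: "f \<in> cohardy p \<Longrightarrow> f \<in> Lp_class p"
  and cohardy_fourier_nonneg: "f \<in> cohardy p \<Longrightarrow> 0 \<le> j \<Longrightarrow> fourier f j = 0"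
  by (simp_all add: cohardy_def)

lemma hardy_imp_L1: "f \<in> hardy p \<Longrightarrow> 1 < p \<Longrightarrow> f \<in> Lp_class 1"
  by (intro Lp_class_imp_L1[OF hardy_Lp])

lemma hardy_add: "f \<in> hardy p \<Longrightarrow> g \<in> hardy p \<Longrightarrow> 1 < p \<Longrightarrow> f + g \<in> hardy p"
  and hardy_diff: "f \<in> hardy p \<Longrightarrow> g \<in> hardy p \<Longrightarrow> 1 < p \<Longrightarrow> f - g \<in> hardy p"
  by (auto simp: hardy_def fourier_add_Lp fourier_diff_Lp Lp_class_add Lp_class_diff)

lemma hardy_const_mult: "f \<in> hardy p \<Longrightarrow> 1 < p \<Longrightarrow> const c * f \<in> hardy p"
  by (simp add: hardy_def Lp_class_const_mult)

lemma hardy_0 [simp]: "1 < p \<Longrightarrow> 0 \<in> hardy p"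
  by (simp add: hardy_def)

lemma hardy_sum: "1 < p \<Longrightarrow> (\<And>i. i \<in> I \<Longrightarrow> f i \<in> hardy p) \<Longrightarrow> sum f I \<in> hardy p"
  by (induction I rule: infinite_finite_induct) (auto intro: hardy_add)

lemma hardy_tpow [simp]: "1 < p \<Longrightarrow> 0 \<le> k \<Longrightarrow> tpow k \<in> hardy p"
  by (simp add: hardy_def fourier_tpow)

lemma hardy_1 [simp]: "1 < p \<Longrightarrow> 1 \<in> hardy p"
  using hardy_tpow[of p 0] by simp

lemma hardy_tpow_mult: "f \<in> hardy p \<Longrightarrow> 1 < p \<Longrightarrow> (\<And>j. 0 \<le> j \<Longrightarrow> j + k < 0 \<Longrightarrow> fourier f j = 0) \<Longrightarrow>
    tpow k * f \<in> hardy p"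
  unfolding hardy_def by (simp add: Lp_class_tpow_mult) (metis add.commute diff_add_cancel not_le)

lemma hardy_closed:
  assumes p: "1 < p" and F: "\<And>n. F n \<in> hardy p" and f: "f \<in> Lp_class p" and lim: "Lp_conv p F f"
  shows "f \<in> hardy p"
proof -
  have "fourier f j = 0" if "j < 0" for j
    by (rule LIMSEQ_unique[OF fourier_tendsto[OF p hardy_Lp[OF F] f lim]])
      (simp add: hardy_fourier_neg[OF F that])
  then show ?thesis using f by (simp add: hardy_def)
qed

lemma fourier_reflect [simp]: "fourier (reflect f) j = fourier f (- j - 1)"
  by (simp add: reflect_def)

lemma reflect_reflect [simp]: "reflect (reflect f) = f"
  by (simp add: reflect_def tpow_mult_assoc)

lemma reflect_add: "reflect (f + g) = reflect f + reflect g"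
  and reflect_diff: "reflect (f - g) = reflect f - reflect g"
  and reflect_mult: "reflect (f * g) = tilde f * reflect g"
  by (simp_all add: reflect_def algebra_simps)

lemma reflect_const_mult: "reflect (const c * f) = const c * reflect f"
  by (simp add: reflect_mult)

lemma reflect_0 [simp]: "reflect 0 = 0"
  by (simp add: reflect_def)

lemma reflect_Lp: "f \<in> Lp_class p \<Longrightarrow> 0 < p \<Longrightarrow> reflect f \<in> Lp_class p"
  by (simp add: reflect_def Lp_class_tpow_mult Lp_class_tilde)

lemma cnorm_reflect: "f \<in> Lp_class p \<Longrightarrow> 0 < p \<Longrightarrow> cnorm p (reflect f) = cnorm p f"
  by (simp add: reflect_def cnorm_tpow_mult Lp_class_tilde)

lemma reflect_hardy: "f \<in> hardy p \<Longrightarrow> 1 < p \<Longrightarrow> reflect f \<in> cohardy p"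
  and reflect_cohardy: "f \<in> cohardy p \<Longrightarrow> 1 < p \<Longrightarrow> reflect f \<in> hardy p"
  by (auto simp: hardy_def cohardy_def reflect_Lp)

lemma riesz_hardy: "f \<in> Lp_class p \<Longrightarrow> 1 < p \<Longrightarrow> riesz f \<in> hardy p"
  by (simp add: hardy_def riesz_Lp fourier_riesz)

lemma riesz_id: "f \<in> hardy p \<Longrightarrow> 1 < p \<Longrightarrow> riesz f = f"
  by (rule riesz_eqI) (auto simp: hardy_fourier_neg hardy_imp_L1)

lemma riesz_cohardy: "f \<in> cohardy p \<Longrightarrow> riesz f = 0"
  by (rule riesz_eqI) (auto simp: cohardy_fourier_nonneg)

lemma riesz_complement: "f \<in> Lp_class p \<Longrightarrow> 1 < p \<Longrightarrow> f - riesz f \<in> cohardy p"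
  by (simp add: cohardy_def Lp_class_diff riesz_Lp fourier_diff_Lp fourier_riesz)

lemma riesz_eq_0_iff: "f \<in> Lp_class p \<Longrightarrow> 1 < p \<Longrightarrow> riesz f = 0 \<longleftrightarrow> f \<in> cohardy p"
  using riesz_complement[of f p] riesz_cohardy[of f p] by auto

lemma analytic_polys_hardy: "f \<in> analytic_polys \<Longrightarrow> 1 < p \<Longrightarrow> f \<in> hardy p"
  by (induction rule: monom_span.induct) (auto intro!: hardy_add hardy_const_mult)

lemma riesz_trig_poly: "f \<in> trig_polys \<Longrightarrow> riesz f \<in> analytic_polys"
proof (induction rule: monom_span.induct)
  case (monom_span_step f k c)
  have "riesz (const c * tpow k) = (if 0 \<le> k then const c * tpow k else 0)"
    by (rule riesz_eqI) (auto simp: fourier_tpow Lp_class_const_mult)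
  moreover have "riesz (const c * tpow k + f) = riesz (const c * tpow k) + riesz f"
    using monom_span_step(1)
    by (intro riesz_add[of _ 2]) (auto simp: Lp_class_const_mult intro: monom_span_subset_Lp)
  ultimately show ?case using monom_span_step by (auto intro: monom_span.intros)
qed (simp add: monom_span_0)

lemma analytic_polys_dense:
  assumes f: "f \<in> hardy p" and p: "1 < p"
  obtains u where "\<And>n. u n \<in> analytic_polys" "Lp_conv p u f"
proof -
  obtain C where C: "0 \<le> C" "\<And>f. f \<in> Lp_class p \<Longrightarrow> cnorm p (riesz f) \<le> C * cnorm p f"
    by (rule Riesz_projection_bounded[OF p]) (rule that)
  have "\<exists>v\<in>trig_polys. cnorm p (f - v) < 1 / (real n + 1)" for n
    by (rule trig_polys_dense[OF hardy_Lp[OF f] p, of "1 / (real n + 1)"]) auto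
  then obtain v where v: "\<And>n. v n \<in> trig_polys" "\<And>n. cnorm p (f - v n) < 1 / (real n + 1)" by metis
  have v_Lp: "v n \<in> Lp_class p" for n using p by (intro monom_span_subset_Lp[OF v(1)]) simp
  have "cnorm p (riesz (v n) - f) \<le> C * (1 / (real n + 1))" for n
  proof -
    have "riesz (v n) - f = riesz (v n - f)"
      using riesz_diff[OF v_Lp hardy_Lp[OF f] p] f p by (simp add: riesz_id)
    then have "cnorm p (riesz (v n) - f) \<le> C * cnorm p (v n - f)"
      using C(2)[OF Lp_class_diff[OF v_Lp hardy_Lp[OF f]]] p by simp
    also have "\<dots> \<le> C * (1 / (real n + 1))"
      using v(2)[of n] p C(1) by (intro mult_left_mono)
        (simp_all add: cnorm_minus_commute[of p "v n" f] less_imp_le)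
    finally show ?thesis .
  qed
  then have "Lp_conv p (\<lambda>n. riesz (v n)) f"
    using tendsto_mult_right_zero[OF LIMSEQ_1_over_Suc] by (rule Lp_convI)
  then show thesis using that[of "\<lambda>n. riesz (v n)"] riesz_trig_poly[OF v(1)] by blast
qed

lemma mean_mult_tendsto:
  assumes p: "1 < p" and F: "\<And>n. F n \<in> Lp_class p" "f \<in> Lp_class p" and lim: "Lp_conv p F f"
    and g: "g \<in> Lp_class (conj_exp p)"
  shows "(\<lambda>n. mean (F n * g)) \<longlonglongrightarrow> mean (f * g)"
proof (rule LIM_zero_cancel, rule Lim_null_comparison[OF always_eventually])
  show "\<forall>n. norm (mean (F n * g) - mean (f * g)) \<le> cnorm p (F n - f) * cnorm (conj_exp p) g"
    using class_Hoelder(2)[OF Lp_class_diff[OF F] g p]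
      mean_diff[OF class_Hoelder(1)[OF F(1) g p] class_Hoelder(1)[OF F(2) g p]] p
    by (simp add: left_diff_distrib)
  show "(\<lambda>n. cnorm p (F n - f) * cnorm (conj_exp p) g) \<longlonglongrightarrow> 0"
    using lim unfolding Lp_conv_def by (rule tendsto_mult_left_zero)
qed

lemma analytic_poly_mult_hardy:
  assumes u: "u \<in> analytic_polys" and g: "g \<in> hardy q" and q: "1 < q"
  shows "j < 0 \<Longrightarrow> fourier (u * g) j = 0" "fourier (u * g) 0 = fourier u 0 * fourier g 0"
proof -
  have "(\<forall>j<0. fourier (u * g) j = 0) \<and> fourier (u * g) 0 = fourier u 0 * fourier g 0"
    using u
  proof (induction rule: monom_span.induct)
    case (monom_span_step u k c)
    have expand: "(const c * tpow k + u) * g = const c * (tpow k * g) + u * g"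
      by (simp add: algebra_simps)
    have "const c * (tpow k * g) \<in> Lp_class q" "u * g \<in> Lp_class q"
      using g q monom_span_subset_Linf[OF monom_span_step(1)]
      by (simp_all add: Lp_class_const_mult Lp_class_tpow_mult hardy_Lp Linf_mult_Lp)
    then have "fourier ((const c * tpow k + u) * g) j = c * fourier g (j - k) + fourier (u * g) j" for j
      unfolding expand using q by (simp add: fourier_add_Lp)
    moreover have "fourier (const c * tpow k + u) 0 = c * (if k = 0 then 1 else 0) + fourier u 0"
      using monom_span_subset_Lp[OF monom_span_step(1), of 1]
      by (simp add: fourier_add Lp_class_const_mult fourier_tpow)
    ultimately show ?case
      using monom_span_step g by (auto simp: hardy_fourier_neg distrib_right)
  qed simp
  then show "j < 0 \<Longrightarrow> fourier (u * g) j = 0" "fourier (u * g) 0 = fourier u 0 * fourier g 0" by auto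
qed

theorem hardy_mult:
  assumes f: "f \<in> hardy p" and g: "g \<in> hardy (conj_exp p)" and p: "1 < p"
  shows "f * g \<in> Lp_class 1" "\<And>j. j < 0 \<Longrightarrow> fourier (f * g) j = 0"
    "fourier (f * g) 0 = fourier f 0 * fourier g 0"
proof -
  have q: "1 < conj_exp p" using p by (rule conj_exp_gt_1)
  show "f * g \<in> Lp_class 1" using f g p by (intro class_Hoelder) (auto intro: hardy_Lp)
  obtain u where u: "\<And>n. u n \<in> analytic_polys" "Lp_conv p u f" using analytic_polys_dense[OF f p] by blast
  have u_Lp: "u n \<in> Lp_class p" for n using p by (intro monom_span_subset_Lp[OF u(1)]) simp
  have fourier_lim: "(\<lambda>n. fourier (u n * g) j) \<longlonglongrightarrow> fourier (f * g) j" for j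
    using mean_mult_tendsto[OF p u_Lp hardy_Lp[OF f] u(2), of "g * tpow (- j)"] g q
    by (simp add: fourier_def mult.assoc Lp_mult_Linf hardy_Lp)
  show "fourier (f * g) j = 0" if "j < 0" for j
    by (rule LIMSEQ_unique[OF fourier_lim]) (simp add: analytic_poly_mult_hardy(1)[OF u(1) g q that])
  have "(\<lambda>n. fourier (u n) 0 * fourier g 0) \<longlonglongrightarrow> fourier f 0 * fourier g 0"
    using fourier_tendsto[OF p u_Lp hardy_Lp[OF f] u(2)] by (intro tendsto_mult tendsto_const)
  then show "fourier (f * g) 0 = fourier f 0 * fourier g 0"
    by (intro LIMSEQ_unique[OF fourier_lim]) (simp add: analytic_poly_mult_hardy(2)[OF u(1) g q])
qed

lemma eq_const_fourierI:
  assumes "h \<in> Lp_class 1" "\<And>j. j \<noteq> 0 \<Longrightarrow> fourier h j = 0" shows "h = const (fourier h 0)"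
  using assms by (intro fourier_eqI) (auto simp: fourier_const)

section \<open>Duality of Hardy spaces\<close>

definition pairing :: "circle_fun \<Rightarrow> circle_fun \<Rightarrow> complex" where
  "pairing f h = mean (f * bar h)"

lemma norm_pairing_le:
  assumes "f \<in> Lp_class p" "h \<in> Lp_class (conj_exp p)" "1 < p"
  shows "norm (pairing f h) \<le> cnorm p f * cnorm (conj_exp p) h"
  using class_Hoelder(2)[OF assms(1) Lp_class_bar[OF assms(2)] assms(3)] by (simp add: pairing_def)

lemma pairing_add:
  assumes "f \<in> Lp_class p" "g \<in> Lp_class p" "h \<in> Lp_class (conj_exp p)" "1 < p"
  shows "pairing (f + g) h = pairing f h + pairing g h"
  using assms class_Hoelder(1)[OF _ Lp_class_bar[OF assms(3)]]
  by (simp add: pairing_def distrib_right mean_add)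

lemma pairing_const_mult: "pairing (const c * f) h = c * pairing f h"
  by (simp add: pairing_def mult.assoc mean_const_mult)

lemma pairing_commute: "pairing h f = cnj (pairing f h)"
  by (simp add: pairing_def mult.commute flip: mean_bar)

lemma pairing_tpow: "pairing (tpow j) h = cnj (fourier h j)"
  by (simp add: pairing_def fourier_def mult.commute flip: mean_bar)

lemma pairing_tendsto:
  assumes "1 < p" "\<And>n. F n \<in> Lp_class p" "f \<in> Lp_class p" "Lp_conv p F f" "h \<in> Lp_class (conj_exp p)"
  shows "(\<lambda>n. pairing (F n) h) \<longlonglongrightarrow> pairing f h"
  unfolding pairing_def using assms by (intro mean_mult_tendsto Lp_class_bar)

lemma pairing_cohardy:
  assumes f: "f \<in> cohardy p" and h: "h \<in> hardy (conj_exp p)" and p: "1 < p"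
  shows "pairing f h = 0"
proof -
  have "tilde (bar h) \<in> hardy (conj_exp p)" using h by (simp add: hardy_def Lp_class_bar Lp_class_tilde)
  from hardy_mult(2)[OF reflect_cohardy[OF f p] this p, of "- 1"]
  have "fourier (tilde f * bar (tilde h)) 0 = 0" by (simp add: reflect_def mult.assoc)
  then show ?thesis using mean_tilde[of "f * bar h"] by (simp add: pairing_def fourier_def)
qed

lemma pairing_riesz_left:
  assumes f: "f \<in> Lp_class p" and h: "h \<in> hardy (conj_exp p)" and p: "1 < p"
  shows "pairing (riesz f) h = pairing f h"
  using pairing_add[OF riesz_Lp[OF f p] cohardy_Lp[OF riesz_complement[OF f p]] hardy_Lp[OF h] p]
    pairing_cohardy[OF riesz_complement[OF f p] h p] by simp

lemma pairing_riesz_right: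
  assumes f: "f \<in> hardy p" and h: "h \<in> Lp_class (conj_exp p)" and p: "1 < p"
  shows "pairing f (riesz h) = pairing f h"
  using pairing_riesz_left[of h "conj_exp p" f] assms conj_exp_gt_1[OF p]
  by (simp add: pairing_commute[of f])

lemma pairing_nondegenerate:
  assumes h: "h \<in> hardy q" "h' \<in> hardy q" and p: "1 < p" "1 < q"
    and eq: "\<And>f. f \<in> hardy p \<Longrightarrow> pairing f h = pairing f h'"
  shows "h = h'"
proof (rule fourier_eqI)
  fix j show "fourier h j = fourier h' j"
    using eq[of "tpow j"] p(1) h by (cases "j < 0") (simp_all add: hardy_fourier_neg pairing_tpow)
qed (use h p in \<open>auto intro: hardy_imp_L1\<close>)

text \<open>The Fejer means of the candidate coefficients are bounded in the dual exponent, because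
  pairing them with \<open>\<psi>\<close> amounts to applying the functional to the Riesz mean of \<open>bar \<psi>\<close>.\<close>

lemma functional_fejer_poly_bound:
  assumes p: "1 < p" and add: "\<And>f g. f \<in> hardy p \<Longrightarrow> g \<in> hardy p \<Longrightarrow> \<Lambda> (f + g) = \<Lambda> f + \<Lambda> g"
    and scale: "\<And>f c. f \<in> hardy p \<Longrightarrow> \<Lambda> (const c * f) = c * \<Lambda> f"
    and bound: "\<And>f. f \<in> hardy p \<Longrightarrow> norm (\<Lambda> f) \<le> M * cnorm p f" and M: "0 \<le> M"
    and riesz: "\<And>f N. f \<in> Lp_class p \<Longrightarrow> 1 \<le> N \<Longrightarrow> cnorm p (riesz_mean N f) \<le> C * cnorm p f" and C: "0 \<le> C"
    and N: "1 \<le> N"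
  shows "cnorm (conj_exp p) (fejer_poly N (nonneg_part (\<lambda>j. cnj (\<Lambda> (tpow j))))) \<le> 2 * pi * (M * C)"
proof -
  define y where "y = nonneg_part (\<lambda>j. cnj (\<Lambda> (tpow j)))"
  have q: "1 < conj_exp p" using p by (rule conj_exp_gt_1)
  then have "fejer_poly N y \<in> Lp_class (conj_exp p)" by simp
  then obtain \<psi> where \<psi>: "\<psi> \<in> Lp_class p" "cnorm p \<psi> \<le> 1"
    and attained: "mean (fejer_poly N y * \<psi>)
      = complex_of_real (cnorm (conj_exp p) (fejer_poly N y) / (2 * pi))"
    using cnorm_dual_attained[OF _ q] p by (metis conj_exp_conj_exp)
  define I where "I = {0..int N}"
  have \<Lambda>_sum: "\<Lambda> (\<Sum>m\<in>J. const (z m) * tpow m) = (\<Sum>m\<in>J. z m * \<Lambda> (tpow m))"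
    if "finite J" "J \<subseteq> {0..}" for z J
    using that
  proof (induction J rule: finite_induct)
    case (insert m J)
    then have "(\<Sum>m\<in>J. const (z m) * tpow m) \<in> hardy p" using p by (intro hardy_sum hardy_const_mult) auto
    then show ?case using insert p by (simp add: add scale hardy_const_mult)
  qed (use scale[of 0 0] p in simp)
  have drop_neg: "(\<Sum>m=- int N..int N. F m) = sum F I" if "\<And>m. m < 0 \<Longrightarrow> F m = 0"
    for F :: "int \<Rightarrow> 'a::comm_monoid_add"
    unfolding I_def using that by (intro sum.mono_neutral_right) auto
  have mean_I: "riesz_mean N (bar \<psi>)
      = (\<Sum>m\<in>I. const (of_real (fejer_weight N m) * fourier (bar \<psi>) m) * tpow m)"
    unfolding fejer_poly_eq_sum by (subst drop_neg) (auto simp: nonneg_part_def I_def intro!: sum.cong)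
  have "mean (fejer_poly N y * \<psi>)
      = (\<Sum>m\<in>I. of_real (fejer_weight N m) * cnj (\<Lambda> (tpow m)) * fourier \<psi> (- m))"
    using Lp_class_imp_L1[OF \<psi>(1) p]
    by (subst mean_fejer_poly_mult, simp, subst drop_neg)
      (auto simp: y_def nonneg_part_def I_def intro!: sum.cong)
  also have "\<dots> = cnj (\<Sum>m\<in>I. of_real (fejer_weight N m) * fourier (bar \<psi>) m * \<Lambda> (tpow m))"
    by (simp add: mult_ac)
  also have "\<dots> = cnj (\<Lambda> (riesz_mean N (bar \<psi>)))" unfolding mean_I by (subst \<Lambda>_sum) (auto simp: I_def)
  finally have "cnorm (conj_exp p) (fejer_poly N y) / (2 * pi) = norm (\<Lambda> (riesz_mean N (bar \<psi>)))"
    using arg_cong[OF attained, of norm] by (simp add: norm_divide)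
  also have "\<dots> \<le> M * cnorm p (riesz_mean N (bar \<psi>))"
    unfolding mean_I using p by (intro bound hardy_sum hardy_const_mult) (auto simp: I_def)
  also have "\<dots> \<le> M * C"
    using riesz[OF Lp_class_bar[OF \<psi>(1)] N] mult_left_mono[OF \<psi>(2) C] M by (intro mult_left_mono) auto
  finally show ?thesis unfolding y_def by (simp add: field_simps)
qed

theorem hardy_functional_representation:
  assumes p: "1 < p" and add: "\<And>f g. f \<in> hardy p \<Longrightarrow> g \<in> hardy p \<Longrightarrow> \<Lambda> (f + g) = \<Lambda> f + \<Lambda> g"
    and scale: "\<And>f c. f \<in> hardy p \<Longrightarrow> \<Lambda> (const c * f) = c * \<Lambda> f"
    and bound: "\<And>f. f \<in> hardy p \<Longrightarrow> norm (\<Lambda> f) \<le> M * cnorm p f" and M: "0 \<le> M"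
  obtains h where "h \<in> hardy (conj_exp p)" "\<And>f. f \<in> hardy p \<Longrightarrow> \<Lambda> f = pairing f h"
proof -
  obtain C where C: "0 \<le> C" "\<And>f N. f \<in> Lp_class p \<Longrightarrow> 1 \<le> N \<Longrightarrow> cnorm p (riesz_mean N f) \<le> C * cnorm p f"
    using riesz_mean_bound[OF p] by blast
  define y where "y = nonneg_part (\<lambda>j. cnj (\<Lambda> (tpow j)))"
  have "cnorm (conj_exp p) (fejer_poly N y) \<le> 2 * pi * (M * C)" if "1 \<le> N" for N
    unfolding y_def by (rule functional_fejer_poly_bound) (fact p add scale bound M C that)+
  then obtain h where h: "h \<in> Lp_class (conj_exp p)" "fourier h = y"
    using bounded_fejer_polys_imp_limit[OF conj_exp_gt_1[OF p]] by blast
  have \<Lambda>_poly: "\<Lambda> u = pairing u h" if "u \<in> analytic_polys" for u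
    using that
  proof (induction rule: monom_span.induct)
    case (monom_span_step u k c)
    then have u: "u \<in> hardy p" "tpow k \<in> hardy p" using p by (auto intro: analytic_polys_hardy)
    have "\<Lambda> (tpow k) = pairing (tpow k) h"
      using monom_span_step(2) by (simp add: pairing_tpow h(2) y_def nonneg_part_def)
    moreover have "pairing (const c * tpow k + u) h = pairing (const c * tpow k) h + pairing u h"
      using u p h(1) by (intro pairing_add) (auto intro: hardy_Lp hardy_const_mult)
    ultimately show ?case
      using monom_span_step.IH u p by (simp add: add scale hardy_const_mult pairing_const_mult)
  qed (use scale[of 0 0] p in \<open>simp add: pairing_def mean_0\<close>)
  have "\<Lambda> f = pairing f h" if f: "f \<in> hardy p" for f
  proof -
    obtain u where u: "\<And>n. u n \<in> analytic_polys" "Lp_conv p u f"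
      using analytic_polys_dense[OF f p] by blast
    have u_hardy: "u n \<in> hardy p" for n using u(1) p by (rule analytic_polys_hardy)
    have "norm (\<Lambda> (u n) - \<Lambda> f) \<le> M * cnorm p (u n - f)" for n
      using add[of "u n - f" f] bound[of "u n - f"] u_hardy f p by (simp add: hardy_diff)
    then have "(\<lambda>n. \<Lambda> (u n) - \<Lambda> f) \<longlonglongrightarrow> 0"
      by (rule Lim_null_comparison[OF always_eventually[OF allI]
        tendsto_mult_right_zero[OF u(2)[unfolded Lp_conv_def]]])
    then have "(\<lambda>n. pairing (u n) h) \<longlonglongrightarrow> \<Lambda> f" using \<Lambda>_poly[OF u(1)] by (simp add: LIM_zero_iff)
    moreover have "(\<lambda>n. pairing (u n) h) \<longlonglongrightarrow> pairing f h"
      using p u_hardy f u(2) h(1) by (intro pairing_tendsto) (auto intro: hardy_Lp)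
    ultimately show ?thesis by (rule LIMSEQ_unique)
  qed
  moreover have "h \<in> hardy (conj_exp p)" using h by (simp add: hardy_def y_def nonneg_part_def)
  ultimately show thesis using that by blast
qed

section \<open>Bounded operators on Hardy spaces\<close>

lemma Metric_space_hardy:
  assumes p: "1 < p" shows "Metric_space (hardy p) (\<lambda>f g. cnorm p (f - g))"
proof
  show "cnorm p (f - g) = cnorm p (g - f)" for f g using p by (simp add: cnorm_minus_commute)
  show "cnorm p (f - g) = 0 \<longleftrightarrow> f = g" if "f \<in> hardy p" "g \<in> hardy p" for f g
    using that p cnorm_eq_0[of "f - g" p] by (auto simp: Lp_class_diff hardy_Lp)
  show "cnorm p (f - h) \<le> cnorm p (f - g) + cnorm p (g - h)" if "f \<in> hardy p" "g \<in> hardy p" "h \<in> hardy p"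
    for f g h
    using that p by (intro cnorm_triangle_via) (auto intro: hardy_Lp)
qed simp

lemma hardy_mcomplete:
  assumes p: "1 < p" shows "Metric_space.mcomplete (hardy p) (\<lambda>f g. cnorm p (f - g))"
proof -
  interpret Metric_space "hardy p" "\<lambda>f g. cnorm p (f - g)" using p by (rule Metric_space_hardy)
  have "\<exists>f. limitin mtopology F f sequentially" if F: "MCauchy F" for F
  proof -
    have F_hardy: "F n \<in> hardy p" for n using F by (auto simp: MCauchy_def)
    have "Lp_Cauchy p F" using F by (simp add: MCauchy_def Lp_Cauchy_def)
    then obtain f where f: "f \<in> Lp_class p" "Lp_conv p F f"
      using Lp_class_complete[where F = F, OF p hardy_Lp[OF F_hardy]] by blast
    then have "f \<in> hardy p" by (rule hardy_closed[OF p F_hardy])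
    then have "limitin mtopology F f sequentially"
      using f(2) F_hardy by (simp add: limitin_metric_dist_null Lp_conv_def)
    then show ?thesis by blast
  qed
  then show ?thesis by (simp add: mcomplete_def)
qed

lemma bounded_on_ball_imp_bounded:
  assumes S: "\<And>h. h \<in> hardy p \<Longrightarrow> S h \<in> hardy p" "\<And>h k. h \<in> hardy p \<Longrightarrow> k \<in> hardy p \<Longrightarrow> S (h + k) = S h + S k"
      "\<And>c h. h \<in> hardy p \<Longrightarrow> S (const c * h) = const c * S h"
    and x: "x \<in> hardy p" and r: "0 < r" and ball: "\<And>y. y \<in> hardy p \<Longrightarrow> cnorm p (x - y) < r \<Longrightarrow>
      cnorm p (S y) \<le> R"
    and h: "h \<in> hardy p" and p: "1 < p"
  shows "cnorm p (S h) \<le> 4 * R / r * cnorm p h"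
proof (cases "cnorm p h = 0")
  case True
  then have "h = 0" using cnorm_eq_0[OF hardy_Lp[OF h]] p by simp
  then show ?thesis using S(3)[OF h, of 0] p by simp
next
  case False
  define c where "c = r / (2 * cnorm p h)"
  have h_pos: "0 < cnorm p h" using False by (simp add: order_less_le)
  then have c: "0 < c" using r by (simp add: c_def)
  define y where "y = x + const (of_real c) * h"
  have y: "y \<in> hardy p" unfolding y_def using x h p by (intro hardy_add hardy_const_mult)
  have "cnorm p (x - y) = c * cnorm p h"
    using c p cnorm_uminus[of p "const (of_real c) * h"] by (simp add: y_def cnorm_const_mult)
  then have "cnorm p (x - y) < r" using h_pos r by (simp add: c_def)
  then have Sy: "cnorm p (S y) \<le> R" using y by (intro ball)
  have "const (of_real c) * S h = S y - S x"
    unfolding y_def using x h p by (simp add: S(2,3) hardy_const_mult)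
  then have "c * cnorm p (S h) = cnorm p (S y - S x)"
    using c p cnorm_const_mult[of p "of_real c" "S h"] by simp
  also have "\<dots> \<le> cnorm p (S y) + cnorm p (S x)" using S(1) x y p by (intro cnorm_triangle_diff hardy_Lp)
  finally have "c * cnorm p (S h) \<le> 2 * R" using Sy ball[OF x] r p by simp
  then show ?thesis using r h_pos by (simp add: c_def field_simps)
qed

locale hardy_operator =
  fixes p :: real and T :: "circle_fun \<Rightarrow> circle_fun"
  assumes exponent: "1 < p" and maps: "f \<in> hardy p \<Longrightarrow> T f \<in> hardy p"
    and add: "f \<in> hardy p \<Longrightarrow> g \<in> hardy p \<Longrightarrow> T (f + g) = T f + T g"
    and scale: "f \<in> hardy p \<Longrightarrow> T (const c * f) = const c * T f"
    and bounded: "\<exists>M\<ge>0. \<forall>f\<in>hardy p. cnorm p (T f) \<le> M * cnorm p f"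
begin

lemma zero [simp]: "T 0 = 0"
  using scale[of 0 0] exponent by simp

lemma diff: "f \<in> hardy p \<Longrightarrow> g \<in> hardy p \<Longrightarrow> T (f - g) = T f - T g"
  using add[of "f - g" g] exponent by (simp add: hardy_diff algebra_simps)

lemma sum:
  assumes "finite I" "\<And>k. k \<in> I \<Longrightarrow> f k \<in> hardy p"
  shows "T (\<Sum>k\<in>I. const (s k) * f k) = (\<Sum>k\<in>I. const (s k) * T (f k))"
  using assms
proof (induction I rule: finite_induct)
  case (insert k I)
  then have "(\<Sum>k\<in>I. const (s k) * f k) \<in> hardy p" "f k \<in> hardy p"
    using exponent by (auto intro!: hardy_sum hardy_const_mult)
  then show ?case using insert exponent by (simp add: add scale hardy_const_mult)
qed simp

lemma tendsto:
  assumes F: "\<And>n. F n \<in> hardy p" "f \<in> hardy p" and lim: "Lp_conv p F f"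
  shows "Lp_conv p (\<lambda>n. T (F n)) (T f)"
proof -
  obtain M where M: "\<And>f. f \<in> hardy p \<Longrightarrow> cnorm p (T f) \<le> M * cnorm p f" using bounded by blast
  have "cnorm p (T (F n) - T f) \<le> M * cnorm p (F n - f)" for n
    using M[of "F n - f"] F exponent by (simp add: diff hardy_diff)
  moreover have "(\<lambda>n. M * cnorm p (F n - f)) \<longlonglongrightarrow> 0"
    using lim unfolding Lp_conv_def by (rule tendsto_mult_right_zero)
  ultimately show ?thesis by (rule Lp_convI)
qed

lemma closed_graph:
  assumes F: "\<And>n. F n \<in> hardy p" and f: "f \<in> hardy p" and h: "h \<in> hardy p"
    and conv: "Lp_conv p F f" "Lp_conv p (\<lambda>n. T (F n)) h"
  shows "T f = h"
proof (rule fourier_eqI)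
  have TF: "T (F n) \<in> Lp_class p" for n by (intro hardy_Lp maps F)
  show "fourier (T f) j = fourier h j" for j
    using fourier_tendsto[OF exponent TF hardy_Lp[OF maps[OF f]] tendsto[OF F f conv(1)]]
      fourier_tendsto[OF exponent TF hardy_Lp[OF h] conv(2)] by (rule LIMSEQ_unique)
qed (use f h maps exponent in \<open>auto intro: hardy_imp_L1\<close>)

text \<open>The nested sets of almost-preimages in the ball are convex, so norm limits of almost-preimages exist
  although the ball is not norm compact.\<close>

lemma image_ball_closed:
  assumes h: "h \<in> hardy p"
    and approx: "\<And>e. 0 < e \<Longrightarrow> \<exists>f\<in>hardy p. cnorm p f \<le> r \<and> cnorm p (T f - h) \<le> e"
  shows "\<exists>f\<in>hardy p. cnorm p f \<le> r \<and> T f = h"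
proof -
  define K where "K n = {f \<in> hardy p. cnorm p f \<le> r \<and> cnorm p (T f - h) \<le> 1 / (real n + 1)}" for n
  have nonempty: "K n \<noteq> {}" for n using approx[of "1 / (real n + 1)"] by (auto simp: K_def)
  have K: "K n \<subseteq> Lp_class p" "f \<in> K n \<Longrightarrow> cnorm p f \<le> r" for n f by (auto simp: K_def hardy_Lp)
  have nested: "K n \<subseteq> K m" if "m \<le> n" for m n
  proof -
    have "1 / (real n + 1) \<le> 1 / (real m + 1)" using that by (intro divide_left_mono) auto
    then show ?thesis by (auto simp: K_def)
  qed
  have midpoint_bound: "cnorm p (const (1/2) * (f + g)) \<le> b"
    if "f \<in> hardy p" "g \<in> hardy p" "cnorm p f \<le> b" "cnorm p g \<le> b" for f g b
    using cnorm_triangle[OF hardy_Lp hardy_Lp exponent, OF that(1,2)] that exponent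
    by (simp add: cnorm_const_mult)
  have convex: "const (1/2) * (f + g) \<in> K n" if fg: "f \<in> K n" "g \<in> K n" for f g n
  proof -
    have hardy: "f \<in> hardy p" "g \<in> hardy p" "T f - h \<in> hardy p" "T g - h \<in> hardy p"
      using fg h exponent by (auto simp: K_def maps hardy_diff)
    have "const (1/2) * (h + h) = const (1/2 + 1/2) * h"
      by (simp only: const_add distrib_left distrib_right)
    moreover have "T (const (1/2) * (f + g)) = const (1/2) * (T f + T g)"
      using hardy exponent by (simp only: scale add hardy_add)
    ultimately have "T (const (1/2) * (f + g)) - h = const (1/2) * ((T f - h) + (T g - h))"
      by (simp add: algebra_simps)
    then show ?thesis
      using midpoint_bound[OF hardy(1,2)] midpoint_bound[OF hardy(3,4)] fg hardy exponent
      by (simp add: K_def hardy_const_mult hardy_add)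
  qed
  obtain F f where F: "\<And>n. F n \<in> K n" and f: "f \<in> Lp_class p" "Lp_conv p F f"
    by (rule nested_convex_sets_limit[of p K r, OF exponent nonempty K(1) nested K(2) convex]) blast+
  have F_hardy: "F n \<in> hardy p" for n using F by (auto simp: K_def)
  have f_hardy: "f \<in> hardy p" using f by (rule hardy_closed[OF exponent F_hardy])
  have "cnorm p f \<le> r"
    by (rule LIMSEQ_le_const2[OF cnorm_tendsto[OF exponent hardy_Lp[OF F_hardy] f]])
      (use F in \<open>auto simp: K_def\<close>)
  moreover have "Lp_conv p (\<lambda>n. T (F n)) h"
    by (rule Lp_convI[OF _ LIMSEQ_1_over_Suc]) (use F in \<open>simp add: K_def\<close>)
  then have "T f = h" by (rule closed_graph[OF F_hardy f_hardy h f(2)])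
  ultimately show ?thesis using f_hardy by blast
qed

lemma image_ball_contains_ball:
  assumes surj: "T ` hardy p = hardy p"
  obtains x r R where "x \<in> hardy p" "0 < r"
    "\<And>y. y \<in> hardy p \<Longrightarrow> cnorm p (x - y) < r \<Longrightarrow> \<exists>f\<in>hardy p. cnorm p f \<le> R \<and> T f = y"
proof -
  interpret Metric_space "hardy p" "\<lambda>f g. cnorm p (f - g)" using exponent by (rule Metric_space_hardy)
  define B where "B n = T ` {f \<in> hardy p. cnorm p f \<le> real n}" for n
  have closed: "closedin mtopology (B n)" for n
    unfolding closedin_metric
  proof (intro conjI allI impI)
    show "B n \<subseteq> hardy p" using maps by (auto simp: B_def)
    fix h assume h: "h \<in> hardy p - B n"
    then have "\<not> (\<exists>f\<in>hardy p. cnorm p f \<le> real n \<and> T f = h)" by (auto simp: B_def)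
    then obtain e where e: "0 < e" "\<And>f. f \<in> hardy p \<Longrightarrow> cnorm p f \<le> real n \<Longrightarrow> e < cnorm p (T f - h)"
      using image_ball_closed[of h "real n"] h by (meson DiffD1 not_le)
    then have "disjnt (B n) (mball h e)"
      using exponent by (force simp: disjnt_iff B_def cnorm_minus_commute[of p h])
    then show "\<exists>r>0. disjnt (B n) (mball h r)" using e(1) by blast
  qed
  have "\<Union>(range B) = hardy p"
  proof (intro equalityI subsetI)
    fix h assume "h \<in> hardy p"
    then obtain f where "f \<in> hardy p" "h = T f" using surj by blast
    moreover obtain n where "cnorm p f \<le> real n" using real_arch_simple by blast
    ultimately show "h \<in> \<Union>(range B)" by (auto simp: B_def)
  qed (use maps in \<open>auto simp: B_def\<close>)
  then have "mtopology interior_of \<Union>(range B) = hardy p"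
    by (metis interior_of_topspace topspace_mtopology)
  then have "mtopology interior_of \<Union>(range B) \<noteq> {}" using hardy_0[OF exponent] by auto
  then obtain n where "mtopology interior_of (B n) \<noteq> {}"
    using metric_Baire_category_alt[of "range B"] hardy_mcomplete[OF exponent] closed by auto
  then obtain x U where U: "openin mtopology U" "x \<in> U" "U \<subseteq> B n" by (auto simp: interior_of_def)
  then obtain r where "0 < r" "mball x r \<subseteq> U" "x \<in> hardy p" unfolding openin_mtopology by blast
  then show thesis using that[of x r "real n"] U(3) by (auto simp: B_def subset_iff)
qed

theorem inv_into_hardy_operator:
  assumes bij: "bij_betw T (hardy p) (hardy p)"
  shows "hardy_operator p (inv_into (hardy p) T)"
proof -
  define S where "S = inv_into (hardy p) T"
  have S: "S h \<in> hardy p" "T (S h) = h" if "h \<in> hardy p" for h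
    unfolding S_def using bij that by (auto simp: bij_betw_def f_inv_into_f inv_into_into)
  have ST: "S (T f) = f" if "f \<in> hardy p" for f
    unfolding S_def using bij that by (simp add: bij_betw_inv_into_left)
  obtain x r R where x: "x \<in> hardy p" and r: "0 < r"
    and ball: "\<And>y. y \<in> hardy p \<Longrightarrow> cnorm p (x - y) < r \<Longrightarrow> \<exists>f\<in>hardy p. cnorm p f \<le> R \<and> T f = y"
    using image_ball_contains_ball bij by (metis bij_betw_imp_surj_on)
  have S_ball: "cnorm p (S y) \<le> R" if y: "y \<in> hardy p" "cnorm p (x - y) < r" for y
    using ball[OF y] ST by auto
  have S_add: "S (h + k) = S h + S k" if "h \<in> hardy p" "k \<in> hardy p" for h k
    using ST[of "S h + S k"] that S exponent by (simp add: add hardy_add)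
  have S_scale: "S (const c * h) = const c * S h" if "h \<in> hardy p" for c h
    using ST[of "const c * S h"] that S exponent by (simp add: scale hardy_const_mult)
  have "0 \<le> R" using order.trans[OF cnorm_nonneg S_ball[OF x]] r exponent by simp
  have "cnorm p (S h) \<le> 4 * R / r * cnorm p h" if "h \<in> hardy p" for h
    using S(1) S_add S_scale x r S_ball that exponent by (rule bounded_on_ball_imp_bounded)
  then show ?thesis
    unfolding S_def[symmetric] using exponent S S_add S_scale \<open>0 \<le> R\<close> r
    by unfold_locales (auto intro!: exI[of _ "4 * R / r"])
qed

end

locale adjoint_hardy_operators = hardy_operator p T + adjoint: hardy_operator "conj_exp p" T'
  for p T T' +
  assumes pairing_adjoint: "f \<in> hardy p \<Longrightarrow> h \<in> hardy (conj_exp p) \<Longrightarrow> pairing (T f) h = pairing f (T' h)"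
begin

lemma adjoint_inj_on:
  assumes "T ` hardy p = hardy p" shows "inj_on T' (hardy (conj_exp p))"
proof (rule inj_onI)
  fix h k assume hk: "h \<in> hardy (conj_exp p)" "k \<in> hardy (conj_exp p)" "T' h = T' k"
  have "pairing g h = pairing g k" if g: "g \<in> hardy p" for g
  proof -
    obtain f where "f \<in> hardy p" "g = T f" using assms g by blast
    then show ?thesis using hk by (simp add: pairing_adjoint)
  qed
  then show "h = k" using hk exponent adjoint.exponent by (intro pairing_nondegenerate)
qed

theorem adjoint_bij_betw:
  assumes bij: "bij_betw T (hardy p) (hardy p)"
  shows "bij_betw T' (hardy (conj_exp p)) (hardy (conj_exp p))"
proof -
  define S where "S = inv_into (hardy p) T"
  interpret inverse: hardy_operator p S unfolding S_def using bij by (rule inv_into_hardy_operator)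
  have TS: "T (S f) = f" and ST: "S (T f) = f" if "f \<in> hardy p" for f
    unfolding S_def using bij that by (simp_all add: bij_betw_inv_into_left bij_betw_inv_into_right)
  obtain M where M: "0 \<le> M" "\<And>f. f \<in> hardy p \<Longrightarrow> cnorm p (S f) \<le> M * cnorm p f"
    using inverse.bounded by blast
  have "k \<in> T' ` hardy (conj_exp p)" if k: "k \<in> hardy (conj_exp p)" for k
  proof -
    have S_Lp: "S f \<in> Lp_class p" if "f \<in> hardy p" for f using that by (intro hardy_Lp inverse.maps)
    have "norm (pairing (S f) k) \<le> (M * cnorm (conj_exp p) k) * cnorm p f" if f: "f \<in> hardy p" for f
      using norm_pairing_le[OF S_Lp[OF f] hardy_Lp[OF k] exponent]
        mult_right_mono[OF M(2)[OF f], of "cnorm (conj_exp p) k"]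
      by (simp add: mult_ac)
    then obtain h where h: "h \<in> hardy (conj_exp p)" "\<And>f. f \<in> hardy p \<Longrightarrow> pairing (S f) k = pairing f h"
      using hardy_functional_representation[of p "\<lambda>f. pairing (S f) k" "M * cnorm (conj_exp p) k"]
        exponent M(1) k
      by (auto simp: inverse.add inverse.scale pairing_add[OF S_Lp S_Lp] pairing_const_mult hardy_Lp)
    have "pairing f (T' h) = pairing f k" if "f \<in> hardy p" for f
      using that h(2)[OF maps[OF that]] by (simp add: ST pairing_adjoint[OF _ h(1), symmetric])
    then have "T' h = k" using adjoint.maps[OF h(1)] k exponent adjoint.exponent
      by (intro pairing_nondegenerate)
    then show ?thesis using h(1) by blast
  qed
  then show ?thesis
    using adjoint_inj_on[OF bij_betw_imp_surj_on[OF bij]] adjoint.maps by (auto simp: bij_betw_def)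
qed

lemma adjoint_symmetric: "adjoint_hardy_operators (conj_exp p) T' T"
  unfolding adjoint_hardy_operators_def adjoint_hardy_operators_axioms_def
  using hardy_operator_axioms adjoint.hardy_operator_axioms exponent pairing_adjoint
  by (simp add: pairing_commute[of "T' _"] pairing_commute[of _ "T _"])

end

section \<open>Toeplitz and Hankel operators\<close>

lemma Linf_mult_hardy: "g \<in> Linf_class \<Longrightarrow> f \<in> hardy p \<Longrightarrow> 1 < p \<Longrightarrow> g * f \<in> Lp_class p"
  by (simp add: Linf_mult_Lp hardy_Lp)

text \<open>The notation \<open>T(a) + H(b)\<close> refers to \<open>toeplitz_hankel a b\<close>: on \<open>hardy p\<close> the flip \<open>J\<close> is \<open>reflect\<close>,
  which maps into the range of \<open>Q\<close>.\<close>

definition toeplitz_hankel :: "circle_fun \<Rightarrow> circle_fun \<Rightarrow> circle_fun \<Rightarrow> circle_fun" where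
  "toeplitz_hankel a b f = riesz (a * f + b * reflect f)"

lemma toeplitz_hankel_Lp:
  assumes "a \<in> Linf_class" "b \<in> Linf_class" "f \<in> hardy p" "1 < p"
  shows "a * f \<in> Lp_class p" "b * reflect f \<in> Lp_class p" "a * f + b * reflect f \<in> Lp_class p"
proof -
  show af: "a * f \<in> Lp_class p" using assms by (simp add: Linf_mult_hardy)
  have "reflect f \<in> Lp_class p" using reflect_hardy[OF assms(3,4)] by (rule cohardy_Lp)
  then show bf: "b * reflect f \<in> Lp_class p" using assms by (simp add: Linf_mult_Lp)
  show "a * f + b * reflect f \<in> Lp_class p" using af bf assms(4) by (simp add: Lp_class_add)
qed

lemma toeplitz_hankel_hardy_operator:
  assumes a: "a \<in> Linf_class" and b: "b \<in> Linf_class" and p: "1 < p"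
  shows "hardy_operator p (toeplitz_hankel a b)"
proof
  note Lp = toeplitz_hankel_Lp[OF a b _ p]
  show "toeplitz_hankel a b f \<in> hardy p" if "f \<in> hardy p" for f
    unfolding toeplitz_hankel_def using Lp(3)[OF that] p by (rule riesz_hardy)
  show "toeplitz_hankel a b (f + g) = toeplitz_hankel a b f + toeplitz_hankel a b g"
    if "f \<in> hardy p" "g \<in> hardy p" for f g
  proof -
    have "a * (f + g) + b * reflect (f + g) = (a * f + b * reflect f) + (a * g + b * reflect g)"
      by (simp add: reflect_add algebra_simps)
    then show ?thesis unfolding toeplitz_hankel_def using riesz_add[OF Lp(3) Lp(3) p] that by simp
  qed
  show "toeplitz_hankel a b (const k * f) = const k * toeplitz_hankel a b f" if "f \<in> hardy p" for f k
  proof -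
    have "a * (const k * f) + b * reflect (const k * f) = const k * (a * f + b * reflect f)"
      unfolding reflect_const_mult by (simp only: algebra_simps)
    then show ?thesis unfolding toeplitz_hankel_def using riesz_const_mult[OF Lp(3)[OF that] p] by simp
  qed
  obtain A where A: "0 \<le> A" "ess_bounded A a" using Linf_classE[OF a] by blast
  obtain B where B: "0 \<le> B" "ess_bounded B b" using Linf_classE[OF b] by blast
  obtain C where C: "0 \<le> C" "\<And>f. f \<in> Lp_class p \<Longrightarrow> cnorm p (riesz f) \<le> C * cnorm p f"
    by (rule Riesz_projection_bounded[OF p]) (rule that)
  have "cnorm p (toeplitz_hankel a b f) \<le> C * (A + B) * cnorm p f" if f: "f \<in> hardy p" for f
  proof -
    have reflect_f: "reflect f \<in> Lp_class p" using f p by (simp add: reflect_Lp hardy_Lp)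
    have "cnorm p (a * f + b * reflect f) \<le> cnorm p (a * f) + cnorm p (b * reflect f)"
      using Lp(1,2)[OF f] p by (rule cnorm_triangle)
    also have "\<dots> \<le> A * cnorm p f + B * cnorm p (reflect f)"
      using ess_bounded_mult_Lp(2)[OF A(2) hardy_Lp[OF f]] ess_bounded_mult_Lp(2)[OF B(2) reflect_f] A(1)
        B(1) p
      by (intro add_mono) auto
    finally have "cnorm p (a * f + b * reflect f) \<le> (A + B) * cnorm p f"
      using f p by (simp add: cnorm_reflect hardy_Lp distrib_right)
    then show ?thesis
      unfolding toeplitz_hankel_def using order.trans[OF C(2)[OF Lp(3)[OF f]] mult_left_mono[OF _ C(1)]]
      by (simp add: mult.assoc)
  qed
  then show "\<exists>M\<ge>0. \<forall>f\<in>hardy p. cnorm p (toeplitz_hankel a b f) \<le> M * cnorm p f"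
    using A(1) B(1) C(1) by (intro exI[of _ "C * (A + B)"]) simp
qed (rule p)

lemma toeplitz_hankel_adjoint:
  assumes a: "a \<in> Linf_class" and b: "b \<in> Linf_class" and p: "1 < p"
  shows "adjoint_hardy_operators p (toeplitz_hankel a b) (toeplitz_hankel (bar a) (bar (tilde b)))"
proof -
  have q: "1 < conj_exp p" using p by (rule conj_exp_gt_1)
  have ab': "bar a \<in> Linf_class" "bar (tilde b) \<in> Linf_class" using a b by simp_all
  have "pairing (toeplitz_hankel a b f) h = pairing f (toeplitz_hankel (bar a) (bar (tilde b)) h)"
    if f: "f \<in> hardy p" and h: "h \<in> hardy (conj_exp p)" for f h
  proof -
    note Lp = toeplitz_hankel_Lp[OF a b f p] and Lq = toeplitz_hankel_Lp[OF ab' h q]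
    have "pairing (toeplitz_hankel a b f) h = pairing (a * f + b * reflect f) h"
      unfolding toeplitz_hankel_def by (rule pairing_riesz_left[OF Lp(3) h p])
    also have "\<dots> = pairing (a * f) h + pairing (b * reflect f) h"
      by (rule pairing_add[OF Lp(1,2) hardy_Lp[OF h] p])
    also have "pairing (a * f) h = pairing f (bar a * h)" by (simp add: pairing_def mult_ac)
    also have "pairing (b * reflect f) h = pairing f (bar (tilde b) * reflect h)"
    proof -
      have "tilde (b * reflect f * bar h) = f * bar (bar (tilde b) * reflect h)"
        by (simp add: reflect_def mult_ac)
      then show ?thesis using mean_tilde[of "b * reflect f * bar h"] by (simp add: pairing_def)
    qed
    also have "pairing f (bar a * h) + pairing f (bar (tilde b) * reflect h)
        = pairing f (bar a * h + bar (tilde b) * reflect h)"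
      using pairing_add[OF Lq(1,2), of f] hardy_Lp[OF f] q p by (simp add: pairing_commute[of f])
    also have "\<dots> = pairing f (toeplitz_hankel (bar a) (bar (tilde b)) h)"
      unfolding toeplitz_hankel_def by (rule pairing_riesz_right[OF f Lq(3) p, symmetric])
    finally show ?thesis .
  qed
  then show ?thesis
    using toeplitz_hankel_hardy_operator[OF a b p] toeplitz_hankel_hardy_operator[OF ab' q]
    by (intro adjoint_hardy_operators.intro adjoint_hardy_operators_axioms.intro)
qed

definition toeplitz :: "circle_fun \<Rightarrow> circle_fun \<Rightarrow> circle_fun" where
  "toeplitz g f = riesz (g * f)"

definition toeplitz_invertible :: "real \<Rightarrow> circle_fun \<Rightarrow> bool" where
  "toeplitz_invertible p g \<longleftrightarrow> bij_betw (toeplitz g) (hardy p) (hardy p)"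

lemma fourier_toeplitz:
  "g \<in> Linf_class \<Longrightarrow> f \<in> hardy p \<Longrightarrow> 1 < p \<Longrightarrow>
      fourier (toeplitz g f) j = (if 0 \<le> j then fourier (g * f) j else 0)"
  by (simp add: toeplitz_def fourier_riesz[OF Linf_mult_hardy])

lemma toeplitz_eq_0_iff: "g \<in> Linf_class \<Longrightarrow> f \<in> hardy p \<Longrightarrow> 1 < p \<Longrightarrow> toeplitz g f = 0 \<longleftrightarrow> g * f \<in> cohardy p"
  unfolding toeplitz_def by (intro riesz_eq_0_iff Linf_mult_hardy)

lemma toeplitz_mult_assoc: "toeplitz (g * h) f = toeplitz g (h * f)"
  by (simp add: toeplitz_def mult.assoc)

lemma toeplitz_hankel_0: "toeplitz_hankel g 0 = toeplitz g"
  by (simp add: fun_eq_iff toeplitz_hankel_def toeplitz_def)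

lemma toeplitz_hardy_operator: "g \<in> Linf_class \<Longrightarrow> 1 < p \<Longrightarrow> hardy_operator p (toeplitz g)"
  using toeplitz_hankel_hardy_operator[of g 0 p] by (simp add: toeplitz_hankel_0)

lemma toeplitz_adjoint:
  "g \<in> Linf_class \<Longrightarrow> 1 < p \<Longrightarrow> adjoint_hardy_operators p (toeplitz g) (toeplitz (bar g))"
  using toeplitz_hankel_adjoint[of g 0 p] by (simp add: toeplitz_hankel_0)

lemma toeplitz_invertible_bar:
  "g \<in> Linf_class \<Longrightarrow> 1 < p \<Longrightarrow> toeplitz_invertible p g \<Longrightarrow> toeplitz_invertible (conj_exp p) (bar g)"
  unfolding toeplitz_invertible_def
  by (rule adjoint_hardy_operators.adjoint_bij_betw[OF toeplitz_adjoint])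

lemma toeplitz_invertibleI:
  assumes g: "g \<in> Linf_class" and p: "1 < p"
    and inj: "\<And>f. f \<in> hardy p \<Longrightarrow> toeplitz g f = 0 \<Longrightarrow> f = 0" and surj: "toeplitz g ` hardy p = hardy p"
  shows "toeplitz_invertible p g"
proof -
  interpret hardy_operator p "toeplitz g" using g p by (rule toeplitz_hardy_operator)
  have "inj_on (toeplitz g) (hardy p)"
    using inj[OF hardy_diff] p by (intro inj_onI) (metis diff eq_iff_diff_eq_0)
  then show ?thesis using surj by (simp add: toeplitz_invertible_def bij_betw_def)
qed

section \<open>Closed subspaces and Coburn's lemma\<close>

interpretation circle: vector_space "\<lambda>c f. const c * f"
  by unfold_locales (simp_all add: const_add const_mult_assoc distrib_left distrib_right)

definition closed_in_hardy :: "real \<Rightarrow> circle_fun set \<Rightarrow> bool" where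
  "closed_in_hardy p S \<longleftrightarrow> S \<subseteq> hardy p \<and> (\<forall>F f. (\<forall>n. F n \<in> S) \<and> f \<in> hardy p \<and> Lp_conv p F f \<longrightarrow> f \<in> S)"

lemma closed_in_hardyD:
  assumes "closed_in_hardy p S"
  shows "S \<subseteq> hardy p" "(\<And>n. F n \<in> S) \<Longrightarrow> f \<in> hardy p \<Longrightarrow> Lp_conv p F f \<Longrightarrow> f \<in> S"
  using assms by (auto simp: closed_in_hardy_def)

lemma closed_dense_eq_hardy:
  assumes closed: "closed_in_hardy p S" and dense: "analytic_polys \<subseteq> S" and p: "1 < p"
  shows "S = hardy p"
proof (intro equalityI subsetI)
  fix f assume f: "f \<in> hardy p"
  obtain u where u: "\<And>n. u n \<in> analytic_polys" "Lp_conv p u f" using analytic_polys_dense[OF f p] by blast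
  then show "f \<in> S" using closed_in_hardyD(2)[OF closed, of u f] f dense by blast
qed (use closed_in_hardyD(1)[OF closed] in blast)

lemma closed_in_hardy_distance:
  assumes closed: "closed_in_hardy p S" and v: "v \<in> hardy p" "v \<notin> S"
  obtains \<delta> where "0 < \<delta>" "\<And>s. s \<in> S \<Longrightarrow> \<delta> \<le> cnorm p (s - v)"
proof (rule ccontr)
  assume "\<not> thesis"
  then have "\<exists>s\<in>S. cnorm p (s - v) < 1 / (real n + 1)" for n
    using that[of "1 / (real n + 1)"] by (auto simp: not_le[symmetric])
  then obtain s where s: "\<And>n. s n \<in> S" "\<And>n. cnorm p (s n - v) < 1 / (real n + 1)" by metis
  have "Lp_conv p s v" using s(2) by (intro Lp_convI[OF _ LIMSEQ_1_over_Suc] less_imp_le)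
  then show False using closed_in_hardyD(2)[OF closed, of s v] s(1) v by blast
qed

lemma distance_scale:
  assumes S: "circle.subspace S" and p: "1 < p"
    and \<delta>: "0 < \<delta>" "\<And>s. s \<in> S \<Longrightarrow> \<delta> \<le> cnorm p (s - v)" and s: "s \<in> S"
  shows "norm c * \<delta> \<le> cnorm p (s + const c * v)"
proof (cases "c = 0")
  case False
  define t where "t = const (- 1 / c) * s"
  have "t \<in> S" unfolding t_def using S s by (rule circle.subspace_scale)
  have "const (- c) * t = s" using False const_mult_assoc[of "- c" "- 1 / c" s] by (simp add: t_def)
  then have "s + const c * v = const (- c) * (t - v)"
    unfolding right_diff_distrib by (simp add: const_uminus)
  then have "cnorm p (s + const c * v) = norm (- c) * cnorm p (t - v)"
    using p by (simp only: cnorm_const_mult)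
  then show ?thesis using \<delta>(2)[OF \<open>t \<in> S\<close>] by (simp add: mult_left_mono)
qed simp

lemma Cauchy_span_insert_coefficients:
  assumes S: "circle.subspace S" and p: "1 < p" and \<delta>: "0 < \<delta>" "\<And>s. s \<in> S \<Longrightarrow> \<delta> \<le> cnorm p (s - v)"
    and F: "\<And>n::nat. F n - const (c n) * v \<in> S" "\<And>n. F n \<in> Lp_class p"
      and f: "f \<in> Lp_class p" "Lp_conv p F f"
  shows "Cauchy c"
proof (rule metric_CauchyI)
  have diff: "dist (c m) (c n) * \<delta> \<le> cnorm p (F m - f) + cnorm p (F n - f)" for m n
  proof -
    have "dist (c m) (c n) * \<delta> \<le> cnorm p (F m - F n)"
      using distance_scale[OF S p \<delta> circle.subspace_diff[OF S F(1) F(1)], of "c m - c n" m n]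
      by (simp add: dist_norm const_diff algebra_simps)
    also have "\<dots> \<le> cnorm p (F m - f) + cnorm p (f - F n)" by (intro cnorm_triangle_via F f(1) p)
    finally show ?thesis using p by (simp add: cnorm_minus_commute[of p f])
  qed
  fix e :: real assume "0 < e"
  then obtain N where N: "\<And>n. N \<le> n \<Longrightarrow> cnorm p (F n - f) < e * \<delta> / 2"
    using order_tendstoD(2)[OF f(2)[unfolded Lp_conv_def], of "e * \<delta> / 2"] \<delta>(1)
    by (auto simp: eventually_sequentially)
  have "dist (c m) (c n) < e" if "N \<le> m" "N \<le> n" for m n
  proof -
    have "dist (c m) (c n) * \<delta> < e * \<delta>" using diff[of m n] N[OF that(1)] N[OF that(2)] by linarith
    then show ?thesis using \<delta>(1) by simp
  qed
  then show "\<exists>N. \<forall>m\<ge>N. \<forall>n\<ge>N. dist (c m) (c n) < e" by blast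
qed

lemma Lp_conv_diff_const_mult:
  assumes F: "\<And>n. F n \<in> Lp_class p" "f \<in> Lp_class p" "Lp_conv p F f" and v: "v \<in> Lp_class p"
    and c: "c \<longlonglongrightarrow> c0" and p: "1 < p"
  shows "Lp_conv p (\<lambda>n. F n - const (c n) * v) (f - const c0 * v)"
proof (rule Lp_convI)
  show "cnorm p ((F n - const (c n) * v) - (f - const c0 * v))
      \<le> cnorm p (F n - f) + norm (c n - c0) * cnorm p v" for n
  proof -
    have "(F n - const (c n) * v) - (f - const c0 * v) = (F n - f) - const (c n - c0) * v"
      by (simp add: const_diff algebra_simps)
    moreover have "cnorm p (F n - f - const (c n - c0) * v)
        \<le> cnorm p (F n - f) + cnorm p (const (c n - c0) * v)"
      using F(1)[of n] F(2) v p
      by (intro cnorm_triangle_diff) (simp_all add: Lp_class_diff Lp_class_const_mult)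
    ultimately show ?thesis using p by (simp only: cnorm_const_mult)
  qed
  have "(\<lambda>n. cnorm p (F n - f) + norm (c n - c0) * cnorm p v) \<longlonglongrightarrow> 0 + 0"
    using c by (intro tendsto_add F(3)[unfolded Lp_conv_def] tendsto_mult_left_zero tendsto_norm_zero
      LIM_zero)
  then show "(\<lambda>n. cnorm p (F n - f) + norm (c n - c0) * cnorm p v) \<longlonglongrightarrow> 0" by simp
qed

lemma closed_in_hardy_span_insert:
  assumes S: "circle.subspace S" and closed: "closed_in_hardy p S" and v: "v \<in> hardy p" and p: "1 < p"
  shows "closed_in_hardy p {f. \<exists>c. f - const c * v \<in> S}"
proof (cases "v \<in> S")
  case True
  have "f \<in> S" if "f - const c * v \<in> S" for f c
    using circle.subspace_add[OF S that circle.subspace_scale[OF S True, of c]] by simp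
  then have "{f. \<exists>c. f - const c * v \<in> S} = S" by (auto intro: exI[of _ 0])
  then show ?thesis using closed by simp
next
  case False
  obtain \<delta> where \<delta>: "0 < \<delta>" "\<And>s. s \<in> S \<Longrightarrow> \<delta> \<le> cnorm p (s - v)"
    using closed_in_hardy_distance[OF closed v False] by blast
  have "\<exists>c. f - const c * v \<in> S" if F: "\<And>n. \<exists>c. F n - const c * v \<in> S" and f: "f \<in> hardy p"
    and conv: "Lp_conv p F f" for F f
  proof -
    obtain c where c: "\<And>n. F n - const (c n) * v \<in> S" using F by metis
    have F_hardy: "F n \<in> hardy p" for n
      using hardy_add[of "F n - const (c n) * v" p "const (c n) * v"] c closed_in_hardyD(1)[OF closed] v p
      by (auto intro: hardy_const_mult)
    have "Cauchy c" using S p \<delta> c hardy_Lp[OF F_hardy] hardy_Lp[OF f] conv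
      by (rule Cauchy_span_insert_coefficients)
    then obtain c0 where c0: "c \<longlonglongrightarrow> c0" using Cauchy_convergent[of c] unfolding convergent_def by blast
    have "Lp_conv p (\<lambda>n. F n - const (c n) * v) (f - const c0 * v)"
      using hardy_Lp[OF F_hardy] hardy_Lp[OF f] conv hardy_Lp[OF v] c0 p by (rule Lp_conv_diff_const_mult)
    then show ?thesis
      using closed_in_hardyD(2)[OF closed, of "\<lambda>n. F n - const (c n) * v"] c f v p
      by (intro exI[of _ c0]) (simp add: hardy_diff hardy_const_mult)
  qed
  moreover have "f \<in> hardy p" if "f - const c * v \<in> S" for f c
    using hardy_add[of "f - const c * v" p "const c * v"] that closed_in_hardyD(1)[OF closed] v p
    by (auto intro: hardy_const_mult)
  ultimately show ?thesis by (auto simp: closed_in_hardy_def)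
qed

lemma toeplitz_range_subspace:
  assumes "g \<in> Linf_class" "1 < p" shows "circle.subspace (toeplitz g ` hardy p)"
proof -
  interpret hardy_operator p "toeplitz g" using assms by (rule toeplitz_hardy_operator)
  show ?thesis
    unfolding circle.subspace_def using exponent
    by (auto simp flip: add scale simp: hardy_add hardy_const_mult intro!: image_eqI[of 0 _ 0])
qed

lemma triangular_family_spans:
  assumes S: "circle.subspace S" and v: "\<And>k::nat. v k \<in> S" "\<And>k. v k \<in> hardy p"
      "\<And>k. fourier (v k) (int k) \<noteq> 0" "\<And>k i. int k < i \<Longrightarrow> fourier (v k) i = 0"
    and p: "1 < p" and w: "w \<in> hardy p" "\<And>i. int k \<le> i \<Longrightarrow> fourier w i = 0"
  shows "w \<in> S"
  using w
proof (induction k arbitrary: w)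
  case 0
  have "w = 0"
    using 0 hardy_fourier_neg[OF 0(1)] p
    by (intro fourier_eqI) (auto simp: hardy_imp_L1 not_le[symmetric])
  then show ?case using circle.subspace_0[OF S] by simp
next
  case (Suc k)
  define c where "c = fourier w (int k) / fourier (v k) (int k)"
  have "w - const c * v k \<in> S"
  proof (rule Suc.IH)
    show "w - const c * v k \<in> hardy p" using Suc.prems(1) v(2) p by (intro hardy_diff hardy_const_mult)
    fix i assume i: "int k \<le> i"
    have "fourier (w - const c * v k) i = fourier w i - c * fourier (v k) i"
      using fourier_diff_Lp[OF hardy_Lp[OF Suc.prems(1)] hardy_Lp[OF hardy_const_mult[OF v(2) p]] p]
      by simp
    then show "fourier (w - const c * v k) i = 0"
      using i v(3)[of k] Suc.prems(2)[of i] v(4)[of k i] by (cases "i = int k") (simp_all add: c_def)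
  qed
  from circle.subspace_add[OF S this circle.subspace_scale[OF S v(1), of c k]]
  show ?case by simp
qed

text \<open>If the highest Fourier coefficient of \<open>g * f\<close> has index \<open>j \<le> 0\<close>, then
  \<open>toeplitz g (tpow (k - j) * f)\<close> is an analytic polynomial of exact degree \<open>k\<close>.\<close>

lemma analytic_polys_subset_toeplitz_range:
  assumes g: "g \<in> Linf_class" and f: "f \<in> hardy p" and p: "1 < p"
    and j: "j \<le> 0" "fourier (g * f) j \<noteq> 0" and top: "\<And>i. j < i \<Longrightarrow> fourier (g * f) i = 0"
  shows "analytic_polys \<subseteq> toeplitz g ` hardy p"
proof -
  note subspace = toeplitz_range_subspace[OF g p]
  define v where "v k = toeplitz g (tpow (int k - j) * f)" for k :: nat
  have hardy: "tpow (int k - j) * f \<in> hardy p" for k using f j p by (intro hardy_tpow_mult) auto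
  then have v_range: "v k \<in> toeplitz g ` hardy p" for k by (simp add: v_def)
  have v_hardy: "v k \<in> hardy p" for k
    unfolding v_def by (rule hardy_operator.maps[OF toeplitz_hardy_operator[OF g p] hardy])
  have fourier_v: "fourier (v k) i = (if 0 \<le> i then fourier (g * f) (i - (int k - j)) else 0)" for k i
  proof -
    have "g * (tpow (int k - j) * f) = tpow (int k - j) * (g * f)" by (simp only: mult_ac)
    then show ?thesis unfolding v_def fourier_toeplitz[OF g hardy p] by (simp only: fourier_tpow_mult)
  qed
  have v_top: "fourier (v k) (int k) \<noteq> 0" "int k < i \<Longrightarrow> fourier (v k) i = 0" for k i
    using j(2) top[of "i - (int k - j)"] by (simp_all add: fourier_v)
  have "tpow k \<in> toeplitz g ` hardy p" if "0 \<le> k" for k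
    using subspace v_range v_hardy v_top p
  proof (rule triangular_family_spans)
    show "fourier (tpow k) i = 0" if "int (nat (k + 1)) \<le> i" for i
      using that \<open>0 \<le> k\<close> by (simp add: fourier_tpow)
  qed (simp_all add: p \<open>0 \<le> k\<close>)
  then show ?thesis
    by (intro subsetI, induct_tac rule: monom_span.induct)
      (auto intro!: circle.subspace_0[OF subspace] circle.subspace_add[OF subspace]
        circle.subspace_scale[OF subspace])
qed

lemma cohardy_top_coefficient:
  assumes m: "m \<in> cohardy p" "m \<noteq> 0" and p: "1 < p"
  obtains j where "j < 0" "fourier m j \<noteq> 0" "\<And>i. j < i \<Longrightarrow> fourier m i = 0"
proof -
  obtain j where "fourier m j \<noteq> 0"
    using m fourier_unique[of m] Lp_class_imp_L1[OF cohardy_Lp[OF m(1)] p] by blast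
  moreover from this have "j < 0" using cohardy_fourier_nonneg[OF m(1)] by (meson not_le)
  ultimately have ex: "\<exists>i. fourier m (- int i) \<noteq> 0" by (intro exI[of _ "nat (- j)"]) simp
  define i where "i = (LEAST i. fourier m (- int i) \<noteq> 0)"
  have i: "fourier m (- int i) \<noteq> 0" unfolding i_def using ex by (rule LeastI_ex)
  show thesis
  proof (rule that[of "- int i"])
    show "- int i < 0" using i cohardy_fourier_nonneg[OF m(1), of "- int i"] by (meson not_le)
    show "fourier m l = 0" if "- int i < l" for l
    proof (cases "0 \<le> l")
      case False
      then have "nat (- l) < i" using that by linarith
      then have "fourier m (- int (nat (- l))) = 0" unfolding i_def using not_less_Least by blast
      then show ?thesis using False by simp
    qed (rule cohardy_fourier_nonneg[OF m(1)])
  qed (rule i)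
qed

theorem Coburn:
  assumes g: "g \<in> Linf_class" "g * inverse g = 1" and closed: "closed_in_hardy p (toeplitz g ` hardy p)"
    and p: "1 < p"
    and f: "f \<in> hardy p" "f \<noteq> 0" "toeplitz g f = 0"
  shows "toeplitz g ` hardy p = hardy p"
proof -
  have cohardy: "g * f \<in> cohardy p" using f p g(1) by (simp add: toeplitz_eq_0_iff)
  have nonzero: "g * f \<noteq> 0"
  proof
    assume "g * f = 0"
    moreover have "(g * inverse g) * f = inverse g * (g * f)" by (simp only: mult_ac)
    ultimately show False using f(2) g(2) by simp
  qed
  obtain j where "j < 0" "fourier (g * f) j \<noteq> 0" "\<And>i. j < i \<Longrightarrow> fourier (g * f) i = 0"
    by (rule cohardy_top_coefficient[OF cohardy nonzero p]) (rule that)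
  then have "analytic_polys \<subseteq> toeplitz g ` hardy p"
    using analytic_polys_subset_toeplitz_range[OF g(1) f(1) p, of j] by simp
  then show ?thesis by (rule closed_dense_eq_hardy[OF closed _ p])
qed

section \<open>Complements of finite dimension\<close>

context vector_space
begin

lemma hyperplane_basis:
  assumes K: "finite K" "independent K" and N: "subspace N" "N \<subseteq> span K" and e: "e \<in> span K" "e \<notin> N"
    and hyperplane: "\<And>y. y \<in> span K \<Longrightarrow> \<exists>c. y - scale c e \<in> N"
  obtains B where "finite B" "independent B" "span B = N" "card K = Suc (card B)"
proof -
  obtain B where B: "B \<subseteq> N" "independent B" "N \<subseteq> span B" by (rule basis_exists)
  then have span_B: "span B = N" using N(1) by (intro span_subspace)
  have independent: "independent (insert e B)" using e(2) B(2) span_B by (intro independent_insertI) auto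
  have "span (insert e B) = span K"
  proof (intro equalityI)
    show "span (insert e B) \<subseteq> span K" using e(1) B(1) N(2) by (intro span_minimal) auto
    show "span K \<subseteq> span (insert e B)" using hyperplane by (auto simp: span_insert span_B)
  qed
  then have card: "card K = card (insert e B)" by (metis K(2) independent dim_eq_card)
  have "finite B" using independent_span_bound[OF K(1) B(2)] B(1) N(2) by blast
  moreover have "e \<notin> B" using e(2) B(1) by blast
  ultimately show thesis using that[of B] B(2) span_B card by simp
qed

definition is_complement :: "'b set \<Rightarrow> 'b set \<Rightarrow> 'b set \<Rightarrow> bool" where
  "is_complement R C H \<longleftrightarrow> finite C \<and> independent C \<and> span C \<inter> R = {0}
      \<and> H = {r + s | r s. r \<in> R \<and> s \<in> span C}"

lemma independent_span_not_trivial: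
  assumes "independent C" "C \<noteq> {}" shows "\<not> span C \<subseteq> {0}"
proof -
  obtain v where v: "v \<in> C" using assms(2) by blast
  then have "v \<noteq> 0" using assms(1) dependent_zero by metis
  then show ?thesis using span_base[OF v] by blast
qed

lemma is_complement_self:
  assumes H: "subspace H" and complement: "local.is_complement H C H"
  shows "C = {}"
proof -
  have C: "independent C" "span C \<inter> H = {0}" and H_eq: "H = {r + s | r s. r \<in> H \<and> s \<in> span C}"
    using complement by (auto simp: is_complement_def)
  have "s \<in> H" if "s \<in> span C" for s
  proof -
    have "0 + s \<in> {r + s | r s. r \<in> H \<and> s \<in> span C}" using that subspace_0[OF H] by blast
    then show ?thesis by (simp only: H_eq[symmetric] add_0)
  qed
  then have "span C \<subseteq> {0}" using C(2) by blast
  then show ?thesis using independent_span_not_trivial[OF C(1)] by blast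
qed

lemma is_complement_exchange:
  assumes complement: "local.is_complement R C H" and R: "subspace R" and u: "u \<in> H" "u \<notin> R"
  obtains C0 where "finite C0" "independent C0" "card C = Suc (card C0)" "span C0 \<subseteq> span C"
    "\<And>r s k. r \<in> R \<Longrightarrow> s \<in> span C0 \<Longrightarrow> r + s = scale k u \<Longrightarrow> s = 0"
    "\<And>y. y \<in> H \<Longrightarrow> \<exists>r\<in>R. \<exists>s\<in>span C0. \<exists>k. y = r + s + scale k u"
proof -
  have C: "finite C" "independent C" "span C \<inter> R = {0}" and H: "H = {r + s | r s. r \<in> R \<and> s \<in> span C}"
    using complement by (auto simp: is_complement_def)
  obtain r1 w where r1: "r1 \<in> R" and w: "w \<in> span C" and u_eq: "u = r1 + w" using u(1) H by auto
  then have "w \<noteq> 0" using u(2) by auto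
  then have "independent {w}" by simp
  then obtain B where B: "{w} \<subseteq> B" "B \<subseteq> span C" "independent B" "span C \<subseteq> span B"
    using maximal_independent_subset_extend[of "{w}" "span C"] w by blast
  have finite_B: "finite B" using independent_span_bound[OF C(1) B(3,2)] by blast
  have span_B: "span B = span C" using B(2,4) span_minimal[OF B(2)] by (intro equalityI) auto
  define C0 where "C0 = B - {w}"
  have B_insert: "B = insert w C0" and w_C0: "w \<notin> C0" using B(1) by (auto simp: C0_def)
  have w_span: "w \<notin> span C0" using B(3) w_C0 unfolding B_insert by (simp add: independent_insert)
  show thesis
  proof (rule that[of C0])
    show "finite C0" using finite_B by (simp add: C0_def)
    show "independent C0" unfolding C0_def using B(3) by (rule independent_mono) auto
    have "card B = card C" using B(3) C(2) span_B dim_eq_card by metis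
    then show "card C = Suc (card C0)" using finite_B w_C0 by (simp add: B_insert)
    show C0_C: "span C0 \<subseteq> span C" unfolding span_B[symmetric] C0_def by (intro span_mono) auto
    show "s = 0" if r: "r \<in> R" and s: "s \<in> span C0" and eq: "r + s = scale k u" for r s k
    proof -
      have "s - scale k w = (r + s) - (r + scale k w)" by simp
      also have "\<dots> = scale k r1 - r" unfolding eq by (simp add: u_eq scale_right_distrib)
      finally have "s - scale k w = scale k r1 - r" .
      moreover have "scale k r1 - r \<in> R" using R r r1 by (intro subspace_diff subspace_scale)
      moreover have "s - scale k w \<in> span C" using s C0_C w by (intro span_diff span_scale) auto
      ultimately have "s - scale k w \<in> span C \<inter> R" by simp
      then have "s = scale k w" unfolding C(3) by simp
      then show ?thesis using s w_span span_scale[of s C0 "inverse k"] by (cases "k = 0") auto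
    qed
    show "\<exists>r\<in>R. \<exists>s\<in>span C0. \<exists>k. y = r + s + scale k u" if "y \<in> H" for y
    proof -
      obtain r s where r: "r \<in> R" and s: "s \<in> span B" and y: "y = r + s"
        using \<open>y \<in> H\<close> unfolding H span_B by blast
      obtain k where "s - scale k w \<in> span C0" using s unfolding B_insert span_insert by blast
      moreover have "y = (r - scale k r1) + (s - scale k w) + scale k u"
        by (simp add: y u_eq scale_right_distrib)
      moreover have "r - scale k r1 \<in> R" using R r r1 by (intro subspace_diff subspace_scale)
      ultimately show ?thesis by blast
    qed
  qed
qed

lemma is_complement_image:
  assumes complement: "local.is_complement R C H" and R: "subspace R" and H: "subspace H"
    and S: "Vector_Spaces.linear scale scale S"
    and u: "u \<in> H" "u \<notin> R" "S u = 0" and kernel: "\<And>y. y \<in> H \<Longrightarrow> S y = 0 \<Longrightarrow> \<exists>k. y = scale k u"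
  obtains C' where "local.is_complement (S ` R) C' (S ` H)" "card C = Suc (card C')"
proof -
  interpret S: Vector_Spaces.linear scale scale S by (rule S)
  have H_eq: "H = {r + s | r s. r \<in> R \<and> s \<in> span C}" using complement by (simp add: is_complement_def)
  obtain C0 where C0: "finite C0" "independent C0" "card C = Suc (card C0)" "span C0 \<subseteq> span C"
    and independent: "\<And>r s k. r \<in> R \<Longrightarrow> s \<in> span C0 \<Longrightarrow> r + s = scale k u \<Longrightarrow> s = 0"
    and spanning: "\<And>y. y \<in> H \<Longrightarrow> \<exists>r\<in>R. \<exists>s\<in>span C0. \<exists>k. y = r + s + scale k u"
    using is_complement_exchange[OF complement R u(1,2)] by metis
  have sum_H: "r + s \<in> H" if "r \<in> R" "s \<in> span C0" for r s using that C0(4) by (auto simp: H_eq)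
  have disjoint: "s = 0" if r: "r \<in> R" and s: "s \<in> span C0" and eq: "S s = S r" for r s
  proof -
    have neg_r: "- r \<in> R" using R r by (rule subspace_neg)
    have "S (- r + s) = 0" by (simp add: S.diff eq)
    then obtain k where "- r + s = scale k u" using kernel sum_H[OF neg_r s] by blast
    then show ?thesis using independent[OF neg_r s] by blast
  qed
  have inj: "inj_on S (span C0)"
    using disjoint[OF subspace_0[OF R] span_diff] by (intro inj_onI) (simp add: S.diff S.zero)
  have "independent (S ` C0)" using C0(2) inj by (rule S.independent_injective_image)
  moreover have "card (S ` C0) = card C0" using inj_on_subset[OF inj span_superset] by (rule card_image)
  moreover have "span (S ` C0) \<inter> S ` R = {0}"
    unfolding S.span_image using disjoint subspace_0[OF R] span_zero[of C0] S.zero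
    by (auto simp: image_iff) (metis S.zero)+
  moreover have "S ` H = {r + s | r s. r \<in> S ` R \<and> s \<in> span (S ` C0)}"
    unfolding S.span_image
  proof (intro equalityI subsetI)
    fix y assume "y \<in> S ` H"
    then obtain r s k where "r \<in> R" "s \<in> span C0" "y = S (r + s + scale k u)" using spanning by blast
    then show "y \<in> {r + s | r s. r \<in> S ` R \<and> s \<in> S ` span C0}" by (auto simp: S.add S.scale u(3))
  next
    fix y assume "y \<in> {r + s | r s. r \<in> S ` R \<and> s \<in> S ` span C0}"
    then show "y \<in> S ` H" using sum_H by (auto simp flip: S.add)
  qed
  ultimately show thesis using that[of "S ` C0"] C0(1,3) by (simp add: is_complement_def)
qed

end

section \<open>From the Fredholm index to invertibility\<close>

interpretation seq: vector_space "\<lambda>(c::complex) (y::int \<Rightarrow> complex) j. c * y j"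
  by unfold_locales (simp_all add: fun_eq_iff algebra_simps)

lemma lincomb_sum: "lincomb K u = (\<Sum>v\<in>K. (\<lambda>j. u v * v j))"
  by (induction K rule: infinite_finite_induct) (simp_all add: lincomb_def fun_eq_iff)

lemma cspan_eq_span: "finite K \<Longrightarrow> cspan K = seq.span K"
  by (auto simp: cspan_def lincomb_sum seq.span_finite)

lemma cindep_iff_independent: "finite K \<Longrightarrow> cindep K \<longleftrightarrow> seq.independent K"
  by (auto simp: cindep_def lincomb_sum seq.dependent_finite zero_fun_def)

lemma fourier_hardy_eq_iff: "f \<in> hardy p \<Longrightarrow> g \<in> hardy p \<Longrightarrow> 1 < p \<Longrightarrow> fourier f = fourier g \<longleftrightarrow> f = g"
  by (auto intro: fourier_eqI hardy_imp_L1)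

lemma fourier_image_subspace:
  assumes V: "circle.subspace V" "V \<subseteq> hardy p" and p: "1 < p"
  shows "seq.subspace (fourier ` V)"
proof (rule seq.subspaceI)
  show "0 \<in> fourier ` V" using circle.subspace_0[OF V(1)]
    by (intro image_eqI[of _ _ 0]) (simp_all add: fun_eq_iff)
  show "(\<lambda>j. c * y j) \<in> fourier ` V" if "y \<in> fourier ` V" for c y
    using that circle.subspace_scale[OF V(1), of _ c]
    by (auto simp: fun_eq_iff intro!: image_eqI[of _ _ "const c * _"])
  show "x + y \<in> fourier ` V" if xy: "x \<in> fourier ` V" "y \<in> fourier ` V" for x y
  proof -
    obtain f g where fg: "f \<in> V" "g \<in> V" "x = fourier f" "y = fourier g" using xy by blast
    then have "f \<in> Lp_class p" "g \<in> Lp_class p" using V(2) by (auto intro: hardy_Lp)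
    then have "x + y = fourier (f + g)" using fg p by (simp add: fun_eq_iff fourier_add_Lp)
    then show ?thesis using circle.subspace_add[OF V(1) fg(1,2)] by blast
  qed
qed

lemma hardy_subspace: "1 < p \<Longrightarrow> circle.subspace (hardy p)"
  by (simp add: circle.subspace_def hardy_add hardy_const_mult)

lemma toeplitz_kernel_nonzero_constant_term:
  assumes g: "g \<in> Linf_class" and p: "1 < p" and f: "f \<in> hardy p" "f \<noteq> 0" "toeplitz g f = 0"
  obtains e where "e \<in> hardy p" "toeplitz g e = 0" "fourier e 0 \<noteq> 0"
proof -
  have "reflect f \<noteq> 0"
  proof
    assume "reflect f = 0"
    then have "f = reflect 0" using reflect_reflect[of f] by simp
    then show False using f(2) by (simp add: reflect_def)
  qed
  then obtain j where j: "j < 0" "fourier (reflect f) j \<noteq> 0" "\<And>i. j < i \<Longrightarrow> fourier (reflect f) i = 0"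
    using cohardy_top_coefficient[OF reflect_hardy[OF f(1) p] _ p] by metis
  define k where "k = - j - 1"
  have k: "0 \<le> k" "fourier f k \<noteq> 0" "\<And>i. i < k \<Longrightarrow> fourier f i = 0"
    using j(1,2) j(3)[of "- _ - 1"] by (auto simp: k_def)
  have "tpow (- k) * f \<in> hardy p" using f(1) p k(3) by (intro hardy_tpow_mult) auto
  moreover have "toeplitz g (tpow (- k) * f) = 0"
  proof -
    have "g * f \<in> cohardy p" using f g p by (simp add: toeplitz_eq_0_iff)
    then have "tpow (- k) * (g * f) \<in> cohardy p"
      using k(1) p by (simp add: cohardy_def Lp_class_tpow_mult)
    then show ?thesis unfolding toeplitz_def mult.left_commute[of g] by (rule riesz_cohardy)
  qed
  ultimately show thesis using that k(2) by simp
qed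

lemma hardy_divide_t:
  assumes "f \<in> hardy p" "1 < p" "fourier f 0 = 0" shows "tpow (- 1) * f \<in> hardy p"
proof (rule hardy_tpow_mult[OF assms(1,2)])
  fix j :: int assume "0 \<le> j" "j + - 1 < 0"
  then have "j = 0" by simp
  then show "fourier f j = 0" using assms(3) by simp
qed

lemma toeplitz_surjective_step:
  assumes g: "g \<in> Linf_class" and p: "1 < p" and surj: "toeplitz g ` hardy p = hardy p"
    and e: "e \<in> hardy p" "toeplitz g e = 0" "fourier e 0 \<noteq> 0"
  shows "toeplitz (g * tpow 1) ` hardy p = hardy p"
proof (intro equalityI subsetI)
  interpret T: hardy_operator p "toeplitz g" using g p by (rule toeplitz_hardy_operator)
  fix y assume "y \<in> hardy p"
  then obtain r where r: "r \<in> hardy p" "toeplitz g r = y" using surj by (metis imageE)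
  define r' where "r' = r - const (fourier r 0 / fourier e 0) * e"
  have r': "r' \<in> hardy p" unfolding r'_def using r(1) e(1) p by (intro hardy_diff hardy_const_mult)
  have "fourier r' 0 = 0"
    using fourier_diff_Lp[OF hardy_Lp[OF r(1)] hardy_Lp[OF hardy_const_mult[OF e(1) p]] p] e(3)
    by (simp add: r'_def)
  then have "tpow (- 1) * r' \<in> hardy p" using r' p by (intro hardy_divide_t)
  moreover have "toeplitz (g * tpow 1) (tpow (- 1) * r') = y"
    using r e p by (simp add: toeplitz_mult_assoc tpow_mult_assoc r'_def T.diff T.scale hardy_const_mult)
  ultimately show "y \<in> toeplitz (g * tpow 1) ` hardy p" by blast
next
  interpret hardy_operator p "toeplitz (g * tpow 1)" using g p by (intro toeplitz_hardy_operator) simp_all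
  show "y \<in> hardy p" if "y \<in> toeplitz (g * tpow 1) ` hardy p" for y using that maps by blast
qed

definition toeplitz_kernel :: "real \<Rightarrow> circle_fun \<Rightarrow> circle_fun set" where
  "toeplitz_kernel p g = {f \<in> hardy p. toeplitz g f = 0}"

lemma toeplitz_kernel_step:
  assumes p: "1 < p"
  shows "fourier ` toeplitz_kernel p (g * tpow 1)
    = (\<lambda>y j. y (j + 1)) ` {y \<in> fourier ` toeplitz_kernel p g. y 0 = 0}"
proof (intro equalityI subsetI)
  fix y assume "y \<in> fourier ` toeplitz_kernel p (g * tpow 1)"
  then obtain f where f: "f \<in> hardy p" "toeplitz (g * tpow 1) f = 0" "y = fourier f"
    by (auto simp: toeplitz_kernel_def)
  have "tpow 1 * f \<in> toeplitz_kernel p g"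
    using f p hardy_tpow_mult[of f p 1] by (simp add: toeplitz_kernel_def toeplitz_mult_assoc)
  moreover have "fourier (tpow 1 * f) 0 = 0" using hardy_fourier_neg[OF f(1), of "- 1"] by simp
  moreover have "y = (\<lambda>j. fourier (tpow 1 * f) (j + 1))" by (simp add: f(3))
  ultimately show "y \<in> (\<lambda>y j. y (j + 1)) ` {y \<in> fourier ` toeplitz_kernel p g. y 0 = 0}" by blast
next
  fix y assume "y \<in> (\<lambda>y j. y (j + 1)) ` {y \<in> fourier ` toeplitz_kernel p g. y 0 = 0}"
  then obtain h where h: "h \<in> hardy p" "toeplitz g h = 0" "fourier h 0 = 0" "y = (\<lambda>j. fourier h (j + 1))"
    by (auto simp: toeplitz_kernel_def)
  then have "tpow (- 1) * h \<in> toeplitz_kernel p (g * tpow 1)"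
    using p by (simp add: toeplitz_kernel_def toeplitz_mult_assoc tpow_mult_assoc hardy_divide_t)
  moreover have "y = fourier (tpow (- 1) * h)" by (simp add: h(4) fun_eq_iff)
  ultimately show "y \<in> fourier ` toeplitz_kernel p (g * tpow 1)" by blast
qed

lemma toeplitz_kernel_step_basis:
  assumes p: "1 < p" and K: "finite K" "seq.independent K" "seq.span K = fourier ` toeplitz_kernel p g"
    and e: "e \<in> hardy p" "toeplitz g e = 0" "fourier e 0 \<noteq> 0"
  obtains B where "finite B" "seq.independent B" "seq.span B = fourier ` toeplitz_kernel p (g * tpow 1)"
    "card K = Suc (card B)"
proof -
  define N where "N = {y \<in> seq.span K. y 0 = 0}"
  have e_K: "fourier e \<in> seq.span K" using e by (auto simp: K(3) toeplitz_kernel_def)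
  obtain B where B: "finite B" "seq.independent B" "seq.span B = N" "card K = Suc (card B)"
  proof (rule seq.hyperplane_basis[OF K(1,2)])
    show "seq.subspace N"
      unfolding N_def using seq.subspace_span[of K] by (auto simp: seq.subspace_def)
    show "N \<subseteq> seq.span K" "fourier e \<in> seq.span K" "fourier e \<notin> N" using e_K e(3) by (auto simp: N_def)
    show "\<exists>c. y - (\<lambda>j. c * fourier e j) \<in> N" if "y \<in> seq.span K" for y
      unfolding N_def using seq.span_diff[OF that seq.span_scale[OF e_K, of "y 0 / fourier e 0"]] e(3)
      by (intro exI[of _ "y 0 / fourier e 0"]) simp
  qed (rule that)
  define shift where "shift = (\<lambda>(y :: int \<Rightarrow> complex) j. y (j + 1))"
  interpret shift: Vector_Spaces.linear "\<lambda>c y j. c * y j" "\<lambda>c y j. c * y j" shift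
    by (intro Vector_Spaces.linear_iff[THEN iffD2])
      (auto simp: shift_def fun_eq_iff seq.vector_space_axioms)
  have inj: "inj_on shift A" for A
    by (rule inj_onI) (auto simp: shift_def fun_eq_iff dest: spec[of _ "_ - 1"])
  show thesis
  proof (rule that)
    show "seq.independent (shift ` B)" using B(2) inj by (rule shift.independent_injective_image)
    show "seq.span (shift ` B) = fourier ` toeplitz_kernel p (g * tpow 1)"
      using shift.span_image[of B] unfolding toeplitz_kernel_step[OF p] B(3) N_def K(3) shift_def .
  qed (use B in \<open>simp_all add: card_image[OF inj]\<close>)
qed

theorem toeplitz_invertible_of_surjective:
  assumes g: "g \<in> Linf_class" and p: "1 < p" and surj: "toeplitz g ` hardy p = hardy p"
    and K: "finite K" "seq.independent K" "seq.span K = fourier ` toeplitz_kernel p g"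
  shows "toeplitz_invertible p (g * tpow (int (card K)))"
  using g surj K
proof (induction "card K" arbitrary: g K)
  case 0
  then have "fourier ` toeplitz_kernel p g = {0}" by simp
  then have "f = 0" if "f \<in> hardy p" "toeplitz g f = 0" for f
    using that p fourier_hardy_eq_iff[of f p 0] by (fastforce simp: toeplitz_kernel_def fun_eq_iff)
  then show ?case using 0 p by (simp add: toeplitz_invertibleI flip: \<open>0 = card K\<close>)
next
  case (Suc m)
  note g = Suc.prems(1) and K = Suc.prems(3-5)
  have "K \<noteq> {}" using Suc.hyps(2) by auto
  then have "\<not> seq.span K \<subseteq> {0}" using K(2) by (intro seq.independent_span_not_trivial)
  then obtain f where f: "f \<in> hardy p" "toeplitz g f = 0" "fourier f \<noteq> 0"
    unfolding K(3) toeplitz_kernel_def by auto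
  then have "f \<noteq> 0" by (auto simp: fun_eq_iff)
  then obtain e where e: "e \<in> hardy p" "toeplitz g e = 0" "fourier e 0 \<noteq> 0"
    using toeplitz_kernel_nonzero_constant_term[OF g p f(1) _ f(2)] by blast
  obtain B where B: "finite B" "seq.independent B" "seq.span B = fourier ` toeplitz_kernel p (g * tpow 1)"
    "card K = Suc (card B)"
    using toeplitz_kernel_step_basis[OF p K e] .
  have "toeplitz (g * tpow 1) ` hardy p = hardy p"
    using g p Suc.prems(2) e by (rule toeplitz_surjective_step)
  then have "toeplitz_invertible p (g * tpow 1 * tpow (int m))"
    using Suc.hyps(1)[of B "g * tpow 1"] Suc.hyps(2) g B by simp
  then show ?case using Suc.hyps(2) by (simp add: mult.assoc tpow_mult add.commute flip: \<open>Suc m = card K\<close>)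
qed

definition backward_shift :: "(int \<Rightarrow> complex) \<Rightarrow> int \<Rightarrow> complex" where
  "backward_shift y j = (if 0 \<le> j then y (j + 1) else 0)"

lemma backward_shift_linear: "Vector_Spaces.linear (\<lambda>c y j. c * y j) (\<lambda>c y j. c * y j) backward_shift"
  by (intro Vector_Spaces.linear_iff[THEN iffD2])
    (auto simp: backward_shift_def fun_eq_iff seq.vector_space_axioms)

lemma fourier_toeplitz_divide_t:
  assumes "g \<in> Linf_class" "f \<in> hardy p" "1 < p"
  shows "fourier (toeplitz (g * tpow (- 1)) f) = backward_shift (fourier (toeplitz g f))"
proof -
  have "g * tpow (- 1) * f = tpow (- 1) * (g * f)" by (simp only: mult_ac)
  then have "fourier (g * tpow (- 1) * f) j = fourier (g * f) (j + 1)" for j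
    by (simp only: fourier_tpow_mult) simp
  then show ?thesis
    using fourier_toeplitz[of "g * tpow (- 1)" f p] assms
    by (simp add: fun_eq_iff backward_shift_def fourier_toeplitz[OF assms])
qed

lemma toeplitz_divide_t_eq_iff:
  assumes g: "g \<in> Linf_class" and p: "1 < p" and f: "f \<in> hardy p" and y: "y \<in> hardy p"
  shows "toeplitz (g * tpow (- 1)) f = y \<longleftrightarrow> (\<exists>c. tpow 1 * y - const c = toeplitz g f)"
proof -
  have hardy: "toeplitz g f \<in> hardy p" "toeplitz (g * tpow (- 1)) f \<in> hardy p" "tpow 1 * y \<in> hardy p"
    using g f y p hardy_operator.maps[OF toeplitz_hardy_operator] hardy_tpow_mult[of y p 1] by auto
  have diff: "fourier (tpow 1 * y - const c) j = fourier y (j - 1) - (if j = 0 then c else 0)" for c j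
    using hardy(3) p fourier_diff_Lp[of "tpow 1 * y" p "const c"] by (simp add: hardy_Lp fourier_const)
  have "toeplitz (g * tpow (- 1)) f = y \<longleftrightarrow> (\<forall>j\<ge>0. fourier (toeplitz g f) (j + 1) = fourier y j)"
    unfolding fourier_hardy_eq_iff[OF hardy(2) y p, symmetric] fourier_toeplitz_divide_t[OF g f p]
    using hardy_fourier_neg[OF y] by (auto simp: fun_eq_iff backward_shift_def)
  also have "\<dots> \<longleftrightarrow> (\<exists>c. fourier (tpow 1 * y - const c) = fourier (toeplitz g f))"
  proof
    assume eq: "\<forall>j\<ge>0. fourier (toeplitz g f) (j + 1) = fourier y j"
    have "fourier (tpow 1 * y - const (- fourier (toeplitz g f) 0)) j = fourier (toeplitz g f) j" for j
      unfolding diff using eq[rule_format, of "j - 1"] hardy_fourier_neg[OF hardy(1), of j]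
        hardy_fourier_neg[OF y, of "j - 1"]
      by (cases "j \<ge> 1") auto
    then show "\<exists>c. fourier (tpow 1 * y - const c) = fourier (toeplitz g f)" by blast
  next
    assume "\<exists>c. fourier (tpow 1 * y - const c) = fourier (toeplitz g f)"
    then obtain c where eq: "fourier (tpow 1 * y - const c) = fourier (toeplitz g f)" by blast
    show "\<forall>j\<ge>0. fourier (toeplitz g f) (j + 1) = fourier y j"
    proof (intro allI impI)
      show "fourier (toeplitz g f) (j + 1) = fourier y j" if "0 \<le> j" for j
        using that fun_cong[OF eq, of "j + 1"] diff[of c "j + 1"] by simp
    qed
  qed
  finally show ?thesis
    using fourier_hardy_eq_iff[OF hardy_diff[OF hardy(3) _ p] hardy(1) p]
      hardy_const_mult[OF hardy_1[OF p] p] by simp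
qed

lemma toeplitz_divide_t_closed:
  assumes g: "g \<in> Linf_class" and p: "1 < p" and closed: "closed_in_hardy p (toeplitz g ` hardy p)"
  shows "closed_in_hardy p (toeplitz (g * tpow (- 1)) ` hardy p)"
proof -
  have range_iff: "y \<in> toeplitz (g * tpow (- 1)) ` hardy p
      \<longleftrightarrow> (\<exists>c. tpow 1 * y - const c \<in> toeplitz g ` hardy p)"
    if "y \<in> hardy p" for y
    using toeplitz_divide_t_eq_iff[OF g p _ that] by (auto simp: image_iff eq_commute[of y])
  have closed_1: "closed_in_hardy p {f. \<exists>c. f - const c \<in> toeplitz g ` hardy p}"
    using closed_in_hardy_span_insert[OF toeplitz_range_subspace[OF g p] closed hardy_1[OF p] p] by simp
  have range_hardy: "toeplitz (g * tpow (- 1)) ` hardy p \<subseteq> hardy p"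
    using hardy_operator.maps[OF toeplitz_hardy_operator[of "g * tpow (- 1)" p]] g p by auto
  have "f \<in> toeplitz (g * tpow (- 1)) ` hardy p"
    if F: "\<And>n. F n \<in> toeplitz (g * tpow (- 1)) ` hardy p" and f: "f \<in> hardy p" and conv: "Lp_conv p F f"
      for F f
  proof -
    have F_hardy: "F n \<in> hardy p" for n using F range_hardy by blast
    have "tpow 1 * F n - tpow 1 * f = tpow 1 * (F n - f)" for n by (simp add: right_diff_distrib)
    then have "Lp_conv p (\<lambda>n. tpow 1 * F n) (tpow 1 * f)"
      using conv F_hardy f p by (simp add: Lp_conv_def cnorm_tpow_mult Lp_class_diff hardy_Lp)
    then have "\<exists>c. tpow 1 * f - const c \<in> toeplitz g ` hardy p"
      using closed_in_hardyD(2)[OF closed_1, of "\<lambda>n. tpow 1 * F n" "tpow 1 * f"]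
        range_iff[OF F_hardy] F f p hardy_tpow_mult[of f p 1] by auto
    then show ?thesis using range_iff[OF f] by blast
  qed
  then show ?thesis using range_hardy by (auto simp: closed_in_hardy_def)
qed

lemma toeplitz_divide_t_injective:
  assumes g: "g \<in> Linf_class" and p: "1 < p" and one: "1 \<notin> toeplitz g ` hardy p"
    and inj: "\<And>f. f \<in> hardy p \<Longrightarrow> toeplitz g f = 0 \<Longrightarrow> f = 0"
    and f: "f \<in> hardy p" "toeplitz (g * tpow (- 1)) f = 0"
  shows "f = 0"
proof -
  interpret hardy_operator p "toeplitz g" using g p by (rule toeplitz_hardy_operator)
  obtain c where c: "toeplitz g f = const c"
    using toeplitz_divide_t_eq_iff[OF g p f(1) hardy_0[OF p]] f(2)
    by (metis add.inverse_inverse const_uminus diff_0 mult.right_neutral mult_zero_right)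
  have "c = 0"
  proof (rule ccontr)
    assume "c \<noteq> 0"
    then have "toeplitz g (const (inverse c) * f) = 1"
      using f(1) c const_mult[of "inverse c" c] by (simp add: scale)
    then show False using one f(1) p by (metis hardy_const_mult image_eqI)
  qed
  then show ?thesis using inj f(1) c by simp
qed

lemma backward_shift_hardy:
  assumes p: "1 < p" shows "backward_shift ` fourier ` hardy p = fourier ` hardy p"
proof (intro equalityI subsetI)
  fix y assume "y \<in> backward_shift ` fourier ` hardy p"
  then obtain f where f: "f \<in> hardy p" "y = backward_shift (fourier f)" by blast
  have "y = fourier (toeplitz (1 * tpow (- 1)) f)"
    using fourier_toeplitz_divide_t[of 1 f p] f p by (simp add: toeplitz_def riesz_id)
  moreover have "toeplitz (1 * tpow (- 1)) f \<in> hardy p"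
    using hardy_operator.maps[OF toeplitz_hardy_operator, of "1 * tpow (- 1)" p f] f p by simp
  ultimately show "y \<in> fourier ` hardy p" by blast
next
  fix y assume "y \<in> fourier ` hardy p"
  then obtain f where f: "f \<in> hardy p" "y = fourier f" by blast
  have "backward_shift (fourier (tpow 1 * f)) = y"
    using hardy_fourier_neg[OF f(1)] by (auto simp: f(2) backward_shift_def)
  moreover have "tpow 1 * f \<in> hardy p" using f(1) p by (intro hardy_tpow_mult) auto
  ultimately show "y \<in> backward_shift ` fourier ` hardy p" by blast
qed

lemma one_notin_toeplitz_range:
  assumes g: "g \<in> Linf_class" and p: "1 < p" and closed: "closed_in_hardy p (toeplitz g ` hardy p)"
    and proper: "toeplitz g ` hardy p \<noteq> hardy p"
  shows "1 \<notin> toeplitz g ` hardy p"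
proof
  assume "1 \<in> toeplitz g ` hardy p"
  then obtain f where f: "f \<in> hardy p" "toeplitz g f = 1" by auto
  then have "fourier (g * f) j = (if j = 0 then 1 else 0)" if "0 \<le> j" for j
    using fourier_toeplitz[OF g f(1) p, of j] that by (simp add: fourier_1)
  then have "toeplitz g ` hardy p = hardy p"
    using analytic_polys_subset_toeplitz_range[OF g f(1) p, of 0] closed_dense_eq_hardy[OF closed _ p]
    by simp
  then show False using proper by simp
qed

lemma backward_shift_kernel:
  assumes y: "y \<in> fourier ` hardy p" "backward_shift y = 0"
  shows "y = (\<lambda>j. y 0 * fourier 1 j)"
proof
  fix j
  have "y j = 0" if "j < 0" using y(1) that by (auto simp: hardy_fourier_neg)
  moreover have "y j = 0" if "0 < j" using fun_cong[OF y(2), of "j - 1"] that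
    by (simp add: backward_shift_def)
  ultimately show "y j = y 0 * fourier 1 j"
    by (cases j "0 :: int" rule: linorder_cases) (simp_all add: fourier_1)
qed

lemma is_complement_toeplitz_divide_t:
  assumes g: "g \<in> Linf_class" and p: "1 < p" and range: "toeplitz g ` hardy p \<subseteq> hardy p"
    and one: "1 \<notin> toeplitz g ` hardy p"
    and complement: "seq.is_complement (fourier ` toeplitz g ` hardy p) C (fourier ` hardy p)"
  obtains C' where "seq.is_complement (fourier ` toeplitz (g * tpow (- 1)) ` hardy p) C'
    (fourier ` hardy p)"
    "card C = Suc (card C')"
proof -
  define R where "R = fourier ` toeplitz g ` hardy p"
  obtain C' where C': "seq.is_complement (backward_shift ` R) C' (backward_shift ` fourier ` hardy p)"
    "card C = Suc (card C')"
  proof (rule seq.is_complement_image[OF complement[folded R_def] _ _ backward_shift_linear,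
    of "fourier 1"])
    show "seq.subspace R" "seq.subspace (fourier ` hardy p)"
      unfolding R_def using range toeplitz_range_subspace[OF g p] hardy_subspace[OF p] p
      by (auto intro: fourier_image_subspace)
    show "fourier 1 \<in> fourier ` hardy p" "backward_shift (fourier 1) = 0"
      using p by (auto simp: backward_shift_def fun_eq_iff fourier_1)
    show "fourier 1 \<notin> R"
    proof
      assume "fourier 1 \<in> R"
      then obtain y where "y \<in> toeplitz g ` hardy p" "fourier 1 = fourier y" by (auto simp: R_def)
      then show False
        using one p fourier_hardy_eq_iff[OF hardy_1[OF p] _ p, of y] range by auto
    qed
    show "\<exists>k. y = (\<lambda>j. k * fourier 1 j)" if "y \<in> fourier ` hardy p" "backward_shift y = 0" for y
      using backward_shift_kernel[OF that] by blast
  qed (rule that)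
  have "backward_shift ` R = fourier ` toeplitz (g * tpow (- 1)) ` hardy p"
    unfolding R_def image_image using fourier_toeplitz_divide_t[OF g _ p] by (intro image_cong) auto
  moreover have "backward_shift ` fourier ` hardy p = fourier ` hardy p"
    using p by (rule backward_shift_hardy)
  ultimately show thesis using that C' by simp
qed

theorem toeplitz_invertible_of_injective:
  assumes g: "g \<in> Linf_class" and p: "1 < p" and inj: "\<And>f. f \<in> hardy p \<Longrightarrow> toeplitz g f = 0 \<Longrightarrow> f = 0"
    and closed: "closed_in_hardy p (toeplitz g ` hardy p)"
    and complement: "seq.is_complement (fourier ` toeplitz g ` hardy p) C (fourier ` hardy p)"
  shows "toeplitz_invertible p (g * tpow (- int (card C)))"
  using g inj closed complement
proof (induction "card C" arbitrary: g C)
  case 0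
  have range: "toeplitz g ` hardy p \<subseteq> hardy p" using closed_in_hardyD(1)[OF 0(4)] .
  have "C = {}" using 0(1,5) by (simp add: seq.is_complement_def)
  then have "fourier ` hardy p = fourier ` toeplitz g ` hardy p"
    using 0(5) by (simp add: seq.is_complement_def)
  then have "toeplitz g ` hardy p = hardy p"
    using range inj_on_image_eq_iff[of fourier "hardy p" "hardy p" "toeplitz g ` hardy p"]
      fourier_hardy_eq_iff[of _ p] p
    by (auto simp: inj_on_def)
  then show ?case using 0 p by (simp add: toeplitz_invertibleI flip: \<open>0 = card C\<close>)
next
  case (Suc m)
  note g = Suc.prems(1) and inj = Suc.prems(2) and closed = Suc.prems(3) and complement = Suc.prems(4)
  have one: "1 \<notin> toeplitz g ` hardy p"
  proof (rule one_notin_toeplitz_range[OF g p closed])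
    have "C \<noteq> {}" using Suc.hyps(2) by auto
    then show "toeplitz g ` hardy p \<noteq> hardy p"
      using seq.is_complement_self[OF fourier_image_subspace[OF hardy_subspace[OF p] subset_refl p], of C]
        complement by auto
  qed
  obtain C' where C': "seq.is_complement (fourier ` toeplitz (g * tpow (- 1)) ` hardy p) C'
      (fourier ` hardy p)"
    "card C = Suc (card C')"
    using is_complement_toeplitz_divide_t[OF g p closed_in_hardyD(1)[OF closed] one complement] .
  define g' where "g' = g * tpow (- 1)"
  have g': "g' \<in> Linf_class" using g by (simp add: g'_def)
  have "seq.is_complement (fourier ` toeplitz g' ` hardy p) C' (fourier ` hardy p)"
    unfolding g'_def by (rule C'(1))
  moreover have "f = 0" if f: "f \<in> hardy p" "toeplitz g' f = 0" for f
    using toeplitz_divide_t_injective[OF g p one inj f[unfolded g'_def]] by simp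
  moreover have "closed_in_hardy p (toeplitz g' ` hardy p)"
    unfolding g'_def using g p closed by (rule toeplitz_divide_t_closed)
  ultimately have "toeplitz_invertible p (g' * tpow (- int m))"
    using Suc.hyps(1)[of C' g'] g' C'(2) Suc.hyps(2) by simp
  then show ?case using Suc.hyps(2) by (simp add: g'_def mult.assoc tpow_mult flip: \<open>Suc m = card C\<close>)
qed

section \<open>Toeplitz operators on functions\<close>

lemma Hp_iff: "F \<in> Hp p \<longleftrightarrow> circ_measurable F \<and> circ_class F \<in> hardy p"
  by (auto simp: Hp_def hardy_def Lp_iff fc_fourier)

lemma Linf_iff: "F \<in> Linf \<longleftrightarrow> circ_measurable F \<and> circ_class F \<in> Linf_class"
  by (auto simp: Linf_def Linf_class_def circ_measurable_def circ_def[abs_def] ess_bounded_circ_class)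

lemma hardy_representative:
  assumes "f \<in> hardy p"
  obtains F where "F \<in> Hp p" "circ_measurable F" "f = circ_class F"
  using assms by (cases f) (auto simp: Hp_iff)

lemma fc_eq_fourier: "circ_measurable F \<Longrightarrow> fc F = fourier (circ_class F)"
  by (simp add: fun_eq_iff fc_fourier)

lemma fc_image_Hp: "fc ` Hp p = fourier ` hardy p"
proof (intro equalityI subsetI)
  fix y assume "y \<in> fourier ` hardy p"
  then obtain f where f: "f \<in> hardy p" "y = fourier f" by blast
  obtain F where "F \<in> Hp p" "circ_measurable F" "f = circ_class F" using hardy_representative[OF f(1)] .
  then show "y \<in> fc ` Hp p" using f(2) by (simp add: fc_eq_fourier[symmetric])
qed (auto simp: Hp_iff fc_eq_fourier)

lemma Pr_class:
  assumes F: "circ_measurable F" "circ_class F \<in> Lp_class p" and p: "1 < p"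
  shows "circ_measurable (Pr F)" "circ_class (Pr F) = riesz (circ_class F)"
proof -
  obtain G where G: "circ_measurable G" "riesz (circ_class F) = circ_class G"
    by (cases "riesz (circ_class F)")
  have "G \<in> Lp 1 \<and> (\<forall>j. fc G j = (if 0 \<le> j then fc F j else 0))"
    using Lp_class_imp_L1[OF riesz_Lp[OF F(2) p] p] fourier_riesz[OF F(2) p] F G
    by (simp add: Lp_iff fc_fourier)
  then have Pr: "Pr F \<in> Lp 1 \<and> (\<forall>j. fc (Pr F) j = (if 0 \<le> j then fc F j else 0))"
    unfolding Pr_def by (rule someI[of _ G])
  then show measurable: "circ_measurable (Pr F)" by (simp add: Lp_iff)
  show "circ_class (Pr F) = riesz (circ_class F)"
    by (rule riesz_eqI[symmetric]) (use Pr measurable F in \<open>auto simp: Lp_iff fc_fourier[symmetric]\<close>)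
qed

lemma Toep_class:
  assumes a: "a \<in> Linf" and F: "F \<in> Hp p" and p: "1 < p"
  shows "circ_measurable (Toep a F)" "circ_class (Toep a F) = toeplitz (circ_class a) (circ_class F)"
proof -
  have "circ_measurable (\<lambda>z. a z * F z)"
    and product: "circ_class (\<lambda>z. a z * F z) = circ_class a * circ_class F"
    using a F by (simp_all add: Linf_iff Hp_iff circ_class_simps)
  moreover have "circ_class (\<lambda>z. a z * F z) \<in> Lp_class p"
    unfolding product using a F p by (intro Linf_mult_hardy) (auto simp: Linf_iff Hp_iff)
  ultimately show "circ_measurable (Toep a F)"
    "circ_class (Toep a F) = toeplitz (circ_class a) (circ_class F)"
    using Pr_class[of "\<lambda>z. a z * F z" p] p by (auto simp: Toep_def toeplitz_def)
qed

lemma ae_eq_0_iff: "circ_measurable F \<Longrightarrow> ae_eq F (\<lambda>_. 0) \<longleftrightarrow> circ_class F = 0"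
  by (simp add: circ_class_0 circ_class_eq_iff)

lemma ker_seq_Toep:
  assumes a: "a \<in> Linf" and p: "1 < p"
  shows "ker_seq p (Toep a) = fourier ` toeplitz_kernel p (circ_class a)"
proof (intro equalityI subsetI)
  fix y assume "y \<in> ker_seq p (Toep a)"
  then show "y \<in> fourier ` toeplitz_kernel p (circ_class a)"
    using Toep_class[OF a _ p]
    by (auto simp: ker_seq_def toeplitz_kernel_def Hp_iff ae_eq_0_iff fc_eq_fourier)
next
  fix y assume "y \<in> fourier ` toeplitz_kernel p (circ_class a)"
  then obtain f where f: "f \<in> hardy p" "toeplitz (circ_class a) f = 0" "y = fourier f"
    by (auto simp: toeplitz_kernel_def)
  obtain F where F: "F \<in> Hp p" "circ_measurable F" "f = circ_class F"
    using hardy_representative[OF f(1)] .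
  then show "y \<in> ker_seq p (Toep a)"
    using f Toep_class[OF a F(1) p]
    by (auto simp: ker_seq_def ae_eq_0_iff fc_eq_fourier intro!: exI[of _ F])
qed

lemma ran_seq_Toep:
  assumes a: "a \<in> Linf" and p: "1 < p"
  shows "ran_seq p (Toep a) = fourier ` toeplitz (circ_class a) ` hardy p"
proof (intro equalityI subsetI)
  fix y assume "y \<in> ran_seq p (Toep a)"
  then show "y \<in> fourier ` toeplitz (circ_class a) ` hardy p"
    using Toep_class[OF a _ p] by (auto simp: ran_seq_def Hp_iff fc_eq_fourier)
next
  fix y assume "y \<in> fourier ` toeplitz (circ_class a) ` hardy p"
  then obtain f where f: "f \<in> hardy p" "y = fourier (toeplitz (circ_class a) f)" by blast
  obtain F where F: "F \<in> Hp p" "circ_measurable F" "f = circ_class F"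
    using hardy_representative[OF f(1)] .
  then show "y \<in> ran_seq p (Toep a)"
    using f Toep_class[OF a F(1) p] by (auto simp: ran_seq_def fc_eq_fourier intro!: exI[of _ F])
qed

lemma closed_range_Toep:
  assumes a: "a \<in> Linf" and p: "1 < p" and closed: "closed_range p (Toep a)"
  shows "closed_in_hardy p (toeplitz (circ_class a) ` hardy p)"
proof -
  have a_class: "circ_class a \<in> Linf_class" using a by (simp add: Linf_iff)
  have "h \<in> toeplitz (circ_class a) ` hardy p"
    if f: "\<And>n. f n \<in> toeplitz (circ_class a) ` hardy p" and h: "h \<in> hardy p" and conv: "Lp_conv p f h"
      for f h
  proof -
    have "\<exists>F. F \<in> Hp p \<and> circ_measurable (Toep a F) \<and> f n = circ_class (Toep a F)" for n
    proof -
      obtain e where e: "e \<in> hardy p" "f n = toeplitz (circ_class a) e" using f by blast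
      obtain F where "F \<in> Hp p" "circ_measurable F" "e = circ_class F"
        using hardy_representative[OF e(1)] .
      then show ?thesis using e(2) Toep_class[OF a _ p] by metis
    qed
    then obtain F where F: "\<And>n. F n \<in> Hp p" "\<And>n. circ_measurable (Toep a (F n))"
      "\<And>n. f n = circ_class (Toep a (F n))"
      by metis
    obtain H where H: "H \<in> Hp p" "circ_measurable H" "h = circ_class H" using hardy_representative[OF h] .
    have "pnorm p (\<lambda>z. Toep a (F n) z - H z) = cnorm p (f n - h)" for n
      using F(2)[of n] H(2) by (simp add: F(3) H(3) pnorm_cnorm circ_class_diff)
    then have "(\<lambda>n. pnorm p (\<lambda>z. Toep a (F n) z - H z)) \<longlonglongrightarrow> 0" using conv by (simp add: Lp_conv_def)
    moreover have "H \<in> Lp p" using H(1) by (simp add: Hp_def)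
    ultimately obtain E where E: "E \<in> Hp p" "ae_eq (Toep a E) H"
      using closed F(1) unfolding closed_range_def by blast
    then have "h = toeplitz (circ_class a) (circ_class E)"
      using Toep_class[OF a E(1) p] H by (metis circ_class_eq_iff)
    then show ?thesis using E(1) by (auto simp: Hp_iff)
  qed
  then show ?thesis
    using hardy_operator.maps[OF toeplitz_hardy_operator[OF a_class p]]
    by (auto simp: closed_in_hardy_def)
qed

theorem fredholm_index_toeplitz_invertible:
  assumes index: "fredholm_index p (Toep a) \<kappa>" and a: "a \<in> Linf" and p: "1 < p"
    and invertible: "circ_class a * inverse (circ_class a) = 1"
  shows "toeplitz_invertible p (circ_class a * tpow \<kappa>)"
proof -
  define g where "g = circ_class a"
  define H where "H = fourier ` hardy p"
  define R where "R = fourier ` toeplitz g ` hardy p"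
  have g: "g \<in> Linf_class" "g * inverse g = 1" using a invertible by (simp_all add: g_def Linf_iff)
  have closed: "closed_in_hardy p (toeplitz g ` hardy p)"
    unfolding g_def using index a p by (intro closed_range_Toep) (simp_all add: fredholm_index_def)
  obtain K C where finite: "finite K" "finite C"
    and basis: "cindep K" "cspan K = fourier ` toeplitz_kernel p g"
    and cobasis: "cindep C" "{(\<lambda>j. r j + s j) | r s. r \<in> R \<and> s \<in> cspan C} = H" "cspan C \<inter> R = {\<lambda>_. 0}"
    and \<kappa>: "\<kappa> = int (card K) - int (card C)"
    using index unfolding fredholm_index_def ker_seq_Toep[OF a p] ran_seq_Toep[OF a p] fc_image_Hp g_def
      R_def H_def
    by blast
  have K: "finite K" "seq.independent K" "seq.span K = fourier ` toeplitz_kernel p g"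
    using finite basis by (simp_all add: cspan_eq_span cindep_iff_independent)
  have complement: "seq.is_complement R C H"
    using finite cobasis by (simp add: seq.is_complement_def cspan_eq_span cindep_iff_independent
      plus_fun_def zero_fun_def)
  show ?thesis
  proof (cases "\<exists>f\<in>hardy p. f \<noteq> 0 \<and> toeplitz g f = 0")
    case True
    then have surj: "toeplitz g ` hardy p = hardy p" using Coburn[OF g closed p] by blast
    then have "seq.is_complement H C H" using complement by (simp add: R_def H_def)
    then have "C = {}"
      using seq.is_complement_self fourier_image_subspace[OF hardy_subspace[OF p] subset_refl p]
      unfolding H_def by blast
    then show ?thesis using toeplitz_invertible_of_surjective[OF g(1) p surj K] \<kappa> by (simp add: g_def)
  next
    case False
    then have inj: "\<And>f. f \<in> hardy p \<Longrightarrow> toeplitz g f = 0 \<Longrightarrow> f = 0" by blast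
    then have "toeplitz_kernel p g \<subseteq> {0}" by (auto simp: toeplitz_kernel_def)
    then have "seq.span K \<subseteq> {0}" by (auto simp: K(3) fun_eq_iff)
    then have "K = {}" using seq.independent_span_not_trivial[OF K(2)] by blast
    then show ?thesis
      using toeplitz_invertible_of_injective[OF g(1) p inj closed complement[unfolded R_def H_def]] \<kappa>
      by (simp add: g_def)
  qed
qed

section \<open>Wiener--Hopf factorization\<close>

locale wiener_hopf =
  fixes p :: real and g :: circle_fun
  assumes exponent: "1 < p" and bounded: "g \<in> Linf_class" and symmetric: "g * tilde g = 1"
    and invertible: "toeplitz_invertible p g"
begin

sublocale T: hardy_operator p "toeplitz g"
  using bounded exponent by (rule toeplitz_hardy_operator)

lemma conj_exponent: "1 < conj_exp p"
  using exponent by (rule conj_exp_gt_1)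

lemma toeplitz_inj: "f \<in> hardy p \<Longrightarrow> h \<in> hardy p \<Longrightarrow> toeplitz g f = toeplitz g h \<Longrightarrow> f = h"
  using invertible by (auto simp: toeplitz_invertible_def bij_betw_def inj_on_def)

definition inverse_plus :: circle_fun where
  "inverse_plus = inv_into (hardy p) (toeplitz g) 1"

definition signature :: complex where
  "signature = fourier inverse_plus 0"

lemma inverse_plus_hardy: "inverse_plus \<in> hardy p"
  and toeplitz_inverse_plus: "toeplitz g inverse_plus = 1"
proof -
  have "1 \<in> toeplitz g ` hardy p"
    using invertible exponent by (simp add: toeplitz_invertible_def bij_betw_def)
  then show "inverse_plus \<in> hardy p" "toeplitz g inverse_plus = 1"
    unfolding inverse_plus_def by (auto intro: inv_into_into f_inv_into_f)
qed

lemma fourier_g_inverse_plus: "0 \<le> j \<Longrightarrow> fourier (g * inverse_plus) j = (if j = 0 then 1 else 0)"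
  using fourier_toeplitz[OF bounded inverse_plus_hardy exponent, of j]
  by (simp add: toeplitz_inverse_plus fourier_1)

lemma tilde_hardy:
  assumes "f \<in> Lp_class p" "\<And>j. 0 < j \<Longrightarrow> fourier f j = 0" shows "tilde f \<in> hardy p"
  using assms by (simp add: hardy_def Lp_class_tilde)

lemma riesz_tilde:
  assumes f: "f \<in> hardy p" shows "riesz (tilde f) = const (fourier f 0)"
  by (rule riesz_eqI) (use f hardy_fourier_neg[OF f, of "- _"] in \<open>auto simp: fourier_const\<close>)

lemma g_inverse_plus: "g * inverse_plus = const signature * tilde inverse_plus"
proof -
  define m where "m = g * inverse_plus"
  have "tilde m \<in> hardy p"
    using Linf_mult_hardy[OF bounded inverse_plus_hardy exponent] fourier_g_inverse_plus
    by (intro tilde_hardy) (simp_all add: m_def)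
  moreover have "g * tilde m = (g * tilde g) * tilde inverse_plus" by (simp add: m_def mult.assoc)
  then have "toeplitz g (tilde m) = const signature"
    by (simp add: symmetric toeplitz_def riesz_tilde[OF inverse_plus_hardy] signature_def)
  moreover have "toeplitz g (const signature * inverse_plus) = const signature"
    by (simp add: T.scale inverse_plus_hardy toeplitz_inverse_plus)
  ultimately have "tilde m = const signature * inverse_plus"
    using hardy_const_mult[OF inverse_plus_hardy exponent] by (intro toeplitz_inj[of "tilde m"]) simp_all
  then have "tilde (tilde m) = const signature * tilde inverse_plus"
    by (simp only: tilde_mult tilde_const)
  then show ?thesis unfolding tilde_tilde m_def .
qed

lemma signature_square: "signature * signature = 1"
  using fourier_g_inverse_plus[of 0] by (simp add: g_inverse_plus signature_def)

lemma const_signature_square: "const signature * const signature = 1"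
  by (simp add: signature_square flip: const_mult)

text \<open>With \<open>T(bar g) y = 1\<close>, the product of \<open>inverse_plus\<close> and \<open>g * bar y\<close> has Fourier coefficients on
  neither side of \<open>0\<close>, hence is constant.\<close>

lemma inverse_plus_unit:
  obtains h where "h \<in> hardy (conj_exp p)" "inverse_plus * h = 1" "fourier h 0 = signature"
proof -
  have "toeplitz_invertible (conj_exp p) (bar g)"
    using bounded exponent invertible by (rule toeplitz_invertible_bar)
  then have "1 \<in> toeplitz (bar g) ` hardy (conj_exp p)"
    using conj_exponent by (simp add: toeplitz_invertible_def bij_betw_def)
  then obtain y where y: "y \<in> hardy (conj_exp p)" "toeplitz (bar g) y = 1" by (metis imageE)
  define h where "h = g * bar y"
  have fourier_h: "fourier h j = (if j = 0 then 1 else 0)" if "j \<le> 0" for j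
  proof -
    have "fourier (bar g * y) (- j) = (if j = 0 then 1 else 0)"
      using fourier_toeplitz[of "bar g" y "conj_exp p" "- j"] y bounded conj_exponent that
      by (simp add: fourier_1)
    then show ?thesis using fourier_bar[of "bar g * y" j] by (simp add: h_def)
  qed
  have h: "h \<in> hardy (conj_exp p)"
    using fourier_h y(1) bounded conj_exponent by (simp add: hardy_def h_def Linf_mult_Lp Lp_class_bar)
  have y': "tilde (bar y) \<in> hardy (conj_exp p)"
    using y(1) by (simp add: hardy_def Lp_class_bar Lp_class_tilde)
  have "inverse_plus * h = (g * inverse_plus) * bar y" unfolding h_def by (simp only: mult_ac)
  also have "\<dots> = const signature * tilde (inverse_plus * tilde (bar y))"
    by (simp only: g_inverse_plus tilde_mult tilde_tilde mult.assoc)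
  finally have "fourier (inverse_plus * h) j = signature * fourier (inverse_plus * tilde (bar y)) (- j)"
    for j
    by (simp only: fourier_const_mult fourier_tilde)
  then have "fourier (inverse_plus * h) j = 0" if "j \<noteq> 0" for j
    using hardy_mult(2)[OF inverse_plus_hardy h exponent, of j]
      hardy_mult(2)[OF inverse_plus_hardy y' exponent, of "- j"] that
    by (cases "j < 0") auto
  then have "inverse_plus * h = const (fourier (inverse_plus * h) 0)"
    using hardy_mult(1)[OF inverse_plus_hardy h exponent] by (intro eq_const_fourierI)
  also have "fourier (inverse_plus * h) 0 = signature"
    using hardy_mult(3)[OF inverse_plus_hardy h exponent] fourier_h[of 0] by (simp add: signature_def)
  finally have product: "inverse_plus * h = const signature" .
  have "inverse_plus * (const signature * h) = const signature * (inverse_plus * h)"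
    by (simp only: mult_ac)
  then show thesis
    using that[of "const signature * h"] h fourier_h[of 0] conj_exponent
    by (simp add: product const_signature_square hardy_const_mult)
qed

definition plus :: circle_fun where
  "plus = inverse inverse_plus"

lemma plus_hardy: "plus \<in> hardy (conj_exp p)"
  and inverse_plus_plus: "inverse_plus * plus = 1"
  and fourier_plus_0: "fourier plus 0 = signature"
  using inverse_plus_unit inverse_unique_class unfolding plus_def by metis+

lemma tilde_inverse_plus_plus: "tilde inverse_plus * tilde plus = 1"
  using arg_cong[OF inverse_plus_plus, of tilde] by simp

lemma factorization: "g = const signature * tilde inverse_plus * plus"
proof -
  have "g = (g * inverse_plus) * plus" by (simp add: inverse_plus_plus mult.assoc)
  also have "\<dots> = const signature * tilde inverse_plus * plus" by (simp only: g_inverse_plus)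
  finally show ?thesis .
qed

lemma plus_eq: "plus = const signature * (g * tilde plus)"
proof -
  have "const signature * (g * tilde plus)
      = const signature * ((const signature * tilde inverse_plus * plus) * tilde plus)"
    using factorization by (rule arg_cong)
  also have "\<dots> = (const signature * const signature) * (tilde inverse_plus * tilde plus) * plus"
    by (simp only: mult_ac)
  finally show ?thesis by (simp add: const_signature_square tilde_inverse_plus_plus)
qed

lemma tilde_plus_mult_cohardy:
  assumes e: "e \<in> cohardy p"
  shows "tilde plus * e \<in> Lp_class 1" "0 \<le> j \<Longrightarrow> fourier (tilde plus * e) j = 0"
proof -
  have reflect_e: "reflect e \<in> hardy p" using e exponent by (rule reflect_cohardy)
  have eq: "tilde plus * e = reflect (reflect e * plus)"
    by (simp add: reflect_def tpow_mult_assoc mult_ac)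
  show "tilde plus * e \<in> Lp_class 1"
    unfolding eq using hardy_mult(1)[OF reflect_e plus_hardy exponent] by (intro reflect_Lp) simp_all
  show "fourier (tilde plus * e) j = 0" if "0 \<le> j"
    unfolding eq fourier_reflect using that
    by (intro hardy_mult(2)[OF reflect_e plus_hardy exponent]) simp
qed

text \<open>Since \<open>plus * f - plus * u\<close> is \<open>signature * tilde plus * (g * f - g * u)\<close>, the function
  \<open>inverse_plus * riesz (plus * u)\<close> is \<open>T\<inverse>(g) T(g) u\<close>.\<close>

lemma riesz_plus_mult:
  assumes u: "u \<in> trig_polys" and f: "f \<in> hardy p" and eq: "toeplitz g f = riesz (g * u)"
  shows "riesz (plus * u) = plus * f"
proof (rule riesz_eqI)
  have u_Lp: "u \<in> Lp_class p" and u_Linf: "u \<in> Linf_class"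
    using u exponent by (auto intro: monom_span_subset_Lp monom_span_subset_Linf)
  have Lp: "g * f \<in> Lp_class p" "g * u \<in> Lp_class p"
    using f u_Lp bounded exponent by (simp_all add: Linf_mult_hardy Linf_mult_Lp)
  then have "riesz (g * f - g * u) = 0" using eq exponent
    by (simp add: riesz_diff[OF _ _ exponent] toeplitz_def)
  then have cohardy: "g * f - g * u \<in> cohardy p"
    using Lp exponent riesz_eq_0_iff[of "g * f - g * u" p] by (simp add: Lp_class_diff)
  have "const signature * (tilde plus * (g * f - g * u)) = (const signature * (g * tilde plus)) * (f - u)"
    by (simp add: algebra_simps)
  then have plus_f: "plus * f = plus * u + const signature * (tilde plus * (g * f - g * u))"
    unfolding plus_eq[symmetric] by (simp add: algebra_simps)
  show plus_f_L1: "plus * f \<in> Lp_class 1"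
    using hardy_mult(1)[OF f plus_hardy exponent] by (simp add: mult.commute)
  have plus_u_L1: "plus * u \<in> Lp_class 1"
    using hardy_imp_L1[OF plus_hardy conj_exponent] u_Linf by (simp add: Lp_mult_Linf)
  show "fourier (plus * f) j = (if 0 \<le> j then fourier (plus * u) j else 0)" for j
  proof (cases "0 \<le> j")
    case True
    then show ?thesis
      using tilde_plus_mult_cohardy[OF cohardy] plus_u_L1
      by (simp add: plus_f fourier_add Lp_class_const_mult)
  next
    case False
    then show ?thesis using hardy_mult(2)[OF f plus_hardy exponent, of j] by (simp add: mult.commute)
  qed
qed

lemma inverse_plus_riesz_plus_bounded:
  obtains c where "\<And>u. u \<in> trig_polys \<Longrightarrow> cnorm p (inverse_plus * riesz (plus * u)) \<le> c * cnorm p u"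
proof -
  define S where "S = inv_into (hardy p) (toeplitz g)"
  interpret S: hardy_operator p S
    unfolding S_def using invertible
    by (intro T.inv_into_hardy_operator) (simp add: toeplitz_invertible_def)
  obtain M where M: "0 \<le> M" "\<And>h. h \<in> hardy p \<Longrightarrow> cnorm p (S h) \<le> M * cnorm p h" using S.bounded by blast
  obtain B where B: "0 \<le> B" "ess_bounded B g" using Linf_classE[OF bounded] by blast
  obtain C where C: "0 \<le> C" "\<And>f. f \<in> Lp_class p \<Longrightarrow> cnorm p (riesz f) \<le> C * cnorm p f"
    by (rule Riesz_projection_bounded[OF exponent]) (rule that)
  have "cnorm p (inverse_plus * riesz (plus * u)) \<le> M * (C * B) * cnorm p u" if u: "u \<in> trig_polys" for u
  proof -
    have u_Lp: "u \<in> Lp_class p" using exponent by (intro monom_span_subset_Lp[OF u]) simp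
    have gu_Lp: "g * u \<in> Lp_class p" using bounded u_Lp exponent by (simp add: Linf_mult_Lp)
    then have range: "riesz (g * u) \<in> hardy p" using exponent by (rule riesz_hardy)
    then have "toeplitz g (S (riesz (g * u))) = riesz (g * u)"
      unfolding S_def using invertible
      by (intro bij_betw_inv_into_right) (simp_all add: toeplitz_invertible_def)
    then have "inverse_plus * riesz (plus * u) = (inverse_plus * plus) * S (riesz (g * u))"
      using riesz_plus_mult[OF u S.maps[OF range]] by (simp add: mult.assoc)
    then have "cnorm p (inverse_plus * riesz (plus * u)) \<le> M * cnorm p (riesz (g * u))"
      using M(2)[OF range] by (simp add: inverse_plus_plus)
    also have "\<dots> \<le> M * (C * (B * cnorm p u))"
      using C(2)[OF gu_Lp] mult_left_mono[OF ess_bounded_mult_Lp(2)[OF B(2) u_Lp] C(1)] B(1) M(1) exponent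
      by (intro mult_left_mono) auto
    finally show ?thesis by (simp add: mult.assoc)
  qed
  then show thesis by (rule that)
qed

end

lemma trig_poly_class:
  assumes "trig_poly \<phi>" shows "circ_measurable \<phi>" "circ_class \<phi> \<in> trig_polys"
proof -
  obtain S c where S: "\<phi> = (\<lambda>z. \<Sum>j\<in>S. c j * z powi j)" using assms unfolding trig_poly_def by blast
  show "circ_measurable \<phi>" by (simp add: S)
  have "circ_class \<phi> = (\<Sum>j\<in>S. const (c j) * tpow j)"
    by (simp add: S circ_class_simps circ_class_sum[symmetric])
  also have "\<dots> \<in> trig_polys" by (intro monom_span_sum monom_span_monom) simp
  finally show "circ_class \<phi> \<in> trig_polys" .
qed

lemma Hbar_iff: "F \<in> Hbar p \<longleftrightarrow> circ_measurable F \<and> tilde (circ_class F) \<in> hardy p"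
proof (cases "circ_measurable F")
  case True
  have "circ_class F \<in> Lp_class p \<longleftrightarrow> tilde (circ_class F) \<in> Lp_class p"
    using Lp_class_tilde[of "circ_class F" p] Lp_class_tilde[of "tilde (circ_class F)" p] by auto
  moreover have "(\<forall>j>0. fourier (circ_class F) j = 0) \<longleftrightarrow> (\<forall>j<0. fourier (circ_class F) (- j) = 0)"
    by (metis minus_minus neg_0_less_iff_less)
  ultimately show ?thesis using True by (simp add: Hbar_def Lp_iff hardy_def fc_fourier)
qed (simp add: Hbar_def Lp_iff)

lemma (in wiener_hopf) wh_fact_exists:
  assumes d: "circ_measurable d" "g = circ_class d * tpow (- k)"
  obtains am ap where "wh_fact p d am k ap" "fc am 0 = 1"
proof -
  obtain ap where ap: "circ_measurable ap" "plus = circ_class ap" by (cases plus)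
  obtain am where am: "circ_measurable am" "const signature * tilde inverse_plus = circ_class am"
    by (cases "const signature * tilde inverse_plus")
  have "const signature * tilde inverse_plus * (const signature * tilde plus) = 1"
    using const_signature_square tilde_inverse_plus_plus
    by (simp only: mult_ac) (simp only: mult.assoc[symmetric] mult_1)
  then have inverse_am: "circ_class (\<lambda>t. inverse (am t)) = const signature * tilde plus"
    using am by (simp add: circ_class_inverse[symmetric] inverse_unique_class)
  have inverse_ap: "circ_class (\<lambda>t. inverse (ap t)) = inverse_plus"
    using ap(1) by (simp add: circ_class_inverse[symmetric] plus_def flip: ap(2))
  have "circ_class d = g * tpow k" by (simp add: d(2) mult.assoc tpow_mult)
  also have "\<dots> = const signature * tilde inverse_plus * plus * tpow k"
    using factorization by (rule arg_cong)
  also have "\<dots> = circ_class (\<lambda>t. am t * t powi k * ap t)"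
    using am(1) ap(1) by (simp add: am(2) ap(2) circ_class_tpow circ_class_mult mult_ac)
  finally have "ae_eq d (\<lambda>t. am t * t powi k * ap t)"
    using d(1) am(1) ap(1) by (simp add: circ_class_eq_iff)
  moreover obtain c where c: "\<And>u. u \<in> trig_polys \<Longrightarrow>
      cnorm p (inverse_plus * riesz (plus * u)) \<le> c * cnorm p u"
    using inverse_plus_riesz_plus_bounded by blast
  have "pnorm p (\<lambda>t. inverse (ap t) * Pr (\<lambda>z. ap z * \<phi> z) t) \<le> c * pnorm p \<phi>" if "trig_poly \<phi>" for \<phi>
  proof -
    note \<phi> = trig_poly_class[OF that]
    have product: "circ_class (\<lambda>z. ap z * \<phi> z) = plus * circ_class \<phi>"
      using ap \<phi>(1) by (simp add: circ_class_mult)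
    have "circ_class (\<lambda>z. ap z * \<phi> z) \<in> Lp_class (conj_exp p)"
      unfolding product using plus_hardy monom_span_subset_Linf[OF \<phi>(2)] conj_exponent
      by (simp add: Lp_mult_Linf hardy_Lp)
    note Pr = Pr_class[OF _ this conj_exponent]
    have "circ_class (\<lambda>t. inverse (ap t) * Pr (\<lambda>z. ap z * \<phi> z) t)
        = inverse_plus * riesz (plus * circ_class \<phi>)"
      using Pr ap(1) \<phi>(1) by (simp add: circ_class_mult[symmetric] inverse_ap product)
    then show ?thesis using c[OF \<phi>(2)] Pr(1) ap(1) \<phi>(1) by (simp add: pnorm_cnorm)
  qed
  moreover have "am \<in> Hbar p" "(\<lambda>t. inverse (am t)) \<in> Hbar (conj_exp p)" "ap \<in> Hp (conj_exp p)"
    "(\<lambda>t. inverse (ap t)) \<in> Hp p"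
    using am(1) ap(1) inverse_plus_hardy plus_hardy exponent conj_exponent
    by (auto simp: Hbar_iff Hp_iff inverse_am inverse_ap hardy_const_mult simp flip: am(2) ap(2))
  ultimately have "wh_fact p d am k ap" unfolding wh_fact_def by blast
  moreover have "fc am 0 = 1" using am(1) signature_square
    by (simp add: fc_fourier signature_def flip: am(2))
  ultimately show thesis by (rule that)
qed

text \<open>The left side has no negative, the right side no positive Fourier coefficients beyond \<open>k\<close>.\<close>

lemma hardy_mult_eq_tilde_mult:
  assumes x: "x \<in> hardy p" and A: "A \<in> hardy (conj_exp p)" and B: "tilde B \<in> hardy (conj_exp p)"
    and p: "1 < p"
    and eq: "x * A = const s * (tpow k * (tilde x * B))" and nonzero: "x * A \<noteq> 0"
  shows "0 \<le> k" "k = 0 \<Longrightarrow> x * A = const (fourier (x * A) 0)"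
proof -
  have above: "fourier (x * A) j = 0" if "k < j" for j
  proof -
    have "tilde x * B = tilde (x * tilde B)" by simp
    then have "fourier (x * A) j = s * fourier (x * tilde B) (k - j)"
      unfolding eq fourier_const_mult fourier_tpow_mult by (simp only: fourier_tilde minus_diff_eq)
    then show ?thesis using hardy_mult(2)[OF x B p, of "k - j"] that by simp
  qed
  note L1 = hardy_mult(1)[OF x A p] and below = hardy_mult(2)[OF x A p]
  show "0 \<le> k"
  proof (rule ccontr)
    assume "\<not> 0 \<le> k"
    then have "fourier (x * A) j = 0" for j using above[of j] below[of j] by (cases "k < j") auto
    then show False using fourier_unique[OF L1] nonzero by blast
  qed
  show "x * A = const (fourier (x * A) 0)" if "k = 0"
  proof (rule eq_const_fourierI[OF L1])
    show "fourier (x * A) j = 0" if "j \<noteq> 0" for j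
      using above[of j] below[of j] \<open>k = 0\<close> that by (cases "j < 0") auto
  qed
qed

lemma (in wiener_hopf) plus_factor_unique:
  assumes A: "A \<in> hardy (conj_exp p)" "A' \<in> hardy p" "A * A' = 1"
    and B: "tilde B \<in> hardy p" "tilde B' \<in> hardy (conj_exp p)" "B * B' = 1" "fourier B 0 = 1"
    and g_eq: "g = B * tpow k * A"
  shows "A = plus"
proof -
  have eq: "const signature * tilde inverse_plus * plus = B * tpow k * A"
    using factorization g_eq by simp
  have "inverse_plus * A = (B * B') * (tpow k * tpow (- k)) * (inverse_plus * A)"
    by (simp add: B(3) tpow_mult)
  also have "\<dots> = (B * tpow k * A) * (tpow (- k) * inverse_plus * B')" by (simp only: mult_ac)
  also have "\<dots> = (inverse_plus * plus) * (const signature * (tpow (- k) * (tilde inverse_plus * B')))"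
    unfolding eq[symmetric] by (simp only: mult_ac)
  finally have left: "inverse_plus * A = const signature * (tpow (- k) * (tilde inverse_plus * B'))"
    by (simp add: inverse_plus_plus)
  have "plus * A' = (const signature * const signature) * (tilde inverse_plus * tilde plus) * (plus * A')"
    by (simp add: const_signature_square tilde_inverse_plus_plus)
  also have "\<dots> = (const signature * tilde inverse_plus * plus) * (const signature * tilde plus * A')"
    by (simp only: mult_ac)
  also have "\<dots> = (A * A') * (const signature * (tpow k * (tilde plus * B)))"
    unfolding eq by (simp only: mult_ac)
  finally have right: "plus * A' = const signature * (tpow k * (tilde plus * B))" by (simp add: A(3))
  have "(inverse_plus * A) * (plus * A') = (inverse_plus * plus) * (A * A')" by (simp only: mult_ac)
  then have product: "(inverse_plus * A) * (plus * A') = 1" by (simp add: inverse_plus_plus A(3))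
  then have nonzero: "inverse_plus * A \<noteq> 0" "plus * A' \<noteq> 0" by auto
  note left = hardy_mult_eq_tilde_mult[OF inverse_plus_hardy A(1) B(2) exponent left nonzero(1)]
  have "0 \<le> k"
    using hardy_mult_eq_tilde_mult(1)[OF plus_hardy _ _ conj_exponent right nonzero(2)] A(2) B(1) exponent
    by simp
  then have k: "k = 0" using left(1) by simp
  define \<kappa> where "\<kappa> = fourier (inverse_plus * A) 0"
  have \<kappa>: "inverse_plus * A = const \<kappa>" unfolding \<kappa>_def by (rule left(2)) (simp add: k)
  have "A = (inverse_plus * plus) * A" by (simp add: inverse_plus_plus)
  also have "\<dots> = (inverse_plus * A) * plus" by (simp only: mult_ac)
  finally have A_eq: "A = const \<kappa> * plus" by (simp add: \<kappa>)
  have "const signature * tilde inverse_plus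
      = (const signature * tilde inverse_plus * plus) * inverse_plus"
    using inverse_plus_plus by (simp add: mult.assoc mult.commute[of plus])
  also have "\<dots> = B * (inverse_plus * A)" unfolding eq k by (simp add: mult_ac)
  also have "\<dots> = const \<kappa> * B" unfolding \<kappa> by (rule mult.commute)
  finally have "const signature * tilde inverse_plus = const \<kappa> * B" .
  from arg_cong[OF this, of "\<lambda>f. fourier f 0"] have "signature * fourier inverse_plus 0 = \<kappa> * fourier B 0"
    by simp
  then have "\<kappa> = 1" using signature_square B(4) by (simp add: signature_def)
  then show ?thesis using A_eq by simp
qed

theorem (in wiener_hopf)
  assumes d: "circ_measurable d" "g = circ_class d * tpow (- k)"
  shows wh_plus_measurable: "circ_measurable (wh_plus p d)"
    and wh_plus_class: "circ_class (wh_plus p d) = plus"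
    and wh_sigma_eq: "wh_sigma p d = signature"
proof -
  define normalized where "normalized = (\<lambda>(am, m, ap). wh_fact p d am m ap \<and> fc am 0 = 1)"
  obtain am0 ap0 where "normalized (am0, k, ap0)"
    by (rule wh_fact_exists[OF d]) (simp add: normalized_def)
  then have some: "normalized (SOME z. normalized z)" by (rule someI)
  obtain am m ap where am_ap: "(SOME z. normalized z) = (am, m, ap)" by (cases "SOME z. normalized z")
  have "wh_fact p d am m ap" "fc am 0 = 1" using some unfolding am_ap by (simp_all add: normalized_def)
  then have d_eq: "ae_eq d (\<lambda>t. am t * t powi m * ap t)"
    and "ap \<in> Hp (conj_exp p)" "(\<lambda>t. inverse (ap t)) \<in> Hp p"
    "am \<in> Hbar p" "(\<lambda>t. inverse (am t)) \<in> Hbar (conj_exp p)" "fc am 0 = 1"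
    unfolding wh_fact_def by blast+
  then have measurable: "circ_measurable ap" "circ_measurable am"
    and hardy: "circ_class ap \<in> hardy (conj_exp p)" "inverse (circ_class ap) \<in> hardy p"
      "tilde (circ_class am) \<in> hardy p" "tilde (inverse (circ_class am)) \<in> hardy (conj_exp p)"
    and normal: "fourier (circ_class am) 0 = 1"
    by (auto simp: Hp_iff Hbar_iff circ_class_inverse fc_fourier)
  have "circ_class d = circ_class am * tpow m * circ_class ap"
    using d_eq d(1) measurable by (simp add: circ_class_simps circ_class_eq_iff)
  then have g_eq: "g = circ_class am * tpow (m - k) * circ_class ap"
    unfolding d(2) by (simp add: mult_ac tpow_mult)
  have "circ_class ap * (circ_class am * tpow (m - k) * tilde g) = g * tilde g"
    "circ_class am * (circ_class ap * tpow (m - k) * tilde g) = g * tilde g"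
    using g_eq by (simp_all only: mult_ac)
  then have "circ_class ap * inverse (circ_class ap) = 1" "circ_class am * inverse (circ_class am) = 1"
    using symmetric inverse_unique_class by metis+
  then have "circ_class ap = plus" using hardy normal g_eq by (intro plus_factor_unique)
  moreover have "wh_plus p d = ap" unfolding wh_plus_def normalized_def[symmetric] am_ap by simp
  ultimately show "circ_measurable (wh_plus p d)" "circ_class (wh_plus p d) = plus"
    "wh_sigma p d = signature"
    using measurable fourier_plus_0 by (simp_all add: wh_sigma_def fc_fourier)
qed

section \<open>Linear systems\<close>

lemma mult_mat_vec_eq_sums:
  fixes A :: "nat \<Rightarrow> nat \<Rightarrow> complex"
  shows "Matrix.mat n n (\<lambda>(i, j). A i j) *\<^sub>v Matrix.vec n x = Matrix.vec n (\<lambda>i. \<Sum>j<n. A i j * x j)"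
  by (rule eq_vecI) (auto simp: scalar_prod_def lessThan_atLeast0 intro!: sum.cong)

lemma vec_components: "v \<in> carrier_vec n \<Longrightarrow> v = Matrix.vec n (\<lambda>i. v $ i)"
  by (intro eq_vecI) auto

lemma vec_eq_iff_components: "Matrix.vec n x = Matrix.vec n y \<longleftrightarrow> (\<forall>i<n. x i = y i)"
  by (auto simp: vec_eq_iff)

lemma det_eq_0_iff_kernel:
  fixes A :: "nat \<Rightarrow> nat \<Rightarrow> complex"
  shows "Determinant.det (Matrix.mat n n (\<lambda>(i, j). A i j)) = 0 \<longleftrightarrow>
    (\<exists>x. (\<exists>j<n. x j \<noteq> 0) \<and> (\<forall>i<n. (\<Sum>j<n. A i j * x j) = 0))"
proof -
  define M where "M = Matrix.mat n n (\<lambda>(i, j). A i j)"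
  have zero: "0\<^sub>v n = Matrix.vec n (\<lambda>_. 0 :: complex)" by (rule eq_vecI) auto
  have "Determinant.det M = 0 \<longleftrightarrow> (\<exists>v. v \<in> carrier_vec n \<and> v \<noteq> 0\<^sub>v n \<and> M *\<^sub>v v = 0\<^sub>v n)"
    by (rule det_0_iff_vec_prod_zero_field) (simp add: M_def)
  also have "\<dots> \<longleftrightarrow> (\<exists>x. Matrix.vec n x \<noteq> 0\<^sub>v n \<and> M *\<^sub>v Matrix.vec n x = 0\<^sub>v n)"
    by (metis vec_carrier vec_components)
  finally show ?thesis
    unfolding M_def mult_mat_vec_eq_sums zero vec_eq_iff_components by auto
qed

lemma det_nonzero_solvable:
  fixes A :: "nat \<Rightarrow> nat \<Rightarrow> complex"
  assumes "Determinant.det (Matrix.mat n n (\<lambda>(i, j). A i j)) \<noteq> 0"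
  obtains x where "\<And>i. i < n \<Longrightarrow> (\<Sum>j<n. A i j * x j) = b i"
proof -
  define M where "M = Matrix.mat n n (\<lambda>(i, j). A i j)"
  have M: "M \<in> carrier_mat n n" by (simp add: M_def)
  obtain B where B: "B \<in> carrier_mat n n" "M * B = 1\<^sub>m n"
    using det_non_zero_imp_unit[OF M, of "()"] assms by (auto simp: M_def Units_def ring_mat_def)
  define v where "v = B *\<^sub>v Matrix.vec n b"
  have v: "v \<in> carrier_vec n" using B(1) by (simp add: v_def)
  have "M *\<^sub>v v = (M * B) *\<^sub>v Matrix.vec n b"
    unfolding v_def using M B(1) by (intro assoc_mult_mat_vec[symmetric]) auto
  then have "M *\<^sub>v v = Matrix.vec n b" by (simp add: B(2))
  then have "\<forall>i<n. (\<Sum>j<n. A i j * v $ j) = b i"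
    unfolding M_def by (subst (asm) vec_components[OF v])
      (simp only: mult_mat_vec_eq_sums vec_eq_iff_components)
  then show thesis using that by blast
qed

section \<open>Toeplitz plus Hankel operators\<close>

locale toeplitz_hankel_pair =
  fixes p :: real and n :: nat and a b :: circle_fun
  assumes exponent: "1 < p" and a_GL: "a \<in> GLinf_class" and b_GL: "b \<in> GLinf_class"
    and matching: "a * tilde a = b * tilde b"
    and c_invertible: "toeplitz_invertible p (a / b * tpow (- 2 * int n))"
    and d_invertible: "toeplitz_invertible p (a / tilde b * tpow (2 * int n))"
begin

abbreviation c :: circle_fun where "c \<equiv> a / b"
abbreviation d :: circle_fun where "d \<equiv> a / tilde b"

lemma Linf: "a \<in> Linf_class" "b \<in> Linf_class" "inverse a \<in> Linf_class" "inverse b \<in> Linf_class"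
  using a_GL b_GL by (auto simp: GLinf_class_def)

lemma cd_Linf: "c \<in> Linf_class" "d \<in> Linf_class"
  using Linf by (simp_all add: divide_circle_fun_def flip: tilde_inverse)

lemma inverses: "a * inverse a = 1" "b * inverse b = 1" "tilde a * inverse (tilde a) = 1"
  "tilde b * inverse (tilde b) = 1"
proof -
  show a: "a * inverse a = 1" and b: "b * inverse b = 1"
    using a_GL b_GL by (simp_all add: GLinf_class_def)
  show "tilde a * inverse (tilde a) = 1" "tilde b * inverse (tilde b) = 1"
    using arg_cong[OF a, of tilde] arg_cong[OF b, of tilde] by (simp_all add: tilde_inverse)
qed

lemma matching_inverse: "inverse a * inverse (tilde a) = inverse b * inverse (tilde b)"
  using arg_cong[OF matching, of inverse] by (simp add: inverse_mult_class)

lemma c_tilde: "c * tilde c = 1" and d_tilde: "d * tilde d = 1"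
  and inverse_b_d: "inverse b * d = inverse (tilde a)"
proof -
  have unit: "(a * tilde a) * (inverse b * inverse (tilde b)) = 1"
  proof -
    have "(a * tilde a) * (inverse b * inverse (tilde b))
        = (a * inverse a) * (tilde a * inverse (tilde a))"
      unfolding matching_inverse[symmetric] by (simp only: mult_ac)
    then show ?thesis by (simp add: inverses)
  qed
  have "c * tilde c = (a * tilde a) * (inverse b * inverse (tilde b))"
    "d * tilde d = (a * tilde a) * (inverse b * inverse (tilde b))"
    by (simp_all add: divide_circle_fun_def mult_ac)
  then show "c * tilde c = 1" "d * tilde d = 1" using unit by simp_all
  have "inverse b * d = a * (inverse b * inverse (tilde b))" by (simp only: divide_circle_fun_def mult_ac)
  also have "\<dots> = (a * inverse a) * inverse (tilde a)"
    unfolding matching_inverse[symmetric] by (simp only: mult.assoc)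
  finally show "inverse b * d = inverse (tilde a)" by (simp add: inverses)
qed

definition shifted_c :: circle_fun where "shifted_c = c * tpow (- 2 * int n)"
definition shifted_d :: circle_fun where "shifted_d = d * tpow (2 * int n)"

lemma shifted_Linf: "shifted_c \<in> Linf_class" "shifted_d \<in> Linf_class"
  using cd_Linf by (simp_all add: shifted_c_def shifted_d_def)

lemma shifted_d_tpow: "shifted_d * tpow (- 2 * int n) = d"
  by (simp add: shifted_d_def mult.assoc tpow_mult)

sublocale WH: wiener_hopf p shifted_d
proof
  have "shifted_d * tilde shifted_d = (d * tilde d) * (tpow (2 * int n) * tpow (- (2 * int n)))"
    by (simp only: shifted_d_def tilde_mult tilde_tpow mult_ac)
  then show "shifted_d * tilde shifted_d = 1" unfolding d_tilde by (simp add: tpow_mult)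
qed (use exponent shifted_Linf d_invertible in \<open>auto simp: shifted_d_def\<close>)

sublocale T: hardy_operator p "toeplitz shifted_c"
  using shifted_Linf(1) exponent by (rule toeplitz_hardy_operator)

abbreviation x :: circle_fun where "x \<equiv> WH.inverse_plus"
abbreviation \<sigma> :: complex where "\<sigma> \<equiv> WH.signature"

lemma d_x: "d * x = const \<sigma> * (tpow (- 2 * int n) * tilde x)"
proof -
  have "d * x = tpow (- 2 * int n) * (shifted_d * x)"
    unfolding shifted_d_tpow[symmetric] by (simp only: mult_ac)
  also have "\<dots> = const \<sigma> * (tpow (- 2 * int n) * tilde x)"
    unfolding WH.g_inverse_plus by (rule mult.left_commute)
  finally show ?thesis .
qed

section \<open>The homogeneous equation\<close>

definition symmetric_poly :: "(nat \<Rightarrow> complex) \<Rightarrow> circle_fun" where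
  "symmetric_poly s = (\<Sum>k<n. const (s k) * (tpow (int n - 1 - int k) + const \<sigma> * tpow (int n + int k)))"

definition homogeneous_basis :: "nat \<Rightarrow> circle_fun" where
  "homogeneous_basis k = x * (tpow (int n - 1 - int k) + const \<sigma> * tpow (int n + int k))"

definition homogeneous :: "(nat \<Rightarrow> complex) \<Rightarrow> circle_fun" where
  "homogeneous s = x * symmetric_poly s"

lemma symmetric_poly_hardy: "1 < r \<Longrightarrow> symmetric_poly s \<in> hardy r"
  unfolding symmetric_poly_def by (intro hardy_sum hardy_const_mult hardy_add hardy_tpow) auto

lemma fourier_symmetric_poly:
  assumes j: "0 \<le> j"
  shows "fourier (symmetric_poly s) j =
    (if j < int n then s (n - 1 - nat j) else if j < 2 * int n then \<sigma> * s (nat j - n) else 0)"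
proof -
  have "fourier (symmetric_poly s) j =
      (\<Sum>k<n. s k * ((if int n - 1 - int k = j then 1 else 0) + \<sigma> * (if int n + int k = j then 1 else 0)))"
    unfolding symmetric_poly_def
    by (subst fourier_sum) (simp_all add: fourier_add Lp_class_add Lp_class_const_mult fourier_tpow)
  also have "\<dots> = (\<Sum>k<n. if k = n - 1 - nat j then if j < int n then s k else 0 else 0)
      + (\<Sum>k<n. if k = nat j - n then if int n \<le> j then \<sigma> * s k else 0 else 0)"
    unfolding sum.distrib[symmetric]
  proof (intro sum.cong refl)
    fix k assume "k \<in> {..<n}"
    then have "int n - 1 - int k = j \<longleftrightarrow> j < int n \<and> k = n - 1 - nat j"
      "int n + int k = j \<longleftrightarrow> int n \<le> j \<and> k = nat j - n"
      using j by auto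
    then show "s k * ((if int n - 1 - int k = j then 1 else 0) + \<sigma> * (if int n + int k = j then 1 else 0))
      = (if k = n - 1 - nat j then if j < int n then s k else 0 else 0)
        + (if k = nat j - n then if int n \<le> j then \<sigma> * s k else 0 else 0)" by simp
  qed
  also have "\<dots> = (if j < int n then s (n - 1 - nat j) else if j
      < 2 * int n then \<sigma> * s (nat j - n) else 0)"
    unfolding sum.delta'[OF finite_lessThan] sum.delta[OF finite_lessThan] using j by auto
  finally show ?thesis .
qed

lemma reflect_symmetric_poly: "reflect (symmetric_poly s)
    = const \<sigma> * (tpow (- 2 * int n) * symmetric_poly s)"
proof (rule fourier_eqI)
  show "fourier (reflect (symmetric_poly s)) j
      = fourier (const \<sigma> * (tpow (- 2 * int n) * symmetric_poly s)) j" for j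
  proof -
    have square: "\<sigma> * (\<sigma> * z) = z" for z by (simp add: WH.signature_square flip: mult.assoc)
    have neg: "fourier (symmetric_poly s) i = 0" if "i < 0" for i
      using symmetric_poly_hardy[of 2] that by (intro hardy_fourier_neg) auto
    consider (nonneg) "0 \<le> j" | (far) "j < 0" "j + 2 * int n < 0" | (near) "j < 0" "0 \<le> j + 2 * int n"
      by linarith
    then show ?thesis
    proof cases
      case near
      then have "nat (- j - 1) - n = n - 1 - nat (j + 2 * int n)"
        "n - 1 - nat (- j - 1) = nat (j + 2 * int n) - n" by linarith+
      then show ?thesis using near by (auto simp: fourier_symmetric_poly square)
    qed (simp_all add: fourier_symmetric_poly neg)
  qed
qed (use hardy_imp_L1[OF symmetric_poly_hardy[of 2]] in
  \<open>simp_all add: reflect_Lp Lp_class_const_mult Lp_class_tpow_mult\<close>)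

lemma reflect_homogeneous: "reflect (homogeneous s) = d * homogeneous s"
proof -
  have "reflect (homogeneous s) = tilde x * (const \<sigma> * (tpow (- 2 * int n) * symmetric_poly s))"
    unfolding homogeneous_def reflect_mult reflect_symmetric_poly ..
  also have "\<dots> = (const \<sigma> * (tpow (- 2 * int n) * tilde x)) * symmetric_poly s" by (simp only: mult_ac)
  finally show ?thesis by (simp only: d_x[symmetric] homogeneous_def mult.assoc)
qed

lemma homogeneous_sum: "homogeneous s = (\<Sum>k<n. const (s k) * homogeneous_basis k)"
  by (simp add: homogeneous_def homogeneous_basis_def symmetric_poly_def sum_distrib_left mult_ac)

lemma homogeneous_basis_hardy:
  assumes "k < n" shows "homogeneous_basis k \<in> hardy p"
proof -
  have "homogeneous_basis k = tpow (int n - 1 - int k) * x + const \<sigma> * (tpow (int n + int k) * x)"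
    unfolding homogeneous_basis_def by (simp only: distrib_left mult_ac)
  also have "\<dots> \<in> hardy p"
    using assms WH.inverse_plus_hardy exponent by (intro hardy_add hardy_const_mult hardy_tpow_mult) auto
  finally show ?thesis .
qed

lemma homogeneous_hardy: "homogeneous s \<in> hardy p"
  unfolding homogeneous_sum using exponent homogeneous_basis_hardy
  by (intro hardy_sum hardy_const_mult) auto

lemma homogeneous_eq_0:
  assumes zero: "homogeneous s = 0" and k: "k < n" shows "s k = 0"
proof -
  have "symmetric_poly s = (x * WH.plus) * symmetric_poly s" by (simp add: WH.inverse_plus_plus)
  also have "\<dots> = WH.plus * homogeneous s" by (simp only: homogeneous_def mult_ac)
  finally have "fourier (symmetric_poly s) (int (n - 1 - k)) = 0" by (simp add: zero)
  moreover have "n - 1 - nat (int (n - 1 - k)) = k" using k by simp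
  ultimately show ?thesis using k by (simp add: fourier_symmetric_poly split: if_splits)
qed

lemma eq_symmetric_polyI:
  assumes v: "v \<in> Lp_class 1" "\<And>j. j < 0 \<Longrightarrow> fourier v j = 0"
    and reflect_v: "reflect v = const \<sigma> * (tpow (- 2 * int n) * v)"
  shows "v = symmetric_poly (\<lambda>k. fourier v (int n - 1 - int k))"
proof -
  define s where "s k = fourier v (int n - 1 - int k)" for k :: nat
  have sym: "fourier v (- j - 1) = \<sigma> * fourier v (j + 2 * int n)" for j
    using fourier_reflect[of v j] by (simp add: reflect_v)
  have "v = symmetric_poly s"
  proof (rule fourier_eqI)
    show "fourier v j = fourier (symmetric_poly s) j" for j
    proof (cases "j < 0")
      case True
      then show ?thesis using v(2) hardy_fourier_neg[OF symmetric_poly_hardy[of 2]] by simp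
    next
      case False
      have mirror: "fourier v j = \<sigma> * fourier v (2 * int n - 1 - j)"
      proof -
        have "fourier v (2 * int n - 1 - j) = \<sigma> * fourier v j"
          using sym[of "j - 2 * int n"] by (simp add: algebra_simps)
        then show ?thesis by (simp only: mult.assoc[symmetric] WH.signature_square mult_1)
      qed
      consider (low) "j < int n" | (high) "int n \<le> j" "j < 2 * int n" | (beyond) "2 * int n \<le> j"
        by linarith
      then show ?thesis
      proof cases
        case low
        then have "int n - 1 - int (n - 1 - nat j) = j" using False by simp
        then show ?thesis using low False by (simp add: fourier_symmetric_poly s_def)
      next
        case high
        then have index: "int n - 1 - int (nat j - n) = 2 * int n - 1 - j" using False by simp
        have "fourier (symmetric_poly s) j = \<sigma> * s (nat j - n)"
          using high False by (simp add: fourier_symmetric_poly)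
        then show ?thesis by (simp only: mirror s_def index)
      next
        case beyond
        then show ?thesis using False mirror v(2)[of "2 * int n - 1 - j"]
          by (simp add: fourier_symmetric_poly)
      qed
    qed
  qed (use v(1) hardy_imp_L1[OF symmetric_poly_hardy[of 2]] in simp_all)
  then show ?thesis by (simp only: s_def[abs_def])
qed

text \<open>The function \<open>v = plus * u\<close> satisfies \<open>reflect v = \<sigma> t\<^sup>-\<^sup>2\<^sup>n v\<close> and is therefore a polynomial of degree
  less than \<open>2n\<close> with symmetric or skew-symmetric coefficients.\<close>

lemma homogeneous_solution:
  assumes u: "u \<in> hardy p" and reflect_u: "reflect u = d * u"
  obtains s where "u = homogeneous s"
proof -
  define v where "v = u * WH.plus"
  have u_eq: "u = x * v"
  proof -
    have "x * v = (x * WH.plus) * u" by (simp only: v_def mult_ac)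
    then show ?thesis by (simp add: WH.inverse_plus_plus)
  qed
  have "tilde x * reflect v = tilde x * (const \<sigma> * (tpow (- 2 * int n) * v))"
  proof -
    have "tilde x * reflect v = d * (x * v)" using reflect_u by (simp add: u_eq reflect_mult)
    also have "\<dots> = (const \<sigma> * (tpow (- 2 * int n) * tilde x)) * v"
      unfolding d_x[symmetric] by (simp only: mult.assoc)
    finally show ?thesis by (simp only: mult_ac)
  qed
  then have "tilde WH.plus * (tilde x * reflect v)
      = tilde WH.plus * (tilde x * (const \<sigma> * (tpow (- 2 * int n) * v)))"
    by simp
  then have "(tilde x * tilde WH.plus) * reflect v
      = (tilde x * tilde WH.plus) * (const \<sigma> * (tpow (- 2 * int n) * v))"
    by (simp only: mult_ac)
  then have "reflect v = const \<sigma> * (tpow (- 2 * int n) * v)" by (simp add: WH.tilde_inverse_plus_plus)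
  moreover have "v \<in> Lp_class 1" "\<And>j. j < 0 \<Longrightarrow> fourier v j = 0"
    unfolding v_def using hardy_mult[OF u WH.plus_hardy exponent] by auto
  ultimately have "v = symmetric_poly (\<lambda>k. fourier v (int n - 1 - int k))" by (intro eq_symmetric_polyI)
  then show thesis using that u_eq unfolding homogeneous_def by metis
qed

end

context toeplitz_hankel_pair
begin

section \<open>The inhomogeneous equation\<close>

lemma reflect_twice: "c * reflect (c * f) = reflect f" "d * reflect (d * f) = reflect f"
  by (simp_all only: reflect_mult mult.assoc[symmetric] c_tilde d_tilde mult_1)

text \<open>The approximate solution \<open>u\<close> obtained by inverting \<open>T(d t\<^sup>2\<^sup>n)\<close> has a defect \<open>r\<close> in the range of \<open>Q\<close>
  with \<open>d * reflect r = - r\<close>, and is corrected by \<open>reflect r / 2\<close>.\<close>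

lemma repair_defect:
  assumes "d * reflect r = - r"
  shows "d * (u + const (1/2) * reflect r) - reflect (u + const (1/2) * reflect r)
    = d * u - reflect u - r"
proof -
  have "d * (const (1/2) * reflect r) = - (const (1/2) * r)" by (simp add: assms mult.left_commute[of d])
  then have "d * (u + const (1/2) * reflect r) - reflect (u + const (1/2) * reflect r)
      = d * u - reflect u - (const (1/2) * r + const (1/2) * r)"
    by (simp add: distrib_left reflect_add reflect_const_mult)
  also have "const (1/2) * r + const (1/2) * r = r" by (simp flip: distrib_right const_add)
  finally show ?thesis .
qed

lemma inhomogeneous_solution:
  assumes g: "g \<in> hardy p"
  obtains u where "u \<in> hardy p" "d * u - reflect u = g - d * reflect g"
proof -
  have reflect_g: "reflect g \<in> cohardy p" and dg: "d * reflect g \<in> Lp_class p"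
    using reflect_hardy[OF g exponent] cd_Linf exponent by (simp_all add: Linf_mult_Lp cohardy_Lp)
  have "g - riesz (d * reflect g) \<in> hardy p" by (intro hardy_diff g riesz_hardy dg exponent)
  then obtain v where v: "v \<in> hardy p" "toeplitz shifted_d v = g - riesz (d * reflect g)"
    using d_invertible unfolding toeplitz_invertible_def bij_betw_def shifted_d_def by (metis imageE)
  define u where "u = tpow (2 * int n) * v"
  have u: "u \<in> hardy p" unfolding u_def by (intro hardy_tpow_mult v exponent) simp
  have riesz_du: "riesz (d * u) = g - riesz (d * reflect g)"
    using v(2) by (simp add: toeplitz_def shifted_d_def u_def mult.assoc)
  define r where "r = (d * u + d * reflect g) - (reflect u + g)"
  have reflect_u: "reflect u \<in> cohardy p" using u exponent by (rule reflect_hardy)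
  have Lp: "d * u \<in> Lp_class p" "reflect u \<in> Lp_class p" "g \<in> Lp_class p"
    using u g reflect_u cd_Linf exponent by (simp_all add: Linf_mult_hardy hardy_Lp cohardy_Lp)
  then have r_Lp: "r \<in> Lp_class p" unfolding r_def
    using dg exponent by (simp add: Lp_class_diff Lp_class_add)
  have "riesz r = (riesz (d * u) + riesz (d * reflect g)) - (riesz (reflect u) + riesz g)"
    unfolding r_def using Lp dg exponent
    by (simp add: riesz_diff[OF _ _ exponent] riesz_add[OF _ _ exponent] Lp_class_add)
  also have "\<dots> = 0" using g exponent by (simp add: riesz_du riesz_cohardy[OF reflect_u] riesz_id)
  finally have r: "r \<in> cohardy p" using riesz_eq_0_iff[OF r_Lp exponent] by simp
  have "d * reflect r = (d * reflect (d * u) + d * reflect (d * reflect g)) - (d * u + d * reflect g)"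
    unfolding r_def by (simp only: reflect_add reflect_diff reflect_reflect distrib_left
      right_diff_distrib)
  then have "d * reflect r = - r" by (simp add: reflect_twice r_def)
  then have "d * (u + const (1/2) * reflect r) - reflect (u + const (1/2) * reflect r)
      = g - d * reflect g"
    by (simp only: repair_defect) (simp add: r_def)
  moreover have "u + const (1/2) * reflect r \<in> hardy p"
    by (intro hardy_add hardy_const_mult u reflect_cohardy r exponent)
  ultimately show thesis using that by blast
qed

section \<open>Reduction to an invertible Toeplitz operator\<close>

lemma shifted_c_bij_betw: "bij_betw (toeplitz shifted_c) (hardy p) (hardy p)"
  using c_invertible unfolding toeplitz_invertible_def shifted_c_def .

lemma shifted_c_inj: "f \<in> hardy p \<Longrightarrow> toeplitz shifted_c f = 0 \<Longrightarrow> f = 0"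
  using inj_onD[of "toeplitz shifted_c" "hardy p" f 0] shifted_c_bij_betw exponent
  by (simp add: bij_betw_def)

lemma shifted_c_surj:
  assumes "h \<in> hardy p" obtains f where "f \<in> hardy p" "toeplitz shifted_c f = h"
  using assms shifted_c_bij_betw unfolding bij_betw_def by (metis imageE)

lemma cohardy_tpow_mult: "f \<in> cohardy p \<Longrightarrow> tpow (- int n) * f \<in> cohardy p"
  using exponent by (simp add: cohardy_def Lp_class_tpow_mult)

lemma shifted_c_tpow: "toeplitz shifted_c (tpow (int n) * f) = riesz (tpow (- int n) * (c * f))"
proof -
  have "shifted_c * (tpow (int n) * f) = (tpow (- 2 * int n) * tpow (int n)) * (c * f)"
    by (simp only: shifted_c_def mult_ac)
  then show ?thesis by (simp add: toeplitz_def tpow_mult)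
qed

text \<open>For a solution of \<open>c * reflect r = r\<close>, vanishing of the non-negative coefficients of \<open>t\<^sup>-\<^sup>n r\<close> puts
  \<open>t\<^sup>n reflect r\<close> into the kernel of \<open>T(c t\<^sup>-\<^sup>2\<^sup>n)\<close>.\<close>

lemma eq_0_of_riesz_shift:
  assumes r: "r \<in> Lp_class p" "c * reflect r = r" and zero: "riesz (tpow (- int n) * r) = 0"
  shows "r = 0"
proof -
  have "tpow (- int n) * r \<in> cohardy p"
    using riesz_eq_0_iff[of "tpow (- int n) * r" p] r(1) zero exponent by (simp add: Lp_class_tpow_mult)
  then have "reflect (tpow (- int n) * r) \<in> hardy p" using exponent by (rule reflect_cohardy)
  then have "tpow (int n) * reflect r \<in> hardy p" by (simp add: reflect_mult)
  moreover have "toeplitz shifted_c (tpow (int n) * reflect r) = 0"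
    unfolding shifted_c_tpow r(2) by (rule zero)
  ultimately have "tpow (int n) * reflect r = 0" by (rule shifted_c_inj)
  then have "tpow (- int n) * (tpow (int n) * reflect r) = 0" by simp
  then have "reflect r = 0" by (simp add: tpow_mult_assoc)
  then have "reflect (reflect r) = c * 0" by simp
  then show ?thesis by simp
qed

lemma shifted_solution:
  assumes w: "w \<in> Lp_class p" "c * reflect w = w"
    and v: "v \<in> hardy p" "toeplitz shifted_c v = riesz (tpow (- int n) * w)"
      "\<And>j. j < n \<Longrightarrow> fourier v (int j) = 0"
  shows "tpow (- int n) * v \<in> hardy p" "c * (tpow (- int n) * v) + reflect (tpow (- int n) * v) = w"
proof -
  define f where "f = tpow (- int n) * v"
  have v_eq: "v = tpow (int n) * f" by (simp add: f_def tpow_mult_assoc)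
  have f: "f \<in> hardy p"
    unfolding f_def
  proof (rule hardy_tpow_mult[OF v(1) exponent])
    show "fourier v j = 0" if "0 \<le> j" "j + - int n < 0" for j using v(3)[of "nat j"] that by simp
  qed
  then show "tpow (- int n) * v \<in> hardy p" by (simp add: f_def)
  have reflect_f: "reflect f \<in> cohardy p" using f exponent by (rule reflect_hardy)
  have Lp: "c * f \<in> Lp_class p" "reflect f \<in> Lp_class p"
    using f reflect_f cd_Linf exponent by (simp_all add: Linf_mult_hardy cohardy_Lp)
  define r where "r = c * f + reflect f - w"
  have r_Lp: "r \<in> Lp_class p" unfolding r_def
    using Lp w(1) exponent by (simp add: Lp_class_add Lp_class_diff)
  have "c * reflect r = c * reflect (c * f) + c * f - c * reflect w"
    unfolding r_def by (simp only: reflect_add reflect_diff reflect_reflect distrib_left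
      right_diff_distrib)
  then have cr: "c * reflect r = r" by (simp only: reflect_twice w(2) r_def add.commute)
  have shift: "tpow (- int n) * (c * f) \<in> Lp_class p" "tpow (- int n) * reflect f \<in> Lp_class p"
    "tpow (- int n) * w \<in> Lp_class p"
    using Lp w(1) exponent by (simp_all add: Lp_class_tpow_mult)
  have "riesz (tpow (- int n) * r)
      = riesz (tpow (- int n) * (c * f)) + riesz (tpow (- int n) * reflect f) - riesz
        (tpow (- int n) * w)"
    unfolding r_def distrib_left right_diff_distrib using shift exponent
    by (simp add: riesz_diff[OF _ _ exponent] riesz_add[OF _ _ exponent] Lp_class_add)
  also have "\<dots> = 0"
    using v(2) by (simp add: shifted_c_tpow v_eq riesz_cohardy[OF cohardy_tpow_mult[OF reflect_f]])
  finally have "r = 0" by (rule eq_0_of_riesz_shift[OF r_Lp cr])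
  then show "c * (tpow (- int n) * v) + reflect (tpow (- int n) * v) = w" by (simp add: r_def f_def)
qed

lemma b_mult_c: "b * (c * f + reflect f) = a * f + b * reflect f"
proof -
  have "b * (c * f + reflect f) = (b * inverse b) * (a * f) + b * reflect f"
    by (simp only: divide_circle_fun_def distrib_left mult_ac)
  then show ?thesis by (simp add: inverses)
qed

lemma toeplitz_hankel_solution:
  assumes g: "g \<in> hardy p" and u: "u \<in> hardy p" and eq: "d * u + d * reflect g = g + reflect u"
    and v: "v \<in> hardy p" "toeplitz shifted_c v = riesz (tpow (- int n) * (inverse b * (g + reflect u)))"
      "\<And>j. j < n \<Longrightarrow> fourier v (int j) = 0"
  obtains f where "f \<in> hardy p" "c * f + reflect f = inverse b * (g + reflect u)"
    "toeplitz_hankel a b f = g"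
proof -
  have reflect_u: "reflect u \<in> cohardy p" using u exponent by (rule reflect_hardy)
  then have Lp: "inverse b * (g + reflect u) \<in> Lp_class p"
    using g Linf exponent by (simp add: Linf_mult_Lp Lp_class_add hardy_Lp cohardy_Lp)
  have "reflect (inverse b * (g + reflect u)) = inverse (tilde b) * (reflect g + u)"
    by (simp only: reflect_mult reflect_add reflect_reflect tilde_inverse)
  then have "c * reflect (inverse b * (g + reflect u)) = inverse b * (d * u + d * reflect g)"
    by (simp only: divide_circle_fun_def distrib_left mult_ac add.commute)
  then have "c * reflect (inverse b * (g + reflect u)) = inverse b * (g + reflect u)" unfolding eq .
  then have f: "tpow (- int n) * v \<in> hardy p"
    "c * (tpow (- int n) * v) + reflect (tpow (- int n) * v) = inverse b * (g + reflect u)"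
    using shifted_solution[OF Lp _ v(1,2)] v(3) by blast+
  have "a * (tpow (- int n) * v) + b * reflect (tpow (- int n) * v)
      = b * (c * (tpow (- int n) * v) + reflect (tpow (- int n) * v))"
    by (rule b_mult_c[symmetric])
  also have "\<dots> = (b * inverse b) * (g + reflect u)" unfolding f(2) by (rule mult.assoc[symmetric])
  finally have "toeplitz_hankel a b (tpow (- int n) * v) = riesz (g + reflect u)"
    by (simp add: toeplitz_hankel_def inverses)
  also have "\<dots> = g"
    using riesz_add[OF hardy_Lp[OF g] cohardy_Lp[OF reflect_u] exponent] g exponent
    by (simp add: riesz_id riesz_cohardy[OF reflect_u])
  finally show thesis using that f by blast
qed

section \<open>The determinant criterion\<close>

definition omega :: "nat \<Rightarrow> circle_fun" where
  "omega k = inv_into (hardy p) (toeplitz shifted_c)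
    (toeplitz (inverse (tilde a) * tpow (- int n)) (homogeneous_basis k))"

definition omega_sum :: "(nat \<Rightarrow> complex) \<Rightarrow> circle_fun" where
  "omega_sum s = (\<Sum>k<n. const (s k) * omega k)"

definition omega_matrix :: "complex mat" where
  "omega_matrix = Matrix.mat n n (\<lambda>(j, k). fourier (omega k) (int j))"

sublocale A: hardy_operator p "toeplitz (inverse (tilde a) * tpow (- int n))"
  using Linf exponent by (intro toeplitz_hardy_operator) (simp_all flip: tilde_inverse)

lemma omega_hardy: "k < n \<Longrightarrow> omega k \<in> hardy p"
  and toeplitz_omega: "k < n \<Longrightarrow> toeplitz shifted_c (omega k)
    = toeplitz (inverse (tilde a) * tpow (- int n)) (homogeneous_basis k)"
  using A.maps[OF homogeneous_basis_hardy] shifted_c_bij_betw unfolding omega_def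
  by (auto simp: bij_betw_def intro: inv_into_into f_inv_into_f)

lemma omega_sum_hardy: "omega_sum s \<in> hardy p"
  unfolding omega_sum_def using exponent omega_hardy by (intro hardy_sum hardy_const_mult) auto

lemma toeplitz_omega_sum:
  "toeplitz shifted_c (omega_sum s) = riesz (tpow (- int n) * (inverse (tilde a) * homogeneous s))"
proof -
  have "toeplitz shifted_c (omega_sum s) = (\<Sum>k<n. const (s k) * toeplitz shifted_c (omega k))"
    unfolding omega_sum_def by (rule T.sum) (simp_all add: omega_hardy)
  also have "\<dots> = (\<Sum>k<n. const (s k) * toeplitz (inverse (tilde a) * tpow (- int n))
      (homogeneous_basis k))"
    by (intro sum.cong refl) (simp add: toeplitz_omega)
  also have "\<dots> = toeplitz (inverse (tilde a) * tpow (- int n)) (homogeneous s)"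
    unfolding homogeneous_sum by (rule A.sum[symmetric]) (simp_all add: homogeneous_basis_hardy)
  finally show ?thesis unfolding toeplitz_def by (simp only: mult_ac)
qed

lemma fourier_omega_sum: "fourier (omega_sum s) j = (\<Sum>k<n. fourier (omega k) j * s k)"
proof -
  have "fourier (omega_sum s) j = (\<Sum>k<n. fourier (const (s k) * omega k) j)"
    unfolding omega_sum_def using exponent hardy_imp_L1[OF omega_hardy]
    by (intro fourier_sum) (auto intro: Lp_class_const_mult)
  then show ?thesis by (simp add: mult.commute)
qed

lemma kernel_of_det_eq_0:
  assumes det: "Determinant.det omega_matrix = 0"
  obtains f where "f \<in> hardy p" "f \<noteq> 0" "toeplitz_hankel a b f = 0"
proof -
  obtain s k where s: "\<And>j. j < n \<Longrightarrow> (\<Sum>k<n. fourier (omega k) (int j) * s k) = 0" and k: "k < n" "s k \<noteq> 0"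
    using det unfolding omega_matrix_def det_eq_0_iff_kernel[of n "\<lambda>j k. fourier (omega k) (int j)"]
    by blast
  have w: "inverse b * reflect (homogeneous s) = inverse (tilde a) * homogeneous s"
    by (simp only: reflect_homogeneous mult.assoc[symmetric] inverse_b_d)
  obtain f where f: "f \<in> hardy p" "c * f + reflect f = inverse b * (0 + reflect (homogeneous s))"
    "toeplitz_hankel a b f = 0"
  proof (rule toeplitz_hankel_solution[OF _ homogeneous_hardy _ omega_sum_hardy])
    show "toeplitz shifted_c (omega_sum s)
        = riesz (tpow (- int n) * (inverse b * (0 + reflect (homogeneous s))))"
      by (simp add: toeplitz_omega_sum w)
  qed (use exponent s in \<open>simp_all add: reflect_homogeneous fourier_omega_sum\<close>)
  have "f \<noteq> 0"
  proof
    assume "f = 0"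
    then have "inverse (tilde a) * homogeneous s = 0" using f(2) by (simp add: w)
    then have "(tilde a * inverse (tilde a)) * homogeneous s = 0" by (simp add: mult.assoc)
    then show False using homogeneous_eq_0[of s k] k by (simp add: inverses)
  qed
  then show thesis using that f by blast
qed

lemma toeplitz_hankel_kernel:
  assumes f: "f \<in> hardy p" and zero: "toeplitz_hankel a b f = 0"
  obtains s where "tpow (int n) * f = omega_sum s"
proof -
  define u where "u = reflect (a * f + b * reflect f)"
  have reflect_u: "reflect u = a * f + b * reflect f" by (simp add: u_def)
  have "a * f + b * reflect f \<in> cohardy p"
    using riesz_eq_0_iff[OF toeplitz_hankel_Lp(3)[OF Linf(1,2) f exponent] exponent] zero
    by (simp add: toeplitz_hankel_def)
  then have u: "u \<in> hardy p" unfolding u_def using exponent by (rule reflect_cohardy)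
  have "d * u = (a * tilde a) * (inverse (tilde b) * reflect f) + (tilde b * inverse (tilde b)) * (a * f)"
    by (simp only: u_def reflect_add reflect_mult reflect_reflect divide_circle_fun_def distrib_left
      mult_ac)
  also have "\<dots> = (tilde b * inverse (tilde b)) * (b * reflect f + a * f)"
    unfolding matching by (simp only: distrib_left mult_ac)
  finally have u_eq: "reflect u = d * u" by (simp add: inverses reflect_u add.commute)
  obtain s where s: "u = homogeneous s" using homogeneous_solution[OF u u_eq] .
  have "(b * inverse b) * (c * f + reflect f) = inverse b * reflect u"
    unfolding reflect_u b_mult_c[symmetric] by (simp only: mult_ac)
  also have "\<dots> = inverse (tilde a) * u" unfolding u_eq mult.assoc[symmetric] inverse_b_d ..
  finally have w: "c * f + reflect f = inverse (tilde a) * u" by (simp add: inverses)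
  have reflect_f: "tpow (- int n) * reflect f \<in> cohardy p"
    by (intro cohardy_tpow_mult reflect_hardy f exponent)
  have shifted_f: "tpow (int n) * f \<in> hardy p" using f exponent by (rule hardy_tpow_mult) simp
  have "toeplitz shifted_c (omega_sum s) = riesz (tpow (- int n) * (c * f) + tpow (- int n) * reflect f)"
    by (simp add: toeplitz_omega_sum distrib_left flip: s w)
  also have "\<dots> = toeplitz shifted_c (tpow (int n) * f)"
    using riesz_add[OF _ cohardy_Lp[OF reflect_f] exponent, of "tpow (- int n) * (c * f)"] f cd_Linf
      exponent
    by (simp add: shifted_c_tpow riesz_cohardy[OF reflect_f] Lp_class_tpow_mult Linf_mult_hardy)
  finally have "toeplitz shifted_c (tpow (int n) * f - omega_sum s) = 0"
    by (simp add: T.diff shifted_f omega_sum_hardy)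
  then have "tpow (int n) * f - omega_sum s = 0"
    by (rule shifted_c_inj[OF hardy_diff[OF shifted_f omega_sum_hardy exponent]])
  then show thesis using that by simp
qed

lemma injective_of_det_nonzero:
  assumes det: "Determinant.det omega_matrix \<noteq> 0" and f: "f \<in> hardy p" "toeplitz_hankel a b f = 0"
  shows "f = 0"
proof -
  obtain s where s: "tpow (int n) * f = omega_sum s" using toeplitz_hankel_kernel[OF f] .
  have "(\<Sum>k<n. fourier (omega k) (int j) * s k) = 0" if "j < n" for j
    unfolding fourier_omega_sum[symmetric] s[symmetric] using that f(1) by (simp add: hardy_fourier_neg)
  then have "\<forall>k<n. s k = 0"
    using det unfolding omega_matrix_def det_eq_0_iff_kernel[of n "\<lambda>j k. fourier (omega k) (int j)"]
    by blast
  then have "omega_sum s = 0" by (simp add: omega_sum_def)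
  then have "tpow (- int n) * (tpow (int n) * f) = 0" by (simp add: s)
  then show ?thesis by (simp add: tpow_mult_assoc)
qed

lemma surjective_of_det_nonzero:
  assumes det: "Determinant.det omega_matrix \<noteq> 0" and g: "g \<in> hardy p"
  obtains f where "f \<in> hardy p" "toeplitz_hankel a b f = g"
proof -
  obtain u where u: "u \<in> hardy p" "d * u - reflect u = g - d * reflect g"
    using inhomogeneous_solution[OF g] .
  have "reflect u \<in> cohardy p" using u(1) exponent by (rule reflect_hardy)
  then have Lp: "tpow (- int n) * (inverse b * (g + reflect u)) \<in> Lp_class p"
    using g Linf exponent by (simp add: Linf_mult_Lp Lp_class_add hardy_Lp cohardy_Lp Lp_class_tpow_mult)
  obtain v where v: "v \<in> hardy p" "toeplitz shifted_c v
      = riesz (tpow (- int n) * (inverse b * (g + reflect u)))"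
    using shifted_c_surj[OF riesz_hardy[OF Lp exponent]] .
  obtain s where s: "\<And>j. j < n \<Longrightarrow> (\<Sum>k<n. fourier (omega k) (int j) * s k) = - fourier v (int j)"
    using det_nonzero_solvable[OF det[unfolded omega_matrix_def], of "\<lambda>j. - fourier v (int j)"] by blast
  have w: "inverse b * (g + reflect (u + homogeneous s))
      = inverse b * (g + reflect u) + inverse (tilde a) * homogeneous s"
    by (simp only: reflect_add reflect_homogeneous distrib_left mult.assoc[symmetric] inverse_b_d
      add.assoc)
  have "tpow (- int n) * (inverse (tilde a) * homogeneous s) \<in> Lp_class p"
    using Linf homogeneous_hardy exponent
    by (simp add: Lp_class_tpow_mult Linf_mult_hardy flip: tilde_inverse)
  then have "toeplitz shifted_c (v + omega_sum s)
      = riesz (tpow (- int n) * (inverse b * (g + reflect (u + homogeneous s))))"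
    by (simp only: T.add v omega_sum_hardy toeplitz_omega_sum w distrib_left[of "tpow (- int n)"]
      riesz_add[OF Lp _ exponent])
  moreover have "d * (u + homogeneous s) + d * reflect g = g + reflect (u + homogeneous s)"
    using u(2) by (simp add: reflect_add reflect_homogeneous algebra_simps)
  moreover have "fourier (v + omega_sum s) (int j) = 0" if "j < n" for j
    using s[OF that] hardy_imp_L1[OF v(1) exponent] hardy_imp_L1[OF omega_sum_hardy exponent]
    by (simp add: fourier_add fourier_omega_sum)
  ultimately show thesis
    using toeplitz_hankel_solution[OF g, of "u + homogeneous s" "v + omega_sum s"] that u(1) v(1) exponent
    by (blast intro: hardy_add homogeneous_hardy omega_sum_hardy)
qed

theorem toeplitz_hankel_inj_iff: "inj_on (toeplitz_hankel a b) (hardy p)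
    \<longleftrightarrow> Determinant.det omega_matrix \<noteq> 0"
  and toeplitz_hankel_bij_betw: "Determinant.det omega_matrix \<noteq> 0 \<Longrightarrow>
    bij_betw (toeplitz_hankel a b) (hardy p) (hardy p)"
proof -
  interpret TH: hardy_operator p "toeplitz_hankel a b"
    using Linf(1,2) exponent by (rule toeplitz_hankel_hardy_operator)
  have inj: "inj_on (toeplitz_hankel a b) (hardy p)" if "Determinant.det omega_matrix \<noteq> 0"
  proof (rule inj_onI)
    fix f h assume fh: "f \<in> hardy p" "h \<in> hardy p" "toeplitz_hankel a b f = toeplitz_hankel a b h"
    then have "toeplitz_hankel a b (f - h) = 0" by (simp add: TH.diff)
    then have "f - h = 0" by (rule injective_of_det_nonzero[OF that hardy_diff[OF fh(1,2) exponent]])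
    then show "f = h" by simp
  qed
  moreover have False if det: "Determinant.det omega_matrix = 0"
    and inj: "inj_on (toeplitz_hankel a b) (hardy p)"
  proof -
    obtain f where "f \<in> hardy p" "f \<noteq> 0" "toeplitz_hankel a b f = 0" using kernel_of_det_eq_0[OF det] .
    then show False using inj_onD[OF inj, of f 0] exponent by simp
  qed
  ultimately show "inj_on (toeplitz_hankel a b) (hardy p) \<longleftrightarrow> Determinant.det omega_matrix \<noteq> 0" by blast
  show "bij_betw (toeplitz_hankel a b) (hardy p) (hardy p)" if "Determinant.det omega_matrix \<noteq> 0"
    using inj[OF that] surjective_of_det_nonzero[OF that] TH.maps unfolding bij_betw_def by blast
qed

end

section \<open>Operators on functions and on classes\<close>

definition induces :: "real \<Rightarrow> ((complex \<Rightarrow> complex) \<Rightarrow> complex \<Rightarrow> complex) \<Rightarrow> (circle_fun \<Rightarrow> circle_fun) \<Rightarrow>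
    bool" where
  "induces p A T \<longleftrightarrow> (\<forall>F\<in>Hp p. A F \<in> Hp p \<and> circ_class (A F) = T (circ_class F))"

lemma inducesD: "induces p A T \<Longrightarrow> F \<in> Hp p \<Longrightarrow> A F \<in> Hp p"
  "induces p A T \<Longrightarrow> F \<in> Hp p \<Longrightarrow> circ_class (A F) = T (circ_class F)"
  by (auto simp: induces_def)

lemma Hp_circ_class_eq_iff: "F \<in> Hp p \<Longrightarrow> G \<in> Hp p \<Longrightarrow> circ_class F = circ_class G \<longleftrightarrow> ae_eq F G"
  by (simp add: Hp_iff circ_class_eq_iff)

lemma induces_exists:
  assumes "\<And>f. f \<in> hardy p \<Longrightarrow> T f \<in> hardy p" obtains A where "induces p A T"
proof -
  have "\<forall>F\<in>Hp p. \<exists>G. G \<in> Hp p \<and> circ_class G = T (circ_class F)"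
    using assms hardy_representative by (metis Hp_iff)
  then show thesis using that unfolding induces_def by (metis bchoice)
qed

lemma hardy_operator_bounded_op:
  assumes T: "hardy_operator p T" and A: "induces p A T"
  shows "bounded_op p A"
proof -
  interpret hardy_operator p T by (rule T)
  note A' = inducesD[OF A]
  have Hp: "circ_measurable F" "circ_class F \<in> hardy p" if "F \<in> Hp p" for F
    using that by (simp_all add: Hp_iff)
  have add': "ae_eq (A (\<lambda>z. F z + G z)) (\<lambda>z. A F z + A G z)" if "F \<in> Hp p" "G \<in> Hp p" for F G
  proof -
    have sum: "circ_class (\<lambda>z. F z + G z) = circ_class F + circ_class G"
      using Hp that by (simp add: circ_class_add)
    then have sum_Hp: "(\<lambda>z. F z + G z) \<in> Hp p" using Hp that exponent by (simp add: Hp_iff hardy_add)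
    have "circ_class (A (\<lambda>z. F z + G z)) = circ_class (\<lambda>z. A F z + A G z)"
      using that Hp A'(1) by (simp add: A'(2)[OF sum_Hp] sum add A'(2) flip: circ_class_add)
    then show ?thesis using Hp(1) A'(1) that sum_Hp by (simp add: circ_class_eq_iff)
  qed
  have scale': "ae_eq (A (\<lambda>z. k * F z)) (\<lambda>z. k * A F z)" if "F \<in> Hp p" for F k
  proof -
    have mult: "circ_class (\<lambda>z. k * F z) = const k * circ_class F"
      using Hp that by (simp add: circ_class_simps)
    then have mult_Hp: "(\<lambda>z. k * F z) \<in> Hp p"
      using Hp that exponent by (simp add: Hp_iff hardy_const_mult)
    have "circ_class (\<lambda>z. k * A F z) = const k * circ_class (A F)"
      using Hp A'(1) that by (simp add: circ_class_simps)
    then have "circ_class (A (\<lambda>z. k * F z)) = circ_class (\<lambda>z. k * A F z)"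
      using that Hp by (simp add: A'(2) mult_Hp mult scale)
    then show ?thesis using Hp(1) A'(1) that mult_Hp by (simp add: circ_class_eq_iff)
  qed
  have cong: "ae_eq (A F) (A G)" if "F \<in> Hp p" "G \<in> Hp p" "ae_eq F G" for F G
    using that A' Hp_circ_class_eq_iff[of F p G] Hp_circ_class_eq_iff[of "A F" p "A G"] by simp
  obtain M where "\<And>f. f \<in> hardy p \<Longrightarrow> cnorm p (T f) \<le> M * cnorm p f" using bounded by blast
  then have "pnorm p (A F) \<le> M * pnorm p F" if "F \<in> Hp p" for F
    using that Hp A'(1) by (simp add: pnorm_cnorm A'(2))
  then show ?thesis
    unfolding bounded_op_def using A'(1) cong add' scale' by blast
qed

lemma left_invertible_inj_on:
  assumes left: "left_invertible p A" and A: "induces p A T"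
  shows "inj_on T (hardy p)"
proof (rule inj_onI)
  fix f g assume fg: "f \<in> hardy p" "g \<in> hardy p" "T f = T g"
  obtain B where B: "bounded_op p B" "\<And>F. F \<in> Hp p \<Longrightarrow> ae_eq (B (A F)) F"
    using left by (auto simp: left_invertible_def)
  obtain F where F: "F \<in> Hp p" "f = circ_class F" using hardy_representative[OF fg(1)] .
  obtain G where G: "G \<in> Hp p" "g = circ_class G" using hardy_representative[OF fg(2)] .
  note AF = inducesD[OF A F(1)] and AG = inducesD[OF A G(1)]
  have "ae_eq (A F) (A G)" using fg(3) AF AG F(2) G(2) by (simp add: Hp_circ_class_eq_iff[symmetric])
  then have "ae_eq (B (A F)) (B (A G))" and "B (A F) \<in> Hp p" "B (A G) \<in> Hp p"
    using B(1) AF(1) AG(1) by (simp_all add: bounded_op_def)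
  then have "circ_class (B (A F)) = circ_class (B (A G))" by (simp add: Hp_circ_class_eq_iff)
  moreover have "circ_class (B (A F)) = f" "circ_class (B (A G)) = g"
    using B(2) F G \<open>B (A F) \<in> Hp p\<close> \<open>B (A G) \<in> Hp p\<close> by (simp_all add: Hp_circ_class_eq_iff)
  ultimately show "f = g" by simp
qed

lemma right_invertible_image:
  assumes right: "right_invertible p A" and A: "induces p A T"
  shows "T ` hardy p = hardy p"
proof (intro equalityI subsetI)
  fix g assume "g \<in> hardy p"
  then obtain G where G: "G \<in> Hp p" "g = circ_class G" using hardy_representative by blast
  obtain B where "bounded_op p B" "ae_eq (A (B G)) G"
    using right G(1) by (auto simp: right_invertible_def)
  then have B: "B G \<in> Hp p" "ae_eq (A (B G)) G" using G(1) by (simp_all add: bounded_op_def)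
  then have "T (circ_class (B G)) = g" using inducesD[OF A B(1)] G
    by (simp add: Hp_circ_class_eq_iff[symmetric])
  then show "g \<in> T ` hardy p" using B(1) by (auto simp: Hp_iff)
next
  fix g assume "g \<in> T ` hardy p"
  then obtain F where "F \<in> Hp p" "g = T (circ_class F)" using hardy_representative by blast
  then show "g \<in> hardy p" using inducesD[OF A] by (metis Hp_iff)
qed

lemma bij_betw_invertible_op:
  assumes T: "hardy_operator p T" and bij: "bij_betw T (hardy p) (hardy p)" and A: "induces p A T"
  shows "invertible_op p A"
proof -
  define S where "S = inv_into (hardy p) T"
  have S: "hardy_operator p S" unfolding S_def
    using T bij by (rule hardy_operator.inv_into_hardy_operator)
  obtain B where B: "induces p B S" using induces_exists hardy_operator.maps[OF S] by blast
  have "bounded_op p B" using S B by (rule hardy_operator_bounded_op)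
  moreover have "ae_eq (B (A F)) F" "ae_eq (A (B F)) F" if F: "F \<in> Hp p" for F
  proof -
    have "circ_class F \<in> hardy p" using F by (simp add: Hp_iff)
    then have "circ_class (B (A F)) = circ_class F" "circ_class (A (B F)) = circ_class F"
      using F bij inducesD[OF A] inducesD[OF B]
      by (simp_all add: S_def bij_betw_inv_into_left bij_betw_inv_into_right)
    then show "ae_eq (B (A F)) F" "ae_eq (A (B F)) F"
      using F inducesD(1)[OF A] inducesD(1)[OF B]
        Hp_circ_class_eq_iff[of "B (A F)" p F] Hp_circ_class_eq_iff[of "A (B F)" p F] by simp_all
  qed
  ultimately show ?thesis by (auto simp: invertible_op_def)
qed

lemma TH_induces:
  assumes a: "a \<in> Linf" and b: "b \<in> Linf" and p: "1 < p"
  shows "induces p (TH a b) (toeplitz_hankel (circ_class a) (circ_class b))"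
proof -
  have "TH a b F \<in> Hp p \<and> circ_class (TH a b F)
      = toeplitz_hankel (circ_class a) (circ_class b) (circ_class F)"
    if F: "F \<in> Hp p" for F
  proof -
    note a' = a[unfolded Linf_iff] and b' = b[unfolded Linf_iff] and F' = F[unfolded Hp_iff]
    have cohardy: "reflect (circ_class F) \<in> cohardy p" using F' p by (simp add: reflect_hardy)
    have flip: "circ_measurable (Jflip F)" "circ_class (Jflip F) = reflect (circ_class F)"
      using F' by (simp_all add: Jflip_def reflect_def circ_class_simps power_int_minus)
    note Pr_flip = Pr_class[OF flip(1) _ p, unfolded flip(2), OF cohardy_Lp[OF cohardy]]
    have "circ_measurable (Qr (Jflip F))" "circ_class (Qr (Jflip F)) = reflect (circ_class F)"
      using flip Pr_flip by (simp_all add: Qr_def riesz_cohardy[OF cohardy] flip: circ_class_diff)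
    then have product: "circ_measurable (\<lambda>z. b z * Qr (Jflip F) z)"
        "circ_class (\<lambda>z. b z * Qr (Jflip F) z) = circ_class b * reflect (circ_class F)"
      using b' by (simp_all flip: circ_class_mult)
    note Lp = toeplitz_hankel_Lp[OF conjunct2[OF a'] conjunct2[OF b'] conjunct2[OF F'] p]
    note Hank = Pr_class[OF product(1) _ p, unfolded product(2), OF Lp(2), folded Hank_def]
      and Toep = Toep_class[OF a F p]
    have "circ_class (TH a b F) = toeplitz_hankel (circ_class a) (circ_class b) (circ_class F)"
      using Hank Toep riesz_add[OF Lp(1,2) p]
      by (simp add: TH_def toeplitz_hankel_def toeplitz_def flip: circ_class_add)
    moreover have "circ_measurable (TH a b F)" using Hank(1) Toep(1) by (simp add: TH_def)
    ultimately show ?thesis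
      using hardy_operator.maps[OF toeplitz_hankel_hardy_operator, of _ _ p] a' b' F' p
      by (simp add: Hp_iff)
  qed
  then show ?thesis by (simp add: induces_def)
qed

section \<open>Subordinated pairs and the matrix \<open>W\<^sub>n(a, b)\<close>\<close>

lemma matching_pair_class:
  assumes "matching_pair a b"
  shows "a \<in> Linf" "b \<in> Linf" "circ_class a \<in> GLinf_class" "circ_class b \<in> GLinf_class"
    and "circ_class a * tilde (circ_class a) = circ_class b * tilde (circ_class b)"
proof -
  obtain g where a: "a \<in> Linf" and b: "b \<in> Linf" and g: "g \<in> Linf" "ae_eq (\<lambda>z. a z * g z) (\<lambda>z. 1)"
    and matching: "ae_eq (\<lambda>t. a t * tld a t) (\<lambda>t. b t * tld b t)"
    using assms unfolding matching_pair_def GLinf_def by blast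
  show "a \<in> Linf" "b \<in> Linf" by (fact a b)+
  define A B G where "A = circ_class a" and "B = circ_class b" and "G = circ_class g"
  have measurable: "circ_measurable a" "circ_measurable b" "circ_measurable g"
    and Linf: "A \<in> Linf_class" "B \<in> Linf_class" "G \<in> Linf_class"
    using a b g(1) by (auto simp: Linf_iff A_def B_def G_def)
  have AG: "A * G = 1" using measurable g(2) by (simp add: A_def G_def circ_class_simps circ_class_eq_iff)
  then show "circ_class a \<in> GLinf_class" using Linf inverse_unique_class[OF AG]
    by (simp add: GLinf_class_def A_def)
  show eq: "circ_class a * tilde (circ_class a) = circ_class b * tilde (circ_class b)"
    using measurable matching by (simp add: circ_class_simps circ_class_eq_iff tld_def)
  have "B * (tilde B * (G * tilde G)) = (A * tilde A) * (G * tilde G)"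
    unfolding A_def B_def eq by (rule mult.assoc[symmetric])
  also have "\<dots> = (A * G) * tilde (A * G)" by (simp only: tilde_mult mult_ac)
  finally have "B * (tilde B * (G * tilde G)) = 1" by (simp add: AG)
  from inverse_unique_class[OF this] this show "circ_class b \<in> GLinf_class"
    using Linf by (simp add: GLinf_class_def B_def)
qed

lemma sub_class:
  assumes "circ_measurable a" "circ_measurable b"
  shows "circ_measurable (sub_c a b)" "circ_class (sub_c a b) = circ_class a / circ_class b"
    and "circ_measurable (sub_d a b)" "circ_class (sub_d a b) = circ_class a / tilde (circ_class b)"
  using assms by (simp_all add: sub_c_def sub_d_def tld_def circ_class_simps)

lemma F_TH_pair:
  assumes F: "F_TH p (- 2 * int n) (2 * int n) a b" and p: "1 < p"
  shows "toeplitz_hankel_pair p n (circ_class a) (circ_class b)"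
proof -
  have matching: "matching_pair a b" and index: "fredholm_index p (Toep (sub_c a b)) (- 2 * int n)"
      "fredholm_index p (Toep (sub_d a b)) (2 * int n)"
    using F by (simp_all add: F_TH_def)
  note pair = matching_pair_class[OF matching]
  have measurable: "circ_measurable a" "circ_measurable b" using pair(1,2) by (simp_all add: Linf_iff)
  note sub = sub_class[OF measurable]
  define A B where "A = circ_class a" and "B = circ_class b"
  have GL: "A \<in> Linf_class" "B \<in> Linf_class" "inverse A \<in> Linf_class" "inverse B \<in> Linf_class"
    "A * inverse A = 1" "B * inverse B = 1"
    using pair(3,4) by (auto simp: GLinf_class_def A_def B_def)
  have "(A / B) * (B * inverse A) = (A * inverse A) * (B * inverse B)"
    "(A / tilde B) * (tilde B * inverse A) = (A * inverse A) * tilde (B * inverse B)"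
    by (simp_all only: divide_circle_fun_def tilde_mult tilde_inverse mult_ac)
  then have unit: "(A / B) * inverse (A / B) = 1" "(A / tilde B) * inverse (A / tilde B) = 1"
    using inverse_unique_class GL(5,6) by (metis mult_1 tilde_1)+
  have "A / B \<in> Linf_class" "A / tilde B \<in> Linf_class"
    using GL by (simp_all add: divide_circle_fun_def flip: tilde_inverse)
  then have "sub_c a b \<in> Linf" "sub_d a b \<in> Linf" using sub by (simp_all add: Linf_iff A_def B_def)
  then have "toeplitz_invertible p (circ_class (sub_c a b) * tpow (- 2 * int n))"
    "toeplitz_invertible p (circ_class (sub_d a b) * tpow (2 * int n))"
    using index p unit by (intro fredholm_index_toeplitz_invertible; simp add: sub A_def B_def)+
  then show ?thesis using p pair by unfold_locales (simp_all add: sub)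
qed

lemma Tinv_class:
  assumes g: "g \<in> Linf" "toeplitz_invertible p (circ_class g)"
    and h: "circ_measurable h" "circ_class h \<in> hardy p" and p: "1 < p"
  shows "circ_measurable (Tinv p g h)" "circ_class (Tinv p g h)
    = inv_into (hardy p) (toeplitz (circ_class g)) (circ_class h)"
proof -
  have bij: "bij_betw (toeplitz (circ_class g)) (hardy p) (hardy p)"
    using g(2) by (simp add: toeplitz_invertible_def)
  define f where "f = inv_into (hardy p) (toeplitz (circ_class g)) (circ_class h)"
  have f: "f \<in> hardy p" "toeplitz (circ_class g) f = circ_class h"
    using bij h(2) unfolding f_def by (auto simp: bij_betw_def intro: inv_into_into f_inv_into_f)
  have solves: "ae_eq (Toep g F) h \<longleftrightarrow> toeplitz (circ_class g) (circ_class F) = circ_class h" if "F \<in> Hp p"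
    for F
    using Toep_class[OF g(1) that p] h(1) by (simp add: circ_class_eq_iff[symmetric])
  obtain F where "F \<in> Hp p" "f = circ_class F" using hardy_representative[OF f(1)] .
  then have "F \<in> Hp p \<and> ae_eq (Toep g F) h" using f(2) by (simp add: solves)
  then have Tinv: "Tinv p g h \<in> Hp p \<and> ae_eq (Toep g (Tinv p g h)) h"
    unfolding Tinv_def by (rule someI[of _ F])
  then show "circ_measurable (Tinv p g h)" by (simp add: Hp_iff)
  have "toeplitz (circ_class g) (circ_class (Tinv p g h)) = toeplitz (circ_class g) f"
    "circ_class (Tinv p g h) \<in> hardy p"
    using Tinv f(2) solves[of "Tinv p g h"] by (auto simp: Hp_iff)
  then show "circ_class (Tinv p g h) = f" using f(1) by (rule inj_onD[OF bij_betw_imp_inj_on[OF bij]])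
qed

lemma Wmat_eq_omega_matrix:
  assumes pair: "toeplitz_hankel_pair p n (circ_class a) (circ_class b)" and a: "circ_measurable a"
    and b: "circ_measurable b"
  shows "Wmat p n a b = toeplitz_hankel_pair.omega_matrix p n (circ_class a) (circ_class b)"
proof -
  interpret THP: toeplitz_hankel_pair p n "circ_class a" "circ_class b" by (rule pair)
  note sub = sub_class[OF a b] and p = THP.exponent
  have d_eq: "THP.shifted_d = circ_class (sub_d a b) * tpow (- (- 2 * int n))"
    by (simp add: sub THP.shifted_d_def)
  note plus = THP.WH.wh_plus_measurable[OF sub(3) d_eq] THP.WH.wh_plus_class[OF sub(3) d_eq]
    and sigma = THP.WH.wh_sigma_eq[OF sub(3) d_eq]
  define g where "g = (\<lambda>t. sub_c a b t * t powi (- (2 * int n)))"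
  define A where "A = (\<lambda>t. inverse (tld a t) * t powi (- int n))"
  define e where "e k = (\<lambda>t. inverse (wh_plus p (sub_d a b) t) * (t ^ (n - k - 1)
      + wh_sigma p (sub_d a b) * t ^ (n + k)))" for k
  have g: "g \<in> Linf" "circ_class g = THP.shifted_c"
    using sub THP.shifted_Linf(1)
    by (simp_all add: g_def THP.shifted_c_def Linf_iff flip: circ_class_mult circ_class_tpow)
  have A: "A \<in> Linf" "circ_class A = inverse (tilde (circ_class a)) * tpow (- int n)"
    using a THP.Linf(3)
    by (simp_all add: A_def tld_def Linf_iff flip: circ_class_mult circ_class_tpow circ_class_inverse
      circ_class_tilde tilde_inverse)
  have e: "circ_measurable (e k)"
    "circ_class (e k) = THP.homogeneous_basis k" if "k < n" for k
  proof -
    have index: "int (n - Suc k) = int n - 1 - int k" using that by auto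
    show "circ_measurable (e k)" using plus(1) by (simp add: e_def)
    show "circ_class (e k) = THP.homogeneous_basis k"
      using plus by (simp add: e_def THP.homogeneous_basis_def sigma THP.WH.plus_def circ_class_power
        index
        flip: circ_class_mult circ_class_add circ_class_inverse circ_class_const)
  qed
  have "circ_measurable (omega p n a b k)" "circ_class (omega p n a b k) = THP.omega k" if k: "k < n"
    for k
  proof -
    have omega: "omega p n a b k = Tinv p g (Toep A (e k))"
      unfolding omega_def Let_def g_def A_def e_def ..
    have "e k \<in> Hp p" using e[OF k] THP.homogeneous_basis_hardy[OF k] by (simp add: Hp_iff)
    note Toep = Toep_class[OF A(1) this p, unfolded A(2) e(2)[OF k]]
    have "toeplitz_invertible p (circ_class g)"
      using THP.c_invertible by (simp add: g(2) THP.shifted_c_def)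
    note Tinv_class[OF g(1) this Toep(1) _ p, unfolded Toep(2) g(2),
      OF THP.A.maps[OF THP.homogeneous_basis_hardy[OF k]]]
    then show "circ_measurable (omega p n a b k)" "circ_class (omega p n a b k) = THP.omega k"
      by (simp_all only: omega THP.omega_def)
  qed
  then show ?thesis unfolding Wmat_def THP.omega_matrix_def by (intro eq_matI) (auto simp: fc_eq_fourier)
qed

section \<open>The adjoint pair and the pair \<open>(a, -b)\<close>\<close>

lemma toeplitz_hankel_pair_adjoint:
  assumes "toeplitz_hankel_pair p n a b"
  shows "toeplitz_hankel_pair (conj_exp p) n (bar a) (bar (tilde b))"
proof -
  interpret toeplitz_hankel_pair p n a b by (rule assms)
  have "toeplitz_invertible (conj_exp p) (bar shifted_c)"
    "toeplitz_invertible (conj_exp p) (bar shifted_d)"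
    using shifted_Linf exponent c_invertible d_invertible
    by (intro toeplitz_invertible_bar; simp add: shifted_c_def shifted_d_def)+
  moreover have "bar a * inverse (bar a) = 1" "bar (tilde b) * inverse (bar (tilde b)) = 1"
    using arg_cong[OF inverses(1), of bar] arg_cong[OF inverses(4), of bar] by simp_all
  moreover have "bar a * tilde (bar a) = bar (tilde b) * tilde (bar (tilde b))"
    using arg_cong[OF matching, of bar] by (simp add: mult.commute)
  ultimately show ?thesis
    using Linf exponent by unfold_locales
      (simp_all add: conj_exp_gt_1 GLinf_class_def shifted_c_def shifted_d_def
      flip: tilde_inverse bar_inverse)
qed

lemma toeplitz_invertible_uminus:
  assumes g: "toeplitz_invertible p g" and p: "1 < p"
  shows "toeplitz_invertible p (- g)"
proof -
  have "- f \<in> hardy p" if "f \<in> hardy p" for f using hardy_diff[OF hardy_0[OF p] that p] by simp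
  then have "bij_betw uminus (hardy p) (hardy p)" by (intro bij_betw_byWitness[where f' = uminus]) auto
  then have "bij_betw (toeplitz g \<circ> uminus) (hardy p) (hardy p)"
    using g unfolding toeplitz_invertible_def by (rule bij_betw_trans)
  moreover have "toeplitz g \<circ> uminus = toeplitz (- g)" by (simp add: fun_eq_iff toeplitz_def)
  ultimately show ?thesis by (simp add: toeplitz_invertible_def)
qed

lemma toeplitz_hankel_pair_uminus:
  assumes "toeplitz_hankel_pair p n a b" shows "toeplitz_hankel_pair p n a (- b)"
proof -
  interpret toeplitz_hankel_pair p n a b by (rule assms)
  have "a / (- b) * tpow (- 2 * int n) = - shifted_c" "a / tilde (- b) * tpow (2 * int n) = - shifted_d"
    by (simp_all add: shifted_c_def shifted_d_def divide_circle_fun_def inverse_uminus_class)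
  moreover have "toeplitz_invertible p (- shifted_c)" "toeplitz_invertible p (- shifted_d)"
    using c_invertible d_invertible exponent
    by (simp_all add: toeplitz_invertible_uminus shifted_c_def shifted_d_def)
  ultimately show ?thesis
    using exponent a_GL b_GL matching
    by unfold_locales (simp_all add: GLinf_class_def inverse_uminus_class)
qed

section \<open>Invertibility of \<open>T(a) + H(b)\<close>\<close>

lemma (in toeplitz_hankel_pair)
  shows toeplitz_hankel_surj_iff:
      "toeplitz_hankel a b ` hardy p = hardy p
          \<longleftrightarrow> inj_on (toeplitz_hankel (bar a) (bar (tilde b))) (hardy (conj_exp p))"
    and toeplitz_hankel_surj_imp_bij_betw:
      "toeplitz_hankel a b ` hardy p = hardy p \<Longrightarrow> bij_betw (toeplitz_hankel a b) (hardy p) (hardy p)"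
proof -
  interpret adjoint_hardy_operators p "toeplitz_hankel a b" "toeplitz_hankel (bar a) (bar (tilde b))"
    using Linf(1,2) exponent by (rule toeplitz_hankel_adjoint)
  interpret adjoint_pair: toeplitz_hankel_pair "conj_exp p" n "bar a" "bar (tilde b)"
    by (rule toeplitz_hankel_pair_adjoint) unfold_locales
  have bij: "bij_betw (toeplitz_hankel a b) (hardy p) (hardy p)"
    if "inj_on (toeplitz_hankel (bar a) (bar (tilde b))) (hardy (conj_exp p))"
    using adjoint_hardy_operators.adjoint_bij_betw[OF adjoint_symmetric] exponent
      adjoint_pair.toeplitz_hankel_bij_betw that by (simp add: adjoint_pair.toeplitz_hankel_inj_iff)
  then show "toeplitz_hankel a b ` hardy p = hardy p
      \<longleftrightarrow> inj_on (toeplitz_hankel (bar a) (bar (tilde b))) (hardy (conj_exp p))"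
    using adjoint_inj_on bij_betw_imp_surj_on by blast
  show "bij_betw (toeplitz_hankel a b) (hardy p) (hardy p)" if "toeplitz_hankel a b ` hardy p = hardy p"
    using that by (intro bij adjoint_inj_on)
qed

lemma invertible_op_imp_one_sided:
  "invertible_op p A \<Longrightarrow> left_invertible p A" "invertible_op p A \<Longrightarrow> right_invertible p A"
  by (auto simp: invertible_op_def left_invertible_def right_invertible_def)

lemma TH_invertibility:
  assumes pair: "toeplitz_hankel_pair p n (circ_class a) (circ_class b)" and a: "a \<in> Linf"
    and b: "b \<in> Linf"
  shows left_invertible_TH_iff: "left_invertible p (TH a b) \<longleftrightarrow> Determinant.det (Wmat p n a b) \<noteq> 0"
    (is "_ \<longleftrightarrow> ?left")
    and right_invertible_TH_iff: "right_invertible p (TH a b) \<longleftrightarrow>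
      Determinant.det (Wmat (conj_exp p) n (\<lambda>t. cnj (a t)) (\<lambda>t. cnj (tld b t))) \<noteq> 0" (is "_ \<longleftrightarrow> ?right")
    and one_sided_invertible_TH_imp: "left_invertible p (TH a b) \<or> right_invertible p (TH a b) \<Longrightarrow>
      invertible_op p (TH a b)"
proof -
  interpret toeplitz_hankel_pair p n "circ_class a" "circ_class b" by (rule pair)
  define T where "T = toeplitz_hankel (circ_class a) (circ_class b)"
  have measurable: "circ_measurable a" "circ_measurable b" using a b by (simp_all add: Linf_iff)
  have induces: "induces p (TH a b) T" unfolding T_def using a b exponent by (rule TH_induces)
  have adjoint_class: "circ_class (\<lambda>t. cnj (a t)) = bar (circ_class a)"
    "circ_class (\<lambda>t. cnj (tld b t)) = bar (tilde (circ_class b))"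
    using measurable by (simp_all add: circ_class_simps tld_def)
  note adjoint_pair = toeplitz_hankel_pair_adjoint[OF pair]
  have left: "?left \<longleftrightarrow> inj_on T (hardy p)"
    using measurable by (simp add: T_def Wmat_eq_omega_matrix[OF pair] toeplitz_hankel_inj_iff)
  have right: "?right \<longleftrightarrow> T ` hardy p = hardy p"
    using measurable Wmat_eq_omega_matrix[of "conj_exp p" n "\<lambda>t. cnj (a t)" "\<lambda>t. cnj (tld b t)"]
      adjoint_pair
    by (simp add: T_def adjoint_class toeplitz_hankel_surj_iff
      toeplitz_hankel_pair.toeplitz_hankel_inj_iff[OF adjoint_pair]) (simp add: tld_def)
  have invertible: "invertible_op p (TH a b)" if "inj_on T (hardy p) \<or> T ` hardy p = hardy p"
  proof (rule bij_betw_invertible_op[OF _ _ induces])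
    show "hardy_operator p T" unfolding T_def
      using Linf(1,2) exponent by (rule toeplitz_hankel_hardy_operator)
    show "bij_betw T (hardy p) (hardy p)"
      using that toeplitz_hankel_inj_iff toeplitz_hankel_bij_betw toeplitz_hankel_surj_imp_bij_betw
      unfolding T_def by blast
  qed
  note left_inj = left_invertible_inj_on[OF _ induces]
    and right_surj = right_invertible_image[OF _ induces]
  show "left_invertible p (TH a b) \<longleftrightarrow> ?left" "right_invertible p (TH a b) \<longleftrightarrow> ?right"
    unfolding left right using left_inj right_surj invertible invertible_op_imp_one_sided by blast+
  show "invertible_op p (TH a b)" if "left_invertible p (TH a b) \<or> right_invertible p (TH a b)"
    using that left_inj right_surj invertible by blast
qed

theorem theorem5p4:
  fixes p :: real and n :: nat and a b :: "complex \<Rightarrow> complex"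
  assumes "1 < p" and "1 \<le> n"
    and "F_TH p (- 2 * int n) (2 * int n) a b"
  shows "(left_invertible p (TH a b) \<longleftrightarrow> Determinant.det (Wmat p n a b) \<noteq> 0)
     \<and> (right_invertible p (TH a b) \<longleftrightarrow>
          Determinant.det (Wmat (conj_exp p) n (\<lambda>t. cnj (a t)) (\<lambda>t. cnj (tld b t))) \<noteq> 0)
     \<and> (invertible_op p (TH a b) \<longleftrightarrow>
          Determinant.det (Wmat p n a b) \<noteq> 0 \<and>
          Determinant.det (Wmat (conj_exp p) n (\<lambda>t. cnj (a t)) (\<lambda>t. cnj (tld b t))) \<noteq> 0)
     \<and> (Determinant.det (Wmat p n a b) \<noteq> 0 \<and> Determinant.det (Wmat p n a (\<lambda>t. - b t)) \<noteq> 0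
          \<longrightarrow> invertible_op p (TH a b) \<and> invertible_op p (TH a (\<lambda>t. - b t)))"
proof -
  have matching: "matching_pair a b" using assms(3) by (simp add: F_TH_def)
  note Linf = matching_pair_class(1,2)[OF matching] and pair = F_TH_pair[OF assms(3,1)]
  have uminus: "(\<lambda>t. - b t) \<in> Linf" "circ_class (\<lambda>t. - b t) = - circ_class b"
    using Linf(2) by (auto simp: Linf_iff simp flip: circ_class_uminus)
  have "toeplitz_hankel_pair p n (circ_class a) (circ_class (\<lambda>t. - b t))"
    unfolding uminus(2) using pair by (rule toeplitz_hankel_pair_uminus)
  note negative = left_invertible_TH_iff[OF this Linf(1) uminus(1)]
    one_sided_invertible_TH_imp[OF this Linf(1) uminus(1)]
  show ?thesis
    using TH_invertibility[OF pair Linf] invertible_op_imp_one_sided[of p "TH a b"] negative by blast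
qed

end
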